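(* Let $\mu$ be a bounded Borel measure on $E$ and let $f$ be such that $y\mapsto f(x,y)$ is nonincreasing for every $x\in E$ and $f(\cdot,0)\in L^1(E;m)$. Let $u$ be a solution of $-Au=f(x,u)+\mu$. Then for every $k\ge0$, $T_k(u)\in D_e[\mathcal{E}]$ and $$\mathcal{E}(T_k(u),T_k(u))\le 2k\big(\|f(\cdot,0)\|_{L^1(E;m)}+\|\mu\|_{TV}\big),$$ where $T_k(u)=\max\{\min\{u,k\},-k\}$.
   Context: Setting. $E$ is a locally compact separable metric space, $m$ is a positive Radon measure on $E$ with $\mathrm{supp}[m]=E$, and $(\mathcal{E},D[\mathcal{E}])$ is a symmetric regular Dirichlet form on $L^2(E;m)$, assumed transient: there is a strictly positive function $g$ on $E$ with $\int_E|u|g\,dm\le\sqrt{\mathcal{E}(u,u)}$ for $u\in D[\mathcal{E}]$. $A$ is the associated negative definite self-adjoint operator: $D(A)\subset D[\mathcal{E}]$, $\mathcal{E}(u,v)=(-Au,v)$ for $u\in D(A)$, $v\in D[\mathcal{E}]$. $\mathbb{X}=((X_t)_{t\ge0},(P_x)_{x\in E},(\mathcal{F}_t)_{t\ge0},\zeta)$ is the associated symmetric Hunt process with life time $\zeta$; $E_x$ is expectation under $P_x$. For $\alpha\ge0$, $R_\alpha h(x)=E_x\int_0^\zeta e^{-\alpha t}h(X_t)\,dt$, and $R=R_0$. It is assumed that $R_\alpha(x,\cdot)\ll m$ for all $x\in E$, $\alpha>0$. Hence for every $\alpha\ge0$ there is a symmetric Borel kernel $r_\alpha:E\times E\to[0,\infty]$,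 $\alpha$-excessive in each variable, with $R_\alpha h(x)=\int_E h(y)r_\alpha(x,y)\,m(dy)$; put $r=r_0$. For a Borel measure $\mu$, $R\mu(x)=\int_E r(x,y)\,\mu(dy)$ (with the convention that this is $0$ if the integrals with respect to $\mu^+$ and $\mu^-$ are both infinite). "Measurable" functions on $E$ are universally measurable. The extended Dirichlet space $D_e[\mathcal{E}]$ is the set of $m$-measurable functions $u$ for which there is an $\mathcal{E}$-Cauchy sequence $\{u_n\}\subset D[\mathcal{E}]$ converging to $u$ $m$-a.e.; for such $u$, $\mathcal{E}(u,u)=\lim_n\mathcal{E}(u_n,u_n)$. Capacity: $\mathrm{Cap}(U)=\inf\{\mathcal{E}(u,u):u\in D[\mathcal{E}],\,u\ge\mathbf{1}_U\ m\text{-a.e.}\}$ for open $U$, and $\mathrm{Cap}(B)=\inf\{\mathrm{Cap}(U):B\subset U,\ U\text{ open}\}$ for arbitrary $B\subset E$; "q.e." means outside a set of capacity zero. $\mathbb{M}$ is the class of (signed, possibly unbounded) Borel measures $\mu$ on $E$ with $R|\mu|(x)<\infty$ for q.e. $x\in E$; it contains all bounded Borel measures. Equation. $f:E\times\mathbb{R}\to\mathbb{R}$ is such that $y\mapsto f(x,y)$ is continuous for every $x$ and $x\mapsto f(x,y)$ is measurable for every $y$. For $\mu\in\mathbb{M}$, a measurable numerical ($[-\infty,\infty]$-valued) function $u$ on $E$ is a solution of $-Au=f(x,u)+\mu$ if $f(\cdot,u)\cdot m\in\mathbb{M}$ and $u(x)=R(f(\cdot,u))(x)+R\mu(x)$ for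 q.e. $x\in E$. *)

theory Defs
  imports "HOL-Probability.Probability"
begin

section \<open>Dirichlet forms\<close>

text \<open>
  Elements of \<open>L\<^sup>2(E;m)\<close> are represented by functions that are measurable with respect to the
  completion of \<open>m\<close>. The domain \<open>D\<close> of a form is therefore a set of functions, saturated under
  \<open>m\<close>-a.e. equality, and the form is invariant under such changes.
\<close>

definition L2 :: "'a measure \<Rightarrow> ('a \<Rightarrow> real) set" where
  "L2 m = {u \<in> borel_measurable (completion m). integrable (completion m) (\<lambda>x. (u x)\<^sup>2)}"

definition inner_L2 :: "'a measure \<Rightarrow> ('a \<Rightarrow> real) \<Rightarrow> ('a \<Rightarrow> real) \<Rightarrow> real" where
  "inner_L2 m u v = (\<integral>x. u x * v x \<partial>completion m)"

definition form1 ::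
  "'a measure \<Rightarrow> (('a \<Rightarrow> real) \<Rightarrow> ('a \<Rightarrow> real) \<Rightarrow> real) \<Rightarrow> ('a \<Rightarrow> real) \<Rightarrow> ('a \<Rightarrow> real) \<Rightarrow> real" where
  "form1 m \<E> u v = \<E> u v + inner_L2 m u v"

definition form_Cauchy ::
  "(('a \<Rightarrow> real) \<Rightarrow> ('a \<Rightarrow> real) \<Rightarrow> real) \<Rightarrow> (nat \<Rightarrow> 'a \<Rightarrow> real) \<Rightarrow> bool" where
  "form_Cauchy Q us \<longleftrightarrow>
    (\<forall>\<epsilon>>0. \<exists>N. \<forall>i\<ge>N. \<forall>j\<ge>N. Q (\<lambda>x. us i x - us j x) (\<lambda>x. us i x - us j x) < \<epsilon>)"

definition Cc :: "('a::topological_space \<Rightarrow> real) set" where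
  "Cc = {\<phi>. continuous_on UNIV \<phi> \<and> compact (closure {x. \<phi> x \<noteq> 0})}"

text \<open>
  On a locally compact separable metric space a Borel measure that is finite on compact sets is
  automatically regular, so \<open>compact_finite\<close> says that \<open>m\<close> is a Radon measure.
\<close>

locale regular_Dirichlet_form =
  fixes m :: "'a::{metric_space, second_countable_topology} measure"
    and D :: "('a \<Rightarrow> real) set"
    and \<E> :: "('a \<Rightarrow> real) \<Rightarrow> ('a \<Rightarrow> real) \<Rightarrow> real"
  assumes locally_compact: "locally_compact_space (euclidean :: 'a topology)"
    and sets_m: "sets m = sets borel"
    and compact_finite: "\<And>K. compact K \<Longrightarrow> emeasure m K < \<infinity>"
    and full_support: "\<And>U. open U \<Longrightarrow> U \<noteq> {} \<Longrightarrow> emeasure m U > 0"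
    and D_L2: "D \<subseteq> L2 m"
    and D_AE: "\<And>u v. u \<in> D \<Longrightarrow> v \<in> L2 m \<Longrightarrow> (AE x in m. v x = u x) \<Longrightarrow> v \<in> D"
    and form_AE: "\<And>u v w. u \<in> D \<Longrightarrow> v \<in> D \<Longrightarrow> w \<in> D \<Longrightarrow> (AE x in m. v x = u x) \<Longrightarrow> \<E> v w = \<E> u w"
    and D_add: "\<And>u v. u \<in> D \<Longrightarrow> v \<in> D \<Longrightarrow> (\<lambda>x. u x + v x) \<in> D"
    and D_scale: "\<And>c u. u \<in> D \<Longrightarrow> (\<lambda>x. c * u x) \<in> D"
    and D_dense: "\<And>u \<epsilon>. u \<in> L2 m \<Longrightarrow> \<epsilon> > 0 \<Longrightarrow>
      \<exists>v\<in>D. inner_L2 m (\<lambda>x. u x - v x) (\<lambda>x. u x - v x) < \<epsilon>"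
    and form_add: "\<And>u v w. u \<in> D \<Longrightarrow> v \<in> D \<Longrightarrow> w \<in> D \<Longrightarrow> \<E> (\<lambda>x. u x + v x) w = \<E> u w + \<E> v w"
    and form_scale: "\<And>c u v. u \<in> D \<Longrightarrow> v \<in> D \<Longrightarrow> \<E> (\<lambda>x. c * u x) v = c * \<E> u v"
    and form_sym: "\<And>u v. u \<in> D \<Longrightarrow> v \<in> D \<Longrightarrow> \<E> u v = \<E> v u"
    and form_nonneg: "\<And>u. u \<in> D \<Longrightarrow> 0 \<le> \<E> u u"
    and form_closed: "\<And>us. (\<And>n. us n \<in> D) \<Longrightarrow> form_Cauchy (form1 m \<E>) us \<Longrightarrow>
      \<exists>u\<in>D. (\<lambda>n. form1 m \<E> (\<lambda>x. us n x - u x) (\<lambda>x. us n x - u x)) \<longlonglongrightarrow> 0"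
    and form_Markov: "\<And>u. u \<in> D \<Longrightarrow> (\<lambda>x. min (max (u x) 0) 1) \<in> D \<and>
      \<E> (\<lambda>x. min (max (u x) 0) 1) (\<lambda>x. min (max (u x) 0) 1) \<le> \<E> u u"
    and regular_form: "\<And>u \<epsilon>. u \<in> D \<Longrightarrow> \<epsilon> > 0 \<Longrightarrow>
      \<exists>\<phi>\<in>D \<inter> Cc. form1 m \<E> (\<lambda>x. u x - \<phi> x) (\<lambda>x. u x - \<phi> x) < \<epsilon>"
    and regular_uniform: "\<And>\<psi> \<epsilon>. \<psi> \<in> Cc \<Longrightarrow> \<epsilon> > 0 \<Longrightarrow> \<exists>\<phi>\<in>D \<inter> Cc. \<forall>x. \<bar>\<psi> x - \<phi> x\<bar> < \<epsilon>"

definition transient_form ::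
  "'a measure \<Rightarrow> ('a \<Rightarrow> real) set \<Rightarrow> (('a \<Rightarrow> real) \<Rightarrow> ('a \<Rightarrow> real) \<Rightarrow> real) \<Rightarrow> bool" where
  "transient_form m D \<E> \<longleftrightarrow>
    (\<exists>g \<in> borel_measurable (completion m). (\<forall>x. 0 < g x) \<and>
      (\<forall>u\<in>D. (\<integral>\<^sup>+x. ennreal (\<bar>u x\<bar> * g x) \<partial>completion m) \<le> ennreal (sqrt (\<E> u u))))"

text \<open>The graph of the operator \<open>A\<close> with \<open>\<E>(u,v) = (-Au,v)\<close>.\<close>

definition form_operator ::
  "'a measure \<Rightarrow> ('a \<Rightarrow> real) set \<Rightarrow> (('a \<Rightarrow> real) \<Rightarrow> ('a \<Rightarrow> real) \<Rightarrow> real)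
    \<Rightarrow> (('a \<Rightarrow> real) \<times> ('a \<Rightarrow> real)) set" where
  "form_operator m D \<E> =
    {(u, w). u \<in> D \<and> w \<in> L2 m \<and> (\<forall>v\<in>D. \<E> u v = inner_L2 m (\<lambda>x. - w x) v)}"

definition approximating ::
  "'a measure \<Rightarrow> ('a \<Rightarrow> real) set \<Rightarrow> (('a \<Rightarrow> real) \<Rightarrow> ('a \<Rightarrow> real) \<Rightarrow> real)
    \<Rightarrow> ('a \<Rightarrow> real) \<Rightarrow> (nat \<Rightarrow> 'a \<Rightarrow> real) \<Rightarrow> bool" where
  "approximating m D \<E> u us \<longleftrightarrow>
    (\<forall>n. us n \<in> D) \<and> form_Cauchy \<E> us \<and> (AE x in m. (\<lambda>n. us n x) \<longlonglongrightarrow> u x)"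

definition extended_domain ::
  "'a measure \<Rightarrow> ('a \<Rightarrow> real) set \<Rightarrow> (('a \<Rightarrow> real) \<Rightarrow> ('a \<Rightarrow> real) \<Rightarrow> real) \<Rightarrow> ('a \<Rightarrow> real) set" where
  "extended_domain m D \<E> =
    {u \<in> borel_measurable (completion m). \<exists>us. approximating m D \<E> u us}"

text \<open>
  \<open>\<E>(u,u)\<close> for \<open>u\<close> in the extended domain: the limit does not depend on the approximating sequence.
\<close>

definition extended_energy ::
  "'a measure \<Rightarrow> ('a \<Rightarrow> real) set \<Rightarrow> (('a \<Rightarrow> real) \<Rightarrow> ('a \<Rightarrow> real) \<Rightarrow> real) \<Rightarrow> ('a \<Rightarrow> real) \<Rightarrow> real" where
  "extended_energy m D \<E> u =
    (THE c. \<exists>us. approximating m D \<E> u us \<and> (\<lambda>n. \<E> (us n) (us n)) \<longlonglongrightarrow> c)"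

text \<open>
  The capacity uses \<open>\<E>\<close> itself, not \<open>\<E>\<^sub>1\<close>, as is customary in the transient case.
\<close>

definition Cap_open ::
  "'a measure \<Rightarrow> ('a \<Rightarrow> real) set \<Rightarrow> (('a \<Rightarrow> real) \<Rightarrow> ('a \<Rightarrow> real) \<Rightarrow> real) \<Rightarrow> 'a set \<Rightarrow> ennreal" where
  "Cap_open m D \<E> U = (INF u\<in>{u\<in>D. AE x in m. u x \<ge> indicator U x}. ennreal (\<E> u u))"

definition Cap ::
  "'a::topological_space measure \<Rightarrow> ('a \<Rightarrow> real) set \<Rightarrow> (('a \<Rightarrow> real) \<Rightarrow> ('a \<Rightarrow> real) \<Rightarrow> real)
    \<Rightarrow> 'a set \<Rightarrow> ennreal" where
  "Cap m D \<E> B = (INF U\<in>{U. open U \<and> B \<subseteq> U}. Cap_open m D \<E> U)"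

definition quasi_everywhere ::
  "'a::topological_space measure \<Rightarrow> ('a \<Rightarrow> real) set \<Rightarrow> (('a \<Rightarrow> real) \<Rightarrow> ('a \<Rightarrow> real) \<Rightarrow> real)
    \<Rightarrow> ('a \<Rightarrow> bool) \<Rightarrow> bool" where
  "quasi_everywhere m D \<E> Q \<longleftrightarrow> (\<exists>N. Cap m D \<E> N = 0 \<and> (\<forall>x. x \<notin> N \<longrightarrow> Q x))"

section \<open>Hunt processes\<close>

text \<open>
  The state space \<open>E\<close> with cemetery is the type \<open>'a option\<close> carrying the topology of the one-point
  compactification; \<open>None\<close> is the cemetery (an isolated point if \<open>E\<close> is compact). Time runs
  through \<open>[0,\<infinity>]\<close>, i.e. through \<open>ennreal\<close>.
\<close>

definition cemetery_topology :: "'a::topological_space option topology" where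
  "cemetery_topology = Alexandroff_compactification euclidean"

definition cemetery_borel :: "'a::topological_space option measure" where
  "cemetery_borel = sigma UNIV {U. openin cemetery_topology U}"

definition lifetime :: "(ennreal \<Rightarrow> 'w \<Rightarrow> 'a option) \<Rightarrow> 'w \<Rightarrow> ennreal" where
  "lifetime X \<omega> = Inf {t. X t \<omega> = None}"

text \<open>
  \<open>F\<close> is any right-continuous admissible filtration for which the strong Markov property and
  quasi-left-continuity hold. Both are required under all \<open>P z\<close>; for general initial laws they
  follow by integration. The simple Markov property is the case of constant stopping times.
\<close>

locale Hunt_process =
  fixes M :: "'w measure"
    and P :: "'a::{metric_space, second_countable_topology} option \<Rightarrow> 'w measure"
    and X :: "ennreal \<Rightarrow> 'w \<Rightarrow> 'a option"
    and F :: "ennreal \<Rightarrow> 'w measure"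
  assumes prob_P: "\<And>z. prob_space (P z)"
    and sets_P: "\<And>z. sets (P z) = sets M"
    and filtration_F: "filtration (space M) F"
    and sets_F: "\<And>t. sets (F t) \<subseteq> sets M"
    and F_right_cont: "\<And>t. t < \<infinity> \<Longrightarrow> sets (F t) = (\<Inter>s\<in>{t<..}. sets (F s))"
    and adapted: "\<And>t. X t \<in> measurable (F t) cemetery_borel"
    and measurable_P: "\<And>t B. B \<in> sets cemetery_borel \<Longrightarrow>
      (\<lambda>z. measure (P z) {\<omega>\<in>space M. X t \<omega> \<in> B}) \<in> borel_measurable cemetery_borel"
    and normal: "\<And>z. AE \<omega> in P z. X 0 \<omega> = z"
    and X_infinity: "\<And>\<omega>. \<omega> \<in> space M \<Longrightarrow> X \<infinity> \<omega> = None"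
    and X_absorbed: "\<And>\<omega> t. \<omega> \<in> space M \<Longrightarrow> lifetime X \<omega> \<le> t \<Longrightarrow> X t \<omega> = None"
    and shifts: "\<And>t. t < \<infinity> \<Longrightarrow>
      \<exists>\<theta>. \<theta> ` space M \<subseteq> space M \<and> (\<forall>\<omega>\<in>space M. \<forall>s. X s (\<theta> \<omega>) = X (s + t) \<omega>)"
    and right_continuous: "\<And>\<omega> t. \<omega> \<in> space M \<Longrightarrow> t < \<infinity> \<Longrightarrow>
      limitin cemetery_topology (\<lambda>s. X s \<omega>) (X t \<omega>) (at_right t)"
    and left_limits: "\<And>\<omega> t. \<omega> \<in> space M \<Longrightarrow> 0 < t \<Longrightarrow> t < \<infinity> \<Longrightarrow>
      \<exists>z. limitin cemetery_topology (\<lambda>s. X s \<omega>) z (at_left t)"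
    and strong_Markov: "\<And>\<sigma> s B z. stopping_time F \<sigma> \<Longrightarrow> s < \<infinity> \<Longrightarrow> B \<in> sets cemetery_borel \<Longrightarrow>
      AE \<omega> in P z.
        real_cond_exp (P z) (filtration.pre_sigma (space M) F \<sigma>)
          (indicator {\<omega>\<in>space M. X (\<sigma> \<omega> + s) \<omega> \<in> B}) \<omega>
        = measure (P (X (\<sigma> \<omega>) \<omega>)) {\<omega>'\<in>space M. X s \<omega>' \<in> B}"
    and quasi_left_continuous: "\<And>\<sigma>s \<sigma> z. (\<And>n. stopping_time F (\<sigma>s n)) \<Longrightarrow> stopping_time F \<sigma> \<Longrightarrow>
      (\<And>\<omega>. \<omega> \<in> space M \<Longrightarrow> incseq (\<lambda>n. \<sigma>s n \<omega>) \<and> (SUP n. \<sigma>s n \<omega>) = \<sigma> \<omega>) \<Longrightarrow>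
      AE \<omega> in P z. \<sigma> \<omega> < \<infinity> \<longrightarrow>
        limitin cemetery_topology (\<lambda>n. X (\<sigma>s n \<omega>) \<omega>) (X (\<sigma> \<omega>) \<omega>) sequentially"

text \<open>
  Functions on \<open>E\<close> are extended by \<open>0\<close> to the cemetery. The nonnegative integral in the library is
  a lower integral, which for functions measurable with respect to the completion of the measure
  is the integral with respect to that completion; hence the integrals below also have their
  intended value for universally measurable \<open>h\<close>.
\<close>

definition transition ::
  "('a option \<Rightarrow> 'w measure) \<Rightarrow> (ennreal \<Rightarrow> 'w \<Rightarrow> 'a option) \<Rightarrow> real \<Rightarrow> ('a \<Rightarrow> ennreal) \<Rightarrow> 'a \<Rightarrow> ennreal" where
  "transition P X t h x = (\<integral>\<^sup>+\<omega>. case_option 0 h (X (ennreal t) \<omega>) \<partial>P (Some x))"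

definition transition_real ::
  "('a option \<Rightarrow> 'w measure) \<Rightarrow> (ennreal \<Rightarrow> 'w \<Rightarrow> 'a option) \<Rightarrow> real \<Rightarrow> ('a \<Rightarrow> real) \<Rightarrow> 'a \<Rightarrow> real" where
  "transition_real P X t h x = (\<integral>\<omega>. case_option 0 h (X (ennreal t) \<omega>) \<partial>P (Some x))"

definition resolvent ::
  "('a option \<Rightarrow> 'w measure) \<Rightarrow> (ennreal \<Rightarrow> 'w \<Rightarrow> 'a option) \<Rightarrow> real \<Rightarrow> ('a \<Rightarrow> ennreal) \<Rightarrow> 'a \<Rightarrow> ennreal" where
  "resolvent P X \<alpha> h x =
    (\<integral>\<^sup>+\<omega>. (\<integral>\<^sup>+t\<in>{t. 0 \<le> t \<and> ennreal t < lifetime X \<omega>}.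
        ennreal (exp (- \<alpha> * t)) * case_option 0 h (X (ennreal t) \<omega>) \<partial>lborel) \<partial>P (Some x))"

text \<open>
  The process is associated with the form: its transition function is \<open>m\<close>-symmetric, and the
  generator of the semigroup it induces on \<open>L\<^sup>2(E;m)\<close> is the operator \<open>A\<close> of the form. Testing
  with Borel functions suffices, since every class in \<open>L\<^sup>2(E;m)\<close> has a Borel representative.
\<close>

definition associated_process ::
  "'a::topological_space measure \<Rightarrow> ('a \<Rightarrow> real) set \<Rightarrow> (('a \<Rightarrow> real) \<Rightarrow> ('a \<Rightarrow> real) \<Rightarrow> real)
    \<Rightarrow> ('a option \<Rightarrow> 'w measure) \<Rightarrow> (ennreal \<Rightarrow> 'w \<Rightarrow> 'a option) \<Rightarrow> bool" where
  "associated_process m D \<E> P X \<longleftrightarrow>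
    (\<forall>t\<ge>0. \<forall>g\<in>borel_measurable borel. \<forall>h\<in>borel_measurable borel.
      (\<integral>\<^sup>+x. transition P X t g x * h x \<partial>m) = (\<integral>\<^sup>+x. g x * transition P X t h x \<partial>m)) \<and>
    (\<forall>u \<in> L2 m \<inter> borel_measurable borel. \<forall>w \<in> L2 m \<inter> borel_measurable borel.
      (u, w) \<in> form_operator m D \<E> \<longleftrightarrow>
      ((\<lambda>t. \<integral>\<^sup>+x. ennreal (((transition_real P X t u x - u x) / t - w x)\<^sup>2) \<partial>m) \<longlongrightarrow> 0) (at_right 0))"

definition absolutely_continuous_resolvent ::
  "'a measure \<Rightarrow> ('a option \<Rightarrow> 'w measure) \<Rightarrow> (ennreal \<Rightarrow> 'w \<Rightarrow> 'a option) \<Rightarrow> bool" where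
  "absolutely_continuous_resolvent m P X \<longleftrightarrow>
    (\<forall>\<alpha>>0. \<forall>x. \<forall>B\<in>null_sets m. resolvent P X \<alpha> (indicator B) x = 0)"

definition excessive ::
  "('a option \<Rightarrow> 'w measure) \<Rightarrow> (ennreal \<Rightarrow> 'w \<Rightarrow> 'a option) \<Rightarrow> real \<Rightarrow> ('a \<Rightarrow> ennreal) \<Rightarrow> bool" where
  "excessive P X \<alpha> h \<longleftrightarrow>
    (\<forall>x. (\<forall>t\<ge>0. ennreal (exp (- \<alpha> * t)) * transition P X t h x \<le> h x) \<and>
      ((\<lambda>t. ennreal (exp (- \<alpha> * t)) * transition P X t h x) \<longlongrightarrow> h x) (at_right 0))"

text \<open>The defining properties determine \<open>r \<alpha>\<close> uniquely for each \<open>\<alpha> \<ge> 0\<close>.\<close>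

definition resolvent_kernel ::
  "'a::topological_space measure \<Rightarrow> ('a option \<Rightarrow> 'w measure) \<Rightarrow> (ennreal \<Rightarrow> 'w \<Rightarrow> 'a option)
    \<Rightarrow> (real \<Rightarrow> 'a \<Rightarrow> 'a \<Rightarrow> ennreal) \<Rightarrow> bool" where
  "resolvent_kernel m P X r \<longleftrightarrow>
    (\<forall>\<alpha>\<ge>0.
      (\<lambda>(x, y). r \<alpha> x y) \<in> borel_measurable (borel \<Otimes>\<^sub>M borel) \<and>
      (\<forall>x y. r \<alpha> x y = r \<alpha> y x) \<and>
      (\<forall>y. excessive P X \<alpha> (\<lambda>x. r \<alpha> x y)) \<and>
      (\<forall>x. excessive P X \<alpha> (\<lambda>y. r \<alpha> x y)) \<and>
      (\<forall>h\<in>borel_measurable borel. \<forall>x. resolvent P X \<alpha> h x = (\<integral>\<^sup>+y. h y * r \<alpha> x y \<partial>m)))"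

section \<open>The semilinear equation\<close>

definition universal_borel :: "'a::topological_space measure" where
  "universal_borel =
    sigma UNIV {A. \<forall>\<nu>. finite_measure \<nu> \<and> sets \<nu> = sets borel \<longrightarrow> A \<in> sets (completion \<nu>)}"

text \<open>
  A signed, possibly unbounded Borel measure \<open>\<mu>\<close> is given by its Jordan decomposition
  \<open>(\<mu>\<^sup>+, \<mu>\<^sup>-)\<close>: if both parts are infinite there is no set function \<open>\<mu>\<^sup>+ - \<mu>\<^sup>-\<close>. The pairs with finite
  parts correspond bijectively to the bounded signed measures.
\<close>

type_synonym 'a signed_measure = "'a measure \<times> 'a measure"

definition signed_borel_measure :: "'a::topological_space signed_measure \<Rightarrow> bool" where
  "signed_borel_measure \<mu> \<longleftrightarrow> sets (fst \<mu>) = sets borel \<and> sets (snd \<mu>) = sets borel \<and>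
    (\<exists>N\<in>sets borel. emeasure (fst \<mu>) N = 0 \<and> emeasure (snd \<mu>) (- N) = 0)"

definition bounded_borel_measure :: "'a::topological_space signed_measure \<Rightarrow> bool" where
  "bounded_borel_measure \<mu> \<longleftrightarrow>
    signed_borel_measure \<mu> \<and> finite_measure (fst \<mu>) \<and> finite_measure (snd \<mu>)"

definition TV_norm :: "'a signed_measure \<Rightarrow> real" where
  "TV_norm \<mu> = measure (fst \<mu>) UNIV + measure (snd \<mu>) UNIV"

text \<open>
  \<open>h \<cdot> m\<close> for a function \<open>h\<close> that is only measurable with respect to the completion of \<open>m\<close>,
  restricted to the Borel sets.
\<close>

definition density_signed :: "'a::topological_space measure \<Rightarrow> ('a \<Rightarrow> real) \<Rightarrow> 'a signed_measure" where
  "density_signed m h =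
    (distr (density (completion m) (\<lambda>x. ennreal (h x))) borel (\<lambda>x. x),
     distr (density (completion m) (\<lambda>x. ennreal (- h x))) borel (\<lambda>x. x))"

text \<open>Difference with the convention \<open>\<infinity> - \<infinity> = 0\<close>.\<close>

definition ennreal_diff0 :: "ennreal \<Rightarrow> ennreal \<Rightarrow> ereal" where
  "ennreal_diff0 a b = (if a = \<infinity> \<and> b = \<infinity> then 0 else enn2ereal a - enn2ereal b)"

definition potential_fun ::
  "('a option \<Rightarrow> 'w measure) \<Rightarrow> (ennreal \<Rightarrow> 'w \<Rightarrow> 'a option) \<Rightarrow> ('a \<Rightarrow> real) \<Rightarrow> 'a \<Rightarrow> ereal" where
  "potential_fun P X h x =
    ennreal_diff0 (resolvent P X 0 (\<lambda>y. ennreal (h y)) x) (resolvent P X 0 (\<lambda>y. ennreal (- h y)) x)"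

definition potential_meas ::
  "(real \<Rightarrow> 'a \<Rightarrow> 'a \<Rightarrow> ennreal) \<Rightarrow> 'a signed_measure \<Rightarrow> 'a \<Rightarrow> ereal" where
  "potential_meas r \<mu> x = ennreal_diff0 (\<integral>\<^sup>+y. r 0 x y \<partial>fst \<mu>) (\<integral>\<^sup>+y. r 0 x y \<partial>snd \<mu>)"

definition potential_abs ::
  "(real \<Rightarrow> 'a \<Rightarrow> 'a \<Rightarrow> ennreal) \<Rightarrow> 'a signed_measure \<Rightarrow> 'a \<Rightarrow> ennreal" where
  "potential_abs r \<mu> x = (\<integral>\<^sup>+y. r 0 x y \<partial>fst \<mu>) + (\<integral>\<^sup>+y. r 0 x y \<partial>snd \<mu>)"

definition class_M ::
  "'a::topological_space measure \<Rightarrow> ('a \<Rightarrow> real) set \<Rightarrow> (('a \<Rightarrow> real) \<Rightarrow> ('a \<Rightarrow> real) \<Rightarrow> real)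
    \<Rightarrow> (real \<Rightarrow> 'a \<Rightarrow> 'a \<Rightarrow> ennreal) \<Rightarrow> 'a signed_measure set" where
  "class_M m D \<E> r =
    {\<mu>. signed_borel_measure \<mu> \<and> quasi_everywhere m D \<E> (\<lambda>x. potential_abs r \<mu> x < \<infinity>)}"

text \<open>
  \<open>f(\<cdot>,u)\<close>; where \<open>u\<close> is infinite, \<open>real_of_ereal\<close> substitutes \<open>0\<close>. This is immaterial, because a
  solution is finite q.e.
\<close>

definition Nemytskii :: "('a \<Rightarrow> real \<Rightarrow> real) \<Rightarrow> ('a \<Rightarrow> ereal) \<Rightarrow> 'a \<Rightarrow> real" where
  "Nemytskii f u x = f x (real_of_ereal (u x))"

definition is_solution ::
  "'a::topological_space measure \<Rightarrow> ('a \<Rightarrow> real) set \<Rightarrow> (('a \<Rightarrow> real) \<Rightarrow> ('a \<Rightarrow> real) \<Rightarrow> real)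
    \<Rightarrow> ('a option \<Rightarrow> 'w measure) \<Rightarrow> (ennreal \<Rightarrow> 'w \<Rightarrow> 'a option) \<Rightarrow> (real \<Rightarrow> 'a \<Rightarrow> 'a \<Rightarrow> ennreal)
    \<Rightarrow> ('a \<Rightarrow> real \<Rightarrow> real) \<Rightarrow> 'a signed_measure \<Rightarrow> ('a \<Rightarrow> ereal) \<Rightarrow> bool" where
  "is_solution m D \<E> P X r f \<mu> u \<longleftrightarrow>
    u \<in> borel_measurable universal_borel \<and>
    density_signed m (Nemytskii f u) \<in> class_M m D \<E> r \<and>
    quasi_everywhere m D \<E> (\<lambda>x. u x = potential_fun P X (Nemytskii f u) x + potential_meas r \<mu> x)"

definition truncation :: "real \<Rightarrow> ('a \<Rightarrow> ereal) \<Rightarrow> 'a \<Rightarrow> real" where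
  "truncation k u x = real_of_ereal (max (min (u x) (ereal k)) (ereal (- k)))"

end

theory Submission
  imports Defs
begin

text \<open>
  Put \<open>q = f(\<cdot>,u) - f(\<cdot>,0)\<close>, so that \<open>u = R(q + f(\<cdot>,0) + \<mu>)\<close> and, by monotonicity,
  \<open>q sgn(u) = -\<bar>q\<bar>\<close>. Kato's inequality, tested against the excessive
  functions \<open>min (N G\<^sub>\<beta>\<phi>) 1\<close> with \<open>G\<^sub>0\<phi> \<le> 1\<close>, which increase to \<open>1\<close>, shows that
  absorption does not create mass: \<open>\<integral>\<bar>q\<bar> dm \<le> \<parallel>f(\<cdot>,0)\<parallel> + \<parallel>\<mu>\<parallel>\<close>. Hence \<open>u\<close> is the potential of a measure of
  total variation at most twice the right-hand side, and it remains to show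
  \<open>\<E>(T\<^sub>k(R\<nu>), T\<^sub>k(R\<nu>)) \<le> k \<parallel>\<nu>\<parallel>\<close>. This is computed for \<open>R\<^sub>\<beta>\<nu>\<close> with the approximate form
  \<open>\<alpha> (v - \<alpha> G\<^sub>\<alpha> v, v)\<close>, which only involves the kernel, and passes to the limit \<open>\<beta> \<rightarrow> 0\<close> by
  lower semicontinuity of the closed form. Working with kernels and \<open>m\<close>-a.e. identities avoids
  quasi-continuous versions and smooth measures; transience enters through the fact that
  sets of capacity zero are \<open>m\<close>-null and through the finiteness of potentials of finite measures.
\<close>

section \<open>Nonnegative quadratic forms\<close>

text \<open>The constant 1 would yield the mass bound at once, but it need not be square integrable,
  and \<open>u\<close> need not be integrable. Its substitutes s are only \<beta>-excessive, so
  Kato's inequality leaves an error \<beta> \<integral> s \<bar>u\<bar> dm. To control it, \<phi> is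
  chosen with \<integral> \<phi> U dm finite, where U is the potential of the absolute values of all
  data: \<beta> \<integral> G_\<beta> \<phi> U dm is the gap between this integral and the same
  integral for the \<beta>-potential, hence vanishes with \<beta>. The factor 2 arises because the
  data enter twice, once as the source and once as the bound for q. The process is tied to the form
  only through the generator graph. It is therefore first reduced to kernels that solve \<E>(w,z) =
  (v - \<alpha> w, z). Potentials of measures need not lie in L2; truncated \<beta>-potentials do,
  and their membership in D is read off from the boundedness of the approximate forms. At \<beta> =
  0 only almost everywhere convergence is left, which is why the energy on the extended domain is
  handled with Fatou's lemma for a kernel expression.\<close>

locale psd_form =
  fixes S :: "('a \<Rightarrow> real) set" and Q :: "('a \<Rightarrow> real) \<Rightarrow> ('a \<Rightarrow> real) \<Rightarrow> real"
  assumes add_mem: "u \<in> S \<Longrightarrow> v \<in> S \<Longrightarrow> (\<lambda>x. u x + v x) \<in> S"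
    and scale_mem: "u \<in> S \<Longrightarrow> (\<lambda>x. c * u x) \<in> S"
    and add_left: "u \<in> S \<Longrightarrow> v \<in> S \<Longrightarrow> w \<in> S \<Longrightarrow> Q (\<lambda>x. u x + v x) w = Q u w + Q v w"
    and scale_left: "u \<in> S \<Longrightarrow> v \<in> S \<Longrightarrow> Q (\<lambda>x. c * u x) v = c * Q u v"
    and sym: "u \<in> S \<Longrightarrow> v \<in> S \<Longrightarrow> Q u v = Q v u"
    and nonneg: "u \<in> S \<Longrightarrow> 0 \<le> Q u u"
begin

lemma add_right: "u \<in> S \<Longrightarrow> v \<in> S \<Longrightarrow> w \<in> S \<Longrightarrow> Q w (\<lambda>x. u x + v x) = Q w u + Q w v"
  using add_left[of u v w] sym add_mem by metis

lemma scale_right: "u \<in> S \<Longrightarrow> v \<in> S \<Longrightarrow> Q v (\<lambda>x. c * u x) = c * Q v u"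
  using scale_left[of u v c] sym scale_mem by metis

lemma diff_mem: "u \<in> S \<Longrightarrow> v \<in> S \<Longrightarrow> (\<lambda>x. u x - v x) \<in> S"
  using add_mem[of u "\<lambda>x. (-1) * v x"] scale_mem[of v "-1"] by simp

lemma diff_left: "u \<in> S \<Longrightarrow> v \<in> S \<Longrightarrow> w \<in> S \<Longrightarrow> Q (\<lambda>x. u x - v x) w = Q u w - Q v w"
  using add_left[of u "\<lambda>x. (-1) * v x" w] scale_mem[of v "-1"] scale_left[of v w "-1"] by simp

lemma diff_right: "u \<in> S \<Longrightarrow> v \<in> S \<Longrightarrow> w \<in> S \<Longrightarrow> Q w (\<lambda>x. u x - v x) = Q w u - Q w v"
  using diff_left[of u v w] sym diff_mem by metis

lemma diff_sq:
  assumes "u \<in> S" "v \<in> S"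
  shows "Q (\<lambda>x. u x - v x) (\<lambda>x. u x - v x) = Q u u - 2 * Q u v + Q v v"
  using assms by (simp add: diff_left diff_right diff_mem sym[of v u])

lemma add_sq:
  assumes "u \<in> S" "v \<in> S"
  shows "Q (\<lambda>x. u x + v x) (\<lambda>x. u x + v x) = Q u u + 2 * Q u v + Q v v"
  using assms by (simp add: add_left add_right add_mem sym[of v u])

lemma scale_sq: "u \<in> S \<Longrightarrow> Q (\<lambda>x. c * u x) (\<lambda>x. c * u x) = c\<^sup>2 * Q u u"
  by (simp add: scale_left scale_right scale_mem power2_eq_square)

lemma diff_scaled_sq:
  assumes "u \<in> S" "v \<in> S"
  shows "Q (\<lambda>x. u x - c * v x) (\<lambda>x. u x - c * v x) = Q u u - 2 * c * Q u v + c\<^sup>2 * Q v v"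
  using diff_sq[OF assms(1) scale_mem[OF assms(2), of c]] assms
  by (simp add: scale_sq scale_right)

text \<open>The discriminant argument for the quadratic c -> Q (u - c v) (u - c v). Since Q is only
  semidefinite, as the L2 product is on functions rather than classes, the case
  \<open>Q v v = 0\<close> is separate: there the quadratic degenerates to an affine function of
  c.\<close>

lemma Cauchy_Schwarz:
  assumes u: "u \<in> S" and v: "v \<in> S"
  shows "(Q u v)\<^sup>2 \<le> Q u u * Q v v"
proof (cases "Q v v = 0")
  case True
  have *: "0 \<le> Q u u - 2 * c * Q u v" for c
    using nonneg[OF diff_mem[OF u scale_mem[OF v, of c]]] diff_scaled_sq[OF u v, of c] True by simp
  have "Q u v = 0"
  proof (rule ccontr)
    assume "Q u v \<noteq> 0"
    \<comment> \<open>For this c the affine function takes the value -1.\<close>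
    then show False using *[of "(Q u u + 1) / (2 * Q u v)"] by (simp add: field_simps)
  qed
  then show ?thesis using True by simp
next
  case False
  then have p: "Q v v > 0" using nonneg[OF v] by simp
  have "0 \<le> Q u u - 2 * (Q u v / Q v v) * Q u v + (Q u v / Q v v)\<^sup>2 * Q v v"
    using nonneg[OF diff_mem[OF u scale_mem[OF v, of "Q u v / Q v v"]]]
      diff_scaled_sq[OF u v, of "Q u v / Q v v"] by simp
  then show ?thesis using p by (simp add: field_simps power2_eq_square)
qed

lemma Cauchy_Schwarz_sqrt:
  assumes "u \<in> S" "v \<in> S"
  shows "\<bar>Q u v\<bar> \<le> sqrt (Q u u) * sqrt (Q v v)"
  using real_sqrt_le_mono[OF Cauchy_Schwarz[OF assms]] by (simp add: real_sqrt_mult)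

lemma triangle:
  assumes "u \<in> S" "v \<in> S"
  shows "sqrt (Q (\<lambda>x. u x + v x) (\<lambda>x. u x + v x)) \<le> sqrt (Q u u) + sqrt (Q v v)"
proof (rule real_le_lsqrt)
  show "0 \<le> sqrt (Q u u) + sqrt (Q v v)" using nonneg assms by simp
  show "Q (\<lambda>x. u x + v x) (\<lambda>x. u x + v x) \<le> (sqrt (Q u u) + sqrt (Q v v))\<^sup>2"
    using Cauchy_Schwarz_sqrt[OF assms] nonneg assms by (simp add: add_sq power2_sum)
qed

lemma minus_commute:
  assumes "u \<in> S" "v \<in> S"
  shows "Q (\<lambda>x. u x - v x) (\<lambda>x. u x - v x) = Q (\<lambda>x. v x - u x) (\<lambda>x. v x - u x)"
  using assms by (simp add: diff_sq sym[of v u])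

lemma sqrt_diff_le:
  assumes u: "u \<in> S" and v: "v \<in> S"
  shows "\<bar>sqrt (Q u u) - sqrt (Q v v)\<bar> \<le> sqrt (Q (\<lambda>x. u x - v x) (\<lambda>x. u x - v x))"
proof -
  have "sqrt (Q u u) \<le> sqrt (Q (\<lambda>x. u x - v x) (\<lambda>x. u x - v x)) + sqrt (Q v v)"
    using triangle[OF diff_mem[OF u v] v] by simp
  moreover have "sqrt (Q v v) \<le> sqrt (Q (\<lambda>x. u x - v x) (\<lambda>x. u x - v x)) + sqrt (Q u u)"
    using triangle[OF diff_mem[OF v u] u] by (simp add: minus_commute[OF u v])
  ultimately show ?thesis by linarith
qed

lemma add_sq_le:
  assumes u: "u \<in> S" and v: "v \<in> S"
  shows "Q (\<lambda>x. u x + v x) (\<lambda>x. u x + v x) \<le> 2 * Q u u + 2 * Q v v"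
  using nonneg[OF diff_mem[OF u v]] by (simp add: diff_sq add_sq u v)

lemma diff_sq_le:
  assumes u: "u \<in> S" and v: "v \<in> S"
  shows "Q (\<lambda>x. u x - v x) (\<lambda>x. u x - v x) \<le> 2 * Q u u + 2 * Q v v"
  using nonneg[OF add_mem[OF u v]] by (simp add: diff_sq add_sq u v)

text \<open>\<open>sqrt (Q u u)\<close> is a seminorm and so 1-Lipschitz with respect to itself.
  Hence the energies converge even if the sequence has no limit in S, which is the situation in the
  extended domain.\<close>

lemma Cauchy_convergent:
  assumes us: "\<And>n. us n \<in> S" and C: "form_Cauchy Q us"
  shows "convergent (\<lambda>n. Q (us n) (us n))"
proof -
  have "Cauchy (\<lambda>n. sqrt (Q (us n) (us n)))"
  proof (rule CauchyI)
    fix e :: real assume e: "0 < e"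
    then have "0 < e\<^sup>2" by simp
    then obtain N where N: "\<And>i j. i \<ge> N \<Longrightarrow> j \<ge> N \<Longrightarrow> Q (\<lambda>x. us i x - us j x) (\<lambda>x. us i x - us j x) < e\<^sup>2"
      using C unfolding form_Cauchy_def by meson
    show "\<exists>M. \<forall>m\<ge>M. \<forall>n\<ge>M. norm (sqrt (Q (us m) (us m)) - sqrt (Q (us n) (us n))) < e"
    proof (intro exI[of _ N] allI impI)
      fix i j assume "N \<le> i" "N \<le> j"
      then have "sqrt (Q (\<lambda>x. us i x - us j x) (\<lambda>x. us i x - us j x)) < e"
        using N e by (intro real_less_lsqrt) auto
      then show "norm (sqrt (Q (us i) (us i)) - sqrt (Q (us j) (us j))) < e"
        using sqrt_diff_le[OF us us, of i j] by simp
    qed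
  qed
  then obtain l where "(\<lambda>n. sqrt (Q (us n) (us n))) \<longlonglongrightarrow> l"
    using Cauchy_convergent_iff convergent_def by blast
  then have "(\<lambda>n. (sqrt (Q (us n) (us n)))\<^sup>2) \<longlonglongrightarrow> l\<^sup>2" by (intro tendsto_intros)
  then show ?thesis using nonneg us by (auto simp: convergent_def)
qed

lemma tendsto_left:
  assumes y: "\<And>n. y n \<in> S" "y0 \<in> S" and z: "z \<in> S"
    and l: "((\<lambda>n. Q (\<lambda>x. y n x - y0 x) (\<lambda>x. y n x - y0 x)) \<longlongrightarrow> 0) G"
  shows "((\<lambda>n. Q (y n) z) \<longlongrightarrow> Q y0 z) G"
proof -
  let ?e = "\<lambda>n. Q (\<lambda>x. y n x - y0 x) (\<lambda>x. y n x - y0 x)"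
  have "norm (Q (y n) z - Q y0 z) \<le> sqrt (?e n) * sqrt (Q z z)" for n
    using Cauchy_Schwarz_sqrt[OF diff_mem[OF y] z, of n] by (simp only: diff_left[OF y z] real_norm_def)
  then have le: "\<forall>\<^sub>F n in G. norm (Q (y n) z - Q y0 z) \<le> sqrt (?e n) * sqrt (Q z z)"
    by (rule always_eventually[OF allI])
  have "((\<lambda>n. sqrt (?e n) * sqrt (Q z z)) \<longlongrightarrow> sqrt 0 * sqrt (Q z z)) G"
    by (intro tendsto_mult tendsto_real_sqrt l tendsto_const)
  then have "((\<lambda>n. sqrt (?e n) * sqrt (Q z z)) \<longlongrightarrow> 0) G" by simp
  from Lim_null_comparison[OF le this] show ?thesis by (rule LIM_zero_cancel)
qed

lemma tendsto_sq:
  assumes y: "\<And>n. y n \<in> S" "y0 \<in> S"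
    and l: "((\<lambda>n. Q (\<lambda>x. y n x - y0 x) (\<lambda>x. y n x - y0 x)) \<longlongrightarrow> 0) G"
  shows "((\<lambda>n. Q (y n) (y n)) \<longlongrightarrow> Q y0 y0) G"
proof -
  let ?e = "\<lambda>n. Q (\<lambda>x. y n x - y0 x) (\<lambda>x. y n x - y0 x)"
  have "((\<lambda>n. ?e n + 2 * Q (y n) y0 - Q y0 y0) \<longlongrightarrow> 0 + 2 * Q y0 y0 - Q y0 y0) G"
    by (intro tendsto_add tendsto_diff tendsto_mult tendsto_const l tendsto_left[OF y y(2) l])
  then show ?thesis by (simp add: diff_sq y)
qed

end

text \<open>The dyadic convex combinations of the tail. Closure under midpoints is all that the
  parallelogram law asks for, and it avoids finite sums of coefficients.\<close>

inductive_set tail_hull :: "(nat \<Rightarrow> 'a \<Rightarrow> real) \<Rightarrow> nat \<Rightarrow> ('a \<Rightarrow> real) set" for v n where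
  base: "n \<le> j \<Longrightarrow> v j \<in> tail_hull v n"
| midpoint: "a \<in> tail_hull v n \<Longrightarrow> b \<in> tail_hull v n \<Longrightarrow> (\<lambda>x. (1/2) * (a x + b x)) \<in> tail_hull v n"

lemma tail_hull_mono: "n \<le> k \<Longrightarrow> tail_hull v k \<subseteq> tail_hull v n"
proof
  fix a assume "n \<le> k" "a \<in> tail_hull v k"
  from this(2,1) show "a \<in> tail_hull v n"
    by (induction rule: tail_hull.induct) (blast intro: tail_hull.intros order_trans)+
qed

lemma tail_hull_close:
  assumes "w \<in> tail_hull v n" "\<And>j. n \<le> j \<Longrightarrow> \<bar>v j x - c\<bar> \<le> e"
  shows "\<bar>w x - c\<bar> \<le> e"
  using assms
proof (induction rule: tail_hull.induct)
  case (midpoint a b)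
  then have "\<bar>a x - c\<bar> \<le> e" "\<bar>b x - c\<bar> \<le> e" by auto
  then show ?case by (simp add: abs_le_iff field_simps)
qed auto

text \<open>Intervals around the limit are convex, so passing to combinations of the tail keeps
  pointwise limits.\<close>

lemma tail_hull_tendsto:
  assumes w: "\<And>n. w n \<in> tail_hull v n" and lim: "(\<lambda>n. v n x) \<longlonglongrightarrow> c"
  shows "(\<lambda>n. w n x) \<longlonglongrightarrow> c"
proof (rule LIMSEQ_I)
  fix e :: real assume "0 < e"
  then have "0 < e / 2" by simp
  then obtain N where N: "\<And>j. j \<ge> N \<Longrightarrow> \<bar>v j x - c\<bar> < e / 2"
    using LIMSEQ_D[OF lim] by (metis real_norm_def)
  show "\<exists>no. \<forall>n\<ge>no. norm (w n x - c) < e"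
  proof (intro exI[of _ N] allI impI)
    fix n assume "N \<le> n"
    then have "\<bar>v j x - c\<bar> \<le> e / 2" if "n \<le> j" for j using N[of j] that by simp
    from tail_hull_close[OF w this] show "norm (w n x - c) < e" using \<open>0 < e\<close> by fastforce
  qed
qed

lemma (in psd_form) tail_hull_bound:
  assumes "w \<in> tail_hull v n" "\<And>j. v j \<in> S" "\<And>j. Q (v j) (v j) \<le> C"
  shows "w \<in> S \<and> Q w w \<le> C"
  using assms(1)
proof (induction rule: tail_hull.induct)
  case (midpoint a b)
  then have ab: "a \<in> S" "b \<in> S" "Q a a \<le> C" "Q b b \<le> C" by auto
  have "Q (\<lambda>x. (1/2) * (a x + b x)) (\<lambda>x. (1/2) * (a x + b x)) \<le> C"
    using add_sq_le[OF ab(1,2)] scale_sq[OF add_mem[OF ab(1,2)], of "1/2"] ab(3,4)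
    by (simp add: power2_eq_square)
  then show ?case using scale_mem[OF add_mem[OF ab(1,2)], of "1/2"] by simp
qed (use assms in auto)

text \<open>A substitute for the Banach--Saks theorem: almost minimal elements of the convex hulls of the
  tails form a Cauchy sequence by the parallelogram law.\<close>

lemma (in psd_form) bounded_imp_Cauchy_hull:
  assumes v: "\<And>j. v j \<in> S" and C: "\<And>j. Q (v j) (v j) \<le> C"
  obtains w where "\<And>n. w n \<in> tail_hull v n" "form_Cauchy Q w"
proof -
  define d where "d n = (INF a\<in>tail_hull v n. Q a a)" for n
  have ne: "tail_hull v n \<noteq> {}" for n using tail_hull.base[of n n v] by auto
  have bdd: "bdd_below ((\<lambda>a. Q a a) ` tail_hull v n)" for n
    using tail_hull_bound[OF _ v C] nonneg by (intro bdd_belowI[of _ 0]) auto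
  have d_le: "a \<in> tail_hull v n \<Longrightarrow> d n \<le> Q a a" for a n
    unfolding d_def by (rule cINF_lower[OF bdd])
  have d_C: "d n \<le> C" for n
    using d_le[OF tail_hull.base[of n n v]] C[of n] by simp
  have d_mono: "incseq d"
    unfolding incseq_def d_def
  proof (intro allI impI)
    fix i j :: nat assume "i \<le> j"
    then show "(INF a\<in>tail_hull v i. Q a a) \<le> (INF a\<in>tail_hull v j. Q a a)"
      by (intro cINF_superset_mono[OF ne bdd tail_hull_mono]) auto
  qed
  have "\<exists>a\<in>tail_hull v n. Q a a < d n + 1 / real (Suc n)" for n
    using cInf_lessD[of "(\<lambda>a. Q a a) ` tail_hull v n" "d n + 1 / real (Suc n)"] ne
    unfolding d_def by fastforce
  then obtain w where w: "\<And>n. w n \<in> tail_hull v n" "\<And>n. Q (w n) (w n) < d n + 1 / real (Suc n)"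
    by metis
  have wS: "w n \<in> S" for n using tail_hull_bound[OF w(1) v C] by blast
  from incseq_convergent[OF d_mono, of C] d_C
  obtain l where l: "d \<longlonglongrightarrow> l" "\<forall>n. d n \<le> l" by blast
  \<comment> \<open>The midpoint of \<open>w i\<close> and \<open>w j\<close> lies in the hull of
    the tail from N, so its energy is at least \<open>d N\<close>, while both endpoints are within
    \<open>1 / (N + 1)\<close> of the limit of the infima. The parallelogram law turns this into a
    bound for the difference.\<close>
  have key: "Q (\<lambda>x. w i x - w j x) (\<lambda>x. w i x - w j x) \<le> 4 * (l - d N) + 4 * (1 / real (Suc N))"
    if "N \<le> i" "N \<le> j" for N i j
  proof -
    have "w i \<in> tail_hull v N" "w j \<in> tail_hull v N"
      using w(1) tail_hull_mono that by blast+
    from d_le[OF tail_hull.midpoint[OF this]]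
    have "4 * d N \<le> Q (\<lambda>x. w i x + w j x) (\<lambda>x. w i x + w j x)"
      using scale_sq[OF add_mem[OF wS wS], of "1/2" i j] by (simp add: power2_eq_square)
    moreover have "Q (\<lambda>x. w i x - w j x) (\<lambda>x. w i x - w j x) =
      2 * Q (w i) (w i) + 2 * Q (w j) (w j) - Q (\<lambda>x. w i x + w j x) (\<lambda>x. w i x + w j x)"
      by (simp add: diff_sq add_sq wS)
    moreover have "Q (w i) (w i) \<le> l + 1 / real (Suc N)" "Q (w j) (w j) \<le> l + 1 / real (Suc N)"
      using w(2)[of i] w(2)[of j] spec[OF l(2), of i] spec[OF l(2), of j] that
        frac_le[of 1 1 "real (Suc N)" "real (Suc i)"] frac_le[of 1 1 "real (Suc N)" "real (Suc j)"]
      by auto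
    moreover have "D \<le> 4 * (l - e) + 4 * \<epsilon>"
      if "4 * e \<le> p" "D = 2 * a + 2 * b - p" "a \<le> l + \<epsilon>" "b \<le> l + \<epsilon>" for D e p a b \<epsilon> :: real
      using that by (simp add: algebra_simps)
    ultimately show ?thesis by blast
  qed
  have "form_Cauchy Q w"
    unfolding form_Cauchy_def
  proof (intro allI impI)
    fix e :: real assume "0 < e"
    have "(\<lambda>N. 4 * (l - d N) + 4 * (1 / real (Suc N))) \<longlonglongrightarrow> 4 * (l - l) + 4 * 0"
      by (intro tendsto_intros l(1) lim_1_over_n[THEN LIMSEQ_Suc])
    then have "(\<lambda>N. 4 * (l - d N) + 4 * (1 / real (Suc N))) \<longlonglongrightarrow> 0" by (simp only: diff_self mult_zero_right add_0)
    from order_tendstoD(2)[OF this \<open>0 < e\<close>] obtain N where N: "4 * (l - d N) + 4 * (1 / real (Suc N)) < e"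
      unfolding eventually_sequentially by blast
    show "\<exists>N. \<forall>i\<ge>N. \<forall>j\<ge>N. Q (\<lambda>x. w i x - w j x) (\<lambda>x. w i x - w j x) < e"
    proof (intro exI[of _ N] allI impI)
      fix i j assume "N \<le> i" "N \<le> j"
      from key[OF this] N show "Q (\<lambda>x. w i x - w j x) (\<lambda>x. w i x - w j x) < e" by (rule order.strict_trans1)
    qed
  qed
  with w(1) show ?thesis by (rule that)
qed

section \<open>Square integrable functions for the completed measure\<close>

lemma L2_integrable_mult:
  assumes "u \<in> L2 m" "v \<in> L2 m"
  shows "integrable (completion m) (\<lambda>x. u x * v x)"
proof (rule Bochner_Integration.integrable_bound)
  show "integrable (completion m) (\<lambda>x. (u x)\<^sup>2 + (v x)\<^sup>2)" using assms by (auto simp: L2_def)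
  show "(\<lambda>x. u x * v x) \<in> borel_measurable (completion m)" using assms by (auto simp: L2_def)
  have "\<bar>a * b\<bar> \<le> a\<^sup>2 + b\<^sup>2" for a b :: real
  proof -
    have "2 * \<bar>a * b\<bar> \<le> a\<^sup>2 + b\<^sup>2"
      using sum_squares_bound[of "\<bar>a\<bar>" "\<bar>b\<bar>"] by (simp add: abs_mult mult.assoc)
    then show ?thesis using abs_ge_zero[of "a * b"] by linarith
  qed
  then show "AE x in completion m. norm (u x * v x) \<le> norm ((u x)\<^sup>2 + (v x)\<^sup>2)" by simp
qed

lemma L2_scale: "u \<in> L2 m \<Longrightarrow> (\<lambda>x. c * u x) \<in> L2 m"
  by (auto simp: L2_def power_mult_distrib)

lemma L2_add:
  assumes "u \<in> L2 m" "v \<in> L2 m"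
  shows "(\<lambda>x. u x + v x) \<in> L2 m"
  using assms L2_integrable_mult[OF assms] by (auto simp: L2_def power2_sum mult.assoc)

lemma inner_L2_psd: "psd_form (L2 m) (inner_L2 m)"
proof
  fix u v w :: "'a \<Rightarrow> real" and c :: real
  assume "u \<in> L2 m" "v \<in> L2 m" "w \<in> L2 m"
  then show "inner_L2 m (\<lambda>x. u x + v x) w = inner_L2 m u w + inner_L2 m v w"
    by (simp add: inner_L2_def distrib_right L2_integrable_mult)
next
  fix u v :: "'a \<Rightarrow> real" and c :: real
  show "inner_L2 m (\<lambda>x. c * u x) v = c * inner_L2 m u v" by (simp add: inner_L2_def mult.assoc)
  show "inner_L2 m u v = inner_L2 m v u" by (simp add: inner_L2_def mult.commute)
qed (auto simp: inner_L2_def L2_add L2_scale)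

interpretation L2: psd_form "L2 m" "inner_L2 m" for m by (rule inner_L2_psd)

lemma inner_L2_cong_AE:
  assumes "u \<in> L2 m" "u' \<in> L2 m" "v \<in> L2 m" "v' \<in> L2 m" "AE x in m. u x = u' x" "AE x in m. v x = v' x"
  shows "inner_L2 m u v = inner_L2 m u' v'"
  unfolding inner_L2_def
  using assms AE_completion[OF assms(5)] AE_completion[OF assms(6)]
  by (intro integral_cong_AE) (auto simp: L2_def)

lemma L2_cong_AE:
  assumes "u \<in> L2 m" "v \<in> borel_measurable (completion m)" "AE x in m. v x = u x"
  shows "v \<in> L2 m"
proof -
  have "integrable (completion m) (\<lambda>x. (v x)\<^sup>2)"
    using assms AE_completion[OF assms(3)]
    by (subst integrable_cong_AE[where g="\<lambda>x. (u x)\<^sup>2"]) (auto simp: L2_def)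
  then show ?thesis using assms(2) by (simp add: L2_def)
qed

lemma inner_L2_zero_AE:
  assumes "u \<in> L2 m" "inner_L2 m u u = 0"
  shows "AE x in m. u x = 0"
proof -
  have "AE x in completion m. u x * u x = 0"
    using assms by (subst integral_nonneg_eq_0_iff_AE[symmetric])
      (auto simp: inner_L2_def L2_integrable_mult)
  then show ?thesis by (simp add: AE_completion_iff)
qed

lemma L2_limit_unique:
  assumes us: "\<And>n. us n \<in> L2 m" and a: "a \<in> L2 m" and b: "b \<in> L2 m"
    and la: "(\<lambda>n. inner_L2 m (\<lambda>x. us n x - a x) (\<lambda>x. us n x - a x)) \<longlonglongrightarrow> 0"
    and lb: "(\<lambda>n. inner_L2 m (\<lambda>x. us n x - b x) (\<lambda>x. us n x - b x)) \<longlonglongrightarrow> 0"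
  shows "AE x in m. a x = b x"
proof -
  let ?d = "\<lambda>x. a x - b x"
  have "inner_L2 m ?d ?d \<le> 2 * inner_L2 m (\<lambda>x. us n x - a x) (\<lambda>x. us n x - a x)
      + 2 * inner_L2 m (\<lambda>x. us n x - b x) (\<lambda>x. us n x - b x)" for n
    using L2.add_sq_le[OF L2.diff_mem[OF a us] L2.diff_mem[OF us b], of n n]
      L2.minus_commute[OF a us, of n] by simp
  moreover have "(\<lambda>n. 2 * inner_L2 m (\<lambda>x. us n x - a x) (\<lambda>x. us n x - a x)
      + 2 * inner_L2 m (\<lambda>x. us n x - b x) (\<lambda>x. us n x - b x)) \<longlonglongrightarrow> 2 * 0 + 2 * 0"
    by (intro tendsto_intros la lb)
  ultimately have "inner_L2 m ?d ?d \<le> 0"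
    by (metis (no_types, lifting) LIMSEQ_le_const add_0 mult_zero_right)
  then have "inner_L2 m ?d ?d = 0" using L2.nonneg[OF L2.diff_mem[OF a b]] by simp
  from inner_L2_zero_AE[OF L2.diff_mem[OF a b] this] show ?thesis by simp
qed

section \<open>Resolvents of a closed form\<close>

context regular_Dirichlet_form
begin

sublocale form: psd_form D \<E>
  by unfold_locales (auto simp: D_add D_scale form_add form_scale intro: form_sym form_nonneg)

lemma D_in_L2: "u \<in> D \<Longrightarrow> u \<in> L2 m"
  using D_L2 by blast

text \<open>Closedness for a limit that is already known: the element supplied by
  \<open>form_closed\<close> is also an L2 limit of the sequence, hence equals \<open>v\<close>
  almost everywhere, and domain and form do not see null sets.\<close>

lemma form_closed_L2:
  assumes w: "\<And>n. w n \<in> D" and v: "v \<in> L2 m" and C: "form_Cauchy \<E> w"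
    and lim: "(\<lambda>n. inner_L2 m (\<lambda>x. w n x - v x) (\<lambda>x. w n x - v x)) \<longlonglongrightarrow> 0"
  shows "v \<in> D" "(\<lambda>n. \<E> (\<lambda>x. w n x - v x) (\<lambda>x. w n x - v x)) \<longlonglongrightarrow> 0"
proof -
  have "form_Cauchy (form1 m \<E>) w"
    unfolding form_Cauchy_def
  proof (intro allI impI)
    fix e :: real assume e: "0 < e"
    obtain N where N: "\<And>i j. i \<ge> N \<Longrightarrow> j \<ge> N \<Longrightarrow> \<E> (\<lambda>x. w i x - w j x) (\<lambda>x. w i x - w j x) < e / 2"
      using C e unfolding form_Cauchy_def by (meson half_gt_zero)
    obtain N' where N': "\<And>n. n \<ge> N' \<Longrightarrow> inner_L2 m (\<lambda>x. w n x - v x) (\<lambda>x. w n x - v x) < e / 8"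
      using order_tendstoD(2)[OF lim, of "e / 8"] e by (auto simp: eventually_sequentially)
    show "\<exists>N. \<forall>i\<ge>N. \<forall>j\<ge>N. form1 m \<E> (\<lambda>x. w i x - w j x) (\<lambda>x. w i x - w j x) < e"
    proof (intro exI[of _ "max N N'"] allI impI)
      fix i j assume ij: "max N N' \<le> i" "max N N' \<le> j"
      have "inner_L2 m (\<lambda>x. w i x - w j x) (\<lambda>x. w i x - w j x) \<le>
          2 * inner_L2 m (\<lambda>x. w i x - v x) (\<lambda>x. w i x - v x) + 2 * inner_L2 m (\<lambda>x. w j x - v x) (\<lambda>x. w j x - v x)"
        using L2.diff_sq_le[OF L2.diff_mem[OF D_in_L2[OF w] v] L2.diff_mem[OF D_in_L2[OF w] v], of i j] by simp
      then show "form1 m \<E> (\<lambda>x. w i x - w j x) (\<lambda>x. w i x - w j x) < e"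
        using N[of i j] N'[of i] N'[of j] ij by (simp add: form1_def)
    qed
  qed
  from form_closed[OF w this] obtain u where u: "u \<in> D"
    and lu: "(\<lambda>n. form1 m \<E> (\<lambda>x. w n x - u x) (\<lambda>x. w n x - u x)) \<longlonglongrightarrow> 0" by blast
  have ge: "0 \<le> \<E> (\<lambda>x. w n x - u x) (\<lambda>x. w n x - u x)" "0 \<le> inner_L2 m (\<lambda>x. w n x - u x) (\<lambda>x. w n x - u x)" for n
    using form.nonneg[OF form.diff_mem[OF w u]] L2.nonneg[OF L2.diff_mem[OF D_in_L2[OF w] D_in_L2[OF u]]] by auto
  have l1: "(\<lambda>n. \<E> (\<lambda>x. w n x - u x) (\<lambda>x. w n x - u x)) \<longlonglongrightarrow> 0"
    using ge by (intro Lim_null_comparison[OF _ lu]) (auto simp: form1_def)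
  have l2: "(\<lambda>n. inner_L2 m (\<lambda>x. w n x - u x) (\<lambda>x. w n x - u x)) \<longlonglongrightarrow> 0"
    using ge by (intro Lim_null_comparison[OF _ lu]) (auto simp: form1_def)
  have eq: "AE x in m. v x = u x"
    using L2_limit_unique[OF D_in_L2[OF w] v D_in_L2[OF u] lim l2] .
  show vD: "v \<in> D" using D_AE[OF u v eq] .
  have "\<E> (\<lambda>x. w n x - v x) (\<lambda>x. w n x - v x) = \<E> (\<lambda>x. w n x - u x) (\<lambda>x. w n x - u x)" for n
  proof -
    have d: "(\<lambda>x. w n x - v x) \<in> D" "(\<lambda>x. w n x - u x) \<in> D" using form.diff_mem w vD u by auto
    have ae: "AE x in m. w n x - v x = w n x - u x" using eq by eventually_elim simp
    show ?thesis
      using form_AE[OF d(2,1,1) ae] form_AE[OF d(2,1,2) ae] form_sym d by metis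
  qed
  with l1 show "(\<lambda>n. \<E> (\<lambda>x. w n x - v x) (\<lambda>x. w n x - v x)) \<longlonglongrightarrow> 0" by simp
qed

text \<open>The weak form of (\<alpha> - A) w = v. For \<alpha> > 0 it determines \<open>w\<close>
  up to null sets, so \<open>w\<close> is the L2 resolvent of \<open>v\<close>.\<close>

definition is_res :: "real \<Rightarrow> ('a \<Rightarrow> real) \<Rightarrow> ('a \<Rightarrow> real) \<Rightarrow> bool" where
  "is_res \<alpha> v w \<longleftrightarrow> w \<in> D \<and> (\<forall>z\<in>D. \<E> w z = inner_L2 m v z - \<alpha> * inner_L2 m w z)"

lemma is_resD: "is_res \<alpha> v w \<Longrightarrow> w \<in> D" "is_res \<alpha> v w \<Longrightarrow> z \<in> D \<Longrightarrow> \<E> w z = inner_L2 m v z - \<alpha> * inner_L2 m w z"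
  by (auto simp: is_res_def)

lemma is_res_diff:
  assumes "is_res \<alpha> v w" "is_res \<alpha> v' w'" "v \<in> L2 m" "v' \<in> L2 m"
  shows "is_res \<alpha> (\<lambda>x. v x - v' x) (\<lambda>x. w x - w' x)"
  using assms unfolding is_res_def
  by (auto simp: form.diff_mem form.diff_left L2.diff_left D_in_L2 algebra_simps)

lemma is_res_scaled_form:
  assumes w: "is_res \<alpha> v w" and v: "v \<in> L2 m" and z: "z \<in> D"
  shows "\<E> (\<lambda>x. \<alpha> * w x) z = \<alpha> * (inner_L2 m v z - inner_L2 m (\<lambda>x. \<alpha> * w x) z)"
  using is_resD[OF w] z by (simp add: form_scale L2.scale_left D_in_L2)

text \<open>The right-hand side is the approximate form \<alpha> (v - \<alpha> G_\<alpha> v, v).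
  Testing the resolvent equation with \<open>w'\<close> itself and expanding the square shows that
  it controls both the energy of \<open>w'\<close> and its distance from \<open>v\<close>.\<close>

lemma is_res_energy_le:
  assumes w: "is_res \<alpha> v w" and \<alpha>: "\<alpha> > 0" and v: "v \<in> L2 m"
  defines "w' \<equiv> (\<lambda>x. \<alpha> * w x)"
  shows "\<E> w' w' + \<alpha> * inner_L2 m (\<lambda>x. v x - w' x) (\<lambda>x. v x - w' x) = \<alpha> * (inner_L2 m v v - inner_L2 m w' v)"
proof -
  have w'D: "w' \<in> D" unfolding w'_def by (intro D_scale is_resD[OF w])
  note w'L = D_in_L2[OF w'D]
  have "\<E> w' w' = \<alpha> * (inner_L2 m v w' - inner_L2 m w' w')"
    using is_res_scaled_form[OF w v w'D] by (simp add: w'_def)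
  then show ?thesis by (simp add: L2.diff_sq v w'L L2.sym[of v m w'] algebra_simps)
qed

lemma is_res_contraction:
  assumes w: "is_res \<alpha> v w" and \<alpha>: "\<alpha> > 0" and v: "v \<in> L2 m"
  shows "inner_L2 m (\<lambda>x. \<alpha> * w x) (\<lambda>x. \<alpha> * w x) \<le> inner_L2 m v v"
proof -
  let ?w = "\<lambda>x. \<alpha> * w x"
  have wD: "?w \<in> D" by (intro D_scale is_resD[OF w])
  have "0 \<le> \<alpha> * (inner_L2 m v ?w - inner_L2 m ?w ?w)"
    using form.nonneg[OF wD] is_res_scaled_form[OF w v wD] by simp
  then have "inner_L2 m ?w ?w \<le> inner_L2 m v ?w" using \<alpha> by (simp add: zero_le_mult_iff)
  then show ?thesis
    using L2.nonneg[OF L2.diff_mem[OF v D_in_L2[OF wD]]] by (simp add: L2.diff_sq v D_in_L2[OF wD])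
qed

text \<open>Energies of \<alpha> G_\<alpha> v increase with \<alpha>, and the increase dominates the
  energy of the difference d = b - a. The point is \<E> a d \<ge> 0: this is \<alpha> times
  \<open>?p\<close>, and (\<beta> - \<alpha>) \<open>?p\<close> = \<E> d d + \<beta> (d, d).\<close>

lemma is_res_energy_mono:
  assumes w: "is_res \<alpha> v w" and z: "is_res \<beta> v z" and \<alpha>: "0 < \<alpha>" "\<alpha> \<le> \<beta>" and v: "v \<in> L2 m"
  defines "a \<equiv> (\<lambda>x. \<alpha> * w x)" and "b \<equiv> (\<lambda>x. \<beta> * z x)"
  shows "\<E> (\<lambda>x. b x - a x) (\<lambda>x. b x - a x) \<le> \<E> b b - \<E> a a"
proof (cases "\<alpha> = \<beta>")
  \<comment> \<open>Division by \<beta> - \<alpha> is impossible here. Both functions are resolvents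
    of the same \<open>v\<close>, so their difference has energy zero.\<close>
  case eq: True
  have aD: "a \<in> D" and bD: "b \<in> D" unfolding a_def b_def by (intro D_scale is_resD[OF w] is_resD[OF z])+
  have rest: "\<E> a x = \<E> b x + \<beta> * (inner_L2 m b x - inner_L2 m a x)" if "x \<in> D" for x
    using is_res_scaled_form[OF w v that] is_res_scaled_form[OF z v that] by (simp add: a_def b_def eq algebra_simps)
  have d: "(\<lambda>x. b x - a x) \<in> D" using aD bD by (rule form.diff_mem[rotated])
  have "\<E> (\<lambda>x. b x - a x) (\<lambda>x. b x - a x) = - \<beta> * inner_L2 m (\<lambda>x. b x - a x) (\<lambda>x. b x - a x)"
    using rest[OF d] by (simp add: form.diff_left L2.diff_left aD bD D_in_L2 d algebra_simps)
  then have e0: "\<E> (\<lambda>x. b x - a x) (\<lambda>x. b x - a x) = 0"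
    using form.nonneg[OF d] L2.nonneg[OF D_in_L2[OF d]] \<alpha> eq
    by (smt (verit) mult_nonneg_nonneg mult_minus_left)
  have "\<bar>\<E> a (\<lambda>x. b x - a x)\<bar> \<le> 0" using form.Cauchy_Schwarz_sqrt[OF aD d] e0 by simp
  then have "\<E> a b = \<E> a a" using form.diff_right[OF bD aD aD] by simp
  moreover have "\<E> (\<lambda>x. b x - a x) (\<lambda>x. b x - a x) = \<E> b b - 2 * \<E> b a + \<E> a a" using form.diff_sq[OF bD aD] .
  ultimately show ?thesis using e0 form_sym[OF aD bD] by simp
next
  case False
  with \<alpha> have lt: "\<beta> - \<alpha> > 0" by simp
  have aD: "a \<in> D" and bD: "b \<in> D" unfolding a_def b_def by (intro D_scale is_resD[OF w] is_resD[OF z])+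
  have dD: "(\<lambda>x. b x - a x) \<in> D" using aD bD by (rule form.diff_mem[rotated])
  let ?d = "\<lambda>x. b x - a x"
  let ?p = "inner_L2 m v ?d - inner_L2 m a ?d"
  have ea: "\<E> a ?d = \<alpha> * ?p" using is_res_scaled_form[OF w v dD] by (simp add: a_def)
  have eb: "\<E> b ?d = \<beta> * (inner_L2 m v ?d - inner_L2 m b ?d)"
    using is_res_scaled_form[OF z v dD] by (simp add: b_def)
  have dd: "inner_L2 m ?d ?d = inner_L2 m b ?d - inner_L2 m a ?d" "\<E> ?d ?d = \<E> b ?d - \<E> a ?d"
    by (simp_all add: form.diff_left L2.diff_left aD bD D_in_L2 dD)
  have "(\<beta> - \<alpha>) * ?p = \<E> ?d ?d + \<beta> * inner_L2 m ?d ?d"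
    unfolding dd ea eb by (simp add: algebra_simps)
  moreover have "0 \<le> \<E> ?d ?d + \<beta> * inner_L2 m ?d ?d"
    using form.nonneg[OF dD] L2.nonneg[OF D_in_L2[OF dD]] \<alpha> by simp
  ultimately have "0 \<le> ?p" using lt by (metis zero_le_mult_iff not_le)
  then have "0 \<le> \<E> a ?d" unfolding ea using \<alpha> by simp
  then show ?thesis
    using form.diff_sq[OF bD aD] form.diff_right[OF bD aD aD] form_sym[OF aD bD] by simp
qed

text \<open>The approximate forms characterise the domain. If they stay below C, the functions a G_a
  v tend to \<open>v\<close> in L2 at rate C / a, and their increasing bounded energies make them
  \<E>-Cauchy by \<open>is_res_energy_mono\<close>; no weak compactness enters.\<close>

lemma L2_bounded_res_imp_D:
  assumes v: "v \<in> L2 m" and w: "\<And>n. is_res (a n) v (w n)" and a: "\<And>n. 0 < a n" "incseq a"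
    "filterlim a at_top sequentially"
    and C: "\<And>n. a n * (inner_L2 m v v - inner_L2 m (\<lambda>x. a n * w n x) v) \<le> C"
  shows "v \<in> D" "\<E> v v \<le> C"
proof -
  define y where "y n = (\<lambda>x. a n * w n x)" for n
  have yD: "y n \<in> D" for n unfolding y_def by (intro D_scale is_resD[OF w])
  have e: "\<E> (y n) (y n) + a n * inner_L2 m (\<lambda>x. v x - y n x) (\<lambda>x. v x - y n x) \<le> C" for n
    using is_res_energy_le[OF w a(1) v, of n] C[of n] by (simp add: y_def)
  have nn: "0 \<le> \<E> (y n) (y n)" "0 \<le> inner_L2 m (\<lambda>x. v x - y n x) (\<lambda>x. v x - y n x)" for n
    using form.nonneg[OF yD] L2.nonneg[OF L2.diff_mem[OF v D_in_L2[OF yD]]] by auto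
  have eC: "\<E> (y n) (y n) \<le> C" for n
    using e[of n] mult_nonneg_nonneg[OF less_imp_le[OF a(1)] nn(2), of n n] by linarith
  have "inner_L2 m (\<lambda>x. v x - y n x) (\<lambda>x. v x - y n x) \<le> C / a n" for n
    using e[of n] nn(1)[of n] a(1)[of n] by (simp add: field_simps)
  then have le: "\<forall>\<^sub>F n in sequentially. norm (inner_L2 m (\<lambda>x. v x - y n x) (\<lambda>x. v x - y n x)) \<le> C / a n"
    using nn(2) by (intro always_eventually) simp
  have "(\<lambda>n. C / a n) \<longlonglongrightarrow> 0"
    by (rule tendsto_divide_0[OF tendsto_const filterlim_at_top_imp_at_infinity[OF a(3)]])
  from Lim_null_comparison[OF le this]
  have "(\<lambda>n. inner_L2 m (\<lambda>x. v x - y n x) (\<lambda>x. v x - y n x)) \<longlonglongrightarrow> 0" .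
  then have l: "(\<lambda>n. inner_L2 m (\<lambda>x. y n x - v x) (\<lambda>x. y n x - v x)) \<longlonglongrightarrow> 0"
    using L2.minus_commute[OF v D_in_L2[OF yD]] by simp
  have mono: "\<E> (\<lambda>x. y j x - y i x) (\<lambda>x. y j x - y i x) \<le> \<E> (y j) (y j) - \<E> (y i) (y i)" if "i \<le> j" for i j
    using is_res_energy_mono[OF w w a(1) _ v, of i j] incseqD[OF a(2) that] by (simp add: y_def)
  have "incseq (\<lambda>n. \<E> (y n) (y n))"
    unfolding incseq_def
  proof (intro allI impI)
    fix i j :: nat assume "i \<le> j"
    from mono[OF this] form.nonneg[OF form.diff_mem[OF yD yD], of j i] show "\<E> (y i) (y i) \<le> \<E> (y j) (y j)" by linarith
  qed
  from incseq_convergent[OF this, of C] eC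
  obtain L where L: "(\<lambda>n. \<E> (y n) (y n)) \<longlonglongrightarrow> L" "\<forall>n. \<E> (y n) (y n) \<le> L" by blast
  have Cy: "form_Cauchy \<E> y"
    unfolding form_Cauchy_def
  proof (intro allI impI)
    fix \<epsilon> :: real assume "0 < \<epsilon>"
    then have "L - \<epsilon> < L" by simp
    from order_tendstoD(1)[OF L(1) this] obtain N where N: "\<And>n. n \<ge> N \<Longrightarrow> L - \<epsilon> < \<E> (y n) (y n)"
      unfolding eventually_sequentially by blast
    have "\<E> (\<lambda>x. y j x - y i x) (\<lambda>x. y j x - y i x) < \<epsilon>" if "N \<le> i" "i \<le> j" for i j
      using mono[OF that(2)] N[OF that(1)] spec[OF L(2), of j] by simp
    then show "\<exists>N. \<forall>i\<ge>N. \<forall>j\<ge>N. \<E> (\<lambda>x. y i x - y j x) (\<lambda>x. y i x - y j x) < \<epsilon>"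
      using form.minus_commute[OF yD yD] by (intro exI[of _ N]) (metis nat_le_linear)
  qed
  show vD: "v \<in> D" using form_closed_L2(1)[OF yD v Cy l] .
  have "(\<lambda>n. \<E> (y n) (y n)) \<longlonglongrightarrow> \<E> v v"
    by (rule form.tendsto_sq[OF yD vD form_closed_L2(2)[OF yD v Cy l]])
  then show "\<E> v v \<le> C" using eC by (intro LIMSEQ_le_const2) auto
qed

text \<open>The approximate form equals \<E> w' v and dominates \<E> w' w', where w' = \<alpha> w.
  Nonnegativity of \<E> (w' - v) (w' - v) then bounds it by \<E> v v.\<close>

lemma is_res_energy_le_form:
  assumes w: "is_res \<alpha> v w" and \<alpha>: "\<alpha> > 0" and v: "v \<in> D"
  shows "\<alpha> * (inner_L2 m v v - inner_L2 m (\<lambda>x. \<alpha> * w x) v) \<le> \<E> v v"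
proof -
  let ?w = "\<lambda>x. \<alpha> * w x"
  let ?e = "\<alpha> * (inner_L2 m v v - inner_L2 m ?w v)"
  note vL = D_in_L2[OF v]
  have wD: "?w \<in> D" by (intro D_scale is_resD[OF w])
  have e: "?e = \<E> ?w v" using is_res_scaled_form[OF w vL v] by simp
  have le: "\<E> ?w ?w \<le> ?e"
    using is_res_energy_le[OF w \<alpha> vL]
      mult_nonneg_nonneg[OF less_imp_le[OF \<alpha>] L2.nonneg[OF L2.diff_mem[OF vL D_in_L2[OF wD]]]] by linarith
  have "0 \<le> \<E> (\<lambda>x. ?w x - v x) (\<lambda>x. ?w x - v x)" using form.nonneg[OF form.diff_mem[OF wD v]] .
  then show ?thesis using form.diff_sq[OF wD v] le e by simp
qed

text \<open>Completing the square gives \<alpha> \<E> w w \<le> (v, v) for a resolvent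
  \<open>w\<close> of \<open>v\<close>. L2 convergence of the data therefore forces \<E>-convergence
  of the resolvents, and the weak equation passes to the limit. This removes boundedness assumptions
  on the data.\<close>

lemma is_res_L2_limit:
  assumes v: "\<And>n. v n \<in> L2 m" "v0 \<in> L2 m" and w: "\<And>n. is_res \<alpha> (v n) (w n)" and w0: "w0 \<in> L2 m" and \<alpha>: "\<alpha> > 0"
    and lv: "(\<lambda>n. inner_L2 m (\<lambda>x. v n x - v0 x) (\<lambda>x. v n x - v0 x)) \<longlonglongrightarrow> 0"
    and lw: "(\<lambda>n. inner_L2 m (\<lambda>x. w n x - w0 x) (\<lambda>x. w n x - w0 x)) \<longlonglongrightarrow> 0"
  shows "is_res \<alpha> v0 w0"
proof -
  have wD: "w n \<in> D" for n using is_resD(1)[OF w] .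
  have bound: "\<alpha> * \<E> (\<lambda>x. w i x - w j x) (\<lambda>x. w i x - w j x) \<le> inner_L2 m (\<lambda>x. v i x - v j x) (\<lambda>x. v i x - v j x)" for i j
  proof -
    let ?v = "\<lambda>x. v i x - v j x" and ?w = "\<lambda>x. w i x - w j x"
    have vL: "?v \<in> L2 m" using L2.diff_mem v by blast
    have r: "is_res \<alpha> ?v ?w" by (rule is_res_diff[OF w w v(1) v(1)])
    have wL: "?w \<in> L2 m" using is_resD(1)[OF r] D_in_L2 by blast
    have "\<alpha> * \<E> ?w ?w = \<alpha> * inner_L2 m ?v ?w - \<alpha>\<^sup>2 * inner_L2 m ?w ?w"
      using is_resD(2)[OF r is_resD(1)[OF r]] by (simp add: right_diff_distrib power2_eq_square mult.assoc)
    moreover have "0 \<le> inner_L2 m ?v ?v - 2 * \<alpha> * inner_L2 m ?v ?w + \<alpha>\<^sup>2 * inner_L2 m ?w ?w"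
      using L2.diff_scaled_sq[OF vL wL, of \<alpha>] L2.nonneg[OF L2.diff_mem[OF vL L2.scale_mem[OF wL]], of \<alpha>] by simp
    moreover have "0 \<le> \<alpha>\<^sup>2 * inner_L2 m ?w ?w" "0 \<le> inner_L2 m ?v ?v" "0 \<le> \<alpha> * \<E> ?w ?w"
      using L2.nonneg[OF vL] L2.nonneg[OF wL] form.nonneg[OF is_resD(1)[OF r]] \<alpha> by auto
    ultimately show ?thesis by linarith
  qed
  have Cw: "form_Cauchy \<E> w"
    unfolding form_Cauchy_def
  proof (intro allI impI)
    fix e :: real assume e: "0 < e"
    then have "0 < \<alpha> * e / 8" using \<alpha> by simp
    from order_tendstoD(2)[OF lv this] obtain N
      where N: "\<And>n. n \<ge> N \<Longrightarrow> inner_L2 m (\<lambda>x. v n x - v0 x) (\<lambda>x. v n x - v0 x) < \<alpha> * e / 8"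
      by (auto simp: eventually_sequentially)
    show "\<exists>N. \<forall>i\<ge>N. \<forall>j\<ge>N. \<E> (\<lambda>x. w i x - w j x) (\<lambda>x. w i x - w j x) < e"
    proof (intro exI[of _ N] allI impI)
      fix i j assume ij: "N \<le> i" "N \<le> j"
      have "inner_L2 m (\<lambda>x. v i x - v j x) (\<lambda>x. v i x - v j x) \<le>
          2 * inner_L2 m (\<lambda>x. v i x - v0 x) (\<lambda>x. v i x - v0 x) + 2 * inner_L2 m (\<lambda>x. v j x - v0 x) (\<lambda>x. v j x - v0 x)"
        using L2.diff_sq_le[OF L2.diff_mem[OF v] L2.diff_mem[OF v], of i j] by simp
      moreover have "0 < \<alpha> * e" using e \<alpha> by simp
      ultimately have "\<alpha> * \<E> (\<lambda>x. w i x - w j x) (\<lambda>x. w i x - w j x) < \<alpha> * e"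
        using bound[of i j] N[OF ij(1)] N[OF ij(2)] by linarith
      then show "\<E> (\<lambda>x. w i x - w j x) (\<lambda>x. w i x - w j x) < e" using \<alpha> by simp
    qed
  qed
  have w0D: "w0 \<in> D" by (rule form_closed_L2(1)[OF wD w0 Cw lw])
  have "\<E> w0 z = inner_L2 m v0 z - \<alpha> * inner_L2 m w0 z" if z: "z \<in> D" for z
  proof (rule LIMSEQ_unique)
    show "(\<lambda>n. \<E> (w n) z) \<longlonglongrightarrow> \<E> w0 z"
      by (rule form.tendsto_left[OF wD w0D z form_closed_L2(2)[OF wD w0 Cw lw]])
    have "(\<lambda>n. inner_L2 m (v n) z - \<alpha> * inner_L2 m (w n) z) \<longlonglongrightarrow> inner_L2 m v0 z - \<alpha> * inner_L2 m w0 z"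
      by (intro tendsto_diff tendsto_mult tendsto_const L2.tendsto_left[OF v(1) v(2) D_in_L2[OF z] lv]
          L2.tendsto_left[OF D_in_L2[OF wD] w0 D_in_L2[OF z] lw])
    then show "(\<lambda>n. \<E> (w n) z) \<longlonglongrightarrow> inner_L2 m v0 z - \<alpha> * inner_L2 m w0 z"
      using is_resD(2)[OF w z] by simp
  qed
  with w0D show ?thesis by (simp add: is_res_def)
qed

text \<open>Convergence is clear for \<open>v \<in> D\<close>, with rate \<open>\<E> v v / \<alpha>\<close>, and extends by density.\<close>

lemma is_res_strong_continuity:
  assumes v: "v \<in> L2 m" and res: "\<And>n y. y \<in> L2 m \<Longrightarrow> is_res (a n) y (w n y)" and a: "\<And>n. 0 < a n"
    "filterlim a at_top sequentially"
  shows "(\<lambda>n. inner_L2 m (\<lambda>x. a n * w n v x - v x) (\<lambda>x. a n * w n v x - v x)) \<longlonglongrightarrow> 0"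
proof -
  define y where "y n u = (\<lambda>x. a n * w n u x)" for n u
  have yL: "y n u \<in> L2 m" if "u \<in> L2 m" for n u
    unfolding y_def using is_resD(1)[OF res[OF that]] D_in_L2 L2_scale by blast
  have "\<forall>\<^sub>F n in sequentially. dist (inner_L2 m (\<lambda>x. a n * w n v x - v x) (\<lambda>x. a n * w n v x - v x)) 0 < c"
    if c: "0 < c" for c
  proof -
    \<comment> \<open>The error for \<open>v\<close> splits into three pieces: the error for
      \<open>u\<close>, the difference \<open>v - u\<close>, and its image, which the contraction
      property keeps as small. Each use of the inequality for squares costs a factor 2, whence c /
      16.\<close>
    obtain u where u: "u \<in> D" "inner_L2 m (\<lambda>x. v x - u x) (\<lambda>x. v x - u x) < c / 16"
      using D_dense[OF v, of "c / 16"] c by auto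
    note uL = D_in_L2[OF u(1)]
    let ?d = "\<lambda>x. v x - u x"
    have dL: "?d \<in> L2 m" using L2.diff_mem[OF v uL] .
    have "(\<lambda>n. \<E> u u / a n) \<longlonglongrightarrow> 0"
      by (rule tendsto_divide_0[OF tendsto_const filterlim_at_top_imp_at_infinity[OF a(2)]])
    moreover have "0 < c / 4" using c by simp
    ultimately have "\<forall>\<^sub>F n in sequentially. \<E> u u / a n < c / 4" by (rule order_tendstoD(2))
    then show ?thesis
    proof eventually_elim
      case (elim n)
      have "a n * inner_L2 m (\<lambda>x. u x - y n u x) (\<lambda>x. u x - y n u x) \<le> \<E> u u"
        using is_res_energy_le[OF res[OF uL] a(1) uL, of n] is_res_energy_le_form[OF res[OF uL] a(1) u(1), of n]
          form.nonneg[OF D_scale[OF is_resD(1)[OF res[OF uL]]], of "a n" n] by (simp add: y_def)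
      then have "inner_L2 m (\<lambda>x. u x - y n u x) (\<lambda>x. u x - y n u x) \<le> \<E> u u / a n"
        by (simp only: pos_le_divide_eq[OF a(1)] mult.commute)
      with elim have 1: "inner_L2 m (\<lambda>x. u x - y n u x) (\<lambda>x. u x - y n u x) < c / 4" by linarith
      define e where "e = (\<lambda>x. y n v x - y n u x)"
      have eL: "e \<in> L2 m" unfolding e_def by (intro L2.diff_mem yL v uL)
      have "inner_L2 m e e \<le> inner_L2 m ?d ?d"
        using is_res_contraction[OF is_res_diff[OF res[OF v] res[OF uL] v uL] a(1) dL, of n]
        by (simp add: e_def y_def right_diff_distrib)
      then have 2: "inner_L2 m e e < c / 16" using u(2) by simp
      have "inner_L2 m (\<lambda>x. e x - ?d x) (\<lambda>x. e x - ?d x) \<le> 2 * inner_L2 m e e + 2 * inner_L2 m ?d ?d"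
        by (rule L2.diff_sq_le[OF eL dL])
      then have 3: "inner_L2 m (\<lambda>x. e x - ?d x) (\<lambda>x. e x - ?d x) < c / 4" using 2 u(2) by simp
      have "inner_L2 m (\<lambda>x. y n v x - v x) (\<lambda>x. y n v x - v x) =
          inner_L2 m (\<lambda>x. (e x - ?d x) - (u x - y n u x)) (\<lambda>x. (e x - ?d x) - (u x - y n u x))"
        by (simp add: e_def)
      also have "\<dots> \<le> 2 * inner_L2 m (\<lambda>x. e x - ?d x) (\<lambda>x. e x - ?d x) + 2 * inner_L2 m (\<lambda>x. u x - y n u x) (\<lambda>x. u x - y n u x)"
        by (rule L2.diff_sq_le[OF L2.diff_mem[OF eL dL] L2.diff_mem[OF uL yL[OF uL]]])
      also have "\<dots> < c" using 1 3 by linarith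
      finally have "inner_L2 m (\<lambda>x. y n v x - v x) (\<lambda>x. y n v x - v x) < c" .
      moreover have "0 \<le> inner_L2 m (\<lambda>x. y n v x - v x) (\<lambda>x. y n v x - v x)"
        by (rule L2.nonneg[OF L2.diff_mem[OF yL[OF v] v]])
      ultimately show ?case by (simp only: y_def dist_real_def diff_0_right abs_of_nonneg)
    qed
  qed
  then show ?thesis by (rule tendstoI)
qed

end

section \<open>Symmetric resolvent kernels\<close>

lemma (in regular_Dirichlet_form) space_m [simp]: "space m = UNIV"
  using sets_eq_imp_space_eq[OF sets_m] by simp

text \<open>Local compactness covers the space by open sets of finite measure, and second
  countability leaves countably many of them.\<close>

lemma (in regular_Dirichlet_form) sigma_finite_m: "sigma_finite_measure m"
proof
  define \<B> where "\<B> = {U :: 'a set. open U \<and> emeasure m U < \<infinity>}"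
  have ex: "\<exists>U\<in>\<B>. x \<in> U" for x
  proof -
    obtain U K where UK: "open U" "compact K" "x \<in> U" "U \<subseteq> K"
      using locally_compact unfolding locally_compact_space_def by (auto dest!: spec[of _ x])
    have "emeasure m U \<le> emeasure m K"
      using UK sets_m by (intro emeasure_mono) (auto intro: borel_closed compact_imp_closed)
    then show ?thesis using UK compact_finite[OF UK(2)] unfolding \<B>_def by (auto intro!: bexI[of _ U] order.strict_trans1)
  qed
  have open_\<B>: "open S" if "S \<in> \<B>" for S using that by (simp add: \<B>_def)
  obtain \<C> where \<C>: "\<C> \<subseteq> \<B>" "countable \<C>" "\<Union>\<C> = \<Union>\<B>"
    by (rule Lindelof[OF open_\<B>])
  have "\<C> \<subseteq> sets m"
  proof
    fix a assume "a \<in> \<C>"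
    then have "open a" using \<C>(1) open_\<B> by (meson subsetD)
    then show "a \<in> sets m" by (simp add: sets_m)
  qed
  moreover have "\<forall>a\<in>\<C>. emeasure m a \<noteq> \<infinity>"
  proof
    fix a assume "a \<in> \<C>"
    then have "a \<in> \<B>" using \<C>(1) by (rule subsetD[rotated])
    then show "emeasure m a \<noteq> \<infinity>" by (simp add: \<B>_def less_top)
  qed
  moreover have "\<Union>\<C> = space m"
    unfolding \<C>(3) space_m
  proof (rule UNIV_eq_I[symmetric])
    fix x show "x \<in> \<Union>\<B>" using ex[of x] by (rule bexE) (rule UnionI)
  qed
  ultimately show "\<exists>A. countable A \<and> A \<subseteq> sets m \<and> \<Union>A = space m \<and> (\<forall>a\<in>A. emeasure m a \<noteq> \<infinity>)"
    using \<C>(2) by (meson)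
qed

definition kernel_op :: "'a measure \<Rightarrow> (real \<Rightarrow> 'a \<Rightarrow> 'a \<Rightarrow> ennreal) \<Rightarrow> real \<Rightarrow> ('a \<Rightarrow> ennreal) \<Rightarrow> 'a \<Rightarrow> ennreal" where
  "kernel_op m r \<alpha> h x = (\<integral>\<^sup>+y. h y * r \<alpha> x y \<partial>m)"

text \<open>The interface between process and form: all later estimates use these properties of the
  kernels and no paths. The link to the form is required for bounded nonnegative functions and
  \<alpha> > 0 only; L2 limits extend it, and \<alpha> = 0 is reached through
  \<open>resolvent_SUP\<close>.\<close>

locale symmetric_resolvent = regular_Dirichlet_form m D \<E>
  for m :: "'a::{metric_space, second_countable_topology} measure" and D \<E> +
  fixes r :: "real \<Rightarrow> 'a \<Rightarrow> 'a \<Rightarrow> ennreal"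
  assumes r_measurable: "\<alpha> \<ge> 0 \<Longrightarrow> (\<lambda>(x, y). r \<alpha> x y) \<in> borel_measurable (borel \<Otimes>\<^sub>M borel)"
    and r_sym: "\<alpha> \<ge> 0 \<Longrightarrow> r \<alpha> x y = r \<alpha> y x"
    and sub_Markov: "\<alpha> > 0 \<Longrightarrow> ennreal \<alpha> * kernel_op m r \<alpha> (\<lambda>_. 1) x \<le> 1"
    and resolvent_equation: "0 \<le> \<alpha> \<Longrightarrow> \<alpha> \<le> \<beta> \<Longrightarrow> h \<in> borel_measurable borel \<Longrightarrow>
      kernel_op m r \<alpha> h x = kernel_op m r \<beta> h x + ennreal (\<beta> - \<alpha>) * kernel_op m r \<beta> (kernel_op m r \<alpha> h) x"
    and resolvent_commute: "0 \<le> \<alpha> \<Longrightarrow> 0 \<le> \<beta> \<Longrightarrow> h \<in> borel_measurable borel \<Longrightarrow>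
      kernel_op m r \<alpha> (kernel_op m r \<beta> h) x = kernel_op m r \<beta> (kernel_op m r \<alpha> h) x"
    and resolvent_SUP: "h \<in> borel_measurable borel \<Longrightarrow> (SUP n. kernel_op m r (1 / real (Suc n)) h x) = kernel_op m r 0 h x"
    and bounded_is_res: "\<alpha> > 0 \<Longrightarrow> k \<in> borel_measurable borel \<Longrightarrow> (\<And>x. 0 \<le> k x \<and> k x \<le> C) \<Longrightarrow> k \<in> L2 m \<Longrightarrow>
      is_res \<alpha> k (\<lambda>x. enn2real (kernel_op m r \<alpha> (\<lambda>y. ennreal (k y)) x))"
begin

abbreviation G where "G \<equiv> kernel_op m r"

sublocale sigma_finite_measure m by (rule sigma_finite_m)
sublocale mm: pair_sigma_finite m m ..

lemmas G_def = kernel_op_def[of m r]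

declare sets_m [measurable_cong]

lemma r_measurable' [measurable]: "\<alpha> \<ge> 0 \<Longrightarrow> (\<lambda>(x, y). r \<alpha> x y) \<in> borel_measurable (borel \<Otimes>\<^sub>M m)"
  using r_measurable by simp

lemma r_measurable_right [measurable]: "\<alpha> \<ge> 0 \<Longrightarrow> (\<lambda>y. r \<alpha> x y) \<in> borel_measurable borel"
  using measurable_compose[OF measurable_Pair1'[of x borel borel] r_measurable, of \<alpha>] by simp

lemma r_measurable_left [measurable]: "\<alpha> \<ge> 0 \<Longrightarrow> (\<lambda>x. r \<alpha> x y) \<in> borel_measurable borel"
  using r_measurable_right[of \<alpha> y] r_sym[of \<alpha> _ y] by simp

lemma G_measurable [measurable]:
  assumes [measurable]: "h \<in> borel_measurable borel" and \<alpha>: "\<alpha> \<ge> 0"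
  shows "G \<alpha> h \<in> borel_measurable borel"
proof -
  have "(\<lambda>(x, y). h y * r \<alpha> x y) \<in> borel_measurable (borel \<Otimes>\<^sub>M m)"
    using r_measurable'[OF \<alpha>] by measurable
  from borel_measurable_nn_integral[OF this] show ?thesis unfolding kernel_op_def .
qed

lemma G_mono: "(\<And>y. h y \<le> k y) \<Longrightarrow> G \<alpha> h x \<le> G \<alpha> k x"
  unfolding G_def by (intro nn_integral_mono mult_right_mono) auto

lemma G_mono_AE: "AE y in m. h y \<le> k y \<Longrightarrow> G \<alpha> h x \<le> G \<alpha> k x"
  unfolding G_def by (intro nn_integral_mono_AE) (auto elim!: eventually_mono intro: mult_right_mono)

lemma G_cong_AE: "AE y in m. h y = k y \<Longrightarrow> G \<alpha> h x = G \<alpha> k x"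
  unfolding G_def by (intro nn_integral_cong_AE) auto

lemma G_add:
  assumes [measurable]: "h \<in> borel_measurable borel" "k \<in> borel_measurable borel" and \<alpha>: "\<alpha> \<ge> 0"
  shows "G \<alpha> (\<lambda>y. h y + k y) x = G \<alpha> h x + G \<alpha> k x"
  unfolding G_def using r_measurable_right[OF \<alpha>, of x]
  by (subst nn_integral_add[symmetric]) (auto simp: distrib_right)

lemma G_cmult:
  assumes [measurable]: "h \<in> borel_measurable borel" and \<alpha>: "\<alpha> \<ge> 0"
  shows "G \<alpha> (\<lambda>y. c * h y) x = c * G \<alpha> h x"
  unfolding G_def using r_measurable_right[OF \<alpha>, of x]
  by (subst nn_integral_cmult[symmetric]) (auto simp: mult.assoc)

lemma G_monotone:
  assumes [measurable]: "\<And>n. h n \<in> borel_measurable borel" and \<alpha>: "\<alpha> \<ge> 0" and mono: "incseq h"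
  shows "G \<alpha> (\<lambda>y. SUP n. h n y) x = (SUP n. G \<alpha> (h n) x)"
proof -
  have "(\<integral>\<^sup>+y. (SUP n. h n y * r \<alpha> x y) \<partial>m) = (SUP n. \<integral>\<^sup>+y. h n y * r \<alpha> x y \<partial>m)"
    using r_measurable_right[OF \<alpha>, of x] mono
    by (intro nn_integral_monotone_convergence_SUP) (auto simp: incseq_def le_fun_def intro!: mult_right_mono)
  then show ?thesis by (simp add: G_def SUP_mult_right_ennreal)
qed

lemma G_sym:
  assumes [measurable]: "h \<in> borel_measurable borel" "k \<in> borel_measurable borel" and \<alpha>: "\<alpha> \<ge> 0"
  shows "(\<integral>\<^sup>+x. k x * G \<alpha> h x \<partial>m) = (\<integral>\<^sup>+x. h x * G \<alpha> k x \<partial>m)"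
proof -
  note [measurable] = r_measurable[OF \<alpha>] r_measurable_right[OF \<alpha>] r_measurable_left[OF \<alpha>]
  have "(\<integral>\<^sup>+x. k x * G \<alpha> h x \<partial>m) = (\<integral>\<^sup>+x. \<integral>\<^sup>+y. k x * (h y * r \<alpha> x y) \<partial>m \<partial>m)"
    unfolding G_def by (intro nn_integral_cong nn_integral_cmult[symmetric]) auto
  also have "\<dots> = (\<integral>\<^sup>+y. \<integral>\<^sup>+x. k x * (h y * r \<alpha> x y) \<partial>m \<partial>m)"
    by (rule mm.Fubini'[symmetric]) measurable
  also have "\<dots> = (\<integral>\<^sup>+y. \<integral>\<^sup>+x. h y * (k x * r \<alpha> y x) \<partial>m \<partial>m)"
    using r_sym[OF \<alpha>] by (simp add: mult.left_commute)
  also have "\<dots> = (\<integral>\<^sup>+x. h x * G \<alpha> k x \<partial>m)"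
    unfolding G_def by (intro nn_integral_cong nn_integral_cmult) auto
  finally show ?thesis .
qed

lemma G_antimono:
  assumes "h \<in> borel_measurable borel" "0 \<le> \<alpha>" "\<alpha> \<le> \<beta>"
  shows "G \<beta> h x \<le> G \<alpha> h x"
  using resolvent_equation[OF assms(2,3,1), of x] by simp

lemma G_bounded:
  assumes "\<And>y. h y \<le> c" and [measurable]: "h \<in> borel_measurable borel" and \<alpha>: "\<alpha> > 0"
  shows "ennreal \<alpha> * G \<alpha> h x \<le> c"
proof -
  have "ennreal \<alpha> * G \<alpha> h x \<le> ennreal \<alpha> * G \<alpha> (\<lambda>_. c * 1) x"
    using assms by (intro mult_left_mono G_mono) auto
  also have "\<dots> = c * (ennreal \<alpha> * G \<alpha> (\<lambda>_. 1) x)"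
    using \<alpha> by (subst G_cmult) (auto simp: mult_ac)
  also have "\<dots> \<le> c" using mult_left_mono[OF sub_Markov[OF \<alpha>], of c x] by simp
  finally show ?thesis .
qed

text \<open>The L1 contraction is the dual of the sub-Markov property, by symmetry of the
  kernel.\<close>

lemma G_mass:
  assumes [measurable]: "h \<in> borel_measurable borel" and \<alpha>: "\<alpha> > 0"
  shows "ennreal \<alpha> * (\<integral>\<^sup>+x. G \<alpha> h x \<partial>m) \<le> (\<integral>\<^sup>+x. h x \<partial>m)"
proof -
  have "ennreal \<alpha> * (\<integral>\<^sup>+x. G \<alpha> h x \<partial>m) = (\<integral>\<^sup>+x. h x * (ennreal \<alpha> * G \<alpha> (\<lambda>_. 1) x) \<partial>m)"
    using G_sym[of h "\<lambda>_. 1" \<alpha>] \<alpha> by (simp add: nn_integral_cmult[symmetric] mult.left_commute)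
  also have "\<dots> \<le> (\<integral>\<^sup>+x. h x * 1 \<partial>m)"
    by (intro nn_integral_mono mult_left_mono sub_Markov \<alpha>) auto
  finally show ?thesis by simp
qed

text \<open>\<alpha> r_\<alpha>(x, y) m(dy) is a subprobability, so this is Cauchy-Schwarz against
  the constant 1.\<close>

lemma G_Jensen:
  assumes [measurable]: "h \<in> borel_measurable borel" and \<alpha>: "\<alpha> > 0"
  shows "(ennreal \<alpha> * G \<alpha> h x)\<^sup>2 \<le> ennreal \<alpha> * G \<alpha> (\<lambda>y. (h y)\<^sup>2) x"
proof -
  note [measurable] = r_measurable_right[of \<alpha> x]
  have d: "G \<alpha> k x = (\<integral>\<^sup>+y. k y \<partial>density m (r \<alpha> x))" if [measurable]: "k \<in> borel_measurable borel" for k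
    unfolding G_def using \<alpha> by (subst nn_integral_density) (auto simp: mult.commute)
  have "(G \<alpha> h x)\<^sup>2 \<le> G \<alpha> (\<lambda>y. (h y)\<^sup>2) x * G \<alpha> (\<lambda>_. 1) x"
    using Cauchy_Schwarz_nn_integral[of h "density m (r \<alpha> x)" "\<lambda>_. 1"] by (simp add: d)
  then have "(ennreal \<alpha>)\<^sup>2 * (G \<alpha> h x)\<^sup>2 \<le> (ennreal \<alpha>)\<^sup>2 * (G \<alpha> (\<lambda>y. (h y)\<^sup>2) x * G \<alpha> (\<lambda>_. 1) x)"
    by (rule mult_left_mono) simp
  also have "\<dots> = ennreal \<alpha> * G \<alpha> (\<lambda>y. (h y)\<^sup>2) x * (ennreal \<alpha> * G \<alpha> (\<lambda>_. 1) x)"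
    by (simp add: power2_eq_square mult_ac)
  also have "\<dots> \<le> ennreal \<alpha> * G \<alpha> (\<lambda>y. (h y)\<^sup>2) x * 1"
    by (intro mult_left_mono sub_Markov \<alpha>) simp
  finally show ?thesis by (simp add: power_mult_distrib)
qed

lemma G_L2_bound:
  assumes [measurable]: "h \<in> borel_measurable borel" and \<alpha>: "\<alpha> > 0"
  shows "(\<integral>\<^sup>+x. (ennreal \<alpha> * G \<alpha> h x)\<^sup>2 \<partial>m) \<le> (\<integral>\<^sup>+x. (h x)\<^sup>2 \<partial>m)"
proof -
  have "(\<integral>\<^sup>+x. (ennreal \<alpha> * G \<alpha> h x)\<^sup>2 \<partial>m) \<le> (\<integral>\<^sup>+x. ennreal \<alpha> * G \<alpha> (\<lambda>y. (h y)\<^sup>2) x \<partial>m)"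
    by (intro nn_integral_mono G_Jensen assms)
  also have "\<dots> \<le> (\<integral>\<^sup>+x. (h x)\<^sup>2 \<partial>m)"
    using G_mass[of "\<lambda>y. (h y)\<^sup>2" \<alpha>] \<alpha> by (subst nn_integral_cmult) auto
  finally show ?thesis .
qed

section \<open>The kernels as resolvents on L2\<close>

lemma L2_borel_iff:
  assumes [measurable]: "u \<in> borel_measurable borel"
  shows "u \<in> L2 m \<longleftrightarrow> (\<integral>\<^sup>+x. ennreal ((u x)\<^sup>2) \<partial>m) < \<infinity>"
proof -
  have "integrable (completion m) (\<lambda>x. (u x)\<^sup>2) \<longleftrightarrow> integrable m (\<lambda>x. (u x)\<^sup>2)"
    by (rule integrable_completion) measurable
  moreover have "u \<in> borel_measurable (completion m)" by (intro measurable_completion) measurable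
  ultimately show ?thesis by (auto simp: L2_def integrable_iff_bounded)
qed

lemma inner_L2_borel:
  assumes [measurable]: "u \<in> borel_measurable borel" "v \<in> borel_measurable borel"
  shows "inner_L2 m u v = (\<integral>x. u x * v x \<partial>m)"
  unfolding inner_L2_def by (rule integral_completion) measurable

lemma L2_borel_integrable:
  assumes u [measurable]: "u \<in> borel_measurable borel" "v \<in> borel_measurable borel" and L: "u \<in> L2 m" "v \<in> L2 m"
  shows "integrable m (\<lambda>x. u x * v x)"
proof -
  have "(\<lambda>x. u x * v x) \<in> borel_measurable m" by measurable
  from integrable_completion[OF this] L2_integrable_mult[OF L] show ?thesis by simp
qed

lemma L2_dominated:
  assumes [measurable]: "\<And>n. u n \<in> borel_measurable borel" "v \<in> borel_measurable borel" "g \<in> borel_measurable borel"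
    and g: "g \<in> L2 m" and bound: "\<And>n. AE x in m. \<bar>u n x - v x\<bar> \<le> g x"
    and lim: "AE x in m. (\<lambda>n. u n x) \<longlonglongrightarrow> v x"
  shows "(\<lambda>n. inner_L2 m (\<lambda>x. u n x - v x) (\<lambda>x. u n x - v x)) \<longlonglongrightarrow> 0"
proof -
  have "(\<lambda>n. \<integral>x. (u n x - v x) * (u n x - v x) \<partial>m) \<longlonglongrightarrow> (\<integral>x. 0 \<partial>m)"
  proof (rule integral_dominated_convergence[where w="\<lambda>x. g x * g x"])
    show "integrable m (\<lambda>x. g x * g x)" by (rule L2_borel_integrable) (use g in auto)
    show "AE x in m. (\<lambda>n. (u n x - v x) * (u n x - v x)) \<longlonglongrightarrow> 0"
      using lim
    proof eventually_elim
      case (elim x)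
      then have "(\<lambda>n. u n x - v x) \<longlonglongrightarrow> 0" by (rule LIM_zero)
      from tendsto_mult[OF this this] show ?case by simp
    qed
    show "AE x in m. norm ((u n x - v x) * (u n x - v x)) \<le> g x * g x" for n
      using bound[of n]
    proof eventually_elim
      case (elim x)
      then have "\<bar>u n x - v x\<bar> * \<bar>u n x - v x\<bar> \<le> g x * g x" by (intro mult_mono) auto
      then show ?case by (simp add: abs_mult)
    qed
  qed auto
  then show ?thesis by (subst inner_L2_borel) auto
qed

lemma G_pos_L2:
  assumes h [measurable]: "h \<in> borel_measurable borel" and L: "h \<in> L2 m" and \<alpha>: "\<alpha> > 0"
  shows "AE x in m. G \<alpha> (\<lambda>y. ennreal (h y)) x < \<infinity>"
    "(\<lambda>x. enn2real (G \<alpha> (\<lambda>y. ennreal (h y)) x)) \<in> L2 m"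
proof -
  let ?w = "G \<alpha> (\<lambda>y. ennreal (h y))"
  have m [measurable]: "?w \<in> borel_measurable borel" using \<alpha> by (intro G_measurable) auto
  have "(\<integral>\<^sup>+x. (ennreal \<alpha> * ?w x)\<^sup>2 \<partial>m) \<le> (\<integral>\<^sup>+x. (ennreal (h x))\<^sup>2 \<partial>m)"
    by (rule G_L2_bound[OF _ \<alpha>]) measurable
  also have "\<dots> \<le> (\<integral>\<^sup>+x. ennreal ((h x)\<^sup>2) \<partial>m)"
    by (intro nn_integral_mono) (metis abs_ge_zero abs_ge_self ennreal_leI ennreal_power power2_abs power_mono_ennreal)
  also have "\<dots> < \<infinity>" using L L2_borel_iff[OF h] by simp
  finally have fin: "(\<integral>\<^sup>+x. (ennreal \<alpha> * ?w x)\<^sup>2 \<partial>m) < \<infinity>" .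
  then have "AE x in m. (ennreal \<alpha> * ?w x)\<^sup>2 \<noteq> \<infinity>"
    by (intro nn_integral_noteq_infinite) auto
  then show ae: "AE x in m. ?w x < \<infinity>"
    by eventually_elim (use \<alpha> in \<open>auto simp: power2_eq_square ennreal_mult_eq_top_iff less_top ennreal_eq_0_iff\<close>)
  have "(\<integral>\<^sup>+x. ennreal (\<alpha>\<^sup>2) * ennreal ((enn2real (?w x))\<^sup>2) \<partial>m) \<le> (\<integral>\<^sup>+x. (ennreal \<alpha> * ?w x)\<^sup>2 \<partial>m)"
    using ae
    by (intro nn_integral_mono_AE) (auto elim!: eventually_mono simp: power_mult_distrib ennreal_power[symmetric] less_imp_le[OF \<alpha>] less_top)
  then have "ennreal (\<alpha>\<^sup>2) * (\<integral>\<^sup>+x. ennreal ((enn2real (?w x))\<^sup>2) \<partial>m) < \<infinity>"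
    using fin by (subst nn_integral_cmult[symmetric]) auto
  then have "(\<integral>\<^sup>+x. ennreal ((enn2real (?w x))\<^sup>2) \<partial>m) < \<infinity>"
    using \<alpha> by (auto simp: ennreal_mult_less_top)
  then show "(\<lambda>x. enn2real (?w x)) \<in> L2 m" by (subst L2_borel_iff) auto
qed

text \<open>Cutting \<open>h\<close> at height n reduces to \<open>bounded_is_res\<close>. On the
  kernel side the cut-offs converge monotonically, and both sequences converge in L2 because they
  are dominated by their limits.\<close>

lemma is_res_nonneg:
  assumes h [measurable]: "h \<in> borel_measurable borel" and pos: "\<And>x. 0 \<le> h x" and L: "h \<in> L2 m" and \<alpha>: "\<alpha> > 0"
  shows "is_res \<alpha> h (\<lambda>x. enn2real (G \<alpha> (\<lambda>y. ennreal (h y)) x))"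
proof -
  define k where "k n = (\<lambda>x. min (h x) (real n))" for n
  have k [measurable]: "k n \<in> borel_measurable borel" for n unfolding k_def by measurable
  have kb: "0 \<le> k n x \<and> k n x \<le> real n" for n x using pos[of x] by (simp add: k_def)
  have kL: "k n \<in> L2 m" for n
  proof -
    have "(\<integral>\<^sup>+x. ennreal ((k n x)\<^sup>2) \<partial>m) \<le> (\<integral>\<^sup>+x. ennreal ((h x)\<^sup>2) \<partial>m)"
      using pos by (intro nn_integral_mono ennreal_leI power_mono) (auto simp: k_def)
    then show ?thesis using L by (auto simp: L2_borel_iff)
  qed
  define w where "w n x = enn2real (G \<alpha> (\<lambda>y. ennreal (k n y)) x)" for n x
  define w0 where "w0 x = enn2real (G \<alpha> (\<lambda>y. ennreal (h y)) x)" for x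
  have wm [measurable]: "w n \<in> borel_measurable borel" "w0 \<in> borel_measurable borel" for n
    using \<alpha> unfolding w_def[abs_def] w0_def[abs_def] by (auto intro!: measurable_compose[OF G_measurable])
  have klim: "(\<lambda>n. k n x) \<longlonglongrightarrow> h x" for x
  proof (rule tendsto_eventually)
    obtain N where "h x \<le> real N" using real_arch_simple by blast
    then show "\<forall>\<^sub>F n in sequentially. k n x = h x"
      unfolding eventually_sequentially k_def by (intro exI[of _ N]) auto
  qed
  have inc: "incseq (\<lambda>n x. ennreal (k n x))"
    by (auto simp: incseq_def le_fun_def k_def intro!: ennreal_leI)
  have sup: "(SUP n. ennreal (k n y)) = ennreal (h y)" for y
  proof (rule LIMSEQ_unique)
    show "(\<lambda>n. ennreal (k n y)) \<longlonglongrightarrow> ennreal (h y)" by (intro tendsto_ennrealI klim)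
    show "(\<lambda>n. ennreal (k n y)) \<longlonglongrightarrow> (SUP n. ennreal (k n y))"
      using inc by (intro LIMSEQ_SUP) (auto simp: incseq_def le_fun_def)
  qed
  have Glim: "(\<lambda>n. G \<alpha> (\<lambda>y. ennreal (k n y)) x) \<longlonglongrightarrow> G \<alpha> (\<lambda>y. ennreal (h y)) x" for x
  proof -
    have "incseq (\<lambda>n. G \<alpha> (\<lambda>y. ennreal (k n y)) x)"
      using inc by (auto simp: incseq_def le_fun_def intro!: G_mono)
    moreover have "(SUP n. G \<alpha> (\<lambda>y. ennreal (k n y)) x) = G \<alpha> (\<lambda>y. ennreal (h y)) x"
      using G_monotone[OF _ _ inc, of \<alpha> x] \<alpha> by (simp add: sup)
    ultimately show ?thesis using LIMSEQ_SUP by metis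
  qed
  note fin = G_pos_L2(1)[OF h L \<alpha>]
  have w0L: "w0 \<in> L2 m" unfolding w0_def[abs_def] by (rule G_pos_L2(2)[OF h L \<alpha>])
  have "is_res \<alpha> h w0"
  proof (rule is_res_L2_limit[OF kL L _ w0L \<alpha>])
    show "is_res \<alpha> (k n) (w n)" for n unfolding w_def[abs_def] by (rule bounded_is_res[OF \<alpha> k kb kL])
    show "(\<lambda>n. inner_L2 m (\<lambda>x. k n x - h x) (\<lambda>x. k n x - h x)) \<longlonglongrightarrow> 0"
    proof (rule L2_dominated[OF k h h L])
      show "AE x in m. \<bar>k n x - h x\<bar> \<le> h x" for n
        using pos by (intro AE_I2) (auto simp: k_def min_def)
      show "AE x in m. (\<lambda>n. k n x) \<longlonglongrightarrow> h x" by (intro AE_I2 klim)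
    qed
    show "(\<lambda>n. inner_L2 m (\<lambda>x. w n x - w0 x) (\<lambda>x. w n x - w0 x)) \<longlonglongrightarrow> 0"
    proof (rule L2_dominated[OF wm(1) wm(2) wm(2) w0L])
      show "AE x in m. (\<lambda>n. w n x) \<longlonglongrightarrow> w0 x"
        using fin by eventually_elim (auto simp: w_def w0_def intro!: tendsto_enn2real Glim simp: less_top)
      show "AE x in m. \<bar>w n x - w0 x\<bar> \<le> w0 x" for n
        using fin
      proof eventually_elim
        case (elim x)
        have "w n x \<le> w0 x"
          unfolding w_def w0_def by (intro enn2real_mono G_mono) (use elim in \<open>auto simp: k_def intro: ennreal_leI\<close>)
        moreover have "0 \<le> w n x" by (simp add: w_def)
        ultimately show ?case by simp
      qed
    qed
  qed
  then show ?thesis unfolding w0_def[abs_def] .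
qed

text \<open>Where one of the parts is infinite, \<open>enn2real\<close> substitutes 0. For
  \<open>h\<close> in L2 and \<alpha> > 0 this concerns a null set only.\<close>

definition Gr :: "real \<Rightarrow> ('a \<Rightarrow> real) \<Rightarrow> 'a \<Rightarrow> real" where
  "Gr \<alpha> h x = enn2real (G \<alpha> (\<lambda>y. ennreal (h y)) x) - enn2real (G \<alpha> (\<lambda>y. ennreal (- h y)) x)"

lemma Gr_measurable [measurable]:
  assumes [measurable]: "h \<in> borel_measurable borel" and \<alpha>: "\<alpha> \<ge> 0"
  shows "Gr \<alpha> h \<in> borel_measurable borel"
proof -
  have "G \<alpha> (\<lambda>y. ennreal (h y)) \<in> borel_measurable borel" "G \<alpha> (\<lambda>y. ennreal (- h y)) \<in> borel_measurable borel"
    using \<alpha> by (auto intro!: G_measurable)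
  then show ?thesis unfolding Gr_def[abs_def] by measurable
qed

lemma L2_pos_part:
  assumes [measurable]: "h \<in> borel_measurable borel" and L: "h \<in> L2 m"
  shows "(\<lambda>x. max (h x) 0) \<in> L2 m"
proof -
  have "(\<integral>\<^sup>+x. ennreal ((max (h x) 0)\<^sup>2) \<partial>m) \<le> (\<integral>\<^sup>+x. ennreal ((h x)\<^sup>2) \<partial>m)"
    by (intro nn_integral_mono ennreal_leI) (auto simp: max_def)
  then show ?thesis using L by (auto simp: L2_borel_iff)
qed

lemma is_res_Gr:
  assumes h [measurable]: "h \<in> borel_measurable borel" and L: "h \<in> L2 m" and \<alpha>: "\<alpha> > 0"
  shows "is_res \<alpha> h (Gr \<alpha> h)"
proof -
  have L': "(\<lambda>x. - h x) \<in> L2 m" using L2_scale[OF L, of "-1"] by simp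
  have p: "is_res \<alpha> (\<lambda>x. max (h x) 0) (\<lambda>x. enn2real (G \<alpha> (\<lambda>y. ennreal (max (h y) 0)) x))"
    by (rule is_res_nonneg[OF _ _ L2_pos_part[OF h L] \<alpha>]) auto
  have n: "is_res \<alpha> (\<lambda>x. max (- h x) 0) (\<lambda>x. enn2real (G \<alpha> (\<lambda>y. ennreal (max (- h y) 0)) x))"
    by (rule is_res_nonneg[OF _ _ L2_pos_part[OF _ L'] \<alpha>]) auto
  have e: "ennreal (max a 0) = ennreal a" for a by (cases "a \<ge> 0") (auto simp: max_def ennreal_neg)
  have "max a 0 - max (- a) 0 = a" for a :: real by simp
  with is_res_diff[OF p n L2_pos_part[OF h L] L2_pos_part[OF _ L']] show ?thesis
    by (simp add: e Gr_def[abs_def])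
qed

end

section \<open>Potentials and energy\<close>

lemma ennreal_liminf_add_le:
  fixes a b :: "nat \<Rightarrow> ennreal"
  shows "liminf a + liminf b \<le> liminf (\<lambda>n. a n + b n)"
proof -
  let ?A = "\<lambda>n. INF k\<in>{n..}. a k" and ?B = "\<lambda>n. INF k\<in>{n..}. b k"
  have "incseq ?A" "incseq ?B" by (auto simp: incseq_def intro!: INF_superset_mono)
  then have "liminf a + liminf b = (SUP n. ?A n + ?B n)"
    by (simp add: liminf_SUP_INF ennreal_SUP_add)
  also have "\<dots> \<le> (SUP n. INF k\<in>{n..}. a k + b k)"
    by (intro SUP_mono') (auto intro!: INF_greatest add_mono INF_lower)
  finally show ?thesis by (simp add: liminf_SUP_INF)
qed

lemma ennreal_mult_liminf_le:
  fixes c :: ennreal and a :: "nat \<Rightarrow> ennreal"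
  shows "c * liminf a \<le> liminf (\<lambda>n. c * a n)"
  unfolding liminf_SUP_INF SUP_mult_left_ennreal
  by (intro SUP_mono') (auto intro!: INF_greatest mult_left_mono INF_lower)

context symmetric_resolvent
begin

text \<open>Sigma-finiteness makes densities unique even when they take the value \<infinity>.
  Identities between possibly infinite potentials can thus be proved by duality, without
  subtraction.\<close>

lemma AE_eq_by_integrals:
  assumes [measurable]: "f \<in> borel_measurable borel" "g \<in> borel_measurable borel"
    and eq: "\<And>\<phi>. \<phi> \<in> borel_measurable borel \<Longrightarrow> (\<integral>\<^sup>+x. \<phi> x * f x \<partial>m) = (\<integral>\<^sup>+x. \<phi> x * g x \<partial>m)"
  shows "AE x in m. f x = g x"
proof (rule density_unique)
  show "density m f = density m g"
  proof (rule measure_eqI)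
    fix A assume "A \<in> sets (density m f)"
    then have [measurable]: "A \<in> sets borel" by (simp add: sets_m)
    show "emeasure (density m f) A = emeasure (density m g) A"
      using eq[of "indicator A"] by (simp add: emeasure_density sets_m mult.commute)
  qed simp
qed measurable

definition pot :: "real \<Rightarrow> 'a measure \<Rightarrow> 'a \<Rightarrow> ennreal" where
  "pot \<alpha> \<nu> x = (\<integral>\<^sup>+y. r \<alpha> x y \<partial>\<nu>)"

lemma pot_measurable [measurable]:
  assumes [measurable_cong]: "sets \<nu> = sets borel" and f: "finite_measure \<nu>" and \<alpha>: "\<alpha> \<ge> 0"
  shows "pot \<alpha> \<nu> \<in> borel_measurable borel"
proof -
  interpret finite_measure \<nu> by fact
  have "(\<lambda>(x, y). r \<alpha> x y) \<in> borel_measurable (borel \<Otimes>\<^sub>M \<nu>)" using r_measurable[OF \<alpha>] by measurable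
  from borel_measurable_nn_integral[OF this] show ?thesis unfolding pot_def[abs_def] .
qed

text \<open>Symmetry moves the kernel from the measure to the test function. Statements about
  potentials of measures thereby reduce to statements about \<open>G \<alpha> \<phi>\<close>, which
  hold at every point and can be integrated against \<nu>.\<close>

lemma pot_pair:
  assumes \<nu> [measurable_cong]: "sets \<nu> = sets borel" and f: "finite_measure \<nu>" and \<alpha>: "\<alpha> \<ge> 0"
    and [measurable]: "\<phi> \<in> borel_measurable borel"
  shows "(\<integral>\<^sup>+x. \<phi> x * pot \<alpha> \<nu> x \<partial>m) = (\<integral>\<^sup>+y. G \<alpha> \<phi> y \<partial>\<nu>)"
proof -
  interpret n: finite_measure \<nu> by fact
  interpret mn: pair_sigma_finite m \<nu> ..
  note [measurable] = r_measurable[OF \<alpha>] r_measurable_right[OF \<alpha>] r_measurable_left[OF \<alpha>]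
  have "(\<integral>\<^sup>+x. \<phi> x * pot \<alpha> \<nu> x \<partial>m) = (\<integral>\<^sup>+x. \<integral>\<^sup>+y. \<phi> x * r \<alpha> x y \<partial>\<nu> \<partial>m)"
    unfolding pot_def by (intro nn_integral_cong nn_integral_cmult[symmetric]) measurable
  also have "\<dots> = (\<integral>\<^sup>+y. \<integral>\<^sup>+x. \<phi> x * r \<alpha> x y \<partial>m \<partial>\<nu>)"
    by (rule mn.Fubini'[symmetric]) measurable
  also have "\<dots> = (\<integral>\<^sup>+y. G \<alpha> \<phi> y \<partial>\<nu>)"
    unfolding kernel_op_def using r_sym[OF \<alpha>] by simp
  finally show ?thesis .
qed

text \<open>Tested with \<phi>, this is the resolvent equation for \<open>G\<close> integrated over
  \<nu>; commutativity of the resolvents brings the factors into the right order. The detour through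
  test functions is why it holds almost everywhere only.\<close>

lemma pot_resolvent:
  assumes \<nu> [measurable_cong]: "sets \<nu> = sets borel" and f: "finite_measure \<nu>" and \<alpha>: "0 \<le> \<alpha>" "\<alpha> \<le> \<beta>"
  shows "AE x in m. pot \<alpha> \<nu> x = pot \<beta> \<nu> x + ennreal (\<beta> - \<alpha>) * G \<beta> (pot \<alpha> \<nu>) x"
proof -
  have \<beta>: "\<beta> \<ge> 0" using \<alpha> by simp
  note [measurable] = pot_measurable[OF \<nu> f \<alpha>(1)] pot_measurable[OF \<nu> f \<beta>] G_measurable[OF _ \<alpha>(1)] G_measurable[OF _ \<beta>]
  show ?thesis
  proof (rule AE_eq_by_integrals)
    fix \<phi> :: "'a \<Rightarrow> ennreal" assume [measurable]: "\<phi> \<in> borel_measurable borel"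
    have "(\<integral>\<^sup>+x. \<phi> x * (pot \<beta> \<nu> x + ennreal (\<beta> - \<alpha>) * G \<beta> (pot \<alpha> \<nu>) x) \<partial>m) =
        (\<integral>\<^sup>+x. \<phi> x * pot \<beta> \<nu> x \<partial>m) + ennreal (\<beta> - \<alpha>) * (\<integral>\<^sup>+x. \<phi> x * G \<beta> (pot \<alpha> \<nu>) x \<partial>m)"
      by (simp add: distrib_left nn_integral_add nn_integral_cmult[symmetric] mult.left_commute)
    also have "(\<integral>\<^sup>+x. \<phi> x * G \<beta> (pot \<alpha> \<nu>) x \<partial>m) = (\<integral>\<^sup>+x. G \<beta> \<phi> x * pot \<alpha> \<nu> x \<partial>m)"
      using G_sym[of "pot \<alpha> \<nu>" \<phi> \<beta>] \<beta> by (simp add: mult.commute)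
    also have "\<dots> = (\<integral>\<^sup>+y. G \<beta> (G \<alpha> \<phi>) y \<partial>\<nu>)"
    proof -
      have "G \<alpha> (G \<beta> \<phi>) = G \<beta> (G \<alpha> \<phi>)"
        by (rule ext) (rule resolvent_commute[OF \<alpha>(1) \<beta>], measurable)
      then show ?thesis by (subst pot_pair[OF \<nu> f \<alpha>(1)]) auto
    qed
    also have "(\<integral>\<^sup>+x. \<phi> x * pot \<beta> \<nu> x \<partial>m) = (\<integral>\<^sup>+y. G \<beta> \<phi> y \<partial>\<nu>)" by (rule pot_pair[OF \<nu> f \<beta>]) measurable
    also have "(\<integral>\<^sup>+y. G \<beta> \<phi> y \<partial>\<nu>) + ennreal (\<beta> - \<alpha>) * (\<integral>\<^sup>+y. G \<beta> (G \<alpha> \<phi>) y \<partial>\<nu>) =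
        (\<integral>\<^sup>+y. G \<beta> \<phi> y + ennreal (\<beta> - \<alpha>) * G \<beta> (G \<alpha> \<phi>) y \<partial>\<nu>)"
      by (subst nn_integral_add) (auto simp: nn_integral_cmult)
    also have "\<dots> = (\<integral>\<^sup>+y. G \<alpha> \<phi> y \<partial>\<nu>)"
      using resolvent_equation[OF \<alpha>, of \<phi>] by simp
    finally show "(\<integral>\<^sup>+x. \<phi> x * pot \<alpha> \<nu> x \<partial>m) =
        (\<integral>\<^sup>+x. \<phi> x * (pot \<beta> \<nu> x + ennreal (\<beta> - \<alpha>) * G \<beta> (pot \<alpha> \<nu>) x) \<partial>m)"
      using pot_pair[OF \<nu> f \<alpha>(1), of \<phi>] by simp
  qed measurable
qed

text \<open>Twice (v - \<alpha> G_\<alpha> v, v), written as a jump part plus a killing part. Both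
  are integrals of nonnegative functions, so Fatou's lemma applies, and no integrability of
  \<open>v\<close> is needed to write the expression down.\<close>

definition kernel_energy :: "real \<Rightarrow> ('a \<Rightarrow> real) \<Rightarrow> ennreal" where
  "kernel_energy \<alpha> v = ennreal \<alpha> * (\<integral>\<^sup>+x. \<integral>\<^sup>+y. ennreal ((v x - v y)\<^sup>2) * r \<alpha> x y \<partial>m \<partial>m)
    + 2 * (\<integral>\<^sup>+x. (1 - ennreal \<alpha> * G \<alpha> (\<lambda>_. 1) x) * ennreal ((v x)\<^sup>2) \<partial>m)"

lemma kernel_energy_eq:
  assumes v [measurable]: "v \<in> borel_measurable borel" and L: "v \<in> L2 m" and \<alpha>: "\<alpha> > 0"
  shows "kernel_energy \<alpha> v = ennreal (2 * (inner_L2 m v v - inner_L2 m (\<lambda>x. \<alpha> * Gr \<alpha> v x) v))"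
proof -
  have \<alpha>0: "0 \<le> \<alpha>" using \<alpha> by simp
  note [measurable] = r_measurable[OF \<alpha>0] r_measurable_right[OF \<alpha>0] r_measurable_left[OF \<alpha>0] G_measurable[OF _ \<alpha>0]
    Gr_measurable[OF _ \<alpha>0]
  \<comment> \<open>The measure r_\<alpha>(x, y) m(dx) m(dy). It may be infinite, but both marginals
    have the density \<open>G \<alpha> 1\<close>, bounded by 1 / \<alpha>, so squares of L2
    functions of either coordinate are integrable.\<close>
  define N where "N = density (m \<Otimes>\<^sub>M m) (\<lambda>(x, y). r \<alpha> x y)"
  have [measurable_cong]: "sets N = sets (borel \<Otimes>\<^sub>M borel)" by (simp add: N_def sets_pair_measure_cong[OF sets_m sets_m])
  have N: "(\<integral>\<^sup>+z. f z \<partial>N) = (\<integral>\<^sup>+x. \<integral>\<^sup>+y. f (x, y) * r \<alpha> x y \<partial>m \<partial>m)"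
    if [measurable]: "f \<in> borel_measurable (borel \<Otimes>\<^sub>M borel)" for f
    unfolding N_def
    by (subst nn_integral_density) (auto simp: nn_integral_fst[symmetric] mult.commute split_beta')
  have Nprod: "(\<integral>\<^sup>+z. p (fst z) * q (snd z) \<partial>N) = (\<integral>\<^sup>+x. p x * G \<alpha> q x \<partial>m)"
    if [measurable]: "p \<in> borel_measurable borel" "q \<in> borel_measurable borel" for p q
  proof -
    have "(\<integral>\<^sup>+z. p (fst z) * q (snd z) \<partial>N) = (\<integral>\<^sup>+x. \<integral>\<^sup>+y. p x * q y * r \<alpha> x y \<partial>m \<partial>m)"
      by (subst N) auto
    also have "\<dots> = (\<integral>\<^sup>+x. p x * G \<alpha> q x \<partial>m)"
      unfolding kernel_op_def by (intro nn_integral_cong, subst nn_integral_cmult[symmetric]) (auto simp: mult.assoc)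
    finally show ?thesis .
  qed
  have G1: "G \<alpha> (\<lambda>_. 1) x \<le> ennreal (1 / \<alpha>)" for x
  proof -
    have "ennreal (1 / \<alpha>) * (ennreal \<alpha> * G \<alpha> (\<lambda>_. 1) x) \<le> ennreal (1 / \<alpha>) * 1"
      by (intro mult_left_mono sub_Markov \<alpha>) simp
    then show ?thesis using \<alpha> by (simp add: mult.assoc[symmetric] ennreal_mult[symmetric])
  qed
  have sqfin: "(\<integral>\<^sup>+x. ennreal ((w x)\<^sup>2) * G \<alpha> (\<lambda>_. 1) x \<partial>m) < \<infinity>"
    if [measurable]: "w \<in> borel_measurable borel" and wL: "w \<in> L2 m" for w
  proof -
    have "(\<integral>\<^sup>+x. ennreal ((w x)\<^sup>2) * G \<alpha> (\<lambda>_. 1) x \<partial>m) \<le> (\<integral>\<^sup>+x. ennreal ((w x)\<^sup>2) * ennreal (1 / \<alpha>) \<partial>m)"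
      by (intro nn_integral_mono mult_left_mono G1) simp
    also have "\<dots> < \<infinity>" using wL L2_borel_iff[of w]
      by (subst nn_integral_multc) (auto simp: ennreal_mult_less_top)
    finally show ?thesis .
  qed
  have sqN: "integrable N (\<lambda>z. (w (fst z))\<^sup>2)" "integrable N (\<lambda>z. (w (snd z))\<^sup>2)"
      "(\<integral>z. (w (snd z))\<^sup>2 \<partial>N) = (\<integral>z. (w (fst z))\<^sup>2 \<partial>N)"
      "(\<integral>z. (w (fst z))\<^sup>2 \<partial>N) = enn2real (\<integral>\<^sup>+x. ennreal ((w x)\<^sup>2) * G \<alpha> (\<lambda>_. 1) x \<partial>m)"
    if [measurable]: "w \<in> borel_measurable borel" and wL: "w \<in> L2 m" for w
  proof -
    have 1: "(\<integral>\<^sup>+z. ennreal ((w (fst z))\<^sup>2) \<partial>N) = (\<integral>\<^sup>+x. ennreal ((w x)\<^sup>2) * G \<alpha> (\<lambda>_. 1) x \<partial>m)"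
      using Nprod[of "\<lambda>x. ennreal ((w x)\<^sup>2)" "\<lambda>_. 1"] by simp
    have 2: "(\<integral>\<^sup>+z. ennreal ((w (snd z))\<^sup>2) \<partial>N) = (\<integral>\<^sup>+x. ennreal ((w x)\<^sup>2) * G \<alpha> (\<lambda>_. 1) x \<partial>m)"
      using Nprod[of "\<lambda>_. 1" "\<lambda>x. ennreal ((w x)\<^sup>2)"] G_sym[of "\<lambda>x. ennreal ((w x)\<^sup>2)" "\<lambda>_. 1" \<alpha>] \<alpha>0 by simp
    show "integrable N (\<lambda>z. (w (fst z))\<^sup>2)" "integrable N (\<lambda>z. (w (snd z))\<^sup>2)"
      using sqfin[OF that] by (auto intro!: integrableI_bounded simp: 1 2)
    show "(\<integral>z. (w (snd z))\<^sup>2 \<partial>N) = (\<integral>z. (w (fst z))\<^sup>2 \<partial>N)"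
      by (subst (1 2) integral_eq_nn_integral) (auto simp: 1 2)
    show "(\<integral>z. (w (fst z))\<^sup>2 \<partial>N) = enn2real (\<integral>\<^sup>+x. ennreal ((w x)\<^sup>2) * G \<alpha> (\<lambda>_. 1) x \<partial>m)"
      by (subst integral_eq_nn_integral) (auto simp: 1)
  qed
  have prodN: "integrable N (\<lambda>z. p (fst z) * q (snd z))"
    if [measurable]: "p \<in> borel_measurable borel" "q \<in> borel_measurable borel" and pq: "p \<in> L2 m" "q \<in> L2 m" for p q
  proof (rule Bochner_Integration.integrable_bound)
    show "integrable N (\<lambda>z. (p (fst z))\<^sup>2 + (q (snd z))\<^sup>2)"
      by (intro Bochner_Integration.integrable_add sqN(1)[OF that(1) pq(1)] sqN(2)[OF that(2) pq(2)])
    have "\<bar>a * b\<bar> \<le> a\<^sup>2 + b\<^sup>2" for a b :: real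
    proof -
      have "2 * \<bar>a * b\<bar> \<le> a\<^sup>2 + b\<^sup>2"
        using sum_squares_bound[of "\<bar>a\<bar>" "\<bar>b\<bar>"] by (simp add: abs_mult mult.assoc)
      then show ?thesis using abs_ge_zero[of "a * b"] by linarith
    qed
    then show "AE z in N. norm (p (fst z) * q (snd z)) \<le> norm ((p (fst z))\<^sup>2 + (q (snd z))\<^sup>2)"
      by (intro AE_I2) simp
  qed measurable
  have prodN_eq: "(\<integral>z. p (fst z) * q (snd z) \<partial>N) = (\<integral>x. p x * enn2real (G \<alpha> (\<lambda>y. ennreal (q y)) x) \<partial>m)"
    if [measurable]: "p \<in> borel_measurable borel" "q \<in> borel_measurable borel" and pq: "q \<in> L2 m"
      and pos: "\<And>x. 0 \<le> p x" "\<And>x. 0 \<le> q x" for p q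
  proof -
    have "(\<integral>z. p (fst z) * q (snd z) \<partial>N) = enn2real (\<integral>\<^sup>+z. ennreal (p (fst z)) * ennreal (q (snd z)) \<partial>N)"
      using pos by (subst integral_eq_nn_integral) (auto simp: ennreal_mult)
    also have "\<dots> = enn2real (\<integral>\<^sup>+x. ennreal (p x) * G \<alpha> (\<lambda>y. ennreal (q y)) x \<partial>m)"
      using Nprod[of "\<lambda>x. ennreal (p x)" "\<lambda>x. ennreal (q x)"] by simp
    also have "\<dots> = enn2real (\<integral>\<^sup>+x. ennreal (p x * enn2real (G \<alpha> (\<lambda>y. ennreal (q y)) x)) \<partial>m)"
      using G_pos_L2(1)[OF that(2) pq \<alpha>]
      by (intro arg_cong[where f=enn2real] nn_integral_cong_AE)
         (auto elim!: eventually_mono simp: ennreal_mult pos less_top)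
    also have "\<dots> = (\<integral>x. p x * enn2real (G \<alpha> (\<lambda>y. ennreal (q y)) x) \<partial>m)"
      using pos by (subst integral_eq_nn_integral) auto
    finally show ?thesis .
  qed
  \<comment> \<open>The mixed term is computed for nonnegative functions, where it is an iterated
    kernel integral, and recombined by bilinearity.\<close>
  define p where "p x = max (v x) 0" for x
  define q where "q x = max (- v x) 0" for x
  have pm [measurable]: "p \<in> borel_measurable borel" "q \<in> borel_measurable borel"
    unfolding p_def[abs_def] q_def[abs_def] by measurable
  have pq: "\<And>x. 0 \<le> p x" "\<And>x. 0 \<le> q x" "\<And>x. v x = p x - q x" by (auto simp: p_def q_def)
  have L': "(\<lambda>x. - v x) \<in> L2 m" using L2_scale[OF L, of "-1"] by simp
  have pL: "p \<in> L2 m" "q \<in> L2 m"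
    unfolding p_def[abs_def] q_def[abs_def] using L2_pos_part[OF v L] L2_pos_part[OF _ L'] by auto
  define Gp where "Gp x = enn2real (G \<alpha> (\<lambda>y. ennreal (p y)) x)" for x
  define Gq where "Gq x = enn2real (G \<alpha> (\<lambda>y. ennreal (q y)) x)" for x
  have GL: "Gp \<in> L2 m" "Gq \<in> L2 m" unfolding Gp_def[abs_def] Gq_def[abs_def]
    using G_pos_L2(2)[OF pm(1) pL(1) \<alpha>] G_pos_L2(2)[OF pm(2) pL(2) \<alpha>] by auto
  have Gm [measurable]: "Gp \<in> borel_measurable borel" "Gq \<in> borel_measurable borel"
    unfolding Gp_def[abs_def] Gq_def[abs_def] by measurable
  have e: "ennreal (max a 0) = ennreal a" for a by (cases "a \<ge> 0") (auto simp: max_def ennreal_neg)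
  have Grv: "Gr \<alpha> v x = Gp x - Gq x" for x by (simp add: Gr_def Gp_def Gq_def p_def q_def e)
  have b: "(\<integral>z. v (fst z) * v (snd z) \<partial>N) = inner_L2 m (Gr \<alpha> v) v"
  proof -
    have "(\<integral>z. v (fst z) * v (snd z) \<partial>N) = (\<integral>z. p (fst z) * p (snd z) - p (fst z) * q (snd z)
        - q (fst z) * p (snd z) + q (fst z) * q (snd z) \<partial>N)"
      unfolding pq(3) by (intro Bochner_Integration.integral_cong) (auto simp: algebra_simps)
    also have "\<dots> = (\<integral>x. p x * Gp x \<partial>m) - (\<integral>x. p x * Gq x \<partial>m) - (\<integral>x. q x * Gp x \<partial>m) + (\<integral>x. q x * Gq x \<partial>m)"
      unfolding Gp_def Gq_def using prodN pm pL pq by (simp add: prodN_eq)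
    also have "\<dots> = (\<integral>x. (Gp x - Gq x) * (p x - q x) \<partial>m)"
      using L2_borel_integrable[OF pm(1) Gm(1) pL(1) GL(1)] L2_borel_integrable[OF pm(1) Gm(2) pL(1) GL(2)]
        L2_borel_integrable[OF pm(2) Gm(1) pL(2) GL(1)] L2_borel_integrable[OF pm(2) Gm(2) pL(2) GL(2)]
      by (simp add: algebra_simps)
    also have "\<dots> = inner_L2 m (Gr \<alpha> v) v"
      by (subst inner_L2_borel) (auto simp: Grv pq(3)[symmetric])
    finally show ?thesis .
  qed
  let ?a = "\<integral>z. (v (fst z))\<^sup>2 \<partial>N"
  have d: "(\<integral>z. (v (fst z) - v (snd z))\<^sup>2 \<partial>N) = 2 * ?a - 2 * inner_L2 m (Gr \<alpha> v) v"
    "integrable N (\<lambda>z. (v (fst z) - v (snd z))\<^sup>2)"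
    using sqN[OF v L] prodN[OF v v L L] by (simp_all add: power2_diff b mult.assoc)
  have 1: "(\<integral>\<^sup>+x. \<integral>\<^sup>+y. ennreal ((v x - v y)\<^sup>2) * r \<alpha> x y \<partial>m \<partial>m) = ennreal (2 * ?a - 2 * inner_L2 m (Gr \<alpha> v) v)"
    using N[of "\<lambda>z. ennreal ((v (fst z) - v (snd z))\<^sup>2)"] nn_integral_eq_integral[OF d(2)] d(1) by simp
  have nn1: "0 \<le> 2 * ?a - 2 * inner_L2 m (Gr \<alpha> v) v" unfolding d(1)[symmetric] by (rule integral_nonneg_AE) simp
  have a: "ennreal ?a = (\<integral>\<^sup>+x. ennreal ((v x)\<^sup>2) * G \<alpha> (\<lambda>_. 1) x \<partial>m)"
    using sqN(4)[OF v L] sqfin[OF v L] by (simp add: less_top)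
  have vv: "(\<integral>\<^sup>+x. ennreal ((v x)\<^sup>2) \<partial>m) = ennreal (inner_L2 m v v)"
    unfolding inner_L2_borel[OF v v] power2_eq_square[symmetric]
    using L2_borel_integrable[OF v v L L]
    by (intro nn_integral_eq_integral) (auto simp: power2_eq_square)
  \<comment> \<open>The killing integral is completed to (v, v) by adding the missing mass.
    Subtraction follows only after both numbers are known to be finite.\<close>
  have "(\<integral>\<^sup>+x. (1 - ennreal \<alpha> * G \<alpha> (\<lambda>_. 1) x) * ennreal ((v x)\<^sup>2) \<partial>m) + ennreal \<alpha> * ennreal ?a =
      (\<integral>\<^sup>+x. (1 - ennreal \<alpha> * G \<alpha> (\<lambda>_. 1) x) * ennreal ((v x)\<^sup>2) + ennreal \<alpha> * (ennreal ((v x)\<^sup>2) * G \<alpha> (\<lambda>_. 1) x) \<partial>m)"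
    unfolding a by (subst nn_integral_add) (auto simp: nn_integral_cmult)
  also have "\<dots> = (\<integral>\<^sup>+x. ennreal ((v x)\<^sup>2) \<partial>m)"
  proof (intro nn_integral_cong)
    fix x
    have "(1 - ennreal \<alpha> * G \<alpha> (\<lambda>_. 1) x) * ennreal ((v x)\<^sup>2) + ennreal \<alpha> * (ennreal ((v x)\<^sup>2) * G \<alpha> (\<lambda>_. 1) x) =
      ((1 - ennreal \<alpha> * G \<alpha> (\<lambda>_. 1) x) + ennreal \<alpha> * G \<alpha> (\<lambda>_. 1) x) * ennreal ((v x)\<^sup>2)"
      by (simp only: distrib_right mult.assoc mult.commute[of "ennreal ((v x)\<^sup>2)" "G \<alpha> (\<lambda>_. 1) x"])
    then show "(1 - ennreal \<alpha> * G \<alpha> (\<lambda>_. 1) x) * ennreal ((v x)\<^sup>2) + ennreal \<alpha> * (ennreal ((v x)\<^sup>2) * G \<alpha> (\<lambda>_. 1) x) = ennreal ((v x)\<^sup>2)"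
      using sub_Markov[OF \<alpha>, of x] by (simp add: diff_add_cancel_ennreal)
  qed
  finally have 2: "(\<integral>\<^sup>+x. (1 - ennreal \<alpha> * G \<alpha> (\<lambda>_. 1) x) * ennreal ((v x)\<^sup>2) \<partial>m) + ennreal (\<alpha> * ?a) = ennreal (inner_L2 m v v)"
    using vv \<alpha>0 by (simp add: ennreal_mult')
  have a0: "0 \<le> ?a" by (rule integral_nonneg_AE) simp
  have "ennreal (\<alpha> * ?a) \<le> ennreal (inner_L2 m v v)" unfolding 2[symmetric] by simp
  then have le: "\<alpha> * ?a \<le> inner_L2 m v v"
    using L2.nonneg[OF L] by (simp add: ennreal_le_iff)
  have 3: "(\<integral>\<^sup>+x. (1 - ennreal \<alpha> * G \<alpha> (\<lambda>_. 1) x) * ennreal ((v x)\<^sup>2) \<partial>m) = ennreal (inner_L2 m v v - \<alpha> * ?a)"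
  proof -
    have "(\<integral>\<^sup>+x. (1 - ennreal \<alpha> * G \<alpha> (\<lambda>_. 1) x) * ennreal ((v x)\<^sup>2) \<partial>m) = ennreal (inner_L2 m v v) - ennreal (\<alpha> * ?a)"
      unfolding 2[symmetric] by simp
    then show ?thesis using a0 \<alpha>0 by (simp add: ennreal_minus)
  qed
  have GrL: "Gr \<alpha> v \<in> L2 m" using is_resD(1)[OF is_res_Gr[OF v L \<alpha>]] D_in_L2 by blast
  have "kernel_energy \<alpha> v = ennreal (\<alpha> * (2 * ?a - 2 * inner_L2 m (Gr \<alpha> v) v)) + ennreal (2 * (inner_L2 m v v - \<alpha> * ?a))"
    unfolding kernel_energy_def 1 3 by (simp only: ennreal_mult[OF \<alpha>0 nn1] ennreal_mult'[OF zero_le_numeral] ennreal_numeral)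
  also have "\<dots> = ennreal (\<alpha> * (2 * ?a - 2 * inner_L2 m (Gr \<alpha> v) v) + 2 * (inner_L2 m v v - \<alpha> * ?a))"
    using \<alpha>0 nn1 le by (intro ennreal_plus[symmetric]) auto
  also have "\<alpha> * (2 * ?a - 2 * inner_L2 m (Gr \<alpha> v) v) + 2 * (inner_L2 m v v - \<alpha> * ?a) = 2 * (inner_L2 m v v - \<alpha> * inner_L2 m (Gr \<alpha> v) v)"
    by (simp add: algebra_simps)
  finally show ?thesis by (simp add: L2.scale_left[OF GrL L])
qed

text \<open>Lower semicontinuity under mere almost everywhere convergence. The sequences that define
  the extended domain give nothing stronger.\<close>

lemma kernel_energy_Fatou:
  assumes [measurable]: "\<And>n. w n \<in> borel_measurable borel" "v \<in> borel_measurable borel"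
    and lim: "AE x in m. (\<lambda>n. w n x) \<longlonglongrightarrow> v x" and \<alpha>: "\<alpha> > 0"
  shows "kernel_energy \<alpha> v \<le> liminf (\<lambda>n. kernel_energy \<alpha> (w n))"
proof -
  have \<alpha>0: "0 \<le> \<alpha>" using \<alpha> by simp
  note [measurable] = r_measurable[OF \<alpha>0] r_measurable_right[OF \<alpha>0] r_measurable_left[OF \<alpha>0] G_measurable[OF _ \<alpha>0]
  have lim_mult: "(\<lambda>n. ennreal ((a n)\<^sup>2) * c) \<longlonglongrightarrow> ennreal (b\<^sup>2) * c \<Longrightarrow> liminf (\<lambda>n. ennreal ((a n)\<^sup>2) * c) = ennreal (b\<^sup>2) * c" for a b c
    by (intro lim_imp_Liminf) auto
  have tm: "(\<lambda>n. ennreal ((a n)\<^sup>2) * c) \<longlonglongrightarrow> ennreal (b\<^sup>2) * c" if "a \<longlonglongrightarrow> b" "c \<noteq> \<infinity>" for a b c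
    using that ennreal_tendsto_cmult[of c "\<lambda>n. ennreal ((a n)\<^sup>2)" "ennreal (b\<^sup>2)" sequentially]
    by (auto simp: mult.commute[of _ c] less_top intro!: tendsto_ennrealI tendsto_power)
  \<comment> \<open>The kernel may be infinite, where the product is discontinuous at b = 0. The
    inequality survives because 0 times \<infinity> is 0.\<close>
  have le: "ennreal (b\<^sup>2) * c \<le> liminf (\<lambda>n. ennreal ((a n)\<^sup>2) * c)" if "a \<longlonglongrightarrow> b" for a b c
  proof (cases "c = \<infinity> \<and> b = 0")
    case True then show ?thesis by simp
  next
    case False
    show ?thesis
    proof (cases "c = \<infinity>")
      case True
      with False have "b\<^sup>2 > 0" by simp
      moreover have "(\<lambda>n. (a n)\<^sup>2) \<longlonglongrightarrow> b\<^sup>2" using that by (intro tendsto_power)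
      ultimately have "\<forall>\<^sub>F n in sequentially. 0 < (a n)\<^sup>2" by (rule order_tendstoD(1)[rotated])
      then have "\<forall>\<^sub>F n in sequentially. \<infinity> \<le> ennreal ((a n)\<^sup>2) * c"
        by eventually_elim (simp add: True ennreal_mult_top)
      then have "\<infinity> \<le> liminf (\<lambda>n. ennreal ((a n)\<^sup>2) * c)" by (rule Liminf_bounded)
      then show ?thesis by (simp add: top.extremum_unique)
    next
      case False
      then show ?thesis using lim_mult[OF tm[OF that]] by simp
    qed
  qed
  have 1: "(\<integral>\<^sup>+x. \<integral>\<^sup>+y. ennreal ((v x - v y)\<^sup>2) * r \<alpha> x y \<partial>m \<partial>m)
      \<le> liminf (\<lambda>n. \<integral>\<^sup>+x. \<integral>\<^sup>+y. ennreal ((w n x - w n y)\<^sup>2) * r \<alpha> x y \<partial>m \<partial>m)"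
  proof -
    have "AE x in m. (\<integral>\<^sup>+y. ennreal ((v x - v y)\<^sup>2) * r \<alpha> x y \<partial>m)
        \<le> liminf (\<lambda>n. \<integral>\<^sup>+y. ennreal ((w n x - w n y)\<^sup>2) * r \<alpha> x y \<partial>m)"
      using lim
    proof eventually_elim
      case x: (elim x)
      have "(\<integral>\<^sup>+y. ennreal ((v x - v y)\<^sup>2) * r \<alpha> x y \<partial>m)
          \<le> (\<integral>\<^sup>+y. liminf (\<lambda>n. ennreal ((w n x - w n y)\<^sup>2) * r \<alpha> x y) \<partial>m)"
        using lim by (intro nn_integral_mono_AE) (auto elim!: eventually_mono intro!: le tendsto_diff x)
      also have "\<dots> \<le> liminf (\<lambda>n. \<integral>\<^sup>+y. ennreal ((w n x - w n y)\<^sup>2) * r \<alpha> x y \<partial>m)"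
        by (intro nn_integral_liminf) measurable
      finally show ?case .
    qed
    then have "(\<integral>\<^sup>+x. \<integral>\<^sup>+y. ennreal ((v x - v y)\<^sup>2) * r \<alpha> x y \<partial>m \<partial>m)
        \<le> (\<integral>\<^sup>+x. liminf (\<lambda>n. \<integral>\<^sup>+y. ennreal ((w n x - w n y)\<^sup>2) * r \<alpha> x y \<partial>m) \<partial>m)"
      by (rule nn_integral_mono_AE)
    also have "\<dots> \<le> liminf (\<lambda>n. \<integral>\<^sup>+x. \<integral>\<^sup>+y. ennreal ((w n x - w n y)\<^sup>2) * r \<alpha> x y \<partial>m \<partial>m)"
      by (intro nn_integral_liminf) measurable
    finally show ?thesis .
  qed
  have 2: "(\<integral>\<^sup>+x. (1 - ennreal \<alpha> * G \<alpha> (\<lambda>_. 1) x) * ennreal ((v x)\<^sup>2) \<partial>m)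
      \<le> liminf (\<lambda>n. \<integral>\<^sup>+x. (1 - ennreal \<alpha> * G \<alpha> (\<lambda>_. 1) x) * ennreal ((w n x)\<^sup>2) \<partial>m)"
  proof -
    have "(\<integral>\<^sup>+x. (1 - ennreal \<alpha> * G \<alpha> (\<lambda>_. 1) x) * ennreal ((v x)\<^sup>2) \<partial>m)
        \<le> (\<integral>\<^sup>+x. liminf (\<lambda>n. (1 - ennreal \<alpha> * G \<alpha> (\<lambda>_. 1) x) * ennreal ((w n x)\<^sup>2)) \<partial>m)"
      using lim by (intro nn_integral_mono_AE) (auto elim!: eventually_mono dest!: le simp: mult.commute)
    also have "\<dots> \<le> liminf (\<lambda>n. \<integral>\<^sup>+x. (1 - ennreal \<alpha> * G \<alpha> (\<lambda>_. 1) x) * ennreal ((w n x)\<^sup>2) \<partial>m)"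
      by (intro nn_integral_liminf) measurable
    finally show ?thesis .
  qed
  have "kernel_energy \<alpha> v \<le> liminf (\<lambda>n. ennreal \<alpha> * (\<integral>\<^sup>+x. \<integral>\<^sup>+y. ennreal ((w n x - w n y)\<^sup>2) * r \<alpha> x y \<partial>m \<partial>m))
      + liminf (\<lambda>n. 2 * (\<integral>\<^sup>+x. (1 - ennreal \<alpha> * G \<alpha> (\<lambda>_. 1) x) * ennreal ((w n x)\<^sup>2) \<partial>m))"
    unfolding kernel_energy_def
    by (intro add_mono order.trans[OF mult_left_mono ennreal_mult_liminf_le] 1 2) auto
  also have "\<dots> \<le> liminf (\<lambda>n. kernel_energy \<alpha> (w n))"
    unfolding kernel_energy_def by (rule ennreal_liminf_add_le)
  finally show ?thesis .
qed

section \<open>The energy on the extended domain\<close>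

lemma D_borel_version:
  assumes u: "u \<in> D"
  obtains u' where "u' \<in> borel_measurable borel" "u' \<in> D" "AE x in m. u' x = u x"
proof -
  have "u \<in> borel_measurable (completion m)" using D_in_L2[OF u] by (simp add: L2_def)
  from completion_ex_borel_measurable_real[OF this] obtain u' where u': "u' \<in> borel_measurable m" "AE x in m. u x = u' x"
    by blast
  then have e: "AE x in m. u' x = u x" by (auto elim: eventually_mono)
  have "u' \<in> L2 m" using L2_cong_AE[OF D_in_L2[OF u] measurable_completion[OF u'(1)] e] .
  with D_AE[OF u _ e] e u'(1) show ?thesis by (intro that) (simp_all add: measurable_cong_sets[OF sets_m refl])
qed

lemma form_AE_eq:
  assumes "u \<in> D" "v \<in> D" "AE x in m. v x = u x"
  shows "\<E> v v = \<E> u u"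
  using form_AE[OF assms(1,2,1,3)] form_AE[OF assms(1,2,2,3)] form_sym[OF assms(1,2)] by simp

text \<open>Closability with respect to almost everywhere convergence, the fact behind the
  independence of the extended energy from the approximating sequence.\<close>

lemma Cauchy_AE_zero_imp_energy_zero:
  assumes x: "\<And>n. x n \<in> D" and C: "form_Cauchy \<E> x" and lim: "AE y in m. (\<lambda>n. x n y) \<longlonglongrightarrow> 0"
  shows "(\<lambda>n. \<E> (x n) (x n)) \<longlonglongrightarrow> 0"
proof -
  have "\<exists>u'. u' \<in> borel_measurable borel \<and> u' \<in> D \<and> (AE y in m. u' y = x n y)" for n
    using D_borel_version[OF x[of n]] by metis
  then obtain z where zm [measurable]: "\<And>n. z n \<in> borel_measurable borel" and zD: "\<And>n. z n \<in> D"
    and zx: "\<And>n. AE y in m. z n y = x n y" by metis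
  have "AE y in m. \<forall>n. z n y = x n y" using zx by (simp add: AE_all_countable)
  with lim have zlim: "AE y in m. (\<lambda>n. z n y) \<longlonglongrightarrow> 0" by eventually_elim simp
  have small: "\<E> (x i) (x i) \<le> e"
    if N: "\<And>i j. i \<ge> N \<Longrightarrow> j \<ge> N \<Longrightarrow> \<E> (\<lambda>y. x i y - x j y) (\<lambda>y. x i y - x j y) < e" and i: "i \<ge> N" for N e i
  proof -
    \<comment> \<open>With i fixed, these differences have energy below e and tend to
      \<open>z i\<close>. Fatou's lemma carries the bound to every approximate form of
      \<open>z i\<close>, and \<open>L2_bounded_res_imp_D\<close> returns it to the energy
      itself.\<close>
    define w where "w l = (\<lambda>y. z i y - z (N + l) y)" for l
    have wm [measurable]: "w l \<in> borel_measurable borel" for l unfolding w_def by measurable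
    have wD: "w l \<in> D" for l unfolding w_def by (intro form.diff_mem zD)
    have we: "\<E> (w l) (w l) < e" for l
    proof -
      have "AE y in m. w l y = x i y - x (N + l) y"
        using zx[of i] zx[of "N + l"] by eventually_elim (simp add: w_def)
      from form_AE_eq[OF form.diff_mem[OF x x] wD this] N[of i "N + l"] i show ?thesis by simp
    qed
    have wlim: "AE y in m. (\<lambda>l. w l y) \<longlonglongrightarrow> z i y"
      using zlim
    proof eventually_elim
      case (elim y)
      then have "(\<lambda>l. z (l + N) y) \<longlonglongrightarrow> 0" by (rule LIMSEQ_ignore_initial_segment)
      from tendsto_diff[OF tendsto_const this, of "z i y"] show ?case by (simp add: w_def add.commute)
    qed
    have "a * (inner_L2 m (z i) (z i) - inner_L2 m (\<lambda>y. a * Gr a (z i) y) (z i)) \<le> e" if a: "0 < a" for a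
    proof -
      let ?q = "\<lambda>v. inner_L2 m v v - inner_L2 m (\<lambda>y. a * Gr a v y) v"
      have wL: "w l \<in> L2 m" for l using D_in_L2[OF wD] .
      have zL: "z i \<in> L2 m" using D_in_L2[OF zD] .
      have "?q (w l) \<le> e / a" for l
        using is_res_energy_le_form[OF is_res_Gr[OF wm wL a] a wD, of l] we[of l] a
        by (simp add: pos_le_divide_eq mult.commute)
      then have "kernel_energy a (w l) \<le> ennreal (2 * (e / a))" for l
        unfolding kernel_energy_eq[OF wm wL a] by (intro ennreal_leI mult_left_mono) auto
      then have "liminf (\<lambda>l. kernel_energy a (w l)) \<le> ennreal (2 * (e / a))"
        by (intro Liminf_le always_eventually allI trivial_limit_sequentially)
      then have "ennreal (2 * ?q (z i)) \<le> ennreal (2 * (e / a))"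
        using kernel_energy_Fatou[OF wm zm wlim a] unfolding kernel_energy_eq[OF zm zL a] by (rule order.trans[rotated])
      moreover have "0 < e" using we[of 0] form.nonneg[OF wD[of 0]] by simp
      ultimately have "?q (z i) \<le> e / a" using a by (subst (asm) ennreal_le_iff) auto
      then show ?thesis using a by (simp add: pos_le_divide_eq mult.commute)
    qed
    then have bound: "real (Suc n) * (inner_L2 m (z i) (z i) - inner_L2 m (\<lambda>y. real (Suc n) * Gr (real (Suc n)) (z i) y) (z i)) \<le> e" for n
      by (rule allI[THEN spec]) simp
    have res: "is_res (real (Suc n)) (z i) (Gr (real (Suc n)) (z i))" for n
      by (rule is_res_Gr[OF zm D_in_L2[OF zD]]) simp
    have "\<E> (z i) (z i) \<le> e"
    proof (rule L2_bounded_res_imp_D(2)[OF D_in_L2[OF zD] res _ _ _ bound])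
      show "filterlim (\<lambda>n. real (Suc n)) at_top sequentially"
        by (rule filterlim_compose[OF filterlim_real_sequentially filterlim_Suc])
    qed (simp_all add: incseq_def)
    then show ?thesis using form_AE_eq[OF x zD zx] by simp
  qed
  show ?thesis
  proof (rule LIMSEQ_I)
    fix e :: real assume "0 < e"
    then have "0 < e / 2" by simp
    then obtain N where N: "\<And>i j. i \<ge> N \<Longrightarrow> j \<ge> N \<Longrightarrow> \<E> (\<lambda>y. x i y - x j y) (\<lambda>y. x i y - x j y) < e / 2"
      using C unfolding form_Cauchy_def by meson
    show "\<exists>no. \<forall>n\<ge>no. norm (\<E> (x n) (x n) - 0) < e"
    proof (intro exI[of _ N] allI impI)
      fix i assume "N \<le> i"
      from small[OF N this] \<open>0 < e\<close> form.nonneg[OF x[of i]] show "norm (\<E> (x i) (x i) - 0) < e" by simp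
    qed
  qed
qed

text \<open>The difference of two approximating sequences is \<E>-Cauchy and tends to 0 almost
  everywhere, so its energy vanishes in the limit. This makes the definite description in
  \<open>extended_energy\<close> denote.\<close>

lemma approximating_limit_unique:
  assumes us: "approximating m D \<E> u us" "(\<lambda>n. \<E> (us n) (us n)) \<longlonglongrightarrow> c"
    and vs: "approximating m D \<E> u vs" "(\<lambda>n. \<E> (vs n) (vs n)) \<longlonglongrightarrow> d"
  shows "c = d"
proof -
  have uD: "us n \<in> D" and vD: "vs n \<in> D" for n using us(1) vs(1) by (auto simp: approximating_def)
  define z where "z n = (\<lambda>x. us n x - vs n x)" for n
  have zD: "z n \<in> D" for n unfolding z_def by (intro form.diff_mem uD vD)
  have "form_Cauchy \<E> z"
    unfolding form_Cauchy_def
  proof (intro allI impI)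
    fix e :: real assume "0 < e"
    then have e: "0 < e / 4" by simp
    obtain N1 where N1: "\<And>i j. i \<ge> N1 \<Longrightarrow> j \<ge> N1 \<Longrightarrow> \<E> (\<lambda>x. us i x - us j x) (\<lambda>x. us i x - us j x) < e / 4"
      using us(1) e unfolding approximating_def form_Cauchy_def by meson
    obtain N2 where N2: "\<And>i j. i \<ge> N2 \<Longrightarrow> j \<ge> N2 \<Longrightarrow> \<E> (\<lambda>x. vs i x - vs j x) (\<lambda>x. vs i x - vs j x) < e / 4"
      using vs(1) e unfolding approximating_def form_Cauchy_def by meson
    show "\<exists>N. \<forall>i\<ge>N. \<forall>j\<ge>N. \<E> (\<lambda>x. z i x - z j x) (\<lambda>x. z i x - z j x) < e"
    proof (intro exI[of _ "max N1 N2"] allI impI)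
      fix i j assume "max N1 N2 \<le> i" "max N1 N2 \<le> j"
      then have "\<E> (\<lambda>x. us i x - us j x) (\<lambda>x. us i x - us j x) < e / 4" "\<E> (\<lambda>x. vs i x - vs j x) (\<lambda>x. vs i x - vs j x) < e / 4"
        using N1 N2 by auto
      moreover have "(\<lambda>x. z i x - z j x) = (\<lambda>x. (us i x - us j x) - (vs i x - vs j x))" by (auto simp: z_def)
      ultimately show "\<E> (\<lambda>x. z i x - z j x) (\<lambda>x. z i x - z j x) < e"
        using form.diff_sq_le[OF form.diff_mem[OF uD uD, of i j] form.diff_mem[OF vD vD, of i j]] by simp
    qed
  qed
  moreover have "AE x in m. (\<lambda>n. z n x) \<longlonglongrightarrow> 0"
  proof -
    have "AE x in m. (\<lambda>n. us n x) \<longlonglongrightarrow> u x" "AE x in m. (\<lambda>n. vs n x) \<longlonglongrightarrow> u x"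
      using us(1) vs(1) by (auto simp: approximating_def)
    then show ?thesis
    proof eventually_elim
      case (elim x)
      from tendsto_diff[OF elim] show ?case by (simp add: z_def)
    qed
  qed
  ultimately have "(\<lambda>n. \<E> (z n) (z n)) \<longlonglongrightarrow> 0" by (rule Cauchy_AE_zero_imp_energy_zero[OF zD])
  from tendsto_real_sqrt[OF this] have s: "(\<lambda>n. sqrt (\<E> (z n) (z n))) \<longlonglongrightarrow> 0" by simp
  have "(\<lambda>n. sqrt (\<E> (us n) (us n)) - sqrt (\<E> (vs n) (vs n))) \<longlonglongrightarrow> 0"
    by (rule Lim_null_comparison[OF _ s]) (use form.sqrt_diff_le[OF uD vD] in \<open>auto simp: z_def\<close>)
  moreover have "(\<lambda>n. sqrt (\<E> (us n) (us n)) - sqrt (\<E> (vs n) (vs n))) \<longlonglongrightarrow> sqrt c - sqrt d"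
    by (intro tendsto_diff tendsto_real_sqrt us vs)
  ultimately have "sqrt c = sqrt d" using LIMSEQ_unique by fastforce
  then show ?thesis by simp
qed

text \<open>Boundedness of the energies is weaker than the Cauchy property demanded by
  \<open>approximating\<close>. Convex combinations of the tails repair this without changing the
  pointwise limit or the bound.\<close>

lemma extended_energy_le:
  assumes v: "v \<in> borel_measurable (completion m)" and w: "\<And>n. w n \<in> D" and C: "\<And>n. \<E> (w n) (w n) \<le> C"
    and lim: "AE x in m. (\<lambda>n. w n x) \<longlonglongrightarrow> v x"
  shows "v \<in> extended_domain m D \<E>" "extended_energy m D \<E> v \<le> C"
proof -
  obtain z where z: "\<And>n. z n \<in> tail_hull w n" "form_Cauchy \<E> z"
    by (rule form.bounded_imp_Cauchy_hull[of w C, OF w C]) blast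
  have zD: "z n \<in> D" "\<E> (z n) (z n) \<le> C" for n using form.tail_hull_bound[OF z(1) w C] by auto
  have "AE x in m. (\<lambda>n. z n x) \<longlonglongrightarrow> v x" using lim by eventually_elim (rule tail_hull_tendsto[OF z(1)])
  with z zD have ap: "approximating m D \<E> v z" by (simp add: approximating_def)
  then show "v \<in> extended_domain m D \<E>" using v by (auto simp: extended_domain_def)
  obtain c where c: "(\<lambda>n. \<E> (z n) (z n)) \<longlonglongrightarrow> c" using form.Cauchy_convergent[OF zD(1) z(2)] by (auto simp: convergent_def)
  have "extended_energy m D \<E> v = c"
    unfolding extended_energy_def
  proof (rule the_equality)
    show "\<exists>us. approximating m D \<E> v us \<and> (\<lambda>n. \<E> (us n) (us n)) \<longlonglongrightarrow> c" using ap c by blast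
    fix d assume "\<exists>us. approximating m D \<E> v us \<and> (\<lambda>n. \<E> (us n) (us n)) \<longlonglongrightarrow> d"
    then obtain us where "approximating m D \<E> v us" "(\<lambda>n. \<E> (us n) (us n)) \<longlonglongrightarrow> d" by blast
    from approximating_limit_unique[OF this ap c] show "d = c" .
  qed
  moreover have "c \<le> C" using zD(2) by (intro LIMSEQ_le_const2[OF c]) auto
  ultimately show "extended_energy m D \<E> v \<le> C" by simp
qed

end

section \<open>Potentials under transience\<close>

lemma ennreal_mult_less_top_imp: "a * b < top \<Longrightarrow> 0 < a \<Longrightarrow> b < (top::ennreal)"
  by (cases "b = top") (auto simp: ennreal_mult_top less_top split: if_splits)

context symmetric_resolvent
begin

lemma L2_AE_subseq:
  assumes [measurable]: "\<And>n. y n \<in> borel_measurable borel" "v \<in> borel_measurable borel"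
    and L: "\<And>n. y n \<in> L2 m" "v \<in> L2 m"
    and lim: "(\<lambda>n. inner_L2 m (\<lambda>x. y n x - v x) (\<lambda>x. y n x - v x)) \<longlonglongrightarrow> 0"
  obtains s where "strict_mono (s :: nat \<Rightarrow> nat)" "AE x in m. (\<lambda>n. y (s n) x) \<longlonglongrightarrow> v x"
proof -
  have int: "integrable m (\<lambda>x. (y n x - v x) * (y n x - v x))" for n
    by (rule L2_borel_integrable) (auto intro: L2.diff_mem L)
  have eq: "inner_L2 m (\<lambda>x. y n x - v x) (\<lambda>x. y n x - v x) = (\<integral>x. norm ((y n x - v x) * (y n x - v x)) \<partial>m)" for n
    by (subst inner_L2_borel) auto
  obtain s :: "nat \<Rightarrow> nat" where s: "strict_mono s" "AE x in m. (\<lambda>n. (y (s n) x - v x) * (y (s n) x - v x)) \<longlonglongrightarrow> 0"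
    using tendsto_L1_AE_subseq[OF int lim[unfolded eq]] by blast
  have "AE x in m. (\<lambda>n. y (s n) x) \<longlonglongrightarrow> v x"
    using s(2)
  proof eventually_elim
    case (elim x)
    from tendsto_real_sqrt[OF elim] have "(\<lambda>n. \<bar>y (s n) x - v x\<bar>) \<longlonglongrightarrow> 0" by simp
    from tendsto_rabs_zero_cancel[OF this] show ?case by (rule LIM_zero_cancel)
  qed
  with s(1) show ?thesis by (rule that)
qed

lemma Gr_AE_subseq:
  assumes v [measurable]: "v \<in> borel_measurable borel" and L: "v \<in> L2 m"
    and a: "\<And>n. 0 < a n" "filterlim a at_top sequentially"
  obtains s where "strict_mono (s :: nat \<Rightarrow> nat)" "AE x in m. (\<lambda>n. a (s n) * Gr (a (s n)) v x) \<longlonglongrightarrow> v x"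
proof -
  \<comment> \<open>The continuity lemma quantifies over all of L2, whereas \<open>Gr\<close> is the
    resolvent of Borel functions only. For other functions any resolvent is chosen; it exists
    through a Borel representative.\<close>
  define w where "w n h = (if h \<in> borel_measurable borel then Gr (a n) h else (SOME w. is_res (a n) h w))" for n h
  have "(\<lambda>n. inner_L2 m (\<lambda>x. a n * w n v x - v x) (\<lambda>x. a n * w n v x - v x)) \<longlonglongrightarrow> 0"
  proof (rule is_res_strong_continuity[OF L _ a])
    fix n h assume hL: "h \<in> L2 m"
    show "is_res (a n) h (w n h)"
    proof (cases "h \<in> borel_measurable borel")
      case True then show ?thesis using is_res_Gr[OF True hL a(1)] by (simp add: w_def)
    next
      case False
      have "h \<in> borel_measurable (completion m)" using hL by (simp add: L2_def)
      from completion_ex_borel_measurable_real[OF this] obtain h' where h': "h' \<in> borel_measurable m" "AE x in m. h x = h' x"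
        by blast
      have hm: "h' \<in> borel_measurable borel" using h'(1) by (simp add: measurable_cong_sets[OF sets_m refl])
      have e: "AE x in m. h' x = h x" using h'(2) by (auto elim: eventually_mono)
      have L': "h' \<in> L2 m" by (rule L2_cong_AE[OF hL measurable_completion[OF h'(1)] e])
      have "is_res (a n) h (Gr (a n) h')"
        using is_res_Gr[OF hm L' a(1), of n] inner_L2_cong_AE[OF hL L' D_in_L2 D_in_L2 h'(2)]
        unfolding is_res_def by auto
      then have "is_res (a n) h (SOME w. is_res (a n) h w)" by (rule someI[where P="is_res (a n) h"])
      with False show ?thesis by (simp add: w_def)
    qed
  qed
  then have "(\<lambda>n. inner_L2 m (\<lambda>x. a n * Gr (a n) v x - v x) (\<lambda>x. a n * Gr (a n) v x - v x)) \<longlonglongrightarrow> 0"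
    by (simp add: w_def)
  moreover have "(\<lambda>x. a n * Gr (a n) v x) \<in> L2 m" for n
    using is_resD(1)[OF is_res_Gr[OF v L a(1)]] D_in_L2 L2_scale by blast
  moreover have "(\<lambda>x. a n * Gr (a n) v x) \<in> borel_measurable borel" for n
    using Gr_measurable[OF v, of "a n"] a(1)[of n] by simp
  ultimately show ?thesis using L2_AE_subseq[of "\<lambda>n x. a n * Gr (a n) v x" v] that L v by blast
qed

lemma G_eq_Gr_nonneg:
  assumes "\<And>y. 0 \<le> h y"
  shows "Gr \<alpha> h x = enn2real (G \<alpha> (\<lambda>y. ennreal (h y)) x)"
proof -
  have "(\<lambda>y. ennreal (- h y)) = (\<lambda>_. 0)" using assms by (auto intro!: ennreal_neg)
  then show ?thesis by (simp add: Gr_def G_def)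
qed

text \<open>If \<open>G \<beta> g\<close> vanishes at x, so does \<open>G \<gamma> g\<close> for
  every \<gamma> \<ge> \<beta>, and \<gamma> G_\<gamma> g could not approach the positive value of
  \<open>g\<close> there.\<close>

lemma AE_G_pos:
  assumes g [measurable]: "g \<in> borel_measurable borel" and L: "g \<in> L2 m" and pos: "\<And>x. 0 \<le> g x"
    and ae: "AE x in m. 0 < g x" and \<beta>: "0 \<le> \<beta>"
  shows "AE x in m. 0 < G \<beta> (\<lambda>y. ennreal (g y)) x"
proof -
  have lim: "filterlim (\<lambda>n. real (Suc n)) at_top sequentially"
    by (rule filterlim_compose[OF filterlim_real_sequentially filterlim_Suc])
  obtain s :: "nat \<Rightarrow> nat" where s: "strict_mono s"
    "AE x in m. (\<lambda>n. real (Suc (s n)) * Gr (real (Suc (s n))) g x) \<longlonglongrightarrow> g x"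
    using Gr_AE_subseq[OF g L _ lim] by auto
  show ?thesis
    using s(2) ae
  proof eventually_elim
    case (elim x)
    show ?case
    proof (rule ccontr)
      assume "\<not> ?thesis"
      then have z: "G \<beta> (\<lambda>y. ennreal (g y)) x = 0" by simp
      obtain N where N: "\<beta> \<le> real N" using real_arch_simple by blast
      have "real (Suc (s n)) * Gr (real (Suc (s n))) g x = 0" if "n \<ge> N" for n
      proof -
        have "n \<le> s n" using s(1) by (rule seq_suble)
        then have "\<beta> \<le> real (Suc (s n))" using N that by linarith
        from G_antimono[OF _ \<beta> this, of "\<lambda>y. ennreal (g y)" x] z
        have "G (real (Suc (s n))) (\<lambda>y. ennreal (g y)) x = 0" by simp
        then show ?thesis by (simp add: G_eq_Gr_nonneg[OF pos])
      qed
      then have "(\<lambda>n. real (Suc (s n)) * Gr (real (Suc (s n))) g x) \<longlonglongrightarrow> 0"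
        by (intro tendsto_eventually) (auto simp: eventually_sequentially)
      from LIMSEQ_unique[OF this elim(1)] elim(2) show False by simp
    qed
  qed
qed

lemma G_incseq:
  assumes "h \<in> borel_measurable borel"
  shows "incseq (\<lambda>n. G (1 / real (Suc n)) h x)"
  unfolding incseq_def by (intro allI impI G_antimono assms) (auto intro!: divide_left_mono)

text \<open>For h \<le> g and W = G_\<alpha> h, transience gives (h, W) \<le> sqrt (\<E> W W), and
  the resolvent equation gives \<E> W W \<le> (h, W). Hence (h, W) \<le> 1 for every \<alpha> > 0,
  and the bound persists as \<alpha> tends to 0.\<close>

lemma transient_potential_finite:
  assumes tr: "transient_form m D \<E>"
  obtains g where "g \<in> borel_measurable borel" "\<And>x. 0 \<le> g x" "g \<in> L2 m" "AE x in m. 0 < g x"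
    "AE x in m. G 0 (\<lambda>y. ennreal (g y)) x < \<infinity>"
proof -
  obtain g where gm: "g \<in> borel_measurable (completion m)" and gpos: "\<And>x. 0 < g x"
    and gE: "\<And>u. u \<in> D \<Longrightarrow> (\<integral>\<^sup>+x. ennreal (\<bar>u x\<bar> * g x) \<partial>completion m) \<le> ennreal (sqrt (\<E> u u))"
    using tr unfolding transient_form_def by blast
  obtain g' where g': "g' \<in> borel_measurable m" "AE x in m. g x = g' x"
    using completion_ex_borel_measurable_real[OF gm] by blast
  have g'm [measurable]: "g' \<in> borel_measurable borel" using g'(1) by (simp add: measurable_cong_sets[OF sets_m refl])
  obtain w :: "'a \<Rightarrow> real" where w: "w \<in> borel_measurable m" "\<And>x. 0 < w x" "\<And>x. w x \<le> 1" "integrable m w"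
    using obtain_positive_integrable_function by blast
  have wm [measurable]: "w \<in> borel_measurable borel" using w(1) by (simp add: measurable_cong_sets[OF sets_m refl])
  \<comment> \<open>The minimum with an integrable function bounded by 1 places \<open>h\<close> in
    L2; it is still positive almost everywhere and below the function from transience.\<close>
  define h where "h x = max 0 (min (g' x) (w x))" for x
  have hm [measurable]: "h \<in> borel_measurable borel" unfolding h_def[abs_def] by measurable
  have h0: "0 \<le> h x" "h x \<le> w x" "h x \<le> 1" for x using w(2)[of x] w(3)[of x] by (auto simp: h_def)
  have hpos: "AE x in m. 0 < h x" using g'(2)
  proof eventually_elim
    case (elim x)
    then show ?case using gpos[of x] w(2)[of x] by (simp add: h_def max_def min_def)
  qed
  have hg: "AE x in m. h x \<le> g x" using g'(2)
  proof eventually_elim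
    case (elim x)
    then show ?case using gpos[of x] by (simp add: h_def)
  qed
  have "(\<integral>\<^sup>+x. ennreal ((h x)\<^sup>2) \<partial>m) \<le> (\<integral>\<^sup>+x. ennreal (w x) \<partial>m)"
  proof (intro nn_integral_mono ennreal_leI)
    fix x
    have "h x * h x \<le> h x * 1" using h0(1,3) by (intro mult_left_mono)
    then show "(h x)\<^sup>2 \<le> w x" using h0(2)[of x] by (simp add: power2_eq_square)
  qed
  also have "\<dots> < \<infinity>" using w(2,4) by (simp add: nn_integral_eq_integral less_imp_le)
  finally have hL: "h \<in> L2 m" by (subst L2_borel_iff) auto
  have le1: "(\<integral>\<^sup>+x. ennreal (h x) * G \<alpha> (\<lambda>y. ennreal (h y)) x \<partial>m) \<le> 1" if \<alpha>: "0 < \<alpha>" for \<alpha>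
  proof -
    define W where "W x = enn2real (G \<alpha> (\<lambda>y. ennreal (h y)) x)" for x
    have res: "is_res \<alpha> h W" unfolding W_def[abs_def] by (rule is_res_nonneg[OF hm h0(1) hL \<alpha>])
    note WD = is_resD(1)[OF res] and WL = D_in_L2[OF is_resD(1)[OF res]]
    have Wm [measurable]: "W \<in> borel_measurable borel" unfolding W_def[abs_def]
      using G_measurable[of "\<lambda>y. ennreal (h y)" \<alpha>] \<alpha> by simp
    let ?e = "\<E> W W" and ?b = "inner_L2 m h W"
    have W0: "0 \<le> W x" for x by (simp add: W_def)
    have "?e \<le> ?b" using is_resD(2)[OF res WD] L2.nonneg[OF WL] \<alpha> by simp
    moreover have bnn: "ennreal ?b = (\<integral>\<^sup>+x. ennreal (h x * W x) \<partial>m)"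
      unfolding inner_L2_borel[OF hm Wm]
      by (rule nn_integral_eq_integral[symmetric, OF L2_borel_integrable[OF hm Wm hL WL]]) (use h0 W0 in auto)
    moreover have "(\<integral>\<^sup>+x. ennreal (h x * W x) \<partial>m) \<le> (\<integral>\<^sup>+x. ennreal (\<bar>W x\<bar> * g x) \<partial>m)"
      using hg by (intro nn_integral_mono_AE) (auto elim!: eventually_mono intro!: ennreal_leI mult_left_mono simp: W0 mult.commute[of "h _"])
    moreover have "\<dots> \<le> ennreal (sqrt ?e)" using gE[OF WD] by (simp add: nn_integral_completion)
    ultimately have eb: "?e \<le> ?b" "ennreal ?b \<le> ennreal (sqrt ?e)" by auto
    have e0: "0 \<le> ?e" by (rule form.nonneg[OF WD])
    have bs: "?b \<le> sqrt ?e" using eb(2) e0 by (simp add: ennreal_le_iff)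
    \<comment> \<open>The two estimates combine to e \<le> sqrt e, which excludes sqrt e >
      1.\<close>
    have "sqrt ?e \<le> 1"
    proof (rule ccontr)
      assume "\<not> ?thesis"
      then have "1 < sqrt ?e" by simp
      then have "sqrt ?e * 1 < sqrt ?e * sqrt ?e" by (intro mult_strict_left_mono) auto
      then show False using eb(1) bs e0 by simp
    qed
    with bs have "?b \<le> 1" by (rule order_trans)
    then have "ennreal ?b \<le> 1" by (simp only: ennreal_le_1)
    moreover have "(\<integral>\<^sup>+x. ennreal (h x) * G \<alpha> (\<lambda>y. ennreal (h y)) x \<partial>m) = (\<integral>\<^sup>+x. ennreal (h x * W x) \<partial>m)"
      using G_pos_L2(1)[OF hm hL \<alpha>]
      by (intro nn_integral_cong_AE) (auto elim!: eventually_mono simp: W_def ennreal_mult h0 less_top)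
    ultimately show ?thesis using bnn by simp
  qed
  have "(\<integral>\<^sup>+x. ennreal (h x) * G 0 (\<lambda>y. ennreal (h y)) x \<partial>m) =
      (\<integral>\<^sup>+x. (SUP n. ennreal (h x) * G (1 / real (Suc n)) (\<lambda>y. ennreal (h y)) x) \<partial>m)"
    by (simp add: resolvent_SUP[symmetric] SUP_mult_left_ennreal)
  also have "\<dots> = (SUP n. \<integral>\<^sup>+x. ennreal (h x) * G (1 / real (Suc n)) (\<lambda>y. ennreal (h y)) x \<partial>m)"
    using G_incseq[of "\<lambda>y. ennreal (h y)"] G_measurable[of "\<lambda>y. ennreal (h y)"]
    by (intro nn_integral_monotone_convergence_SUP) (auto simp: incseq_def le_fun_def intro!: mult_left_mono)
  also have "\<dots> \<le> 1" by (intro SUP_least le1) simp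
  finally have "(\<integral>\<^sup>+x. ennreal (h x) * G 0 (\<lambda>y. ennreal (h y)) x \<partial>m) \<noteq> \<infinity>" by (auto simp: top_unique)
  then have "AE x in m. ennreal (h x) * G 0 (\<lambda>y. ennreal (h y)) x \<noteq> \<infinity>"
    using G_measurable[of "\<lambda>y. ennreal (h y)" 0] by (intro nn_integral_noteq_infinite) auto
  with hpos have "AE x in m. G 0 (\<lambda>y. ennreal (h y)) x < \<infinity>"
    by eventually_elim (auto intro: ennreal_mult_less_top_imp simp: less_top)
  with hm h0(1) hL hpos show ?thesis by (rule that)
qed

text \<open>The functions \<open>s - G 1 s\<close> with \<open>s = min (G 0 g) j\<close> have bounded potentials, since \<open>s\<close> is excessive.\<close>

lemma bounded_potential:
  assumes tr: "transient_form m D \<E>"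
  obtains \<phi> where "\<phi> \<in> borel_measurable borel" "AE x in m. 0 < \<phi> x" "\<And>x. G 0 \<phi> x \<le> 1"
proof -
  obtain g where g [measurable]: "g \<in> borel_measurable borel" and g0: "\<And>x. 0 \<le> g x" and gL: "g \<in> L2 m"
    and gpos: "AE x in m. 0 < g x" and fin: "AE x in m. G 0 (\<lambda>y. ennreal (g y)) x < \<infinity>"
    by (rule transient_potential_finite[OF tr]) blast
  define W where "W = G 0 (\<lambda>y. ennreal (g y))"
  have Wm [measurable]: "W \<in> borel_measurable borel" unfolding W_def by (intro G_measurable) auto
  have Weq: "W x = G 1 (\<lambda>y. ennreal (g y)) x + G 1 W x" for x
    using resolvent_equation[of 0 1 "\<lambda>y. ennreal (g y)" x] by (simp add: W_def)
  define s where "s j x = min (W x) (of_nat j)" for j :: nat and x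
  have sm [measurable]: "s j \<in> borel_measurable borel" for j unfolding s_def[abs_def] by measurable
  have sj: "s j x \<le> of_nat j" for j x by (simp add: s_def)
  have G1m [measurable]: "G 1 h \<in> borel_measurable borel" if "h \<in> borel_measurable borel" for h
    using that by (intro G_measurable) auto
  \<comment> \<open>Both W and the constant j dominate their images under \<open>G 1\<close>, hence
    so does their minimum.\<close>
  have G1s: "G 1 (s j) x \<le> s j x" for j x
  proof -
    have "G 1 (s j) x \<le> G 1 W x" by (intro G_mono) (simp add: s_def)
    also have "\<dots> \<le> G 1 (\<lambda>y. ennreal (g y)) x + G 1 W x" by simp
    also have "\<dots> = W x" by (rule Weq[symmetric])
    finally show ?thesis using G_bounded[OF sj sm, of 1 j x] by (simp add: s_def)
  qed
  have jfin: "(of_nat j :: ennreal) < \<infinity>" for j by (simp add: ennreal_of_nat_eq_real_of_nat)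
  have sfin: "s j x < \<infinity>" for j x using sj jfin by (rule order.strict_trans1)
  define \<psi> where "\<psi> j x = s j x - G 1 (s j) x" for j x
  have \<psi>m [measurable]: "\<psi> j \<in> borel_measurable borel" for j unfolding \<psi>_def[abs_def] by measurable
  have split: "s j x = \<psi> j x + G 1 (s j) x" for j x
    unfolding \<psi>_def using G1s[of j x] by (simp add: diff_add_cancel_ennreal)
  \<comment> \<open>By the resolvent equation, G_\<alpha> \<psi> = G_1 s - \<alpha> G_\<alpha> (G_1
    s) \<le> G_1 s \<le> j. The term \<open>?A\<close> must be finite to be cancelled, which is why
    \<alpha> > 0 comes first and 0 is reached by a supremum.\<close>
  have G\<psi>: "G \<alpha> (\<psi> j) x \<le> of_nat j" if \<alpha>: "0 < \<alpha>" "\<alpha> \<le> 1" for \<alpha> j x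
  proof -
    let ?A = "G \<alpha> (G 1 (s j)) x"
    have "G \<alpha> (s j) x = G \<alpha> (\<psi> j) x + ?A"
      using G_add[OF \<psi>m G1m[OF sm], of \<alpha> j j x] \<alpha> by (simp add: split[symmetric])
    moreover have "G \<alpha> (s j) x = G 1 (s j) x + ennreal (1 - \<alpha>) * ?A"
      using resolvent_equation[of \<alpha> 1 "s j" x] resolvent_commute[of 1 \<alpha> "s j" x] \<alpha> by simp
    moreover have "ennreal (1 - \<alpha>) * ?A \<le> 1 * ?A" using \<alpha> by (intro mult_right_mono) (auto simp: ennreal_le_1)
    ultimately have "G \<alpha> (\<psi> j) x + ?A \<le> G 1 (s j) x + ?A" by (metis add_left_mono mult_1)
    moreover have "?A < \<infinity>"
    proof -
      have "ennreal \<alpha> * ?A \<le> of_nat j"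
        using \<alpha>(1) by (intro G_bounded) (auto intro: order_trans[OF G1s sj])
      from order.strict_trans1[OF this jfin] show ?thesis
        using \<alpha>(1) ennreal_mult_less_top_imp[of "ennreal \<alpha>" ?A] by simp
    qed
    ultimately have "G \<alpha> (\<psi> j) x \<le> G 1 (s j) x" by (auto simp: ennreal_add_left_cancel_le add.commute)
    also have "\<dots> \<le> of_nat j" using order_trans[OF G1s sj] .
    finally show ?thesis .
  qed
  have G0\<psi>: "G 0 (\<psi> j) x \<le> of_nat j" for j x
    unfolding resolvent_SUP[OF \<psi>m, symmetric] by (intro SUP_least G\<psi>) auto
  \<comment> \<open>Division by j + 1 compensates the bound j for the potential of
    \<open>\<psi> j\<close>; the powers of 1/2 sum to 1.\<close>
  define c :: "nat \<Rightarrow> real" where "c j = (1/2) ^ Suc j / (real j + 1)" for j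
  have c0: "0 < c j" for j by (simp add: c_def)
  define \<phi> where "\<phi> x = (\<Sum>j. ennreal (c j) * \<psi> j x)" for x
  have \<phi>m: "\<phi> \<in> borel_measurable borel" unfolding \<phi>_def[abs_def] by measurable
  have "AE x in m. 0 < G 1 (\<lambda>y. ennreal (g y)) x" by (rule AE_G_pos[OF g gL g0 gpos]) simp
  then have pos: "AE x in m. 0 < \<phi> x"
    using fin
  proof eventually_elim
    case (elim x)
    then have "W x < \<infinity>" by (simp add: W_def)
    \<comment> \<open>Beyond the finite value of W the cut-off is inactive at x, and there
      \<open>\<psi> j\<close> is at least \<open>G 1 g\<close>, which is positive.\<close>
    then obtain j :: nat where "W x \<le> of_nat j"
      using ennreal_Ex_less_of_nat[of "W x"] by (auto intro: less_imp_le)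
    then have sW: "s j x = W x" by (simp add: s_def)
    have "G 1 (s j) x \<le> G 1 W x" by (intro G_mono) (simp add: s_def)
    then have "G 1 (\<lambda>y. ennreal (g y)) x + G 1 (s j) x \<le> s j x"
      unfolding sW by (subst Weq) (rule add_left_mono)
    then have "G 1 (\<lambda>y. ennreal (g y)) x \<le> \<psi> j x"
      using order.strict_trans1[OF G1s sfin, of j x] unfolding split[of j x]
      by (auto simp: add.commute ennreal_add_left_cancel_le)
    with elim(1) have "0 < \<psi> j x" by (rule order.strict_trans2)
    then have "0 < ennreal (c j) * \<psi> j x" using c0[of j] by (simp add: ennreal_zero_less_mult_iff)
    also have "\<dots> \<le> \<phi> x" unfolding \<phi>_def using sum_le_suminf[OF summableI, of "{j}" "\<lambda>j. ennreal (c j) * \<psi> j x"] by simp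
    finally show ?case .
  qed
  have "G 0 \<phi> x \<le> 1" for x
  proof -
    have "G 0 \<phi> x = (\<integral>\<^sup>+y. (\<Sum>j. ennreal (c j) * \<psi> j y * r 0 x y) \<partial>m)"
      unfolding G_def \<phi>_def by (simp add: ennreal_suminf_multc)
    also have "\<dots> = (\<Sum>j. \<integral>\<^sup>+y. ennreal (c j) * \<psi> j y * r 0 x y \<partial>m)"
      using r_measurable_right[of 0 x] by (intro nn_integral_suminf) auto
    also have "\<dots> = (\<Sum>j. ennreal (c j) * G 0 (\<psi> j) x)"
      using G_cmult[OF \<psi>m, of 0] by (simp add: G_def)
    also have "\<dots> \<le> (\<Sum>j. ennreal ((1/2) ^ Suc j))"
    proof (intro suminf_le summableI)
      fix j
      have "ennreal (c j) * G 0 (\<psi> j) x \<le> ennreal (c j) * ennreal (real j)"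
        using G0\<psi>[of j x] by (intro mult_left_mono) (auto simp: ennreal_of_nat_eq_real_of_nat)
      also have "\<dots> = ennreal (c j * real j)" using c0[of j] by (simp add: ennreal_mult)
      also have "\<dots> \<le> ennreal ((1/2) ^ Suc j)"
      proof (rule ennreal_leI)
        have "c j * real j = (1/2) ^ Suc j * (real j / (real j + 1))" by (simp add: c_def)
        also have "\<dots> \<le> (1/2) ^ Suc j * 1" by (intro mult_left_mono) (auto simp: divide_le_eq_1)
        finally show "c j * real j \<le> (1/2) ^ Suc j" by simp
      qed
      finally show "ennreal (c j) * G 0 (\<psi> j) x \<le> ennreal ((1/2) ^ Suc j)" .
    qed
    also have "\<dots> = ennreal 1"
      by (rule suminf_ennreal_eq[OF _ power_half_series]) (rule zero_le_power, simp)
    finally show ?thesis by (simp only: ennreal_1)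
  qed
  with \<phi>m pos show ?thesis by (rule that)
qed

text \<open>Duality with a positive \<phi> whose potential is at most 1: the integral of \<phi>
  times the potential is at most the mass of \<nu>.\<close>

lemma pot_finite:
  assumes tr: "transient_form m D \<E>" and \<nu>: "sets \<nu> = sets borel" "finite_measure \<nu>"
  shows "AE x in m. pot 0 \<nu> x < \<infinity>"
proof -
  interpret n: finite_measure \<nu> by fact
  obtain \<phi> where \<phi> [measurable]: "\<phi> \<in> borel_measurable borel" and pos: "AE x in m. 0 < \<phi> x" and le: "\<And>x. G 0 \<phi> x \<le> 1"
    by (rule bounded_potential[OF tr]) blast
  have [measurable]: "pot 0 \<nu> \<in> borel_measurable borel" using pot_measurable[OF \<nu>] by simp
  have "(\<integral>\<^sup>+x. \<phi> x * pot 0 \<nu> x \<partial>m) = (\<integral>\<^sup>+y. G 0 \<phi> y \<partial>\<nu>)" by (rule pot_pair[OF \<nu>]) auto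
  also have "\<dots> \<le> (\<integral>\<^sup>+y. 1 \<partial>\<nu>)" by (intro nn_integral_mono le)
  also have "\<dots> < \<infinity>" by (simp add: n.emeasure_eq_measure)
  finally have "(\<integral>\<^sup>+x. \<phi> x * pot 0 \<nu> x \<partial>m) \<noteq> \<infinity>" by simp
  then have "AE x in m. \<phi> x * pot 0 \<nu> x \<noteq> \<infinity>" by (intro nn_integral_noteq_infinite) auto
  with pos show ?thesis by eventually_elim (auto intro: ennreal_mult_less_top_imp simp: less_top)
qed

text \<open>Monotonicity along the sequence comes from \<open>pot_resolvent\<close> and the limit is
  identified by duality, so both hold almost everywhere.\<close>

lemma pot_LIMSEQ:
  assumes \<nu>: "sets \<nu> = sets borel" "finite_measure \<nu>"
  shows "AE x in m. (\<lambda>n. pot (1 / real (Suc n)) \<nu> x) \<longlonglongrightarrow> pot 0 \<nu> x"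
proof -
  have pm [measurable]: "pot \<alpha> \<nu> \<in> borel_measurable borel" if "\<alpha> \<ge> 0" for \<alpha> using pot_measurable[OF \<nu> that] .
  have m [measurable]: "pot (1 / real (Suc n)) \<nu> \<in> borel_measurable borel" "pot 0 \<nu> \<in> borel_measurable borel" for n
    by (rule pm, simp)+
  have mono: "AE x in m. pot (1 / real (Suc n)) \<nu> x \<le> pot (1 / real (Suc (Suc n))) \<nu> x" for n
    using pot_resolvent[OF \<nu>, of "1 / real (Suc (Suc n))" "1 / real (Suc n)"]
    by (auto elim!: eventually_mono simp: divide_left_mono)
  have "AE x in m. (SUP n. pot (1 / real (Suc n)) \<nu> x) = pot 0 \<nu> x"
  proof (rule AE_eq_by_integrals)
    fix \<phi> :: "'a \<Rightarrow> ennreal" assume \<phi> [measurable]: "\<phi> \<in> borel_measurable borel"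
    have "(\<integral>\<^sup>+x. \<phi> x * (SUP n. pot (1 / real (Suc n)) \<nu> x) \<partial>m) = (\<integral>\<^sup>+x. (SUP n. \<phi> x * pot (1 / real (Suc n)) \<nu> x) \<partial>m)"
      by (simp add: SUP_mult_left_ennreal)
    also have "\<dots> = (SUP n. \<integral>\<^sup>+x. \<phi> x * pot (1 / real (Suc n)) \<nu> x \<partial>m)"
    proof (rule nn_integral_monotone_convergence_SUP_AE)
      show "AE x in m. \<phi> x * pot (1 / real (Suc n)) \<nu> x \<le> \<phi> x * pot (1 / real (Suc (Suc n))) \<nu> x" for n
        using mono[of n] by eventually_elim (rule mult_left_mono, simp_all)
    qed measurable
    also have "\<dots> = (SUP n. \<integral>\<^sup>+y. G (1 / real (Suc n)) \<phi> y \<partial>\<nu>)"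
      by (intro SUP_cong refl pot_pair[OF \<nu>]) auto
    also have "\<dots> = (\<integral>\<^sup>+y. (SUP n. G (1 / real (Suc n)) \<phi> y) \<partial>\<nu>)"
      using G_incseq[OF \<phi>] G_measurable[OF \<phi>]
      by (intro nn_integral_monotone_convergence_SUP[symmetric])
         (auto simp: incseq_def le_fun_def measurable_cong_sets[OF \<nu>(1) refl])
    also have "\<dots> = (\<integral>\<^sup>+x. \<phi> x * pot 0 \<nu> x \<partial>m)"
      unfolding resolvent_SUP[OF \<phi>] by (rule pot_pair[OF \<nu> _ \<phi>, symmetric]) simp
    finally show "(\<integral>\<^sup>+x. \<phi> x * (SUP n. pot (1 / real (Suc n)) \<nu> x) \<partial>m) = (\<integral>\<^sup>+x. \<phi> x * pot 0 \<nu> x \<partial>m)" .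
  qed measurable
  moreover have "AE x in m. \<forall>n. pot (1 / real (Suc n)) \<nu> x \<le> pot (1 / real (Suc (Suc n))) \<nu> x"
    using mono by (simp add: AE_all_countable)
  ultimately show ?thesis
  proof eventually_elim
    case (elim x)
    have "incseq (\<lambda>n. pot (1 / real (Suc n)) \<nu> x)" using elim(2) by (intro incseq_SucI) simp
    from LIMSEQ_SUP[OF this] elim(1) show ?case by simp
  qed
qed

text \<open>At points where the absolute potential is finite, \<open>Gr\<close> is a Bochner
  integral against one fixed measure. This supplies linearity and the triangle inequality
  pointwise.\<close>

lemma Gr_integral:
  assumes [measurable]: "h \<in> borel_measurable borel" and \<alpha>: "\<alpha> \<ge> 0" and fin: "G \<alpha> (\<lambda>y. ennreal \<bar>h y\<bar>) x < \<infinity>"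
  shows "integrable (density m (r \<alpha> x)) h" "Gr \<alpha> h x = (\<integral>y. h y \<partial>density m (r \<alpha> x))"
proof -
  note [measurable] = r_measurable_right[OF \<alpha>, of x]
  have d: "G \<alpha> k x = (\<integral>\<^sup>+y. k y \<partial>density m (r \<alpha> x))" if [measurable]: "k \<in> borel_measurable borel" for k
    unfolding G_def by (subst nn_integral_density) (auto simp: mult.commute)
  show i: "integrable (density m (r \<alpha> x)) h"
    using fin by (intro integrableI_bounded) (auto simp: d)
  show "Gr \<alpha> h x = (\<integral>y. h y \<partial>density m (r \<alpha> x))"
    using real_lebesgue_integral_def[OF i] by (simp add: Gr_def d)
qed

lemma pot_mass:
  assumes \<nu>: "sets \<nu> = sets borel" "finite_measure \<nu>" and \<beta>: "0 < \<beta>"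
  shows "ennreal \<beta> * (\<integral>\<^sup>+x. pot \<beta> \<nu> x \<partial>m) \<le> emeasure \<nu> UNIV"
proof -
  have [measurable]: "G \<beta> (\<lambda>_. 1) \<in> borel_measurable borel" using \<beta> by (intro G_measurable) auto
  have "ennreal \<beta> * (\<integral>\<^sup>+x. pot \<beta> \<nu> x \<partial>m) = ennreal \<beta> * (\<integral>\<^sup>+y. G \<beta> (\<lambda>_. 1) y \<partial>\<nu>)"
    using pot_pair[OF \<nu>, of \<beta> "\<lambda>_. 1"] \<beta> by simp
  also have "\<dots> = (\<integral>\<^sup>+y. ennreal \<beta> * G \<beta> (\<lambda>_. 1) y \<partial>\<nu>)"
    by (rule nn_integral_cmult[symmetric]) (simp add: measurable_cong_sets[OF \<nu>(1) refl])
  also have "\<dots> \<le> (\<integral>\<^sup>+y. 1 \<partial>\<nu>)" by (intro nn_integral_mono sub_Markov \<beta>)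
  also have "\<dots> = emeasure \<nu> UNIV" using sets_eq_imp_space_eq[OF \<nu>(1)] by simp
  finally show ?thesis .
qed

lemma pot_resolvent_finite:
  assumes \<nu>: "sets \<nu> = sets borel" "finite_measure \<nu>" and \<beta>: "0 < \<beta>"
  shows "AE x in m. pot \<beta> \<nu> x < \<infinity>" "integrable m (\<lambda>x. enn2real (pot \<beta> \<nu> x))"
    "\<beta> * (\<integral>x. enn2real (pot \<beta> \<nu> x) \<partial>m) \<le> measure \<nu> UNIV"
proof -
  interpret n: finite_measure \<nu> by fact
  have [measurable]: "pot \<beta> \<nu> \<in> borel_measurable borel" using pot_measurable[OF \<nu>] \<beta> by simp
  note mass = pot_mass[OF \<nu> \<beta>]
  have "(\<integral>\<^sup>+x. pot \<beta> \<nu> x \<partial>m) < \<infinity>"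
    using \<beta> order.strict_trans1[OF mass, of top]
      ennreal_mult_less_top_imp[of "ennreal \<beta>" "\<integral>\<^sup>+x. pot \<beta> \<nu> x \<partial>m"] by (simp add: n.emeasure_eq_measure)
  then have fin: "(\<integral>\<^sup>+x. pot \<beta> \<nu> x \<partial>m) \<noteq> \<infinity>" by simp
  from nn_integral_noteq_infinite[OF _ this] show ae: "AE x in m. pot \<beta> \<nu> x < \<infinity>" by (simp add: less_top)
  have eq: "(\<integral>\<^sup>+x. ennreal (enn2real (pot \<beta> \<nu> x)) \<partial>m) = (\<integral>\<^sup>+x. pot \<beta> \<nu> x \<partial>m)"
    using ae by (intro nn_integral_cong_AE) (auto elim!: eventually_mono simp: less_top)
  show int: "integrable m (\<lambda>x. enn2real (pot \<beta> \<nu> x))"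
    using fin eq by (intro integrableI_bounded) (auto simp: less_top)
  have "(\<integral>x. enn2real (pot \<beta> \<nu> x) \<partial>m) = enn2real (\<integral>\<^sup>+x. pot \<beta> \<nu> x \<partial>m)"
    using integral_eq_nn_integral[of "\<lambda>x. enn2real (pot \<beta> \<nu> x)" m] eq by simp
  then have "ennreal (\<beta> * (\<integral>x. enn2real (pot \<beta> \<nu> x) \<partial>m)) = ennreal \<beta> * (\<integral>\<^sup>+x. pot \<beta> \<nu> x \<partial>m)"
    using fin \<beta> by (simp add: ennreal_mult less_top)
  with mass have "ennreal (\<beta> * (\<integral>x. enn2real (pot \<beta> \<nu> x) \<partial>m)) \<le> ennreal (measure \<nu> UNIV)"
    by (simp only: n.emeasure_eq_measure)
  then show "\<beta> * (\<integral>x. enn2real (pot \<beta> \<nu> x) \<partial>m) \<le> measure \<nu> UNIV"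
    by (simp only: ennreal_le_iff[OF measure_nonneg])
qed

end

section \<open>Truncated potentials\<close>

definition add_measure :: "'a measure \<Rightarrow> 'a measure \<Rightarrow> 'a measure" where
  "add_measure M N = measure_of (space M) (sets M) (\<lambda>A. emeasure M A + emeasure N A)"

lemma sets_add_measure [simp, measurable_cong]: "sets (add_measure M N) = sets M"
  by (simp add: add_measure_def)

lemma space_add_measure [simp]: "space (add_measure M N) = space M"
  by (simp add: add_measure_def)

lemma emeasure_add_measure:
  assumes "sets N = sets M" "A \<in> sets M"
  shows "emeasure (add_measure M N) A = emeasure M A + emeasure N A"
  unfolding add_measure_def
proof (rule emeasure_measure_of_sigma)
  show "countably_additive (sets M) (\<lambda>A. emeasure M A + emeasure N A)"
    using assms(1) by (auto simp: countably_additive_def suminf_add[symmetric] suminf_emeasure)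
qed (use assms in \<open>auto simp: positive_def sets.sigma_algebra_axioms\<close>)

lemma nn_integral_add_measure:
  assumes S: "sets N = sets M" and f: "f \<in> borel_measurable M"
  shows "(\<integral>\<^sup>+x. f x \<partial>add_measure M N) = (\<integral>\<^sup>+x. f x \<partial>M) + (\<integral>\<^sup>+x. f x \<partial>N)"
  using f
proof (induction rule: borel_measurable_induct)
  case (cong f g)
  have "space N = space M" using S by (rule sets_eq_imp_space_eq)
  then have "(\<integral>\<^sup>+x. f x \<partial>add_measure M N) = (\<integral>\<^sup>+x. g x \<partial>add_measure M N)"
    "(\<integral>\<^sup>+x. f x \<partial>M) = (\<integral>\<^sup>+x. g x \<partial>M)" "(\<integral>\<^sup>+x. f x \<partial>N) = (\<integral>\<^sup>+x. g x \<partial>N)"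
    using cong(3) by (auto intro!: nn_integral_cong)
  with cong(4) show ?case by simp
next
  case (set A)
  then show ?case using S by (simp add: emeasure_add_measure)
next
  case (mult u c)
  have "u \<in> borel_measurable N" "u \<in> borel_measurable (add_measure M N)"
    using mult(2) measurable_cong_sets[OF S refl, of borel] measurable_cong_sets[OF sets_add_measure refl, of borel] by auto
  then show ?case using mult(2,4) by (simp only: nn_integral_cmult distrib_left)
next
  case (add u v)
  have "u \<in> borel_measurable N" "u \<in> borel_measurable (add_measure M N)"
    "v \<in> borel_measurable N" "v \<in> borel_measurable (add_measure M N)"
    by (simp_all only: measurable_cong_sets[OF S refl] measurable_cong_sets[OF sets_add_measure refl] add.hyps(1,3))
  then have "(\<integral>\<^sup>+x. u x + v x \<partial>add_measure M N) = (\<integral>\<^sup>+x. u x \<partial>add_measure M N) + (\<integral>\<^sup>+x. v x \<partial>add_measure M N)"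
    "(\<integral>\<^sup>+x. u x + v x \<partial>M) = (\<integral>\<^sup>+x. u x \<partial>M) + (\<integral>\<^sup>+x. v x \<partial>M)"
    "(\<integral>\<^sup>+x. u x + v x \<partial>N) = (\<integral>\<^sup>+x. u x \<partial>N) + (\<integral>\<^sup>+x. v x \<partial>N)"
    using add.hyps(1,3) by (simp_all only: nn_integral_add)
  then show ?case by (simp only: add.IH add_ac)
next
  case (seq U)
  have mN: "U i \<in> borel_measurable N" for i
    by (simp only: measurable_cong_sets[OF S refl] seq.hyps(1))
  have mA: "U i \<in> borel_measurable (add_measure M N)" for i
    by (simp only: measurable_cong_sets[OF sets_add_measure refl] seq.hyps(1))
  have inc: "incseq (\<lambda>i. \<integral>\<^sup>+x. U i x \<partial>M)" "incseq (\<lambda>i. \<integral>\<^sup>+x. U i x \<partial>N)"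
    using seq.hyps(3) by (auto simp: incseq_def le_fun_def intro!: nn_integral_mono)
  have "(\<integral>\<^sup>+x. (SUP i. U i x) \<partial>add_measure M N) = (SUP i. \<integral>\<^sup>+x. U i x \<partial>add_measure M N)"
    by (rule nn_integral_monotone_convergence_SUP[OF seq.hyps(3) mA])
  also have "\<dots> = (SUP i. (\<integral>\<^sup>+x. U i x \<partial>M) + (\<integral>\<^sup>+x. U i x \<partial>N))" by (simp only: seq.IH)
  also have "\<dots> = (SUP i. \<integral>\<^sup>+x. U i x \<partial>M) + (SUP i. \<integral>\<^sup>+x. U i x \<partial>N)" by (rule ennreal_SUP_add[OF inc])
  also have "\<dots> = (\<integral>\<^sup>+x. (SUP i. U i x) \<partial>M) + (\<integral>\<^sup>+x. (SUP i. U i x) \<partial>N)"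
    using nn_integral_monotone_convergence_SUP[OF seq.hyps(3) seq.hyps(1)] nn_integral_monotone_convergence_SUP[OF seq.hyps(3) mN] by simp
  finally show ?case by (simp add: image_comp)
qed

lemma finite_measure_add_measure:
  assumes S: "sets N = sets M" and "finite_measure M" "finite_measure N"
  shows "finite_measure (add_measure M N)"
proof
  interpret M: finite_measure M by fact
  interpret N: finite_measure N by fact
  show "emeasure (add_measure M N) (space (add_measure M N)) \<noteq> \<infinity>"
    using sets_eq_imp_space_eq[OF S] by (simp add: emeasure_add_measure[OF S] M.emeasure_eq_measure N.emeasure_eq_measure)
qed

lemma measure_add_measure:
  assumes S: "sets N = sets M" and "finite_measure M" "finite_measure N" and A: "A \<in> sets M"
  shows "measure (add_measure M N) A = measure M A + measure N A"
proof -
  interpret M: finite_measure M by fact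
  interpret N: finite_measure N by fact
  interpret A: finite_measure "add_measure M N" by (rule finite_measure_add_measure[OF assms(1-3)])
  have "ennreal (measure (add_measure M N) A) = ennreal (measure M A + measure N A)"
    using emeasure_add_measure[OF S A]
    by (simp add: M.emeasure_eq_measure N.emeasure_eq_measure A.emeasure_eq_measure)
  then show ?thesis by (subst (asm) ennreal_inj) auto
qed

definition clamp_real :: "real \<Rightarrow> real \<Rightarrow> real" where
  "clamp_real k a = max (min a k) (- k)"

context symmetric_resolvent
begin

text \<open>With \<open>v\<close> the truncation of \<open>w\<close> and \<open>z = w - v\<close> one has \<open>z * v = k * \<bar>z\<bar>\<close> pointwise, so the
  contribution of \<open>z\<close> to the approximate energy has the right sign.\<close>

lemma truncated_resolvent_potential:
  assumes p: "sets \<nu>p = sets borel" "finite_measure \<nu>p" and n: "sets \<nu>n = sets borel" "finite_measure \<nu>n"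
    and \<beta>: "0 < \<beta>" and k: "0 \<le> k"
  defines "w \<equiv> (\<lambda>x. enn2real (pot \<beta> \<nu>p x) - enn2real (pot \<beta> \<nu>n x))"
  defines "v \<equiv> (\<lambda>x. clamp_real k (w x))"
  shows "v \<in> borel_measurable borel" "v \<in> D" "\<E> v v \<le> k * (measure \<nu>p UNIV + measure \<nu>n UNIV)"
proof -
  let ?P = "\<lambda>a x. enn2real (pot a \<nu>p x)" and ?N = "\<lambda>a x. enn2real (pot a \<nu>n x)"
  let ?L = "measure \<nu>p UNIV + measure \<nu>n UNIV"
  have pm [measurable]: "pot a \<nu>p \<in> borel_measurable borel" "pot a \<nu>n \<in> borel_measurable borel" if "a \<ge> 0" for a
    using pot_measurable[OF p that] pot_measurable[OF n that] by auto
  have pm' [measurable]: "pot \<beta> \<nu>p \<in> borel_measurable borel" "pot \<beta> \<nu>n \<in> borel_measurable borel"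
    using pm \<beta> by auto
  have wm [measurable]: "w \<in> borel_measurable borel" unfolding w_def by measurable
  show vm [measurable]: "v \<in> borel_measurable borel" unfolding v_def clamp_real_def by measurable
  have w_int: "integrable m w"
    unfolding w_def by (intro Bochner_Integration.integrable_diff pot_resolvent_finite[OF p \<beta>] pot_resolvent_finite[OF n \<beta>])
  have vb: "\<bar>v x\<bar> \<le> k" "\<bar>v x\<bar> \<le> \<bar>w x\<bar>" for x using k by (auto simp: v_def clamp_real_def)
  \<comment> \<open>The \<beta>-potential is integrable and its truncation is bounded by k, so the
    square of the truncation is at most k times an integrable function.\<close>
  have vL: "v \<in> L2 m"
  proof -
    have "(\<integral>\<^sup>+x. ennreal ((v x)\<^sup>2) \<partial>m) \<le> (\<integral>\<^sup>+x. ennreal k * ennreal (norm (w x)) \<partial>m)"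
    proof (intro nn_integral_mono)
      fix x
      have "\<bar>v x\<bar> * \<bar>v x\<bar> \<le> k * \<bar>w x\<bar>" using vb[of x] k by (intro mult_mono) auto
      then show "ennreal ((v x)\<^sup>2) \<le> ennreal k * ennreal (norm (w x))"
        using k by (simp add: ennreal_mult[symmetric] power2_eq_square abs_mult[symmetric] ennreal_leI)
    qed
    also have "\<dots> < \<infinity>" using w_int by (subst nn_integral_cmult) (auto simp: integrable_iff_bounded ennreal_mult_less_top)
    finally show ?thesis by (subst L2_borel_iff) auto
  qed
  define z where "z x = w x - v x" for x
  have zm [measurable]: "z \<in> borel_measurable borel" unfolding z_def[abs_def] by measurable
  have zv: "z x * v x = k * \<bar>z x\<bar>" for x using k by (auto simp: z_def v_def clamp_real_def max_def min_def algebra_simps)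
  have wz: "w x = v x + z x" for x by (simp add: z_def)
  have zb: "\<bar>z x\<bar> \<le> \<bar>w x\<bar>" for x using k by (auto simp: z_def v_def clamp_real_def max_def min_def)
  have z_int: "integrable m z" by (rule Bochner_Integration.integrable_bound[OF w_int]) (auto simp: zb)
  \<comment> \<open>The restriction \<beta> \<le> \<gamma> keeps the coefficient \<gamma> - \<beta>
    in the resolvent equation nonnegative. Only large \<gamma> matter for the limit.\<close>
  have bound: "\<gamma> * (inner_L2 m v v - inner_L2 m (\<lambda>x. \<gamma> * Gr \<gamma> v x) v) \<le> k * ?L" if \<gamma>: "\<beta> \<le> \<gamma>" for \<gamma>
  proof -
    have \<gamma>0: "0 < \<gamma>" using \<beta> \<gamma> by simp
    have gm [measurable]: "G \<gamma> h \<in> borel_measurable borel" if "h \<in> borel_measurable borel" for h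
      using that \<gamma>0 by (intro G_measurable) auto
    have [measurable]: "pot \<gamma> \<nu>p \<in> borel_measurable borel" "pot \<gamma> \<nu>n \<in> borel_measurable borel" using pm \<gamma>0 by auto
    have [measurable]: "Gr \<gamma> v \<in> borel_measurable borel" using \<gamma>0 by (intro Gr_measurable) auto
    let ?a = "\<gamma> - \<beta>"
    let ?V = "\<lambda>x. ?P \<gamma> x + ?N \<gamma> x"
    let ?Z = "\<lambda>x. enn2real (G \<gamma> (\<lambda>y. ennreal \<bar>z y\<bar>) x)"
    have a0: "0 \<le> ?a" using \<gamma> by simp
    have Gfin: "AE x in m. G \<gamma> (\<lambda>y. ennreal \<bar>h y\<bar>) x < \<infinity>" if [measurable]: "h \<in> borel_measurable borel" and hi: "integrable m h" for h
    proof -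
      have "ennreal \<gamma> * (\<integral>\<^sup>+x. G \<gamma> (\<lambda>y. ennreal \<bar>h y\<bar>) x \<partial>m) \<le> (\<integral>\<^sup>+x. ennreal \<bar>h x\<bar> \<partial>m)"
        by (rule G_mass[OF _ \<gamma>0]) measurable
      also have "\<dots> < top" using hi by (simp add: integrable_iff_bounded)
      finally have "(\<integral>\<^sup>+x. G \<gamma> (\<lambda>y. ennreal \<bar>h y\<bar>) x \<partial>m) < top"
        using \<gamma>0 ennreal_mult_less_top_imp[of "ennreal \<gamma>"] by simp
      then have "AE x in m. G \<gamma> (\<lambda>y. ennreal \<bar>h y\<bar>) x \<noteq> \<infinity>" by (intro nn_integral_noteq_infinite) auto
      then show ?thesis by (simp add: less_top)
    qed
    have Zint: "integrable m ?Z" "\<gamma> * (\<integral>x. ?Z x \<partial>m) \<le> (\<integral>x. \<bar>z x\<bar> \<partial>m)"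
    proof -
      have le: "ennreal \<gamma> * (\<integral>\<^sup>+x. G \<gamma> (\<lambda>y. ennreal \<bar>z y\<bar>) x \<partial>m) \<le> (\<integral>\<^sup>+x. ennreal \<bar>z x\<bar> \<partial>m)"
        by (rule G_mass[OF _ \<gamma>0]) measurable
      have eq: "(\<integral>\<^sup>+x. ennreal (?Z x) \<partial>m) = (\<integral>\<^sup>+x. G \<gamma> (\<lambda>y. ennreal \<bar>z y\<bar>) x \<partial>m)"
        using Gfin[OF zm z_int] by (intro nn_integral_cong_AE) (auto elim!: eventually_mono simp: less_top)
      have zn: "(\<integral>\<^sup>+x. ennreal \<bar>z x\<bar> \<partial>m) = ennreal (\<integral>x. \<bar>z x\<bar> \<partial>m)"
        using z_int by (intro nn_integral_eq_integral) auto
      have "ennreal \<gamma> * (\<integral>\<^sup>+x. ennreal (?Z x) \<partial>m) < top" unfolding eq using order.strict_trans1[OF le[unfolded zn], of top] by simp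
      then have fin: "(\<integral>\<^sup>+x. ennreal (?Z x) \<partial>m) < top" using \<gamma>0 ennreal_mult_less_top_imp[of "ennreal \<gamma>"] by simp
      then show i: "integrable m ?Z" by (intro integrableI_bounded) auto
      have "ennreal (\<gamma> * (\<integral>x. ?Z x \<partial>m)) = ennreal \<gamma> * (\<integral>\<^sup>+x. ennreal (?Z x) \<partial>m)"
        using \<gamma>0 nn_integral_eq_integral[OF i] by (simp add: ennreal_mult)
      with le have "ennreal (\<gamma> * (\<integral>x. ?Z x \<partial>m)) \<le> ennreal (\<integral>x. \<bar>z x\<bar> \<partial>m)" by (simp only: eq zn)
      then show "\<gamma> * (\<integral>x. ?Z x \<partial>m) \<le> (\<integral>x. \<bar>z x\<bar> \<partial>m)" by (subst (asm) ennreal_le_iff) auto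
    qed
    have hfin: "G \<gamma> (pot \<beta> \<nu>p) x = G \<gamma> (\<lambda>y. ennreal (?P \<beta> y)) x" for x
      using pot_resolvent_finite(1)[OF p \<beta>] by (intro G_cong_AE) (auto elim!: eventually_mono simp: less_top)
    have hfin': "G \<gamma> (pot \<beta> \<nu>n) x = G \<gamma> (\<lambda>y. ennreal (?N \<beta> y)) x" for x
      using pot_resolvent_finite(1)[OF n \<beta>] by (intro G_cong_AE) (auto elim!: eventually_mono simp: less_top)
    have Pint: "integrable m (?P \<beta>)" "integrable m (?N \<beta>)"
      by (rule pot_resolvent_finite(2)[OF p \<beta>], rule pot_resolvent_finite(2)[OF n \<beta>])
    have Pm [measurable]: "?P \<beta> \<in> borel_measurable borel" "?N \<beta> \<in> borel_measurable borel" by measurable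
    \<comment> \<open>The resolvent equation reads w = (\<gamma>-potential) + a G_\<gamma> (v + z)
      with a = \<gamma> - \<beta>. It is multiplied by \<open>v\<close>: the left side becomes v v +
      k \<bar>z\<bar>, and on the right \<open>v\<close> is estimated by k except in the quadratic
      term.\<close>
    have ae: "AE x in m. v x * v x - ?a * (Gr \<gamma> v x * v x) \<le> k * ?V x + k * (?a * ?Z x - \<bar>z x\<bar>)"
      using pot_resolvent[OF p less_imp_le[OF \<beta>] \<gamma>] pot_resolvent[OF n less_imp_le[OF \<beta>] \<gamma>]
        pot_resolvent_finite(1)[OF p \<beta>] pot_resolvent_finite(1)[OF n \<beta>]
        Gfin[OF wm w_int] Gfin[OF zm z_int]
        Gfin[OF Pm(1) Pint(1)] Gfin[OF Pm(2) Pint(2)]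
    proof eventually_elim
      case (elim x)
      note Gw = Gr_integral[OF wm less_imp_le[OF \<gamma>0] elim(5)]
      note Gz = Gr_integral[OF zm less_imp_le[OF \<gamma>0] elim(6)]
      note GP = Gr_integral[OF Pm(1) less_imp_le[OF \<gamma>0] elim(7)]
      note GN = Gr_integral[OF Pm(2) less_imp_le[OF \<gamma>0] elim(8)]
      have "G \<gamma> (\<lambda>y. ennreal \<bar>v y\<bar>) x < \<infinity>"
        by (rule order.strict_trans1[OF G_mono elim(5)]) (rule ennreal_leI[OF vb(2)])
      note Gv = Gr_integral[OF vm less_imp_le[OF \<gamma>0] this]
      let ?\<kappa> = "density m (r \<gamma> x)"
      have wd: "Gr \<gamma> w x = Gr \<gamma> (?P \<beta>) x - Gr \<gamma> (?N \<beta>) x"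
        unfolding Gw(2) GP(2) GN(2) unfolding w_def by (rule Bochner_Integration.integral_diff[OF GP(1) GN(1)])
      have wvz: "Gr \<gamma> w x = Gr \<gamma> v x + Gr \<gamma> z x"
        unfolding Gw(2) Gv(2) Gz(2) wz by (rule Bochner_Integration.integral_add[OF Gv(1) Gz(1)])
      have zZ: "\<bar>Gr \<gamma> z x\<bar> \<le> ?Z x"
      proof -
        have "?Z x = (\<integral>y. \<bar>z y\<bar> \<partial>?\<kappa>)"
          using Gr_integral(2)[of "\<lambda>y. \<bar>z y\<bar>" \<gamma> x] elim(6) \<gamma>0 by (simp add: G_eq_Gr_nonneg)
        then show ?thesis unfolding Gz(2) using integral_abs_bound[of ?\<kappa> z] by simp
      qed
      have P: "?P \<beta> x = ?P \<gamma> x + ?a * Gr \<gamma> (?P \<beta>) x"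
      proof -
        have "G \<gamma> (\<lambda>y. ennreal (?P \<beta> y)) x < top" using elim(7) by simp
        moreover have "pot \<gamma> \<nu>p x < top" using elim(1,3) by (auto simp: less_top)
        ultimately have "?P \<beta> x = enn2real (pot \<gamma> \<nu>p x) + enn2real (ennreal ?a * G \<gamma> (\<lambda>y. ennreal (?P \<beta> y)) x)"
          using elim(1) a0 unfolding hfin by (simp add: enn2real_plus ennreal_mult_less_top)
        then show ?thesis using a0 by (simp add: enn2real_mult G_eq_Gr_nonneg)
      qed
      have N: "?N \<beta> x = ?N \<gamma> x + ?a * Gr \<gamma> (?N \<beta>) x"
      proof -
        have "G \<gamma> (\<lambda>y. ennreal (?N \<beta> y)) x < top" using elim(8) by simp
        moreover have "pot \<gamma> \<nu>n x < top" using elim(2,4) by (auto simp: less_top)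
        ultimately have "?N \<beta> x = enn2real (pot \<gamma> \<nu>n x) + enn2real (ennreal ?a * G \<gamma> (\<lambda>y. ennreal (?N \<beta> y)) x)"
          using elim(2) a0 unfolding hfin' by (simp add: enn2real_plus ennreal_mult_less_top)
        then show ?thesis using a0 by (simp add: enn2real_mult G_eq_Gr_nonneg)
      qed
      have w: "w x = (?P \<gamma> x - ?N \<gamma> x) + ?a * (Gr \<gamma> v x + Gr \<gamma> z x)"
        unfolding wvz[symmetric] wd using P N by (simp add: w_def right_diff_distrib)
      have "v x * v x + k * \<bar>z x\<bar> = v x * w x" using zv[of x] wz[of x] by (simp add: distrib_left mult.commute)
      also have "\<dots> = v x * (?P \<gamma> x - ?N \<gamma> x) + ?a * (Gr \<gamma> v x * v x) + ?a * (v x * Gr \<gamma> z x)"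
        unfolding w by (simp add: algebra_simps)
      finally have eq: "v x * v x + k * \<bar>z x\<bar> = v x * (?P \<gamma> x - ?N \<gamma> x) + ?a * (Gr \<gamma> v x * v x) + ?a * (v x * Gr \<gamma> z x)" .
      have "\<bar>v x * (?P \<gamma> x - ?N \<gamma> x)\<bar> \<le> k * ?V x"
        unfolding abs_mult using vb(1)[of x] k
        by (intro mult_mono) (auto simp: abs_le_iff)
      moreover have "\<bar>v x * Gr \<gamma> z x\<bar> \<le> k * ?Z x"
        unfolding abs_mult using vb(1)[of x] k zZ by (intro mult_mono) auto
      then have "?a * (v x * Gr \<gamma> z x) \<le> ?a * (k * ?Z x)" using a0 by (intro mult_left_mono) auto
      moreover have "k * (?a * ?Z x - \<bar>z x\<bar>) = ?a * (k * ?Z x) - k * \<bar>z x\<bar>" by (simp add: algebra_simps)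
      ultimately show ?case using eq by linarith
    qed
    have vv_int: "integrable m (\<lambda>x. v x * v x)" by (rule L2_borel_integrable[OF vm vm vL vL])
    have GrL: "Gr \<gamma> v \<in> L2 m" using is_resD(1)[OF is_res_Gr[OF vm vL \<gamma>0]] D_in_L2 by blast
    have Gv_int: "integrable m (\<lambda>x. Gr \<gamma> v x * v x)" by (rule L2_borel_integrable[OF _ vm GrL vL]) measurable
    have V_int: "integrable m ?V"
      by (intro Bochner_Integration.integrable_add pot_resolvent_finite[OF p \<gamma>0] pot_resolvent_finite[OF n \<gamma>0])
    have "inner_L2 m v v - ?a * inner_L2 m (Gr \<gamma> v) v = (\<integral>x. v x * v x - ?a * (Gr \<gamma> v x * v x) \<partial>m)"
      using vv_int Gv_int by (simp add: inner_L2_borel)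
    also have "\<dots> \<le> (\<integral>x. k * ?V x + k * (?a * ?Z x - \<bar>z x\<bar>) \<partial>m)"
      using vv_int Gv_int V_int Zint(1) z_int by (intro integral_mono_AE ae) auto
    also have "\<dots> = k * (\<integral>x. ?V x \<partial>m) + k * (?a * (\<integral>x. ?Z x \<partial>m) - (\<integral>x. \<bar>z x\<bar> \<partial>m))"
      using V_int Zint(1) z_int by simp
    also have "\<dots> \<le> k * (\<integral>x. ?V x \<partial>m) + k * 0"
    proof -
      \<comment> \<open>The cut-off part has the favourable sign: a \<le> \<gamma>, and \<gamma>
        G_\<gamma> does not increase the L1 norm of z.\<close>
      have "?a * (\<integral>x. ?Z x \<partial>m) \<le> \<gamma> * (\<integral>x. ?Z x \<partial>m)"
        using \<beta> by (intro mult_right_mono integral_nonneg_AE) auto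
      then show ?thesis using Zint(2) k by (intro add_left_mono mult_left_mono) auto
    qed
    finally have 1: "inner_L2 m v v - ?a * inner_L2 m (Gr \<gamma> v) v \<le> k * (\<integral>x. ?V x \<partial>m)" by simp
    have "\<gamma> * (\<integral>x. ?V x \<partial>m) = \<gamma> * (\<integral>x. ?P \<gamma> x \<partial>m) + \<gamma> * (\<integral>x. ?N \<gamma> x \<partial>m)"
      using pot_resolvent_finite(2)[OF p \<gamma>0] pot_resolvent_finite(2)[OF n \<gamma>0] by (simp add: distrib_left)
    also have "\<dots> \<le> ?L" by (intro add_mono pot_resolvent_finite(3) p n \<gamma>0)
    finally have 2: "k * (\<gamma> * (\<integral>x. ?V x \<partial>m)) \<le> k * ?L" by (rule mult_left_mono[OF _ k])
    note res = is_res_Gr[OF vm vL \<gamma>0]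
    \<comment> \<open>Since (v, G_\<gamma> v) \<ge> 0, replacing \<gamma> - \<beta> by \<gamma> only
      decreases the left side. This produces the approximate form.\<close>
    have "0 \<le> inner_L2 m v (Gr \<gamma> v) - \<gamma> * inner_L2 m (Gr \<gamma> v) (Gr \<gamma> v)"
      using is_resD(2)[OF res is_resD(1)[OF res]] form.nonneg[OF is_resD(1)[OF res]] by simp
    then have "0 \<le> inner_L2 m v (Gr \<gamma> v)"
      using mult_nonneg_nonneg[OF less_imp_le[OF \<gamma>0] L2.nonneg[OF GrL]] by linarith
    then have "?a * inner_L2 m (Gr \<gamma> v) v \<le> \<gamma> * inner_L2 m (Gr \<gamma> v) v"
      using \<beta> by (intro mult_right_mono) (auto simp: L2.sym[OF GrL vL])
    with 1 have "inner_L2 m v v - \<gamma> * inner_L2 m (Gr \<gamma> v) v \<le> k * (\<integral>x. ?V x \<partial>m)" by linarith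
    from mult_left_mono[OF this less_imp_le[OF \<gamma>0]] 2
    show ?thesis by (simp add: L2.scale_left[OF GrL vL] mult.left_commute)
  qed
  obtain N where N: "\<beta> \<le> real N" using real_arch_simple by blast
  have N0: "0 < real (N + i)" "\<beta> \<le> real (N + i)" for i using N \<beta> by auto
  have res: "is_res (real (N + i)) v (Gr (real (N + i)) v)" for i
    by (rule is_res_Gr[OF vm vL N0(1)])
  have inc: "incseq (\<lambda>i. real (N + i))" by (simp add: incseq_def)
  have lim: "filterlim (\<lambda>i. real (N + i)) at_top sequentially"
    using filterlim_tendsto_add_at_top[OF tendsto_const filterlim_real_sequentially, of "real N"] by simp
  from L2_bounded_res_imp_D[OF vL res N0(1) inc lim bound[OF N0(2)]]
  show "v \<in> D" "\<E> v v \<le> k * ?L" by auto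
qed

text \<open>As \<beta> = 1 / (i + 1) tends to 0, the bound for the truncated \<beta>-potentials is
  uniform and they converge almost everywhere. Transience enters because the limits must be finite
  for \<open>enn2real\<close> to be continuous there.\<close>

lemma truncated_potential:
  assumes tr: "transient_form m D \<E>"
    and p: "sets \<nu>p = sets borel" "finite_measure \<nu>p" and n: "sets \<nu>n = sets borel" "finite_measure \<nu>n"
    and k: "0 \<le> k" and v: "v \<in> borel_measurable (completion m)"
    and eq: "AE x in m. v x = clamp_real k (enn2real (pot 0 \<nu>p x) - enn2real (pot 0 \<nu>n x))"
  shows "v \<in> extended_domain m D \<E>" "extended_energy m D \<E> v \<le> k * (measure \<nu>p UNIV + measure \<nu>n UNIV)"
proof -
  define w where "w i x = clamp_real k (enn2real (pot (1 / real (Suc i)) \<nu>p x) - enn2real (pot (1 / real (Suc i)) \<nu>n x))" for i x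
  have wD: "w i \<in> D" "\<E> (w i) (w i) \<le> k * (measure \<nu>p UNIV + measure \<nu>n UNIV)" for i
    unfolding w_def[abs_def] using truncated_resolvent_potential[OF p n _ k, of "1 / real (Suc i)"] by auto
  have lim: "AE x in m. (\<lambda>i. w i x) \<longlonglongrightarrow> v x"
    using pot_LIMSEQ[OF p] pot_LIMSEQ[OF n] pot_finite[OF tr p] pot_finite[OF tr n] eq
  proof eventually_elim
    case (elim x)
    show ?case unfolding w_def elim(5) clamp_real_def
      by (intro tendsto_max tendsto_min tendsto_diff tendsto_enn2real tendsto_const)
         (use elim(1-4) in \<open>auto simp: less_top\<close>)
  qed
  show "v \<in> extended_domain m D \<E>" "extended_energy m D \<E> v \<le> k * (measure \<nu>p UNIV + measure \<nu>n UNIV)"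
    using extended_energy_le[OF v wD lim] by auto
qed


section \<open>Kato's inequality\<close>

text \<open>Kato's inequality \<open>-A\<bar>u\<bar> \<le> sgn u * (-A u)\<close>, tested against the excessive function \<open>s\<close>.\<close>

lemma Kato_test:
  assumes p: "sets \<kappa>p = sets borel" "finite_measure \<kappa>p" and n: "sets \<kappa>n = sets borel" "finite_measure \<kappa>n"
    and q [measurable]: "q \<in> borel_measurable borel" and u [measurable]: "u \<in> borel_measurable borel"
    and Ufin: "AE x in m. G 0 (\<lambda>y. ennreal \<bar>q y\<bar>) x + (pot 0 \<kappa>p x + pot 0 \<kappa>n x) < \<infinity>"
    and eq: "AE x in m. u x = (enn2real (G 0 (\<lambda>y. ennreal (q y)) x) + enn2real (pot 0 \<kappa>p x))
        - (enn2real (G 0 (\<lambda>y. ennreal (- q y)) x) + enn2real (pot 0 \<kappa>n x))"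
    and s [measurable]: "s \<in> borel_measurable borel" and s1: "\<And>x. s x \<le> 1"
    and \<beta>: "0 < \<beta>" and a: "0 < a" and exc: "\<And>x. ennreal a * G (a + \<beta>) s x \<le> s x"
    and I: "(\<integral>\<^sup>+x. s x * ennreal \<bar>u x\<bar> \<partial>m) < \<infinity>"
  defines "sp \<equiv> (\<lambda>x. s x * indicator {y. 0 < u y} x)" and "sm \<equiv> (\<lambda>x. s x * indicator {y. u y < 0} x)"
  shows "(\<integral>\<^sup>+x. ennreal (- q x) * (ennreal a * G (a + \<beta>) sp x) \<partial>m) + (\<integral>\<^sup>+x. ennreal (q x) * (ennreal a * G (a + \<beta>) sm x) \<partial>m)
    \<le> (\<integral>\<^sup>+x. ennreal (q x) * (ennreal a * G (a + \<beta>) sp x) \<partial>m) + (\<integral>\<^sup>+x. ennreal (- q x) * (ennreal a * G (a + \<beta>) sm x) \<partial>m)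
      + (emeasure \<kappa>p UNIV + emeasure \<kappa>n UNIV) + ennreal \<beta> * (\<integral>\<^sup>+x. s x * ennreal \<bar>u x\<bar> \<partial>m)"
proof -
  define \<gamma> where "\<gamma> = a + \<beta>"
  have \<gamma>: "0 < \<gamma>" "0 \<le> \<gamma>" "a \<le> \<gamma>" using a \<beta> by (auto simp: \<gamma>_def)
  define qp where "qp x = ennreal (q x)" for x
  define qm where "qm x = ennreal (- q x)" for x
  define au where "au x = ennreal \<bar>u x\<bar>" for x
  have [measurable]: "qp \<in> borel_measurable borel" "qm \<in> borel_measurable borel" "au \<in> borel_measurable borel"
    unfolding qp_def[abs_def] qm_def[abs_def] au_def[abs_def] by measurable
  have spm [measurable]: "sp \<in> borel_measurable borel" "sm \<in> borel_measurable borel" unfolding sp_def sm_def by measurable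
  have gm [measurable]: "G \<gamma> h \<in> borel_measurable borel" "G 0 h \<in> borel_measurable borel" if "h \<in> borel_measurable borel" for h
    using that \<gamma> by (auto intro!: G_measurable)
  have pm [measurable]: "pot 0 \<kappa>p \<in> borel_measurable borel" "pot 0 \<kappa>n \<in> borel_measurable borel"
      "pot \<gamma> \<kappa>p \<in> borel_measurable borel" "pot \<gamma> \<kappa>n \<in> borel_measurable borel"
    using pot_measurable[OF p] pot_measurable[OF n] \<gamma> by auto
  \<comment> \<open>Positive and negative contributions to \<open>u\<close> are kept apart as
    nonnegative potentials, so that every later rearrangement is an addition of extended
    numbers.\<close>
  define Up where "Up x = G 0 qp x + pot 0 \<kappa>p x" for x
  define Um where "Um x = G 0 qm x + pot 0 \<kappa>n x" for x
  define Vp where "Vp x = G \<gamma> qp x + pot \<gamma> \<kappa>p x" for x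
  define Vm where "Vm x = G \<gamma> qm x + pot \<gamma> \<kappa>n x" for x
  have [measurable]: "Up \<in> borel_measurable borel" "Um \<in> borel_measurable borel" "Vp \<in> borel_measurable borel" "Vm \<in> borel_measurable borel"
    unfolding Up_def[abs_def] Um_def[abs_def] Vp_def[abs_def] Vm_def[abs_def] by measurable
  have fin: "AE x in m. Up x < top \<and> Um x < top"
    using Ufin
  proof eventually_elim
    case (elim x)
    have "G 0 qp x \<le> G 0 (\<lambda>y. ennreal \<bar>q y\<bar>) x" "G 0 qm x \<le> G 0 (\<lambda>y. ennreal \<bar>q y\<bar>) x"
      by (auto intro!: G_mono ennreal_leI simp: qp_def qm_def)
    with elim show ?case by (auto simp: Up_def Um_def intro: order.strict_trans1)
  qed
  have ueq: "AE x in m. u x = enn2real (Up x) - enn2real (Um x)"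
    using eq fin
  proof eventually_elim
    case (elim x)
    then show ?case unfolding Up_def Um_def qp_def[abs_def] qm_def[abs_def] by (simp add: enn2real_plus)
  qed
  \<comment> \<open>The identity \<bar>u\<bar> = sgn u (Up - Um), rearranged without
    subtraction.\<close>
  have bal: "AE x in m. au x + Um x = Up x \<and> 0 < u x \<or> au x + Up x = Um x \<and> u x < 0 \<or> u x = 0 \<and> Up x = Um x"
    using ueq fin
  proof eventually_elim
    case (elim x)
    then obtain b c where bc: "Up x = ennreal b" "0 \<le> b" "Um x = ennreal c" "0 \<le> c"
      by (metis ennreal_cases less_irrefl)
    with elim have ux: "u x = b - c" by simp
    consider "u x > 0" | "u x < 0" | "u x = 0" by linarith
    then show ?case
    proof cases
      case 1
      then have "au x + Um x = ennreal ((b - c) + c)" using ux bc by (simp add: au_def ennreal_plus[symmetric] del: ennreal_plus)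
      then show ?thesis using 1 bc by simp
    next
      case 2
      then have "au x + Up x = ennreal ((c - b) + b)" using ux bc by (simp add: au_def ennreal_plus[symmetric] del: ennreal_plus)
      then show ?thesis using 2 bc by simp
    next
      case 3 then show ?thesis using ux bc by simp
    qed
  qed
  have GUp: "G \<gamma> Up x \<le> G \<gamma> Um x + G \<gamma> au x" for x
  proof -
    have "AE y in m. Up y \<le> Um y + au y"
      using bal
    proof eventually_elim
      case (elim y)
      consider "au y + Um y = Up y" | "au y + Up y = Um y" | "Up y = Um y" using elim by auto
      then show ?case
      proof cases
        case 1 then show ?thesis by (simp add: add.commute)
      next
        case 2
        have "Up y \<le> au y + Up y" by simp
        also have "\<dots> = Um y" by (rule 2)
        also have "\<dots> \<le> Um y + au y" by simp
        finally show ?thesis .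
      next
        case 3 then show ?thesis by simp
      qed
    qed
    then have "G \<gamma> Up x \<le> G \<gamma> (\<lambda>y. Um y + au y) x" by (rule G_mono_AE)
    then show ?thesis using \<gamma> by (subst (asm) G_add) auto
  qed
  have GUm: "G \<gamma> Um x \<le> G \<gamma> Up x + G \<gamma> au x" for x
  proof -
    have "AE y in m. Um y \<le> Up y + au y"
      using bal
    proof eventually_elim
      case (elim y)
      consider "au y + Up y = Um y" | "au y + Um y = Up y" | "Um y = Up y" using elim by auto
      then show ?case
      proof cases
        case 1 then show ?thesis by (simp add: add.commute)
      next
        case 2
        have "Um y \<le> au y + Um y" by simp
        also have "\<dots> = Up y" by (rule 2)
        also have "\<dots> \<le> Up y + au y" by simp
        finally show ?thesis .
      next
        case 3 then show ?thesis by simp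
      qed
    qed
    then have "G \<gamma> Um x \<le> G \<gamma> (\<lambda>y. Up y + au y) x" by (rule G_mono_AE)
    then show ?thesis using \<gamma> by (subst (asm) G_add) auto
  qed
  have resU: "AE x in m. Up x = Vp x + ennreal \<gamma> * G \<gamma> Up x \<and> Um x = Vm x + ennreal \<gamma> * G \<gamma> Um x"
    using pot_resolvent[OF p order_refl \<gamma>(2)] pot_resolvent[OF n order_refl \<gamma>(2)]
  proof eventually_elim
    case (elim x)
    have "G \<gamma> Up x = G \<gamma> (G 0 qp) x + G \<gamma> (pot 0 \<kappa>p) x" "G \<gamma> Um x = G \<gamma> (G 0 qm) x + G \<gamma> (pot 0 \<kappa>n) x"
      unfolding Up_def[abs_def] Um_def[abs_def] using \<gamma> by (auto intro!: G_add)
    then show ?case using elim resolvent_equation[of 0 \<gamma> qp x] resolvent_equation[of 0 \<gamma> qm x] \<gamma>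
      by (simp add: Up_def Um_def Vp_def Vm_def distrib_left add_ac)
  qed
  \<comment> \<open>From A + U' = U the two resolvent equations and the comparison of
    \<open>GU\<close> with \<open>GU'\<close> eliminate the resolvent terms; cancellation requires c
    times \<open>GU'\<close> to be finite.\<close>
  have canc: "A + V' \<le> V + g" if "A + U' = U" "U = V + c * GU" "U' = V' + c * GU'" "GU \<le> GU' + h" "g = c * h" "c * GU' < top"
    for A U U' V V' GU GU' c g h :: ennreal
  proof -
    have "A + V' + c * GU' = V + c * GU" using that(1-3) by (simp add: add_ac)
    also have "\<dots> \<le> V + (c * GU' + g)" using mult_left_mono[OF that(4), of c] that(5) by (intro add_left_mono) (simp add: distrib_left)
    finally have "c * GU' + (A + V') \<le> c * GU' + (V + g)" by (simp add: add_ac)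
    then show ?thesis using that(6) by (auto simp: ennreal_add_left_cancel_le)
  qed
  \<comment> \<open>The inequality \<bar>u\<bar> \<le> sgn u (Vp - Vm) + \<gamma> G_\<gamma>
    \<bar>u\<bar>, multiplied by \<open>s\<close>; \<open>sp\<close> and \<open>sm\<close> carry the
    sign of \<open>u\<close>.\<close>
  have pointwise: "AE x in m. s x * au x + (sp x * Vm x + sm x * Vp x) \<le> (sp x * Vp x + sm x * Vm x) + ennreal \<gamma> * (s x * G \<gamma> au x)"
    using bal resU fin
  proof eventually_elim
    case (elim x)
    have f1: "ennreal \<gamma> * G \<gamma> Um x < top" "ennreal \<gamma> * G \<gamma> Up x < top"
      using elim(2,3) by (auto intro: order.strict_trans1[rotated] simp: top.not_eq_extremum[symmetric])
    consider "au x + Um x = Up x" "0 < u x" | "au x + Up x = Um x" "u x < 0" | "u x = 0" using elim(1) by blast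
    then show ?case
    proof cases
      case 1
      have "au x + Vm x \<le> Vp x + ennreal \<gamma> * G \<gamma> au x"
        by (rule canc[OF 1(1) conjunct1[OF elim(2)] conjunct2[OF elim(2)] GUp refl f1(1)])
      from mult_left_mono[OF this, of "s x"] show ?thesis using 1(2) by (simp add: sp_def sm_def distrib_left mult.left_commute)
    next
      case 2
      have "au x + Vp x \<le> Vm x + ennreal \<gamma> * G \<gamma> au x"
        by (rule canc[OF 2(1) conjunct2[OF elim(2)] conjunct1[OF elim(2)] GUm refl f1(2)])
      from mult_left_mono[OF this, of "s x"] show ?thesis using 2(2) by (simp add: sp_def sm_def distrib_left mult.left_commute)
    next
      case 3 then show ?thesis by (simp add: sp_def sm_def au_def)
    qed
  qed
  let ?I = "\<integral>\<^sup>+x. s x * au x \<partial>m" and ?J = "\<integral>\<^sup>+x. s x * G \<gamma> au x \<partial>m"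
  let ?K = "emeasure \<kappa>p UNIV + emeasure \<kappa>n UNIV"
  let ?c = "\<lambda>h k. \<integral>\<^sup>+x. h x * G \<gamma> k x \<partial>m"
  have sle: "sp x \<le> 1" "sm x \<le> 1" for x using s1[of x] by (auto simp: sp_def sm_def indicator_def)
  have A: "?c qm sp + ?c qp sm \<le> (\<integral>\<^sup>+x. sp x * Vm x + sm x * Vp x \<partial>m)"
  proof -
    have "?c qm sp + ?c qp sm = (\<integral>\<^sup>+x. sp x * G \<gamma> qm x + sm x * G \<gamma> qp x \<partial>m)"
      using G_sym[of sp qm \<gamma>] G_sym[of sm qp \<gamma>] \<gamma> by (simp add: nn_integral_add)
    also have "\<dots> \<le> (\<integral>\<^sup>+x. sp x * Vm x + sm x * Vp x \<partial>m)"
      by (intro nn_integral_mono add_mono mult_left_mono) (auto simp: Vp_def Vm_def)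
    finally show ?thesis .
  qed
  have B: "(\<integral>\<^sup>+x. sp x * Vp x + sm x * Vm x \<partial>m) \<le> ?c qp sp + ?c qm sm + ((\<integral>\<^sup>+x. pot \<gamma> \<kappa>p x \<partial>m) + (\<integral>\<^sup>+x. pot \<gamma> \<kappa>n x \<partial>m))"
  proof -
    have "(\<integral>\<^sup>+x. sp x * Vp x + sm x * Vm x \<partial>m) \<le> (\<integral>\<^sup>+x. (sp x * G \<gamma> qp x + sm x * G \<gamma> qm x) + (pot \<gamma> \<kappa>p x + pot \<gamma> \<kappa>n x) \<partial>m)"
    proof (intro nn_integral_mono)
      fix x
      have "sp x * pot \<gamma> \<kappa>p x + sm x * pot \<gamma> \<kappa>n x \<le> 1 * pot \<gamma> \<kappa>p x + 1 * pot \<gamma> \<kappa>n x"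
        by (intro add_mono mult_right_mono sle) auto
      then have "(sp x * G \<gamma> qp x + sm x * G \<gamma> qm x) + (sp x * pot \<gamma> \<kappa>p x + sm x * pot \<gamma> \<kappa>n x)
          \<le> (sp x * G \<gamma> qp x + sm x * G \<gamma> qm x) + (pot \<gamma> \<kappa>p x + pot \<gamma> \<kappa>n x)"
        by (intro add_left_mono) simp
      then show "sp x * Vp x + sm x * Vm x \<le> (sp x * G \<gamma> qp x + sm x * G \<gamma> qm x) + (pot \<gamma> \<kappa>p x + pot \<gamma> \<kappa>n x)"
        by (simp add: Vp_def Vm_def distrib_left add_ac)
    qed
    also have "\<dots> = ?c qp sp + ?c qm sm + ((\<integral>\<^sup>+x. pot \<gamma> \<kappa>p x \<partial>m) + (\<integral>\<^sup>+x. pot \<gamma> \<kappa>n x \<partial>m))"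
      using G_sym[of sp qp \<gamma>] G_sym[of sm qm \<gamma>] \<gamma> by (simp add: nn_integral_add)
    finally show ?thesis .
  qed
  \<comment> \<open>Symmetry moves the resolvent from \<bar>u\<bar> to \<open>s\<close>, where the
    excessiveness assumption applies.\<close>
  have aJ: "ennreal a * ?J \<le> ?I"
  proof -
    have "ennreal a * ?J = (\<integral>\<^sup>+x. au x * (ennreal a * G \<gamma> s x) \<partial>m)"
      using G_sym[of au s \<gamma>] \<gamma> by (simp add: nn_integral_cmult[symmetric] mult.left_commute)
    also have "\<dots> \<le> (\<integral>\<^sup>+x. au x * s x \<partial>m)"
      using exc unfolding \<gamma>_def[symmetric] by (intro nn_integral_mono mult_left_mono) auto
    finally show ?thesis by (simp add: mult.commute)
  qed
  have aK: "ennreal a * ((\<integral>\<^sup>+x. pot \<gamma> \<kappa>p x \<partial>m) + (\<integral>\<^sup>+x. pot \<gamma> \<kappa>n x \<partial>m)) \<le> ?K"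
  proof -
    have "ennreal a * (\<integral>\<^sup>+x. pot \<gamma> \<kappa> x \<partial>m) \<le> ennreal \<gamma> * (\<integral>\<^sup>+x. pot \<gamma> \<kappa> x \<partial>m)" for \<kappa>
      using \<gamma> by (intro mult_right_mono ennreal_leI) auto
    then show ?thesis unfolding distrib_left
      by (intro add_mono) (blast intro: order_trans pot_mass[OF p \<gamma>(1)] pot_mass[OF n \<gamma>(1)])+
  qed
  have "?I + (?c qm sp + ?c qp sm) \<le> ?I + (\<integral>\<^sup>+x. sp x * Vm x + sm x * Vp x \<partial>m)" using A by (rule add_left_mono)
  also have "\<dots> = (\<integral>\<^sup>+x. s x * au x + (sp x * Vm x + sm x * Vp x) \<partial>m)" by (rule nn_integral_add[symmetric]) measurable
  also have "\<dots> \<le> (\<integral>\<^sup>+x. (sp x * Vp x + sm x * Vm x) + ennreal \<gamma> * (s x * G \<gamma> au x) \<partial>m)"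
    by (rule nn_integral_mono_AE[OF pointwise])
  also have "\<dots> = (\<integral>\<^sup>+x. sp x * Vp x + sm x * Vm x \<partial>m) + ennreal \<gamma> * ?J"
    by (subst nn_integral_add) (auto simp: nn_integral_cmult)
  also have "\<dots> \<le> ?c qp sp + ?c qm sm + ((\<integral>\<^sup>+x. pot \<gamma> \<kappa>p x \<partial>m) + (\<integral>\<^sup>+x. pot \<gamma> \<kappa>n x \<partial>m)) + ennreal \<gamma> * ?J"
    using B by (rule add_right_mono)
  finally have "ennreal a * (?I + (?c qm sp + ?c qp sm)) \<le>
      ennreal a * (?c qp sp + ?c qm sm + ((\<integral>\<^sup>+x. pot \<gamma> \<kappa>p x \<partial>m) + (\<integral>\<^sup>+x. pot \<gamma> \<kappa>n x \<partial>m)) + ennreal \<gamma> * ?J)"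
    by (rule mult_left_mono) simp
  also have "\<dots> = ennreal a * (?c qp sp + ?c qm sm) + ennreal a * ((\<integral>\<^sup>+x. pot \<gamma> \<kappa>p x \<partial>m) + (\<integral>\<^sup>+x. pot \<gamma> \<kappa>n x \<partial>m)) + ennreal \<gamma> * (ennreal a * ?J)"
    by (simp only: distrib_left mult.left_commute[of "ennreal a" "ennreal \<gamma>"])
  also have "\<dots> \<le> ennreal a * (?c qp sp + ?c qm sm) + ?K + ennreal \<gamma> * ?I"
    by (intro add_mono order_refl aK mult_left_mono aJ) simp
  \<comment> \<open>Since \<gamma> = a + \<beta>, the finite a-part cancels against the left side,
    and the error \<beta> \<integral> s \<bar>u\<bar> dm remains.\<close>
  also have "ennreal \<gamma> * ?I = ennreal a * ?I + ennreal \<beta> * ?I"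
    using a \<beta> by (simp add: \<gamma>_def ennreal_plus distrib_right)
  finally have "ennreal a * ?I + ennreal a * (?c qm sp + ?c qp sm) \<le> ennreal a * ?I + (ennreal a * (?c qp sp + ?c qm sm) + ?K + ennreal \<beta> * ?I)"
    by (simp only: distrib_left add_ac)
  moreover have "ennreal a * ?I < top" using I by (simp add: au_def ennreal_mult_less_top)
  ultimately have "ennreal a * (?c qm sp + ?c qp sm) \<le> ennreal a * (?c qp sp + ?c qm sm) + ?K + ennreal \<beta> * ?I"
    by (auto simp: ennreal_add_left_cancel_le)
  moreover have "ennreal a * ?c h k = (\<integral>\<^sup>+x. h x * (ennreal a * G \<gamma> k x) \<partial>m)"
    if [measurable]: "h \<in> borel_measurable borel" "k \<in> borel_measurable borel" for h k
    by (simp add: nn_integral_cmult[symmetric] mult.left_commute)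
  ultimately show ?thesis
    unfolding \<gamma>_def[symmetric] au_def[symmetric] qp_def[symmetric] qm_def[symmetric] by (simp only: distrib_left spm) (simp add: distrib_left)
qed

text \<open>As a grows, a G_(a+\<beta>) restores \<open>sp\<close> and \<open>sm\<close> in the
  tested inequality. Excessiveness of \<open>s\<close> makes s \<bar>q\<bar> a common majorant, and
  the sign condition collapses the four limits to one integral.\<close>

lemma Kato_limit:
  assumes p: "sets \<kappa>p = sets borel" "finite_measure \<kappa>p" and n: "sets \<kappa>n = sets borel" "finite_measure \<kappa>n"
    and q [measurable]: "q \<in> borel_measurable borel" and u [measurable]: "u \<in> borel_measurable borel"
    and Ufin: "AE x in m. G 0 (\<lambda>y. ennreal \<bar>q y\<bar>) x + (pot 0 \<kappa>p x + pot 0 \<kappa>n x) < \<infinity>"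
    and eq: "AE x in m. u x = (enn2real (G 0 (\<lambda>y. ennreal (q y)) x) + enn2real (pot 0 \<kappa>p x))
        - (enn2real (G 0 (\<lambda>y. ennreal (- q y)) x) + enn2real (pot 0 \<kappa>n x))"
    and sgn: "AE x in m. q x * sgn (u x) = - \<bar>q x\<bar>"
    and s [measurable]: "s \<in> borel_measurable borel" and s1: "\<And>x. s x \<le> 1" and sL: "(\<lambda>x. enn2real (s x)) \<in> L2 m"
    and \<beta>: "0 < \<beta>" and exc: "\<And>a x. 0 < a \<Longrightarrow> ennreal a * G (a + \<beta>) s x \<le> s x"
    and I: "(\<integral>\<^sup>+x. s x * ennreal \<bar>u x\<bar> \<partial>m) < \<infinity>" and Q: "(\<integral>\<^sup>+x. s x * ennreal \<bar>q x\<bar> \<partial>m) < \<infinity>"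
  shows "(\<integral>\<^sup>+x. s x * ennreal \<bar>q x\<bar> \<partial>m) \<le>
    (emeasure \<kappa>p UNIV + emeasure \<kappa>n UNIV) + ennreal \<beta> * (\<integral>\<^sup>+x. s x * ennreal \<bar>u x\<bar> \<partial>m)"
proof -
  define sp where "sp x = s x * indicator {y. 0 < u y} x" for x
  define sm where "sm x = s x * indicator {y. u y < 0} x" for x
  have spm [measurable]: "sp \<in> borel_measurable borel" "sm \<in> borel_measurable borel"
    unfolding sp_def[abs_def] sm_def[abs_def] by measurable
  have sle: "sp x \<le> s x" "sm x \<le> s x" for x by (auto simp: sp_def sm_def indicator_def)
  have stop: "s x < top" for x using s1[of x] by (rule order.strict_trans1) simp
  define b where "b i = real (Suc i) + \<beta>" for i
  have b: "0 < b i" for i using \<beta> by (simp add: b_def)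
  have blim: "filterlim b at_top sequentially"
    unfolding b_def[abs_def]
    by (rule filterlim_at_top_mono[OF filterlim_compose[OF filterlim_real_sequentially filterlim_Suc]]) (use \<beta> in auto)
  have L: "(\<lambda>x. enn2real (h x)) \<in> L2 m" if [measurable]: "h \<in> borel_measurable borel" and h: "\<And>x. h x \<le> s x" for h
  proof -
    have "(\<integral>\<^sup>+x. ennreal ((enn2real (h x))\<^sup>2) \<partial>m) \<le> (\<integral>\<^sup>+x. ennreal ((enn2real (s x))\<^sup>2) \<partial>m)"
      using h stop by (intro nn_integral_mono ennreal_leI power_mono enn2real_mono) auto
    then show ?thesis using sL by (auto simp: L2_borel_iff)
  qed
  \<comment> \<open>Almost everywhere convergence is available along subsequences only; extracting
    the second from the first gives one sequence that serves both \<open>sp\<close> and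
    \<open>sm\<close>.\<close>
  obtain s1' :: "nat \<Rightarrow> nat" where s1': "strict_mono s1'"
    "AE x in m. (\<lambda>i. b (s1' i) * Gr (b (s1' i)) (\<lambda>x. enn2real (sp x)) x) \<longlonglongrightarrow> enn2real (sp x)"
    using Gr_AE_subseq[OF _ L[OF spm(1) sle(1)] b blim] by auto
  have blim': "filterlim (\<lambda>i. b (s1' i)) at_top sequentially"
    by (rule filterlim_compose[OF blim filterlim_subseq[OF s1'(1)]])
  obtain s2' :: "nat \<Rightarrow> nat" where s2': "strict_mono s2'"
    "AE x in m. (\<lambda>i. b (s1' (s2' i)) * Gr (b (s1' (s2' i))) (\<lambda>x. enn2real (sm x)) x) \<longlonglongrightarrow> enn2real (sm x)"
    using Gr_AE_subseq[OF _ L[OF spm(2) sle(2)], of "\<lambda>i. b (s1' i)"] b blim' by auto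
  define c where "c i = real (Suc (s1' (s2' i)))" for i
  have c: "0 < c i" for i by (simp add: c_def)
  have cb: "c i + \<beta> = b (s1' (s2' i))" for i by (simp add: c_def b_def)
  have clim: "filterlim c at_top sequentially"
    unfolding c_def[abs_def]
    by (intro filterlim_compose[OF filterlim_real_sequentially] filterlim_compose[OF filterlim_Suc]
        filterlim_compose[OF filterlim_subseq[OF s1'(1)]] filterlim_subseq[OF s2'(1)])
  \<comment> \<open>Strong continuity concerns the factor c + \<beta>, whereas the tested inequality
    carries c.\<close>
  have ratio: "(\<lambda>i. 1 - \<beta> / (c i + \<beta>)) \<longlonglongrightarrow> 1 - 0"
  proof (intro tendsto_diff tendsto_const tendsto_divide_0[OF tendsto_const filterlim_at_top_imp_at_infinity])
    show "filterlim (\<lambda>i. c i + \<beta>) at_top sequentially"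
      by (rule filterlim_at_top_mono[OF clim]) (use \<beta> in auto)
  qed
  have conv: "(\<lambda>i. ennreal (c i) * G (c i + \<beta>) h x) \<longlonglongrightarrow> h x"
    if [measurable]: "h \<in> borel_measurable borel" and h: "\<And>x. h x \<le> s x"
      and l: "(\<lambda>i. (c i + \<beta>) * Gr (c i + \<beta>) (\<lambda>x. enn2real (h x)) x) \<longlonglongrightarrow> enn2real (h x)" for h x
  proof -
    have hr: "h y = ennreal (enn2real (h y))" for y
      using order.strict_trans1[OF h stop, of y] by (simp add: less_top)
    have "ennreal (c i) * G (c i + \<beta>) h x = ennreal ((1 - \<beta> / (c i + \<beta>)) * ((c i + \<beta>) * Gr (c i + \<beta>) (\<lambda>x. enn2real (h x)) x))" for i
    proof -
      have cb0: "0 < c i + \<beta>" using c[of i] \<beta> by simp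
      have "ennreal (c i + \<beta>) * G (c i + \<beta>) h x \<le> 1"
        by (rule G_bounded[OF _ _ cb0]) (use h s1 in \<open>auto intro: order_trans\<close>)
      then have "ennreal (c i + \<beta>) * G (c i + \<beta>) h x < top" by (rule order.strict_trans1) simp
      then have "G (c i + \<beta>) h x < top" using cb0 ennreal_mult_less_top_imp[of "ennreal (c i + \<beta>)"] by simp
      then have "G (c i + \<beta>) h x = ennreal (Gr (c i + \<beta>) (\<lambda>x. enn2real (h x)) x)"
        by (simp add: G_eq_Gr_nonneg hr[symmetric])
      moreover have "(1 - \<beta> / (c i + \<beta>)) * ((c i + \<beta>) * Gr (c i + \<beta>) (\<lambda>x. enn2real (h x)) x) = c i * Gr (c i + \<beta>) (\<lambda>x. enn2real (h x)) x"
        using cb0 by (simp add: field_simps)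
      ultimately show ?thesis using c[of i] by (simp only: ennreal_mult'[OF less_imp_le[OF c]])
    qed
    moreover have "(\<lambda>i. ennreal ((1 - \<beta> / (c i + \<beta>)) * ((c i + \<beta>) * Gr (c i + \<beta>) (\<lambda>x. enn2real (h x)) x))) \<longlonglongrightarrow> ennreal ((1 - 0) * enn2real (h x))"
      by (intro tendsto_ennrealI tendsto_mult ratio l)
    ultimately show ?thesis by (simp add: hr[symmetric])
  qed
  have lims: "AE x in m. (\<lambda>i. ennreal (c i) * G (c i + \<beta>) sp x) \<longlonglongrightarrow> sp x"
    "AE x in m. (\<lambda>i. ennreal (c i) * G (c i + \<beta>) sm x) \<longlonglongrightarrow> sm x"
  proof -
    show "AE x in m. (\<lambda>i. ennreal (c i) * G (c i + \<beta>) sp x) \<longlonglongrightarrow> sp x"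
      using s1'(2)
    proof eventually_elim
      case (elim x)
      from LIMSEQ_subseq_LIMSEQ[OF elim s2'(1)] show ?case
        by (intro conv[OF spm(1) sle(1)]) (simp add: o_def cb)
    qed
    show "AE x in m. (\<lambda>i. ennreal (c i) * G (c i + \<beta>) sm x) \<longlonglongrightarrow> sm x"
      using s2'(2)
    proof eventually_elim
      case (elim x)
      then show ?case by (intro conv[OF spm(2) sle(2)]) (simp add: cb)
    qed
  qed
  have term_lim: "(\<lambda>i. \<integral>\<^sup>+x. g x * (ennreal (c i) * G (c i + \<beta>) h x) \<partial>m) \<longlonglongrightarrow> (\<integral>\<^sup>+x. g x * h x \<partial>m)"
    if [measurable]: "g \<in> borel_measurable borel" "h \<in> borel_measurable borel"
      and g: "\<And>x. g x \<le> ennreal \<bar>q x\<bar>" and h: "\<And>x. h x \<le> s x"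
      and l: "AE x in m. (\<lambda>i. ennreal (c i) * G (c i + \<beta>) h x) \<longlonglongrightarrow> h x" for g h
  proof (rule nn_integral_dominated_convergence[where w="\<lambda>x. s x * ennreal \<bar>q x\<bar>"])
    have [measurable]: "G (c i + \<beta>) h \<in> borel_measurable borel" for i using c[of i] \<beta> by (intro G_measurable) auto
    show "(\<lambda>x. g x * (ennreal (c i) * G (c i + \<beta>) h x)) \<in> borel_measurable m" for i by measurable
    show "AE x in m. g x * (ennreal (c i) * G (c i + \<beta>) h x) \<le> s x * ennreal \<bar>q x\<bar>" for i
    proof (rule AE_I2)
      fix x
      have "ennreal (c i) * G (c i + \<beta>) h x \<le> ennreal (c i) * G (c i + \<beta>) s x" by (intro mult_left_mono G_mono h) simp
      also have "\<dots> \<le> s x" by (rule exc[OF c])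
      finally have "g x * (ennreal (c i) * G (c i + \<beta>) h x) \<le> ennreal \<bar>q x\<bar> * s x" by (intro mult_mono g) auto
      then show "g x * (ennreal (c i) * G (c i + \<beta>) h x) \<le> s x * ennreal \<bar>q x\<bar>" by (simp only: mult.commute[of "s x"])
    qed
    show "AE x in m. (\<lambda>i. g x * (ennreal (c i) * G (c i + \<beta>) h x)) \<longlonglongrightarrow> g x * h x"
      using l
    proof eventually_elim
      case (elim x)
      have "g x < top" using g[of x] by (rule order.strict_trans1) simp
      then show ?case using elim by (rule ennreal_tendsto_cmult)
    qed
  qed (use Q in auto)
  let ?E = "(emeasure \<kappa>p UNIV + emeasure \<kappa>n UNIV) + ennreal \<beta> * (\<integral>\<^sup>+x. s x * ennreal \<bar>u x\<bar> \<partial>m)"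
  let ?T = "\<lambda>g h i. \<integral>\<^sup>+x. g x * (ennreal (c i) * G (c i + \<beta>) h x) \<partial>m"
  let ?qp = "\<lambda>x. ennreal (q x)" and ?qm = "\<lambda>x. ennreal (- q x)"
  have ineq: "?T ?qm sp i + ?T ?qp sm i \<le> ?T ?qp sp i + ?T ?qm sm i + ?E" for i
    using Kato_test[OF p n q u Ufin eq s s1 \<beta> c exc[OF c] I, of i] unfolding sp_def sm_def by (simp only: add.assoc)
  have qle: "?qp x \<le> ennreal \<bar>q x\<bar>" "?qm x \<le> ennreal \<bar>q x\<bar>" for x by (auto intro!: ennreal_leI)
  have "(\<integral>\<^sup>+x. ?qm x * sp x \<partial>m) + (\<integral>\<^sup>+x. ?qp x * sm x \<partial>m) \<le> (\<integral>\<^sup>+x. ?qp x * sp x \<partial>m) + (\<integral>\<^sup>+x. ?qm x * sm x \<partial>m) + ?E"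
  proof (rule LIMSEQ_le)
    show "(\<lambda>i. ?T ?qm sp i + ?T ?qp sm i) \<longlonglongrightarrow> (\<integral>\<^sup>+x. ?qm x * sp x \<partial>m) + (\<integral>\<^sup>+x. ?qp x * sm x \<partial>m)"
      by (intro tendsto_add term_lim lims sle qle) measurable
    show "(\<lambda>i. ?T ?qp sp i + ?T ?qm sm i + ?E) \<longlonglongrightarrow> (\<integral>\<^sup>+x. ?qp x * sp x \<partial>m) + (\<integral>\<^sup>+x. ?qm x * sm x \<partial>m) + ?E"
      by (intro tendsto_add tendsto_const term_lim lims sle qle) measurable
    show "\<exists>N. \<forall>i\<ge>N. ?T ?qm sp i + ?T ?qp sm i \<le> ?T ?qp sp i + ?T ?qm sm i + ?E" using ineq by blast
  qed
  \<comment> \<open>Where u > 0 the sign condition forces q \<le> 0, and where u < 0 it forces q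
    \<ge> 0; these two products therefore vanish.\<close>
  moreover have "(\<integral>\<^sup>+x. ?qp x * sp x \<partial>m) = (\<integral>\<^sup>+x. 0 \<partial>m)" "(\<integral>\<^sup>+x. ?qm x * sm x \<partial>m) = (\<integral>\<^sup>+x. 0 \<partial>m)"
  proof -
    have "AE x in m. ?qp x * sp x = 0"
      using sgn
    proof eventually_elim
      case (elim x)
      then have "q x \<le> 0" if "0 < u x" using that by simp
      then show ?case by (cases "0 < u x") (simp_all add: sp_def ennreal_neg)
    qed
    then show "(\<integral>\<^sup>+x. ?qp x * sp x \<partial>m) = (\<integral>\<^sup>+x. 0 \<partial>m)" by (rule nn_integral_cong_AE)
    have "AE x in m. ?qm x * sm x = 0"
      using sgn
    proof eventually_elim
      case (elim x)
      then have "0 \<le> q x" if "u x < 0" using that by simp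
      then show ?case by (cases "u x < 0") (simp_all add: sm_def ennreal_neg)
    qed
    then show "(\<integral>\<^sup>+x. ?qm x * sm x \<partial>m) = (\<integral>\<^sup>+x. 0 \<partial>m)" by (rule nn_integral_cong_AE)
  qed
  moreover have "(\<integral>\<^sup>+x. ?qm x * sp x \<partial>m) + (\<integral>\<^sup>+x. ?qp x * sm x \<partial>m) = (\<integral>\<^sup>+x. s x * ennreal \<bar>q x\<bar> \<partial>m)"
  proof -
    have "(\<integral>\<^sup>+x. ?qm x * sp x \<partial>m) + (\<integral>\<^sup>+x. ?qp x * sm x \<partial>m) = (\<integral>\<^sup>+x. ?qm x * sp x + ?qp x * sm x \<partial>m)"
      by (rule nn_integral_add[symmetric]) measurable
    also have "\<dots> = (\<integral>\<^sup>+x. s x * ennreal \<bar>q x\<bar> \<partial>m)"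
      using sgn
    proof (intro nn_integral_cong_AE, eventually_elim)
      case (elim x)
      \<comment> \<open>Where u = 0 the sign condition makes q vanish, so this set contributes to
        neither side.\<close>
      consider "u x > 0" | "u x < 0" | "u x = 0" by linarith
      then show ?case
        by cases (use elim in \<open>auto simp: sp_def sm_def mult.commute abs_if split: if_splits\<close>)
    qed
    finally show ?thesis .
  qed
  ultimately show ?thesis by simp
qed


lemma pot_add_measure:
  assumes "sets \<kappa>p = sets borel" "sets \<kappa>n = sets borel" "0 \<le> \<alpha>"
  shows "pot \<alpha> (add_measure \<kappa>p \<kappa>n) x = pot \<alpha> \<kappa>p x + pot \<alpha> \<kappa>n x"
  unfolding pot_def using r_measurable_right[OF assms(3)] assms
  by (intro nn_integral_add_measure) (simp_all add: measurable_cong_sets[OF assms(1) refl])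

text \<open>Kato's inequality with a test function s close to 1 bounds \<integral> s \<bar>q\<bar>
  dm by the total mass plus \<beta> \<integral> s \<bar>u\<bar> dm. First \<beta> tends to 0 to
  remove the error, then s increases to 1.\<close>

lemma absorption_mass:
  assumes tr: "transient_form m D \<E>"
    and p: "sets \<kappa>p = sets borel" "finite_measure \<kappa>p" and n: "sets \<kappa>n = sets borel" "finite_measure \<kappa>n"
    and q [measurable]: "q \<in> borel_measurable borel" and u [measurable]: "u \<in> borel_measurable borel"
    and qfin: "AE x in m. G 0 (\<lambda>y. ennreal \<bar>q y\<bar>) x < \<infinity>"
    and eq: "AE x in m. u x = (enn2real (G 0 (\<lambda>y. ennreal (q y)) x) + enn2real (pot 0 \<kappa>p x))
        - (enn2real (G 0 (\<lambda>y. ennreal (- q y)) x) + enn2real (pot 0 \<kappa>n x))"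
    and sgn: "AE x in m. q x * sgn (u x) = - \<bar>q x\<bar>"
  shows "(\<integral>\<^sup>+x. ennreal \<bar>q x\<bar> \<partial>m) \<le> emeasure \<kappa>p UNIV + emeasure \<kappa>n UNIV"
proof -
  let ?K = "emeasure \<kappa>p UNIV + emeasure \<kappa>n UNIV"
  define \<kappa> where "\<kappa> = add_measure \<kappa>p \<kappa>n"
  have \<kappa>: "sets \<kappa> = sets borel" "finite_measure \<kappa>"
    unfolding \<kappa>_def using p n by (auto intro: finite_measure_add_measure)
  define Q where "Q y = ennreal \<bar>q y\<bar>" for y
  have [measurable]: "Q \<in> borel_measurable borel" unfolding Q_def[abs_def] by measurable
  define U where "U x = G 0 Q x + pot 0 \<kappa> x" for x
  have gm [measurable]: "G \<alpha> h \<in> borel_measurable borel" if "h \<in> borel_measurable borel" "0 \<le> \<alpha>" for h \<alpha>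
    using that by (rule G_measurable)
  have pm [measurable]: "pot \<alpha> \<kappa> \<in> borel_measurable borel" if "0 \<le> \<alpha>" for \<alpha> using pot_measurable[OF \<kappa> that] .
  have Um [measurable]: "U \<in> borel_measurable borel" unfolding U_def[abs_def] using gm[of Q 0] pm[of 0] by measurable
  have pot\<kappa>: "pot 0 \<kappa> x = pot 0 \<kappa>p x + pot 0 \<kappa>n x" for x unfolding \<kappa>_def by (rule pot_add_measure[OF p(1) n(1)]) simp
  have Ufin: "AE x in m. U x < top"
    using qfin pot_finite[OF tr \<kappa>] by eventually_elim (simp add: U_def Q_def[abs_def])
  have uU: "AE x in m. ennreal \<bar>u x\<bar> \<le> U x"
    using eq Ufin
  proof eventually_elim
    case (elim x)
    let ?gp = "G 0 (\<lambda>y. ennreal (q y)) x" and ?gm = "G 0 (\<lambda>y. ennreal (- q y)) x"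
    have g: "?gp \<le> G 0 Q x" "?gm \<le> G 0 Q x" by (auto intro!: G_mono ennreal_leI simp: Q_def)
    have fin: "G 0 Q x < top" "pot 0 \<kappa>p x < top" "pot 0 \<kappa>n x < top" using elim(2) by (auto simp: U_def pot\<kappa>)
    have "\<bar>u x\<bar> \<le> enn2real (G 0 Q x) + (enn2real (pot 0 \<kappa>p x) + enn2real (pot 0 \<kappa>n x))"
      using elim(1) enn2real_mono[OF g(1) fin(1)] enn2real_mono[OF g(2) fin(1)]
        enn2real_nonneg[of ?gp] enn2real_nonneg[of ?gm] enn2real_nonneg[of "pot 0 \<kappa>p x"] enn2real_nonneg[of "pot 0 \<kappa>n x"]
      by linarith
    also have "\<dots> = enn2real (U x)" using fin by (simp add: U_def pot\<kappa> enn2real_plus)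
    finally have "ennreal \<bar>u x\<bar> \<le> ennreal (enn2real (U x))" by (rule ennreal_leI)
    then show ?case using elim(2) by (simp add: less_top)
  qed
  obtain w :: "'a \<Rightarrow> real" where w: "w \<in> borel_measurable m" "\<And>x. 0 < w x" "\<And>x. w x \<le> 1" "integrable m w"
    using obtain_positive_integrable_function by blast
  have wm [measurable]: "w \<in> borel_measurable borel" using w(1) by (simp add: measurable_cong_sets[OF sets_m refl])
  have wint: "(\<integral>\<^sup>+x. ennreal (w x) \<partial>m) < top" using w(2,4) by (simp add: nn_integral_eq_integral less_imp_le)
  \<comment> \<open>Division by 1 + U makes f U \<le> w almost everywhere, hence integrable. Also f
    \<le> w \<le> 1, so f is square integrable, and f stays positive, so its potentials do
    too.\<close>
  define f where "f x = w x / (1 + enn2real (U x))" for x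
  have fm [measurable]: "f \<in> borel_measurable borel" unfolding f_def[abs_def] by measurable
  have f0: "0 < f x" for x using w(2)[of x] by (simp add: f_def add_pos_nonneg)
  have fw: "f x \<le> w x" for x using w(2)[of x] by (simp add: f_def divide_le_eq add_pos_nonneg mult_left_le_one_le algebra_simps)
  have fL: "f \<in> L2 m"
  proof -
    have "(\<integral>\<^sup>+x. ennreal ((f x)\<^sup>2) \<partial>m) \<le> (\<integral>\<^sup>+x. ennreal (w x) \<partial>m)"
    proof (intro nn_integral_mono ennreal_leI)
      fix x
      have "f x * f x \<le> w x * 1" using f0[of x] fw[of x] w(3)[of x] by (intro mult_mono) auto
      then show "(f x)\<^sup>2 \<le> w x" by (simp add: power2_eq_square)
    qed
    then show ?thesis using wint by (subst L2_borel_iff) (auto intro: order.strict_trans1)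
  qed
  define \<phi> where "\<phi> x = ennreal (f x)" for x
  have \<phi>m [measurable]: "\<phi> \<in> borel_measurable borel" unfolding \<phi>_def[abs_def] by measurable
  have \<phi>1: "\<phi> x \<le> 1" for x using fw[of x] w(3)[of x] by (simp add: \<phi>_def ennreal_le_1)
  let ?c = "\<integral>\<^sup>+x. \<phi> x * U x \<partial>m"
  have cfin: "?c < top"
  proof -
    have "?c \<le> (\<integral>\<^sup>+x. ennreal (w x) \<partial>m)"
      using Ufin
    proof (intro nn_integral_mono_AE, eventually_elim)
      case (elim x)
      then obtain b where b: "U x = ennreal b" "0 \<le> b" by (cases "U x") auto
      then have "f x * b \<le> w x" using w(2)[of x] by (simp add: f_def divide_le_eq algebra_simps add_pos_nonneg)
      then show ?case using b f0[of x] by (simp add: \<phi>_def ennreal_mult[symmetric] ennreal_leI less_imp_le)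
    qed
    then show ?thesis using wint by (rule order.strict_trans1)
  qed
  \<comment> \<open>\<open>d \<beta>\<close> is the integral of \<phi> against the \<beta>-potential
    of the data and \<open>e \<beta>\<close> is the remainder in the resolvent equation. Their sum
    is independent of \<beta>.\<close>
  define d where "d \<beta> = (\<integral>\<^sup>+x. \<phi> x * G \<beta> Q x \<partial>m) + (\<integral>\<^sup>+x. \<phi> x * pot \<beta> \<kappa> x \<partial>m)" for \<beta>
  define e where "e \<beta> = ennreal \<beta> * (\<integral>\<^sup>+x. G \<beta> \<phi> x * U x \<partial>m)" for \<beta>
  have d_eq: "d \<beta> = (\<integral>\<^sup>+x. G \<beta> \<phi> x * Q x \<partial>m) + (\<integral>\<^sup>+x. G \<beta> \<phi> x \<partial>\<kappa>)" if \<beta>: "0 \<le> \<beta>" for \<beta>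
    unfolding d_def using pot_pair[OF \<kappa> \<beta> \<phi>m] G_sym[of Q \<phi> \<beta>] \<beta> by (simp add: mult.commute)
  have de: "d \<beta> + e \<beta> = ?c" if \<beta>: "0 \<le> \<beta>" for \<beta>
  proof -
    have [measurable]: "G \<beta> Q \<in> borel_measurable borel" "G \<beta> U \<in> borel_measurable borel" "pot \<beta> \<kappa> \<in> borel_measurable borel"
      "G 0 Q \<in> borel_measurable borel" "pot 0 \<kappa> \<in> borel_measurable borel"
      using \<beta> by (auto intro!: gm pm)
    have "AE x in m. U x = (G \<beta> Q x + pot \<beta> \<kappa> x) + ennreal \<beta> * G \<beta> U x"
      using pot_resolvent[OF \<kappa> order_refl \<beta>]
    proof eventually_elim
      case (elim x)
      have "G \<beta> U x = G \<beta> (G 0 Q) x + G \<beta> (pot 0 \<kappa>) x" unfolding U_def[abs_def] by (rule G_add[OF _ _ \<beta>]) measurable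
      then show ?case using elim resolvent_equation[of 0 \<beta> Q x] \<beta> by (simp add: U_def distrib_left add_ac)
    qed
    then have "?c = (\<integral>\<^sup>+x. \<phi> x * ((G \<beta> Q x + pot \<beta> \<kappa> x) + ennreal \<beta> * G \<beta> U x) \<partial>m)"
      by (intro nn_integral_cong_AE) (auto elim!: eventually_mono)
    also have "\<dots> = (\<integral>\<^sup>+x. \<phi> x * G \<beta> Q x \<partial>m) + (\<integral>\<^sup>+x. \<phi> x * pot \<beta> \<kappa> x \<partial>m) + ennreal \<beta> * (\<integral>\<^sup>+x. \<phi> x * G \<beta> U x \<partial>m)"
      by (simp add: distrib_left nn_integral_add nn_integral_cmult[symmetric] mult.left_commute)
    finally show ?thesis using G_sym[of U \<phi> \<beta>] \<beta> by (simp add: d_def e_def mult.commute)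
  qed
  have main: "(\<integral>\<^sup>+x. min (of_nat N * G \<beta> \<phi> x) 1 * Q x \<partial>m) \<le> ?K + of_nat N * e \<beta>" if \<beta>: "0 < \<beta>" for \<beta> N
  proof -
    have [measurable]: "G \<beta> \<phi> \<in> borel_measurable borel" using \<beta> by (intro gm) auto
    \<comment> \<open>Minima of \<beta>-excessive functions stay excessive in the required sense.
      The bound by a multiple of \<open>G \<beta> \<phi>\<close> gives square integrability and ties
      the error to \<open>e \<beta>\<close>.\<close>
    define s where "s x = min (of_nat N * G \<beta> \<phi> x) 1" for x
    have sm [measurable]: "s \<in> borel_measurable borel" unfolding s_def[abs_def] by measurable
    have sle: "s x \<le> of_nat N * G \<beta> \<phi> x" for x by (simp add: s_def)
    have Gfin: "G \<beta> \<phi> x < top" for x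
      using order.strict_trans1[OF G_bounded[OF \<phi>1 \<phi>m \<beta>], of top x] \<beta> ennreal_mult_less_top_imp[of "ennreal \<beta>"] by simp
    have sL: "(\<lambda>x. enn2real (s x)) \<in> L2 m"
    proof -
      have "(\<integral>\<^sup>+x. ennreal ((enn2real (s x))\<^sup>2) \<partial>m) \<le> (\<integral>\<^sup>+x. ennreal ((real N * enn2real (G \<beta> \<phi> x))\<^sup>2) \<partial>m)"
      proof (intro nn_integral_mono ennreal_leI power_mono)
        fix x
        have "enn2real (s x) \<le> enn2real (of_nat N * G \<beta> \<phi> x)"
          using Gfin[of x] by (intro enn2real_mono sle) (simp add: ennreal_mult_less_top ennreal_of_nat_eq_real_of_nat)
        then show "enn2real (s x) \<le> real N * enn2real (G \<beta> \<phi> x)"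
          by (simp add: enn2real_mult ennreal_of_nat_eq_real_of_nat)
      qed simp
      moreover have "(\<lambda>x. real N * enn2real (G \<beta> \<phi> x)) \<in> L2 m"
        unfolding \<phi>_def[abs_def] by (rule L2_scale[OF G_pos_L2(2)[OF fm fL \<beta>]])
      ultimately show ?thesis by (subst L2_borel_iff) (auto simp: L2_borel_iff intro: order.strict_trans1)
    qed
    have exc: "ennreal a * G (a + \<beta>) s x \<le> s x" if a: "0 < a" for a x
    proof -
      have g0: "0 < a + \<beta>" "0 \<le> a + \<beta>" "\<beta> \<le> a + \<beta>" "0 \<le> \<beta>" using a \<beta> by auto
      have "ennreal a * G (a + \<beta>) s x \<le> ennreal a * G (a + \<beta>) (\<lambda>y. of_nat N * G \<beta> \<phi> y) x"
        by (intro mult_left_mono G_mono sle) simp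
      also have "\<dots> = of_nat N * (ennreal a * G (a + \<beta>) (G \<beta> \<phi>) x)"
        using g0 by (subst G_cmult) (auto simp: mult_ac)
      also have "\<dots> \<le> of_nat N * G \<beta> \<phi> x"
        using resolvent_equation[OF g0(4,3) \<phi>m, of x] by (intro mult_left_mono) auto
      finally have 1: "ennreal a * G (a + \<beta>) s x \<le> of_nat N * G \<beta> \<phi> x" .
      have "ennreal a * G (a + \<beta>) s x \<le> ennreal (a + \<beta>) * G (a + \<beta>) s x"
        using \<beta> by (intro mult_right_mono ennreal_leI) auto
      also have "\<dots> \<le> 1" by (rule G_bounded[OF _ sm g0(1)]) (simp add: s_def)
      finally show ?thesis using 1 by (simp add: s_def)
    qed
    have sU: "ennreal \<beta> * (\<integral>\<^sup>+x. s x * U x \<partial>m) \<le> of_nat N * e \<beta>"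
    proof -
      have "(\<integral>\<^sup>+x. s x * U x \<partial>m) \<le> (\<integral>\<^sup>+x. of_nat N * (G \<beta> \<phi> x * U x) \<partial>m)"
        using mult_right_mono[OF sle] by (intro nn_integral_mono) (simp add: mult.assoc)
      also have "\<dots> = of_nat N * (\<integral>\<^sup>+x. G \<beta> \<phi> x * U x \<partial>m)" by (rule nn_integral_cmult) measurable
      finally show ?thesis unfolding e_def using mult_left_mono[of _ _ "ennreal \<beta>"] by (simp add: mult.left_commute)
    qed
    have "d \<beta> + e \<beta> < top" using de[of \<beta>] \<beta> cfin by simp
    then have efin: "e \<beta> < top" "d \<beta> < top" by (auto simp: less_top)
    have su: "(\<integral>\<^sup>+x. s x * ennreal \<bar>u x\<bar> \<partial>m) \<le> (\<integral>\<^sup>+x. s x * U x \<partial>m)"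
      using uU by (intro nn_integral_mono_AE) (auto elim!: eventually_mono intro: mult_left_mono)
    have "ennreal \<beta> * (\<integral>\<^sup>+x. s x * U x \<partial>m) < top"
      by (rule order.strict_trans1[OF sU]) (simp add: ennreal_mult_less_top efin ennreal_of_nat_eq_real_of_nat)
    then have "(\<integral>\<^sup>+x. s x * U x \<partial>m) < top" using \<beta> ennreal_mult_less_top_imp[of "ennreal \<beta>"] by simp
    with su have I: "(\<integral>\<^sup>+x. s x * ennreal \<bar>u x\<bar> \<partial>m) < \<infinity>" by (simp add: order.strict_trans1)
    have sQ: "(\<integral>\<^sup>+x. s x * ennreal \<bar>q x\<bar> \<partial>m) < \<infinity>"
    proof -
      have "(\<integral>\<^sup>+x. s x * ennreal \<bar>q x\<bar> \<partial>m) \<le> (\<integral>\<^sup>+x. of_nat N * (G \<beta> \<phi> x * Q x) \<partial>m)"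
        unfolding Q_def using mult_right_mono[OF sle] by (intro nn_integral_mono) (simp add: mult.assoc)
      also have "\<dots> = of_nat N * (\<integral>\<^sup>+x. G \<beta> \<phi> x * Q x \<partial>m)" by (rule nn_integral_cmult) measurable
      also have "\<dots> \<le> of_nat N * d \<beta>" using d_eq[of \<beta>] \<beta> by (intro mult_left_mono) auto
      also have "\<dots> < \<infinity>" using efin(2) by (simp add: ennreal_mult_less_top ennreal_of_nat_eq_real_of_nat)
      finally show ?thesis .
    qed
    have "AE x in m. G 0 (\<lambda>y. ennreal \<bar>q y\<bar>) x + (pot 0 \<kappa>p x + pot 0 \<kappa>n x) < \<infinity>"
      using Ufin by eventually_elim (simp add: U_def Q_def[abs_def] pot\<kappa>)
    from Kato_limit[OF p n q u this eq sgn sm _ sL \<beta> exc I sQ]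
    have "(\<integral>\<^sup>+x. s x * Q x \<partial>m) \<le> ?K + ennreal \<beta> * (\<integral>\<^sup>+x. s x * ennreal \<bar>u x\<bar> \<partial>m)" by (simp add: s_def Q_def)
    also have "\<dots> \<le> ?K + of_nat N * e \<beta>"
      by (intro add_left_mono order_trans[OF mult_left_mono[OF su] sU]) simp
    finally show ?thesis by (simp add: s_def)
  qed
  define b where "b i = 1 / real (Suc i)" for i
  have b: "0 < b i" "0 \<le> b i" for i by (auto simp: b_def)
  have inc: "incseq (\<lambda>i. G (b i) \<phi> x)" for x unfolding b_def by (rule G_incseq[OF \<phi>m])
  have sup: "(SUP i. G (b i) \<phi> x) = G 0 \<phi> x" for x unfolding b_def by (rule resolvent_SUP[OF \<phi>m])
  have bm [measurable]: "G (b i) \<phi> \<in> borel_measurable borel" for i using b(2) by (rule gm[OF \<phi>m])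
  \<comment> \<open>\<open>G \<beta> \<phi>\<close> increases to \<open>G 0 \<phi>\<close>, so
    \<open>d\<close> increases to \<open>d 0\<close>, and \<open>d 0\<close> is the whole constant
    because \<open>e 0\<close> carries the factor 0.\<close>
  have dlim: "(\<lambda>i. d (b i)) \<longlonglongrightarrow> ?c"
  proof -
    have "(\<lambda>i. (\<integral>\<^sup>+x. G (b i) \<phi> x * Q x \<partial>m) + (\<integral>\<^sup>+x. G (b i) \<phi> x \<partial>\<kappa>)) \<longlonglongrightarrow> (\<integral>\<^sup>+x. G 0 \<phi> x * Q x \<partial>m) + (\<integral>\<^sup>+x. G 0 \<phi> x \<partial>\<kappa>)"
    proof (intro tendsto_add)
      have i1: "incseq (\<lambda>i x. G (b i) \<phi> x * Q x)" using inc by (auto simp: incseq_def le_fun_def intro!: mult_right_mono)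
      have "(\<integral>\<^sup>+x. G 0 \<phi> x * Q x \<partial>m) = (\<integral>\<^sup>+x. (SUP i. G (b i) \<phi> x * Q x) \<partial>m)"
        by (simp add: sup[symmetric] SUP_mult_right_ennreal)
      also have "\<dots> = (SUP i. \<integral>\<^sup>+x. G (b i) \<phi> x * Q x \<partial>m)"
        by (rule nn_integral_monotone_convergence_SUP[OF i1]) measurable
      finally show "(\<lambda>i. \<integral>\<^sup>+x. G (b i) \<phi> x * Q x \<partial>m) \<longlonglongrightarrow> (\<integral>\<^sup>+x. G 0 \<phi> x * Q x \<partial>m)"
        using i1 by (simp only:) (intro LIMSEQ_SUP, auto simp: incseq_def le_fun_def intro!: nn_integral_mono)
      have i2: "incseq (\<lambda>i. G (b i) \<phi>)" using inc by (auto simp: incseq_def le_fun_def)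
      have "(\<integral>\<^sup>+x. G 0 \<phi> x \<partial>\<kappa>) = (\<integral>\<^sup>+x. (SUP i. G (b i) \<phi> x) \<partial>\<kappa>)" by (simp only: sup)
      also have "\<dots> = (SUP i. \<integral>\<^sup>+x. G (b i) \<phi> x \<partial>\<kappa>)"
        by (rule nn_integral_monotone_convergence_SUP[OF i2]) (simp only: measurable_cong_sets[OF \<kappa>(1) refl] bm)
      finally show "(\<lambda>i. \<integral>\<^sup>+x. G (b i) \<phi> x \<partial>\<kappa>) \<longlonglongrightarrow> (\<integral>\<^sup>+x. G 0 \<phi> x \<partial>\<kappa>)"
        using i2 by (simp only:) (intro LIMSEQ_SUP, auto simp: incseq_def le_fun_def intro!: nn_integral_mono)
    qed
    moreover have "e 0 = 0" by (simp add: e_def)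
    ultimately show ?thesis using de[of 0] d_eq[of 0] by (simp add: d_eq[OF b(2)])
  qed
  have elim0: "(\<lambda>i. e (b i)) \<longlonglongrightarrow> 0"
  proof -
    have "e (b i) = ?c - d (b i)" for i
      using de[OF b(2), of i] cfin by (metis add_diff_self_ennreal ennreal_add_diff_cancel_left infinity_ennreal_def le_iff_add neq_top_trans top.not_eq_extremum)
    moreover have "(\<lambda>i. ?c - d (b i)) \<longlonglongrightarrow> ?c - ?c"
      using cfin by (intro tendsto_diff_ennreal tendsto_const dlim) auto
    ultimately show ?thesis using cfin by simp
  qed
  \<comment> \<open>The test function is frozen at index i. It lies below those of larger index j,
    whose error terms tend to 0.\<close>
  have N: "(\<integral>\<^sup>+x. min (of_nat N * G (b i) \<phi> x) 1 * Q x \<partial>m) \<le> ?K" for N i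
  proof (rule LIMSEQ_le_const)
    have "(\<lambda>j. ?K + of_nat N * e (b j)) \<longlonglongrightarrow> ?K + of_nat N * 0"
      by (intro tendsto_add tendsto_const ennreal_tendsto_cmult elim0) (simp add: ennreal_of_nat_eq_real_of_nat)
    then show "(\<lambda>j. ?K + of_nat N * e (b j)) \<longlonglongrightarrow> ?K" by simp
    show "\<exists>k. \<forall>j\<ge>k. (\<integral>\<^sup>+x. min (of_nat N * G (b i) \<phi> x) 1 * Q x \<partial>m) \<le> ?K + of_nat N * e (b j)"
    proof (intro exI[of _ i] allI impI)
      fix j assume "i \<le> j"
      have "(\<integral>\<^sup>+x. min (of_nat N * G (b i) \<phi> x) 1 * Q x \<partial>m) \<le> (\<integral>\<^sup>+x. min (of_nat N * G (b j) \<phi> x) 1 * Q x \<partial>m)"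
        using incseqD[OF inc \<open>i \<le> j\<close>] by (intro nn_integral_mono mult_right_mono min.mono mult_left_mono) auto
      also have "\<dots> \<le> ?K + of_nat N * e (b j)" by (rule main[OF b(1)])
      finally show "(\<integral>\<^sup>+x. min (of_nat N * G (b i) \<phi> x) 1 * Q x \<partial>m) \<le> ?K + of_nat N * e (b j)" .
    qed
  qed
  have "AE x in m. 0 < G (b 0) \<phi> x"
    unfolding \<phi>_def[abs_def] by (rule AE_G_pos[OF fm fL]) (use f0 b in \<open>auto simp: less_imp_le\<close>)
  \<comment> \<open>Positivity of a single resolvent of \<phi> suffices: its multiples eventually
    exceed 1 at almost every point.\<close>
  then have "AE x in m. (SUP N. min (of_nat N * G (b 0) \<phi> x) 1) = 1"
  proof eventually_elim
    case (elim x)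
    obtain N :: nat where N: "1 \<le> of_nat N * G (b 0) \<phi> x"
    proof (cases "G (b 0) \<phi> x = top")
      case True then show ?thesis using that[of 1] by simp
    next
      case False
      then obtain g where g: "G (b 0) \<phi> x = ennreal g" "0 < g" using elim by (cases "G (b 0) \<phi> x") auto
      obtain N where "1 / g \<le> real N" using real_arch_simple by blast
      then have "1 \<le> real N * g" using g by (simp add: field_simps)
      then have "ennreal 1 \<le> ennreal (real N * g)" by (rule ennreal_leI)
      then show ?thesis using that[of N] g by (simp add: ennreal_mult ennreal_of_nat_eq_real_of_nat)
    qed
    have "min (of_nat N * G (b 0) \<phi> x) 1 = 1" using N by (simp add: min_absorb2)
    then have "1 \<le> (SUP N. min (of_nat N * G (b 0) \<phi> x) 1)" by (metis SUP_upper UNIV_I)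
    moreover have "(SUP N. min (of_nat N * G (b 0) \<phi> x) 1) \<le> 1" by (intro SUP_least) simp
    ultimately show ?case by (rule antisym[rotated])
  qed
  then have "(\<integral>\<^sup>+x. Q x \<partial>m) = (\<integral>\<^sup>+x. (SUP N. min (of_nat N * G (b 0) \<phi> x) 1) * Q x \<partial>m)"
    by (intro nn_integral_cong_AE) (auto elim!: eventually_mono)
  also have "\<dots> = (\<integral>\<^sup>+x. (SUP N. min (of_nat N * G (b 0) \<phi> x) 1 * Q x) \<partial>m)" by (simp only: SUP_mult_right_ennreal)
  also have "\<dots> = (SUP N. \<integral>\<^sup>+x. min (of_nat N * G (b 0) \<phi> x) 1 * Q x \<partial>m)"
  proof (rule nn_integral_monotone_convergence_SUP)
    show "incseq (\<lambda>N x. min (of_nat N * G (b 0) \<phi> x) 1 * Q x)"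
      by (auto simp: incseq_def le_fun_def intro!: mult_right_mono min.mono of_nat_mono)
  qed measurable
  also have "\<dots> \<le> ?K" by (intro SUP_least N)
  finally show ?thesis by (simp only: Q_def)
qed

text \<open>\<open>absorption_mass\<close> turns q m into a measure of mass at most that of the
  data. \<open>u\<close> is then the potential of a measure of at most twice that mass, which is the
  origin of the factor 2.\<close>

theorem truncation_energy:
  assumes tr: "transient_form m D \<E>"
    and p: "sets \<kappa>p = sets borel" "finite_measure \<kappa>p" and n: "sets \<kappa>n = sets borel" "finite_measure \<kappa>n"
    and q [measurable]: "q \<in> borel_measurable borel" and u [measurable]: "u \<in> borel_measurable borel"
    and qfin: "AE x in m. G 0 (\<lambda>y. ennreal \<bar>q y\<bar>) x < \<infinity>"
    and eq: "AE x in m. u x = (enn2real (G 0 (\<lambda>y. ennreal (q y)) x) + enn2real (pot 0 \<kappa>p x))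
        - (enn2real (G 0 (\<lambda>y. ennreal (- q y)) x) + enn2real (pot 0 \<kappa>n x))"
    and sgn: "AE x in m. q x * sgn (u x) = - \<bar>q x\<bar>"
    and k: "0 \<le> k" and v: "v \<in> borel_measurable (completion m)" and vu: "AE x in m. v x = clamp_real k (u x)"
  shows "v \<in> extended_domain m D \<E>" "extended_energy m D \<E> v \<le> 2 * k * (measure \<kappa>p UNIV + measure \<kappa>n UNIV)"
proof -
  interpret p: finite_measure \<kappa>p by fact
  interpret n: finite_measure \<kappa>n by fact
  define K where "K = measure \<kappa>p UNIV + measure \<kappa>n UNIV"
  have K0: "0 \<le> K" by (simp add: K_def)
  have Q: "(\<integral>\<^sup>+x. ennreal \<bar>q x\<bar> \<partial>m) \<le> ennreal K"
    using absorption_mass[OF tr p n q u qfin eq sgn] by (simp add: K_def p.emeasure_eq_measure n.emeasure_eq_measure)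
  define qp where "qp = density m (\<lambda>x. ennreal (q x))"
  define qm where "qm = density m (\<lambda>x. ennreal (- q x))"
  have sq: "sets qp = sets borel" "sets qm = sets borel" by (simp_all add: qp_def qm_def sets_m)
  have eq_q: "emeasure qp UNIV = (\<integral>\<^sup>+x. ennreal (q x) \<partial>m)" "emeasure qm UNIV = (\<integral>\<^sup>+x. ennreal (- q x) \<partial>m)"
    unfolding qp_def qm_def by (auto simp: emeasure_density sets_m)
  have le: "(\<integral>\<^sup>+x. ennreal (q x) \<partial>m) \<le> ennreal K" "(\<integral>\<^sup>+x. ennreal (- q x) \<partial>m) \<le> ennreal K"
    by (rule order_trans[OF nn_integral_mono Q], rule ennreal_leI, simp)+
  have fq: "finite_measure qp" "finite_measure qm"
    using order.strict_trans1[OF le(1), of top] order.strict_trans1[OF le(2), of top] eq_q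
      sets_eq_imp_space_eq[OF sq(1)] sets_eq_imp_space_eq[OF sq(2)]
    by (auto intro!: finite_measureI)
  interpret qp: finite_measure qp by fact
  interpret qm: finite_measure qm by fact
  define \<nu>p where "\<nu>p = add_measure qp \<kappa>p"
  define \<nu>n where "\<nu>n = add_measure qm \<kappa>n"
  have \<nu>: "sets \<nu>p = sets borel" "finite_measure \<nu>p" "sets \<nu>n = sets borel" "finite_measure \<nu>n"
    unfolding \<nu>p_def \<nu>n_def using p n sq fq by (auto intro: finite_measure_add_measure)
  have potq: "pot 0 qp x = G 0 (\<lambda>y. ennreal (q y)) x" "pot 0 qm x = G 0 (\<lambda>y. ennreal (- q y)) x" for x
    unfolding pot_def qp_def qm_def G_def using r_measurable_right[of 0 x]
    by (auto simp: nn_integral_density)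
  have pot\<nu>: "pot 0 \<nu>p x = G 0 (\<lambda>y. ennreal (q y)) x + pot 0 \<kappa>p x" "pot 0 \<nu>n x = G 0 (\<lambda>y. ennreal (- q y)) x + pot 0 \<kappa>n x" for x
    unfolding \<nu>p_def \<nu>n_def using pot_add_measure[OF sq(1) p(1)] pot_add_measure[OF sq(2) n(1)] by (auto simp: potq)
  have "AE x in m. v x = clamp_real k (enn2real (pot 0 \<nu>p x) - enn2real (pot 0 \<nu>n x))"
    using vu eq pot_finite[OF tr \<nu>(1,2)] pot_finite[OF tr \<nu>(3,4)]
    by eventually_elim (simp add: pot\<nu> enn2real_plus)
  note trunc = truncated_potential[OF tr \<nu> k v this]
  show "v \<in> extended_domain m D \<E>" by (rule trunc(1))
  have "measure qp UNIV + measure qm UNIV \<le> K"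
  proof -
    have "ennreal (measure qp UNIV + measure qm UNIV) = (\<integral>\<^sup>+x. ennreal (q x) + ennreal (- q x) \<partial>m)"
      using eq_q by (simp add: nn_integral_add qp.emeasure_eq_measure qm.emeasure_eq_measure)
    also have "\<dots> = (\<integral>\<^sup>+x. ennreal \<bar>q x\<bar> \<partial>m)"
      by (intro nn_integral_cong) (auto simp: abs_if ennreal_neg)
    finally have "ennreal (measure qp UNIV + measure qm UNIV) \<le> ennreal K" using Q by simp
    then show ?thesis using K0 by (simp only: ennreal_le_iff)
  qed
  moreover have "measure \<nu>p UNIV = measure qp UNIV + measure \<kappa>p UNIV" "measure \<nu>n UNIV = measure qm UNIV + measure \<kappa>n UNIV"
    unfolding \<nu>p_def \<nu>n_def using p n sq fq by (auto intro!: measure_add_measure)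
  ultimately have "measure \<nu>p UNIV + measure \<nu>n UNIV \<le> 2 * K" by (simp add: K_def)
  from mult_left_mono[OF this k] trunc(2) show "extended_energy m D \<E> v \<le> 2 * k * (measure \<kappa>p UNIV + measure \<kappa>n UNIV)"
    by (simp add: K_def mult.assoc mult.left_commute)
qed

end

section \<open>The semigroup and resolvent of a Hunt process\<close>

text \<open>Time is replaced by a grid point to its right. For each grid the function is a countable
  gluing of measurable ones, and right continuity gives the limit.\<close>

lemma right_continuous_measurable_pair:
  fixes f :: "real \<Rightarrow> 'b \<Rightarrow> real"
  assumes m [measurable]: "\<And>t. f t \<in> borel_measurable N"
    and rc: "\<And>t b. b \<in> space N \<Longrightarrow> ((\<lambda>s. f s b) \<longlongrightarrow> f t b) (at_right t)"
  shows "(\<lambda>z. f (fst z) (snd z)) \<in> borel_measurable (borel \<Otimes>\<^sub>M N)"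
proof (rule borel_measurable_LIMSEQ_real)
  \<comment> \<open>Adding 1 to the floor keeps the grid point strictly to the right of t, even if t
    itself lies on the grid.\<close>
  define g where "g n t = (of_int \<lfloor>real (Suc n) * t\<rfloor> + 1) / real (Suc n)" for n and t :: real
  have gt: "t < g n t" "g n t \<le> t + 1 / real (Suc n)" for n t
  proof -
    have "real (Suc n) * t < of_int \<lfloor>real (Suc n) * t\<rfloor> + 1" by linarith
    then show "t < g n t" unfolding g_def by (simp add: pos_less_divide_eq mult.commute)
    have "of_int \<lfloor>real (Suc n) * t\<rfloor> + 1 \<le> real (Suc n) * t + 1" by linarith
    also have "\<dots> = (t + 1 / real (Suc n)) * real (Suc n)" by (simp add: field_simps)
    finally show "g n t \<le> t + 1 / real (Suc n)" unfolding g_def by (simp only: pos_divide_le_eq of_nat_0_less_iff zero_less_Suc)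
  qed
  have glim: "filterlim (\<lambda>n. g n t) (at_right t) sequentially" for t
  proof -
    have "(\<lambda>n. t + 1 / real (Suc n)) \<longlonglongrightarrow> t + 0"
      by (intro tendsto_add tendsto_const LIMSEQ_Suc[OF lim_1_over_n])
    then have "(\<lambda>n. g n t) \<longlonglongrightarrow> t"
      by (intro tendsto_sandwich[OF _ _ tendsto_const, of t "\<lambda>n. g n t" sequentially "\<lambda>n. t + 1 / real (Suc n)"])
         (use gt in \<open>auto simp: less_imp_le\<close>)
    moreover have "g n t \<noteq> t" for n using gt(1)[of t n] by simp
    ultimately show ?thesis using gt(1) by (simp add: filterlim_at)
  qed
  show "(\<lambda>z. f (g n (fst z)) (snd z)) \<in> borel_measurable (borel \<Otimes>\<^sub>M N)" for n
  proof -
    have "(\<lambda>z. f ((of_int \<lfloor>real (Suc n) * fst z\<rfloor> + 1) / real (Suc n)) (snd z)) \<in> borel_measurable (borel \<Otimes>\<^sub>M N)"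
    proof (rule measurable_compose_countable[where f="\<lambda>i z. f ((of_int i + 1) / real (Suc n)) (snd z)"])
      show "(\<lambda>z. f ((of_int i + 1) / real (Suc n)) (snd z)) \<in> borel_measurable (borel \<Otimes>\<^sub>M N)" for i :: int
        by measurable
      show "(\<lambda>z. \<lfloor>real (Suc n) * fst z\<rfloor>) \<in> measurable (borel \<Otimes>\<^sub>M N) (count_space UNIV)" by measurable
    qed
    then show ?thesis by (simp only: g_def)
  qed
  fix z :: "real \<times> 'b" assume "z \<in> space (borel \<Otimes>\<^sub>M N)"
  then have "snd z \<in> space N" by (auto simp: space_pair_measure)
  from filterlim_compose[OF rc[OF this] glim] show "(\<lambda>n. f (g n (fst z)) (snd z)) \<longlonglongrightarrow> f (fst z) (snd z)" .
qed

section \<open>The Borel structure of the state space with cemetery\<close>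

lemma space_cemetery_borel [simp]: "space (cemetery_borel :: 'a::topological_space option measure) = UNIV"
  by (simp add: cemetery_borel_def)

lemma sets_cemetery_borel: "sets (cemetery_borel :: 'a::topological_space option measure) = sigma_sets UNIV {U. openin cemetery_topology U}"
  by (simp add: cemetery_borel_def)

lemma openin_cemetery_Some: "open U \<Longrightarrow> openin cemetery_topology (Some ` (U :: 'a::topological_space set))"
  by (auto simp: cemetery_topology_def openin_Alexandroff_compactification)

lemma openin_cemetery_cases:
  assumes "openin cemetery_topology (V :: 'a::t2_space option set)"
  obtains U where "open U" "V = Some ` U" | C where "closed C" "V = - Some ` C"
proof -
  have "insert None (Some ` (- C)) = - Some ` C" for C :: "'a set"
  proof (rule set_eqI)
    show "x \<in> insert None (Some ` (- C)) \<longleftrightarrow> x \<in> - Some ` C" for x by (cases x) auto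
  qed
  with assms that show ?thesis
    unfolding cemetery_topology_def openin_Alexandroff_compactification by (auto simp: Compl_eq_Diff_UNIV)
qed

lemma Some_image_sets:
  assumes "B \<in> sets (borel :: 'a::topological_space measure)"
  shows "Some ` B \<in> sets (cemetery_borel :: 'a option measure)"
proof -
  have op: "Some ` U \<in> sets (cemetery_borel :: 'a option measure)" if "open U" for U :: "'a set"
    unfolding sets_cemetery_borel using openin_cemetery_Some[OF that] by auto
  have "B \<in> sigma_sets UNIV {S :: 'a set. open S}" using assms by (simp add: borel_def)
  then show ?thesis
  proof induction
    case (Compl a)
    have "Some ` (UNIV - a) = Some ` UNIV - Some ` a" by auto
    then show ?case using op[OF open_UNIV] Compl by auto
  next
    case (Union a)
    then show ?case by (simp add: image_UN sets.countable_UN)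
  qed (auto intro: op)
qed

lemma measurable_case_option_cemetery:
  assumes h: "h \<in> measurable (borel :: 'a::topological_space measure) N" and c: "c \<in> space N"
  shows "case_option c h \<in> measurable (cemetery_borel :: 'a option measure) N"
proof (rule measurableI)
  show "case_option c h z \<in> space N" for z using c measurable_space[OF h] by (auto split: option.split)
  fix A assume A: "A \<in> sets N"
  have "h -` A \<in> sets (borel :: 'a measure)" using measurable_sets[OF h A] by simp
  then have s: "Some ` (h -` A) \<in> sets (cemetery_borel :: 'a option measure)" by (rule Some_image_sets)
  have N: "{None} \<in> sets (cemetery_borel :: 'a option measure)"
  proof -
    have "{None} = (UNIV :: 'a option set) - Some ` UNIV" by (auto simp: image_iff)
    then show ?thesis using Some_image_sets[of "UNIV :: 'a set"] sets.compl_sets[of "Some ` UNIV" "cemetery_borel :: 'a option measure"] by simp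
  qed
  have "case_option c h -` A = (if c \<in> A then insert None (Some ` (h -` A)) else Some ` (h -` A))"
  proof (rule set_eqI)
    show "z \<in> case_option c h -` A \<longleftrightarrow> z \<in> (if c \<in> A then insert None (Some ` (h -` A)) else Some ` (h -` A))" for z
      by (cases z) auto
  qed
  then show "case_option c h -` A \<inter> space cemetery_borel \<in> sets cemetery_borel"
    using s sets.Un[OF N s] by auto
qed

lemma measurable_Some_cemetery: "Some \<in> measurable borel (cemetery_borel :: 'a::t2_space option measure)"
  unfolding cemetery_borel_def
proof (rule measurable_measure_of)
  fix V :: "'a option set" assume "V \<in> {U. openin cemetery_topology U}"
  then have "openin cemetery_topology V" by simp
  then show "Some -` V \<inter> space borel \<in> sets borel"
  proof (cases rule: openin_cemetery_cases)
    case (1 U) then show ?thesis by (simp add: inj_vimage_image_eq)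
  next
    case (2 C) then show ?thesis by (simp add: vimage_Compl inj_vimage_image_eq)
  qed
qed auto

section \<open>Joint measurability of paths and transition kernels\<close>

context Hunt_process
begin

lemma space_P [simp]: "space (P z) = space M"
  using sets_eq_imp_space_eq[OF sets_P] .

lemma measurable_P_eq: "measurable (P z) N = measurable M N"
  by (rule measurable_cong_sets[OF sets_P refl])

lemma space_F: "space (F t) = space M"
  using filtration_F by (simp add: filtration_def)

lemma X_measurable: "X t \<in> measurable M cemetery_borel"
  using adapted[of t] sets_F[of t] space_F[of t] unfolding measurable_def by auto

definition Xh :: "('a \<Rightarrow> 'c) \<Rightarrow> 'c \<Rightarrow> real \<Rightarrow> 'w \<Rightarrow> 'c" where
  "Xh h c t \<omega> = case_option c h (X (ennreal t) \<omega>)"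

lemma Xh_measurable:
  assumes "h \<in> measurable borel N" "c \<in> space N"
  shows "Xh h c t \<in> measurable M N"
  unfolding Xh_def[abs_def] by (rule measurable_compose[OF X_measurable measurable_case_option_cemetery[OF assms]])

lemma X_dead: "\<omega> \<in> space M \<Longrightarrow> X s \<omega> = None \<Longrightarrow> s \<le> t \<Longrightarrow> X t \<omega> = None"
  by (rule X_absorbed) (auto simp: lifetime_def intro: Inf_lower2)

lemma filterlim_ennreal_at_right:
  assumes "0 \<le> t"
  shows "filterlim ennreal (at_right (ennreal t)) (at_right t)"
  unfolding filterlim_at
proof
  have "eventually (\<lambda>x. t < x) (at_right t)" by (simp add: eventually_at_right_less)
  then show "\<forall>\<^sub>F x in at_right t. ennreal x \<in> {ennreal t<..} \<and> ennreal x \<noteq> ennreal t"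
    by eventually_elim (use assms in \<open>auto simp: ennreal_less_iff\<close>)
  show "(ennreal \<longlongrightarrow> ennreal t) (at_right t)" by (intro tendsto_ennrealI tendsto_ident_at)
qed

lemma Xh_right_continuous:
  fixes f :: "'a \<Rightarrow> real"
  assumes f: "continuous_on UNIV f" and \<omega>: "\<omega> \<in> space M"
  shows "((\<lambda>s. Xh f 0 s \<omega>) \<longlongrightarrow> Xh f 0 t \<omega>) (at_right t)"
\<comment> \<open>For negative t the conversion \<open>ennreal t\<close> is 0, so the path is
  constant on the negative half-line. This extension lets real time range over the whole
  line.\<close>
proof (cases "t < 0")
  case True
  have "\<forall>\<^sub>F s in at_right t. s < 0" by (rule order_tendstoD(2)[OF tendsto_ident_at True])
  then show ?thesis
    by (rule tendsto_eventually[OF eventually_mono]) (use True in \<open>simp add: Xh_def ennreal_neg\<close>)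
next
  case False
  then have t: "0 \<le> t" by simp
  show ?thesis
  proof (cases "X (ennreal t) \<omega>")
    case None
    have "\<forall>\<^sub>F s in at_right t. t < s" by (simp add: eventually_at_right_less)
    then have "\<forall>\<^sub>F s in at_right t. Xh f 0 s \<omega> = Xh f 0 t \<omega>"
    proof eventually_elim
      case (elim s)
      then have "X (ennreal s) \<omega> = None" by (intro X_dead[OF \<omega> None]) (simp add: ennreal_leI)
      then show ?case by (simp add: Xh_def None)
    qed
    then show ?thesis by (rule tendsto_eventually)
  next
    case (Some x)
    show ?thesis
    proof (rule topological_tendstoI)
      fix V :: "real set" assume V: "open V" "Xh f 0 t \<omega> \<in> V"
      then have fx: "f x \<in> V" by (simp add: Xh_def Some)
      have "open (f -` V)" using open_vimage[OF V(1) f] .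
      then have "openin cemetery_topology (Some ` (f -` V))" by (rule openin_cemetery_Some)
      moreover have "X (ennreal t) \<omega> \<in> Some ` (f -` V)" using fx Some by simp
      ultimately have "\<forall>\<^sub>F s in at_right (ennreal t). X s \<omega> \<in> Some ` (f -` V)"
        using right_continuous[OF \<omega>, of "ennreal t"] unfolding limitin_def by auto
      from eventually_compose_filterlim[OF this filterlim_ennreal_at_right[OF t]]
      show "\<forall>\<^sub>F s in at_right t. Xh f 0 s \<omega> \<in> V"
        by eventually_elim (auto simp: Xh_def)
    qed
  qed
qed

lemma X_measurable_pair: "(\<lambda>z. X (ennreal (fst z)) (snd z)) \<in> measurable (borel \<Otimes>\<^sub>M M) cemetery_borel"
proof -
  let ?Y = "\<lambda>z. X (ennreal (fst z)) (snd z)"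
  let ?S = "space (borel \<Otimes>\<^sub>M M) :: (real \<times> 'w) set"
  have op: "?Y -` (Some ` U) \<inter> ?S \<in> sets (borel \<Otimes>\<^sub>M M)" if U: "open U" for U
  proof -
    obtain f :: "'a \<Rightarrow> real" where f: "continuous_on UNIV f" "U = {x. 0 < f x}"
    \<comment> \<open>The distance to an empty complement is 0 by convention and would not describe
      U.\<close>
    proof (cases "U = UNIV")
      case True then show ?thesis by (intro that[of "\<lambda>_. 1"]) auto
    next
      case False
      have "closed (- U)" using U by (rule closed_Compl)
      then have "infdist x (- U) = 0 \<longleftrightarrow> x \<in> - U" for x using in_closed_iff_infdist_zero[of "- U"] False by auto
      then have "U = {x. 0 < infdist x (- U)}" using infdist_nonneg by (auto simp: less_le)
      then show ?thesis by (intro that[of "\<lambda>x. infdist x (- U)"]) (auto intro: continuous_on_infdist continuous_on_id)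
    qed
    have fm: "f \<in> borel_measurable borel" using f(1) by (rule borel_measurable_continuous_onI)
    have "(\<lambda>z. Xh f 0 (fst z) (snd z)) \<in> borel_measurable (borel \<Otimes>\<^sub>M M)"
      by (rule right_continuous_measurable_pair[OF Xh_measurable[OF fm] Xh_right_continuous[OF f(1)]]) auto
    then have "(\<lambda>z. Xh f 0 (fst z) (snd z)) -` {0<..} \<inter> ?S \<in> sets (borel \<Otimes>\<^sub>M M)"
      by (rule measurable_sets) simp
    moreover have "(\<lambda>z. Xh f 0 (fst z) (snd z)) -` {0<..} = ?Y -` (Some ` U)"
      by (auto simp: Xh_def f(2) split: option.splits)
    ultimately show ?thesis by simp
  qed
  have B: "?Y -` (Some ` B) \<inter> ?S \<in> sets (borel \<Otimes>\<^sub>M M)" if "B \<in> sets borel" for B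
  proof -
    have "B \<in> sigma_sets UNIV {S :: 'a set. open S}" using that by (simp add: borel_def)
    then show ?thesis
    proof induction
      case (Compl a)
      have "?Y -` (Some ` (UNIV - a)) \<inter> ?S = (?Y -` (Some ` UNIV) \<inter> ?S) - (?Y -` (Some ` a) \<inter> ?S)" by auto
      then show ?case using op[OF open_UNIV] Compl by auto
    next
      case (Union a)
      have "?Y -` (Some ` (\<Union>i. a i)) \<inter> ?S = (\<Union>i. ?Y -` (Some ` a i) \<inter> ?S)" by auto
      also have "\<dots> \<in> sets (borel \<Otimes>\<^sub>M M)" by (intro sets.countable_UN image_subsetI Union.IH)
      finally show ?case .
    qed (auto intro: op)
  qed
  show ?thesis
    unfolding cemetery_borel_def
  proof (rule measurable_measure_of)
    fix V :: "'a option set" assume "V \<in> {U. openin cemetery_topology U}"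
    then have "openin cemetery_topology V" by simp
    then show "?Y -` V \<inter> ?S \<in> sets (borel \<Otimes>\<^sub>M M)"
    proof (cases rule: openin_cemetery_cases)
      case (1 U) then show ?thesis using op by simp
    next
      case (2 C)
      have "?Y -` V \<inter> ?S = ?S - (?Y -` (Some ` C) \<inter> ?S)" using 2 by auto
      then show ?thesis using B[of C] 2 by auto
    qed
  qed auto
qed

lemma Xh_measurable_pair:
  assumes "h \<in> measurable borel N" "c \<in> space N"
  shows "(\<lambda>z. Xh h c (fst z) (snd z)) \<in> measurable (borel \<Otimes>\<^sub>M M) N"
  unfolding Xh_def by (rule measurable_compose[OF X_measurable_pair measurable_case_option_cemetery[OF assms]])

text \<open>The law of the position at time t on the space with cemetery. Killing becomes mass at
  \<open>None\<close>, so each value is a probability measure and measurability in the space of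
  subprobabilities is available.\<close>

definition K :: "real \<Rightarrow> 'a \<Rightarrow> 'a option measure" where
  "K t y = distr (P (Some y)) cemetery_borel (X (ennreal t))"

lemma prob_K: "prob_space (K t y)"
  unfolding K_def by (intro prob_space.prob_space_distr prob_P) (simp add: measurable_P_eq X_measurable)

lemma sets_K [simp, measurable_cong]: "sets (K t y) = sets cemetery_borel"
  by (simp add: K_def)

lemma emeasure_K: "B \<in> sets cemetery_borel \<Longrightarrow> emeasure (K t y) B = emeasure (P (Some y)) {\<omega>\<in>space M. X (ennreal t) \<omega> \<in> B}"
  unfolding K_def by (subst emeasure_distr) (auto simp: measurable_P_eq X_measurable vimage_def Int_def conj_commute)

lemma transition_K:
  assumes "h \<in> borel_measurable borel"
  shows "transition P X t h y = (\<integral>\<^sup>+z. case_option 0 h z \<partial>K t y)"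
  unfolding K_def transition_def
  by (rule nn_integral_distr[symmetric])
     (auto simp: measurable_P_eq X_measurable intro: measurable_case_option_cemetery[OF assms])

lemma K_measurable1: "K t \<in> measurable borel (subprob_algebra cemetery_borel)"
proof (rule measurable_subprob_algebra)
  fix B :: "'a option set" assume B: "B \<in> sets cemetery_borel"
  interpret prob_space "P z" for z by (rule prob_P)
  have "(\<lambda>z. ennreal (measure (P z) {\<omega>\<in>space M. X (ennreal t) \<omega> \<in> B})) \<in> borel_measurable cemetery_borel"
    using measurable_P[OF B] by measurable
  from measurable_compose[OF measurable_Some_cemetery this]
  show "(\<lambda>y. emeasure (K t y) B) \<in> borel_measurable borel"
    by (simp add: emeasure_K[OF B] emeasure_eq_measure)
qed (simp_all add: prob_space_imp_subprob_space prob_K)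

lemma transition_right_continuous:
  fixes f :: "'a \<Rightarrow> real"
  assumes f: "continuous_on UNIV f" and b: "\<And>x. \<bar>f x\<bar> \<le> c"
  shows "((\<lambda>s. \<integral>\<omega>. Xh f 0 s \<omega> \<partial>P (Some y)) \<longlongrightarrow> (\<integral>\<omega>. Xh f 0 t \<omega> \<partial>P (Some y))) (at_right t)"
proof (rule tendsto_at_right_sequentially)
  show "t < t + 1" by simp
  fix S assume S: "\<And>n. t < S n" "S \<longlonglongrightarrow> t"
  have fm: "f \<in> borel_measurable borel" using f by (rule borel_measurable_continuous_onI)
  interpret prob_space "P (Some y)" by (rule prob_P)
  have "S n \<noteq> t" for n using S(1)[of n] by simp
  with S have Sl: "filterlim S (at_right t) sequentially" by (simp add: filterlim_at)
  show "(\<lambda>n. \<integral>\<omega>. Xh f 0 (S n) \<omega> \<partial>P (Some y)) \<longlonglongrightarrow> (\<integral>\<omega>. Xh f 0 t \<omega> \<partial>P (Some y))"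
  proof (rule integral_dominated_convergence[where w="\<lambda>_. c"])
    show "AE \<omega> in P (Some y). (\<lambda>n. Xh f 0 (S n) \<omega>) \<longlonglongrightarrow> Xh f 0 t \<omega>"
      using filterlim_compose[OF Xh_right_continuous[OF f] Sl] by (intro AE_I2) simp
    have "0 \<le> c" using b[of undefined] by (meson abs_ge_zero order_trans)
    then show "AE \<omega> in P (Some y). norm (Xh f 0 (S n) \<omega>) \<le> c" for n
      using b by (intro AE_I2) (auto simp: Xh_def split: option.split)
  qed (auto simp: measurable_P_eq intro: Xh_measurable[OF fm])
qed

text \<open>For continuous bounded functions, expectations are right-continuous in time by dominated
  convergence, hence jointly measurable. Indicators of open sets are their limits, and open sets
  generate and are stable under intersection.\<close>

lemma K_measurable: "(\<lambda>z. K (fst z) (snd z)) \<in> measurable (borel \<Otimes>\<^sub>M borel) (subprob_algebra cemetery_borel)"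
proof (rule measurable_subprob_algebra_generated[where G="{U. openin cemetery_topology U}" and \<Omega>=UNIV])
  have op: "(\<lambda>z. emeasure (K (fst z) (snd z)) (Some ` U)) \<in> borel_measurable (borel \<Otimes>\<^sub>M borel)" if U: "open U" for U
  proof -
    obtain f :: "'a \<Rightarrow> real" where f: "continuous_on UNIV f" "U = {x. 0 < f x}" "\<And>x. 0 \<le> f x"
    proof (cases "U = UNIV")
      case True then show ?thesis by (intro that[of "\<lambda>_. 1"]) auto
    next
      case False
      have "closed (- U)" using U by (rule closed_Compl)
      then have "infdist x (- U) = 0 \<longleftrightarrow> x \<in> - U" for x using in_closed_iff_infdist_zero[of "- U"] False by auto
      then have "U = {x. 0 < infdist x (- U)}" using infdist_nonneg by (auto simp: less_le)
      then show ?thesis by (intro that[of "\<lambda>x. infdist x (- U)"]) (auto intro: continuous_on_infdist continuous_on_id infdist_nonneg)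
    qed
    \<comment> \<open>Continuous approximations increasing to the indicator of U; the indicator
      itself need not be right-continuous along paths.\<close>
    define g where "g n x = min 1 (real n * f x)" for n x
    have gc: "continuous_on UNIV (g n)" for n unfolding g_def by (intro continuous_intros f(1))
    have gb: "\<bar>g n x\<bar> \<le> 1" "0 \<le> g n x" for n x using f(3)[of x] by (auto simp: g_def)
    have gm: "g n \<in> borel_measurable borel" for n using gc by (rule borel_measurable_continuous_onI)
    define E where "E n t y = (\<integral>\<omega>. Xh (g n) 0 t \<omega> \<partial>P (Some y))" for n t y
    have Em: "(\<lambda>z. E n (fst z) (snd z)) \<in> borel_measurable (borel \<Otimes>\<^sub>M borel)" for n
    proof (rule right_continuous_measurable_pair)
      show "((\<lambda>s. E n s y) \<longlongrightarrow> E n t y) (at_right t)" for t y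
        unfolding E_def by (rule transition_right_continuous[OF gc gb(1)])
      have "E n t y = (\<integral>z. case_option 0 (g n) z \<partial>K t y)" for t y
        unfolding E_def K_def Xh_def
        by (rule integral_distr[symmetric]) (auto simp: measurable_P_eq X_measurable intro: measurable_case_option_cemetery[OF gm])
      moreover have "(\<lambda>y. \<integral>z. case_option 0 (g n) z \<partial>K t y) \<in> borel_measurable borel" for t
        by (rule measurable_compose[OF K_measurable1 integral_measurable_subprob_algebra])
           (rule measurable_case_option_cemetery[OF gm], simp)
      ultimately show "E n t \<in> borel_measurable borel" for t by (simp cong: measurable_cong)
    qed
    have "(\<lambda>z. measure (K (fst z) (snd z)) (Some ` U)) \<in> borel_measurable (borel \<Otimes>\<^sub>M borel)"
    proof (rule borel_measurable_LIMSEQ_real[OF _ Em])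
      fix z :: "real \<times> 'a"
      interpret prob_space "P (Some (snd z))" by (rule prob_P)
      have glim: "(\<lambda>n. g n x) \<longlonglongrightarrow> indicator U x" for x
      proof (cases "x \<in> U")
        case True
        then have "0 < f x" using f(2) by simp
        obtain N where "1 / f x \<le> real N" using real_arch_simple by blast
        then have "1 \<le> real n * f x" if "n \<ge> N" for n
          using \<open>0 < f x\<close> that by (simp add: pos_divide_le_eq) (meson mult_right_mono of_nat_le_iff order_trans less_imp_le)
        then have "\<forall>\<^sub>F n in sequentially. g n x = 1" unfolding eventually_sequentially g_def by (intro exI[of _ N]) auto
        then show ?thesis using True by (simp add: tendsto_eventually)
      next
        case False
        then have "f x = 0" using f(2) f(3)[of x] by auto
        then show ?thesis using False by (simp add: g_def)
      qed
      have "(\<lambda>n. E n (fst z) (snd z)) \<longlonglongrightarrow> (\<integral>\<omega>. Xh (indicator U) 0 (fst z) \<omega> \<partial>P (Some (snd z)))"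
        unfolding E_def
      proof (rule integral_dominated_convergence[where w="\<lambda>_. 1"])
        show "AE \<omega> in P (Some (snd z)). (\<lambda>n. Xh (g n) 0 (fst z) \<omega>) \<longlonglongrightarrow> Xh (indicator U) 0 (fst z) \<omega>"
          by (intro AE_I2) (auto simp: Xh_def glim split: option.split)
        show "AE \<omega> in P (Some (snd z)). norm (Xh (g n) 0 (fst z) \<omega>) \<le> 1" for n
          using gb by (intro AE_I2) (auto simp: Xh_def split: option.split)
        have "(indicator U :: 'a \<Rightarrow> real) \<in> borel_measurable borel" using U by simp
        then show "Xh (indicator U :: 'a \<Rightarrow> real) 0 (fst z) \<in> borel_measurable (P (Some (snd z)))"
          unfolding measurable_P_eq by (rule Xh_measurable) simp
      qed (auto simp: measurable_P_eq intro: Xh_measurable[OF gm])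
      also have "(\<integral>\<omega>. Xh (indicator U) 0 (fst z) \<omega> \<partial>P (Some (snd z))) = (\<integral>\<omega>. indicator {\<omega>\<in>space M. X (ennreal (fst z)) \<omega> \<in> Some ` U} \<omega> \<partial>P (Some (snd z)))"
        by (intro Bochner_Integration.integral_cong) (auto simp: Xh_def indicator_def split: option.split)
      also have "\<dots> = measure (P (Some (snd z))) {\<omega>\<in>space M. X (ennreal (fst z)) \<omega> \<in> Some ` U}"
        unfolding Bochner_Integration.integral_indicator by (rule arg_cong[where f="measure _"]) auto
      also have "\<dots> = measure (K (fst z) (snd z)) (Some ` U)"
        using emeasure_K[OF Some_image_sets, of U "fst z" "snd z"] U by (simp add: measure_def)
      finally show "(\<lambda>n. E n (fst z) (snd z)) \<longlonglongrightarrow> measure (K (fst z) (snd z)) (Some ` U)" .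
    qed
    moreover have "emeasure (K t y) B = ennreal (measure (K t y) B)" for t y B
      using finite_measure.emeasure_eq_measure[OF prob_space.axioms(1)[OF prob_K]] .
    ultimately show ?thesis by simp
  qed
  fix V :: "'a option set" assume "V \<in> {U. openin cemetery_topology U}"
  then have V: "openin cemetery_topology V" by simp
  then show "(\<lambda>z. emeasure (K (fst z) (snd z)) V) \<in> borel_measurable (borel \<Otimes>\<^sub>M borel)"
  proof (cases rule: openin_cemetery_cases)
    case (1 U) then show ?thesis using op by simp
  next
    case (2 C)
    \<comment> \<open>Two complements express a neighbourhood of the cemetery through images of open
      subsets of the state space, for which measurability is known.\<close>
    have "emeasure (K t y) V = 1 - (emeasure (K t y) (Some ` UNIV) - emeasure (K t y) (Some ` (- C)))" for t y
    proof -
      interpret prob_space "K t y" by (rule prob_K)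
      have s: "Some ` C \<in> sets (cemetery_borel :: 'a option measure)" "Some ` (- C) \<in> sets (cemetery_borel :: 'a option measure)"
        "Some ` UNIV \<in> sets (cemetery_borel :: 'a option measure)"
        using 2 by (auto intro!: Some_image_sets)
      have "emeasure (K t y) (Some ` UNIV) - emeasure (K t y) (Some ` (- C)) = emeasure (K t y) (Some ` UNIV - Some ` (- C))"
        using s by (intro emeasure_Diff[symmetric]) auto
      also have "Some ` UNIV - Some ` (- C) = Some ` C" by auto
      also have "1 - emeasure (K t y) (Some ` C) = emeasure (K t y) (UNIV - Some ` C)"
        using s emeasure_space_1 sets_eq_imp_space_eq[OF sets_K, of t y] sets.top[of "cemetery_borel :: 'a option measure"]
        by (subst emeasure_Diff) auto
      finally show ?thesis using 2 by (simp add: Compl_eq_Diff_UNIV)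
    qed
    moreover have "(\<lambda>z. 1 - (emeasure (K (fst z) (snd z)) (Some ` UNIV) - emeasure (K (fst z) (snd z)) (Some ` (- C)))) \<in> borel_measurable (borel \<Otimes>\<^sub>M borel)"
      using 2 by (intro borel_measurable_minus_ennreal borel_measurable_const op open_UNIV open_Compl)
    ultimately show ?thesis by simp
  qed
next
  have "emeasure (K t y) UNIV = 1" for t y
    using prob_space.emeasure_space_1[OF prob_K, of t y] sets_eq_imp_space_eq[OF sets_K, of t y] by simp
  then show "(\<lambda>z. emeasure (K (fst z) (snd z)) UNIV) \<in> borel_measurable (borel \<Otimes>\<^sub>M borel)" by simp
qed (auto simp: sets_cemetery_borel Int_stable_def prob_space_imp_subprob_space prob_K intro: openin_Int)

lemma transition_measurable_pair:
  assumes h: "h \<in> borel_measurable borel"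
  shows "(\<lambda>z. transition P X (fst z) h (snd z)) \<in> borel_measurable (borel \<Otimes>\<^sub>M borel)"
  unfolding transition_K[OF h]
  by (rule measurable_compose[OF K_measurable nn_integral_measurable_subprob_algebra])
     (rule measurable_case_option_cemetery[OF h], simp)

lemma transition_measurable:
  assumes h: "h \<in> borel_measurable borel"
  shows "transition P X t h \<in> borel_measurable borel"
  using measurable_compose[OF measurable_Pair1' transition_measurable_pair[OF h], of t] by simp

end

text \<open>The half-line is built into the weight, so time integrals run over the whole line and
  translations need no adjustment of the limits.\<close>

definition exp_weight :: "real \<Rightarrow> real \<Rightarrow> ennreal" where
  "exp_weight \<alpha> t = ennreal (exp (- \<alpha> * t)) * indicator {0..} t"

lemma exp_weight_measurable [measurable]: "exp_weight \<alpha> \<in> borel_measurable borel"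
  unfolding exp_weight_def[abs_def] by measurable

text \<open>The resolvent equation in its scalar form: convolving the two exponentials over [0, v]
  gives their difference divided by \<beta> - \<alpha>.\<close>

lemma exp_weight_convolution:
  assumes "\<alpha> < \<beta>"
  shows "ennreal (\<beta> - \<alpha>) * (\<integral>\<^sup>+t. exp_weight \<beta> t * exp_weight \<alpha> (v - t) \<partial>lborel) + exp_weight \<beta> v = exp_weight \<alpha> v"
proof (cases "0 \<le> v")
  case False
  then have z: "exp_weight \<beta> t * exp_weight \<alpha> (v - t) = 0" for t by (auto simp: exp_weight_def indicator_def)
  have "(\<integral>\<^sup>+t. exp_weight \<beta> t * exp_weight \<alpha> (v - t) \<partial>lborel) = 0" by (simp only: z nn_integral_const mult_zero_left)
  moreover have "exp_weight \<beta> v = 0" "exp_weight \<alpha> v = 0" using False by (auto simp: exp_weight_def)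
  ultimately show ?thesis by (simp only: mult_zero_right add_0)
next
  case True
  let ?f = "\<lambda>t. (\<beta> - \<alpha>) * exp (- \<alpha> * v - (\<beta> - \<alpha>) * t)" and ?F = "\<lambda>t. - exp (- \<alpha> * v - (\<beta> - \<alpha>) * t)"
  have "ennreal (\<beta> - \<alpha>) * (\<integral>\<^sup>+t. exp_weight \<beta> t * exp_weight \<alpha> (v - t) \<partial>lborel) =
      (\<integral>\<^sup>+t. ennreal (\<beta> - \<alpha>) * (exp_weight \<beta> t * exp_weight \<alpha> (v - t)) \<partial>lborel)"
    by (rule nn_integral_cmult[symmetric]) measurable
  also have "\<dots> = (\<integral>\<^sup>+t. ennreal (?f t) * indicator {0..v} t \<partial>lborel)"
  proof (intro nn_integral_cong)
    fix t
    have "exp (- \<beta> * t) * exp (- \<alpha> * (v - t)) = exp (- \<alpha> * v - (\<beta> - \<alpha>) * t)"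
      unfolding exp_add[symmetric] by (rule arg_cong[where f=exp]) (simp add: algebra_simps)
    then show "ennreal (\<beta> - \<alpha>) * (exp_weight \<beta> t * exp_weight \<alpha> (v - t)) = ennreal (?f t) * indicator {0..v} t"
      using assms by (auto simp: exp_weight_def indicator_def ennreal_mult[symmetric])
  qed
  also have "\<dots> = ennreal (?F v - ?F 0)"
    by (rule nn_integral_FTC_Icc) (use True assms in \<open>auto intro!: derivative_eq_intros simp: algebra_simps\<close>)
  also have "?F v - ?F 0 = exp (- \<alpha> * v) - exp (- \<beta> * v)" by (simp add: algebra_simps)
  finally have e: "ennreal (\<beta> - \<alpha>) * (\<integral>\<^sup>+t. exp_weight \<beta> t * exp_weight \<alpha> (v - t) \<partial>lborel) = ennreal (exp (- \<alpha> * v) - exp (- \<beta> * v))" .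
  have "exp (- \<beta> * v) \<le> exp (- \<alpha> * v)" using True assms by (simp add: mult_right_mono)
  then show ?thesis unfolding e using True by (simp add: exp_weight_def ennreal_plus[symmetric] del: ennreal_plus)
qed

lemma exp_weight_mass:
  assumes "0 < \<alpha>"
  shows "ennreal \<alpha> * (\<integral>\<^sup>+t. exp_weight \<alpha> t \<partial>lborel) = 1"
proof -
  have "ennreal \<alpha> * (\<integral>\<^sup>+t. exp_weight \<alpha> t \<partial>lborel) = (\<integral>\<^sup>+t. ennreal \<alpha> * exp_weight \<alpha> t \<partial>lborel)"
    by (rule nn_integral_cmult[symmetric]) measurable
  also have "\<dots> = (\<integral>\<^sup>+t. ennreal (\<alpha> * exp (- \<alpha> * t)) * indicator {0..} t \<partial>lborel)"
    using assms by (intro nn_integral_cong) (simp add: exp_weight_def ennreal_mult mult.assoc)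
  also have "\<dots> = ennreal (0 - (- exp (- \<alpha> * 0)))"
  proof (rule nn_integral_FTC_atLeast)
    have "filterlim (\<lambda>t. \<alpha> * t) at_top at_top"
      using assms by (intro filterlim_tendsto_pos_mult_at_top[OF tendsto_const]) (auto intro: filterlim_ident)
    then have "filterlim (\<lambda>t. - (\<alpha> * t)) at_bot at_top" by (simp add: filterlim_uminus_at_top)
    from filterlim_compose[OF exp_at_bot this] have "((\<lambda>t. exp (- (\<alpha> * t))) \<longlongrightarrow> 0) at_top" .
    from tendsto_minus[OF this] show "((\<lambda>t. - exp (- \<alpha> * t)) \<longlongrightarrow> 0) at_top" by simp
  qed (use assms in \<open>auto intro!: derivative_eq_intros\<close>)
  finally show ?thesis by simp
qed

section \<open>Semigroup property and resolvent equation of the process\<close>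

context Hunt_process
begin

lemma transition_mono: "(\<And>y. h y \<le> k y) \<Longrightarrow> transition P X t h x \<le> transition P X t k x"
  unfolding transition_def by (intro nn_integral_mono) (auto split: option.split)

lemma transition_le_const:
  assumes "\<And>y. h y \<le> c"
  shows "transition P X t h x \<le> c"
proof -
  interpret prob_space "P (Some x)" by (rule prob_P)
  have "transition P X t h x \<le> (\<integral>\<^sup>+\<omega>. c \<partial>P (Some x))"
    unfolding transition_def using assms by (intro nn_integral_mono) (auto split: option.split)
  then show ?thesis using emeasure_space_1 by simp
qed

lemma transition_cmult:
  assumes "h \<in> borel_measurable borel"
  shows "transition P X t (\<lambda>y. c * h y) x = c * transition P X t h x"
proof -
  have "transition P X t (\<lambda>y. c * h y) x = (\<integral>\<^sup>+\<omega>. c * case_option 0 h (X (ennreal t) \<omega>) \<partial>P (Some x))"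
    unfolding transition_def by (intro nn_integral_cong) (auto split: option.split)
  also have "\<dots> = c * transition P X t h x"
    unfolding transition_def
    using Xh_measurable[of h borel 0 t] assms by (intro nn_integral_cmult) (simp add: measurable_P_eq Xh_def[abs_def])
  finally show ?thesis .
qed

lemma transition_add:
  assumes "h \<in> borel_measurable borel" "k \<in> borel_measurable borel"
  shows "transition P X t (\<lambda>y. h y + k y) x = transition P X t h x + transition P X t k x"
proof -
  have "transition P X t (\<lambda>y. h y + k y) x = (\<integral>\<^sup>+\<omega>. case_option 0 h (X (ennreal t) \<omega>) + case_option 0 k (X (ennreal t) \<omega>) \<partial>P (Some x))"
    unfolding transition_def by (intro nn_integral_cong) (auto split: option.split)
  also have "\<dots> = transition P X t h x + transition P X t k x"
    unfolding transition_def
    using Xh_measurable[of h borel 0 t] Xh_measurable[of k borel 0 t] assms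
    by (intro nn_integral_add) (simp_all add: measurable_P_eq Xh_def[abs_def])
  finally show ?thesis .
qed

lemma transition_SUP:
  assumes "\<And>i. h i \<in> borel_measurable borel" "incseq h"
  shows "transition P X t (\<lambda>y. SUP i. h i y) x = (SUP i. transition P X t (h i) x)"
proof -
  have "transition P X t (\<lambda>y. SUP i. h i y) x = (\<integral>\<^sup>+\<omega>. (SUP i. case_option 0 (h i) (X (ennreal t) \<omega>)) \<partial>P (Some x))"
    unfolding transition_def by (intro nn_integral_cong) (auto split: option.split)
  also have "\<dots> = (SUP i. transition P X t (h i) x)"
    unfolding transition_def
  proof (rule nn_integral_monotone_convergence_SUP)
    show "incseq (\<lambda>i \<omega>. case_option 0 (h i) (X (ennreal t) \<omega>))"
      using assms(2) by (auto simp: incseq_def le_fun_def split: option.split)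
    show "(\<lambda>\<omega>. case_option 0 (h i) (X (ennreal t) \<omega>)) \<in> borel_measurable (P (Some x))" for i
      using Xh_measurable[of "h i" borel 0 t] assms(1) by (simp add: measurable_P_eq Xh_def[abs_def])
  qed
  finally show ?thesis .
qed

lemma P_None: "B \<in> sets borel \<Longrightarrow> emeasure (P None) {\<omega>\<in>space M. X t \<omega> \<in> Some ` B} = 0"
proof -
  assume B: "B \<in> sets borel"
  have "AE \<omega> in P None. \<not> X t \<omega> \<in> Some ` B"
    using normal[of None] AE_space
  proof eventually_elim
    case (elim \<omega>)
    then have "X t \<omega> = None" by (intro X_dead[of \<omega> 0 t]) auto
    then show ?case by auto
  qed
  moreover have "{\<omega>\<in>space M. X t \<omega> \<in> Some ` B} \<in> sets (P None)"
    using measurable_sets[OF X_measurable Some_image_sets[OF B], of t] by (simp add: sets_P vimage_def Int_def conj_commute)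
  ultimately show ?thesis by (subst (asm) AE_iff_measurable) auto
qed

text \<open>The strong Markov property at a constant stopping time, with the conditional expectation
  integrated out.\<close>

lemma Chapman_Kolmogorov_emeasure:
  assumes B: "B \<in> sets cemetery_borel" and s: "s < \<infinity>"
  shows "emeasure (P z) {\<omega>\<in>space M. X (t + s) \<omega> \<in> B} = (\<integral>\<^sup>+\<omega>. emeasure (P (X t \<omega>)) {\<omega>'\<in>space M. X s \<omega>' \<in> B} \<partial>P z)"
proof -
  interpret Pz: prob_space "P z" by (rule prob_P)
  interpret F: filtration "space M" F by (rule filtration_F)
  let ?S = "F.pre_sigma (\<lambda>_. t)"
  let ?A = "{\<omega>\<in>space M. X (t + s) \<omega> \<in> B}"
  let ?m = "\<lambda>\<omega>. measure (P (X t \<omega>)) {\<omega>'\<in>space M. X s \<omega>' \<in> B}"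
  have A: "?A \<in> sets (P z)"
    using measurable_sets[OF X_measurable B, of "t + s"] by (simp add: sets_P vimage_def Int_def conj_commute)
  have st: "stopping_time F (\<lambda>_. t)" by (rule stopping_time_const)
  have "subalgebra (P z) ?S"
    unfolding subalgebra_def
  proof
    show "space ?S = space (P z)" by (simp add: F.space_pre_sigma)
    show "sets ?S \<subseteq> sets (P z)"
    proof
      fix A assume "A \<in> sets ?S"
      from F.sets_pre_sigmaD[OF st this, of t] show "A \<in> sets (P z)" using sets_F[of t] by (auto simp: sets_P)
    qed
  qed
  then interpret sub: finite_measure_subalgebra "P z" ?S by unfold_locales
  have ind: "integrable (P z) (indicator ?A :: 'w \<Rightarrow> real)"
    by (rule integrable_real_indicator[OF A]) (simp add: Pz.emeasure_eq_measure)
  have mm: "?m \<in> borel_measurable (P z)"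
    using measurable_compose[OF X_measurable measurable_P[OF B]] by (simp add: measurable_P_eq)
  have "measure (P z) ?A = (\<integral>\<omega>. indicator ?A \<omega> \<partial>P z)"
    unfolding Bochner_Integration.integral_indicator by (rule arg_cong[where f="measure _"]) auto
  also have "\<dots> = (\<integral>\<omega>. real_cond_exp (P z) ?S (indicator ?A) \<omega> \<partial>P z)"
    by (rule sub.real_cond_exp_int(2)[OF ind, symmetric])
  also have "\<dots> = (\<integral>\<omega>. ?m \<omega> \<partial>P z)"
    using strong_Markov[OF st s B, of z] mm
    by (intro integral_cong_AE) (auto simp: borel_measurable_cond_exp2)
  finally have e: "measure (P z) ?A = (\<integral>\<omega>. ?m \<omega> \<partial>P z)" .
  have "integrable (P z) ?m"
    using mm prob_space.prob_le_1[OF prob_P] by (intro Pz.integrable_const_bound[where B=1]) auto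
  then have "(\<integral>\<^sup>+\<omega>. ennreal (?m \<omega>) \<partial>P z) = ennreal (measure (P z) ?A)"
    unfolding e by (intro nn_integral_eq_integral) auto
  moreover have "emeasure (P y) B' = ennreal (measure (P y) B')" for y B'
    using finite_measure.emeasure_eq_measure[OF prob_space.axioms(1)[OF prob_P]] .
  ultimately show ?thesis by simp
qed

text \<open>Induction over Borel functions. The indicator case is the Markov property; paths already
  at the cemetery contribute 0 by \<open>P_None\<close>, in accordance with the extension of
  functions by 0.\<close>

lemma transition_semigroup:
  assumes h: "h \<in> borel_measurable borel" and t: "0 \<le> t" "0 \<le> s"
  shows "transition P X (t + s) h x = transition P X t (transition P X s h) x"
  using h
proof (induction rule: borel_measurable_induct)
  case (cong f g)
  then have "f = g" by auto
  with cong show ?case by simp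
next
  case (set B)
  then have B: "B \<in> sets borel" by simp
  have tr: "transition P X a (indicator B) y = emeasure (P (Some y)) {\<omega>\<in>space M. X (ennreal a) \<omega> \<in> Some ` B}" for a y
  proof -
    have "transition P X a (indicator B) y = (\<integral>\<^sup>+\<omega>. indicator {\<omega>\<in>space M. X (ennreal a) \<omega> \<in> Some ` B} \<omega> \<partial>P (Some y))"
      unfolding transition_def by (intro nn_integral_cong) (auto simp: indicator_def split: option.split)
    also have "\<dots> = emeasure (P (Some y)) {\<omega>\<in>space M. X (ennreal a) \<omega> \<in> Some ` B}"
      using measurable_sets[OF X_measurable Some_image_sets[OF B], of "ennreal a"]
      by (intro nn_integral_indicator) (simp add: sets_P vimage_def Int_def conj_commute)
    finally show ?thesis .
  qed
  have "transition P X (t + s) (indicator B) x = (\<integral>\<^sup>+\<omega>. emeasure (P (X (ennreal t) \<omega>)) {\<omega>'\<in>space M. X (ennreal s) \<omega>' \<in> Some ` B} \<partial>P (Some x))"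
    unfolding tr using t Chapman_Kolmogorov_emeasure[OF Some_image_sets[OF B], of "ennreal s" "Some x" "ennreal t"]
    by (simp add: ennreal_plus)
  also have "\<dots> = transition P X t (transition P X s (indicator B)) x"
    unfolding transition_def[of P X t] by (intro nn_integral_cong) (auto simp: tr P_None[OF B] split: option.split)
  finally show ?case .
next
  case (mult u c)
  have "transition P X s (\<lambda>y. c * u y) = (\<lambda>y. c * transition P X s u y)" using transition_cmult[OF mult.hyps(2)] by auto
  then show ?case by (simp add: transition_cmult[OF mult.hyps(2)] transition_cmult[OF transition_measurable[OF mult.hyps(2)]] mult.IH)
next
  case (add u v)
  have "transition P X s (\<lambda>y. v y + u y) = (\<lambda>y. transition P X s v y + transition P X s u y)"
    using transition_add[OF add.hyps(3,1)] by auto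
  then show ?case
    by (simp add: transition_add[OF add.hyps(3,1)] transition_add[OF transition_measurable[OF add.hyps(3)] transition_measurable[OF add.hyps(1)]] add.IH)
next
  case (seq U)
  have Um: "\<And>i. U i \<in> borel_measurable borel" and inc: "incseq U" using seq.hyps by auto
  have "transition P X s (\<lambda>y. SUP i. U i y) = (\<lambda>y. SUP i. transition P X s (U i) y)"
    using transition_SUP[OF Um inc] by auto
  moreover have "incseq (\<lambda>i. transition P X s (U i))"
    using inc by (auto simp: incseq_def le_fun_def intro!: transition_mono)
  ultimately have "transition P X (t + s) (\<lambda>y. SUP i. U i y) x = transition P X t (transition P X s (\<lambda>y. SUP i. U i y)) x"
    using transition_SUP[OF Um inc] transition_SUP[OF transition_measurable[OF Um]] seq.IH by simp
  then show ?case by (simp add: image_comp SUP_apply[abs_def])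
qed

text \<open>After the lifetime the path stays at the cemetery, where functions are 0, so the
  restriction to times before the lifetime is automatic. Then Fubini applies.\<close>

lemma resolvent_eq:
  assumes h: "h \<in> borel_measurable borel"
  shows "resolvent P X \<alpha> h x = (\<integral>\<^sup>+t. exp_weight \<alpha> t * transition P X t h x \<partial>lborel)"
proof -
  interpret Px: prob_space "P (Some x)" by (rule prob_P)
  interpret pair_sigma_finite lborel "P (Some x)" ..
  have Xm: "(\<lambda>z. Xh h 0 (fst z) (snd z)) \<in> borel_measurable (lborel \<Otimes>\<^sub>M P (Some x))"
    using Xh_measurable_pair[of h borel 0] h
    by (simp add: measurable_cong_sets[OF sets_pair_measure_cong[OF sets_lborel sets_P] refl])
  have "resolvent P X \<alpha> h x = (\<integral>\<^sup>+\<omega>. \<integral>\<^sup>+t. exp_weight \<alpha> t * Xh h 0 t \<omega> \<partial>lborel \<partial>P (Some x))"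
    unfolding resolvent_def
  proof (intro nn_integral_cong)
    fix \<omega> t assume \<omega>: "\<omega> \<in> space (P (Some x))"
    have "Xh h 0 t \<omega> = 0" if "\<not> ennreal t < lifetime X \<omega>"
      using X_absorbed[of \<omega> "ennreal t"] \<omega> that by (simp add: Xh_def)
    then show "ennreal (exp (- \<alpha> * t)) * case_option 0 h (X (ennreal t) \<omega>) * indicator {t. 0 \<le> t \<and> ennreal t < lifetime X \<omega>} t
        = exp_weight \<alpha> t * Xh h 0 t \<omega>"
      by (auto simp: exp_weight_def Xh_def indicator_def)
  qed
  also have "\<dots> = (\<integral>\<^sup>+t. \<integral>\<^sup>+\<omega>. exp_weight \<alpha> t * Xh h 0 t \<omega> \<partial>P (Some x) \<partial>lborel)"
    using Xm by (intro Fubini') (simp add: split_beta')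
  also have "\<dots> = (\<integral>\<^sup>+t. exp_weight \<alpha> t * transition P X t h x \<partial>lborel)"
    unfolding transition_def
  proof (intro nn_integral_cong)
    fix t
    have "(\<lambda>\<omega>. Xh h 0 t \<omega>) \<in> borel_measurable (P (Some x))" using Xh_measurable[of h borel 0 t] h by (simp add: measurable_P_eq)
    then show "(\<integral>\<^sup>+\<omega>. exp_weight \<alpha> t * Xh h 0 t \<omega> \<partial>P (Some x)) = exp_weight \<alpha> t * (\<integral>\<^sup>+\<omega>. case_option 0 h (X (ennreal t) \<omega>) \<partial>P (Some x))"
      by (simp add: nn_integral_cmult Xh_def)
  qed
  finally show ?thesis .
qed

lemma transition_measurable_swap:
  assumes h: "h \<in> borel_measurable borel"
  shows "(\<lambda>z. transition P X (snd z) h (fst z)) \<in> borel_measurable (borel \<Otimes>\<^sub>M lborel)"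
proof -
  have "(\<lambda>z. (snd z, fst z)) \<in> measurable (borel \<Otimes>\<^sub>M lborel) (borel \<Otimes>\<^sub>M borel)" by measurable
  from measurable_compose[OF this transition_measurable_pair[OF h]] show ?thesis by simp
qed

lemma transition_time_measurable:
  assumes h: "h \<in> borel_measurable borel"
  shows "(\<lambda>t. transition P X t h x) \<in> borel_measurable borel"
proof -
  have "(\<lambda>t. (t, x)) \<in> measurable borel (borel \<Otimes>\<^sub>M borel)" by measurable
  from measurable_compose[OF this transition_measurable_pair[OF h]] show ?thesis by simp
qed

lemma resolvent_measurable:
  assumes h: "h \<in> borel_measurable borel"
  shows "resolvent P X \<alpha> h \<in> borel_measurable borel"
proof -
  have "(\<lambda>(x, t). exp_weight \<alpha> t * transition P X t h x) \<in> borel_measurable (borel \<Otimes>\<^sub>M lborel)"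
    using transition_measurable_swap[OF h] by (simp add: split_beta')
  from lborel.borel_measurable_nn_integral[OF this] show ?thesis using resolvent_eq[OF h] by (simp cong: measurable_cong)
qed

lemma transition_resolvent:
  assumes h: "h \<in> borel_measurable borel" and t: "0 \<le> t"
  shows "transition P X t (resolvent P X \<beta> h) x = (\<integral>\<^sup>+s. exp_weight \<beta> s * transition P X (t + s) h x \<partial>lborel)"
proof -
  interpret Kx: prob_space "K t x" by (rule prob_K)
  interpret pair_sigma_finite lborel "K t x" ..
  let ?T = "\<lambda>s z. case_option 0 (transition P X s h) z"
  \<comment> \<open>An arbitrary point that stands in for the cemetery, so that joint measurability
    on the state space can be composed; a factor vanishing at \<open>None\<close> removes its
    effect.\<close>
  obtain a :: 'a where True by blast
  have Tm: "(\<lambda>z. ?T (fst z) (snd z)) \<in> borel_measurable (lborel \<Otimes>\<^sub>M K t x)"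
  proof -
    have d: "case_option a id \<in> measurable (cemetery_borel :: 'a option measure) borel"
      by (rule measurable_case_option_cemetery) auto
    have i: "case_option (0::ennreal) (\<lambda>_. 1) \<in> measurable (cemetery_borel :: 'a option measure) borel"
      by (rule measurable_case_option_cemetery) auto
    have "(\<lambda>z. case_option a id (snd z)) \<in> measurable (lborel \<Otimes>\<^sub>M K t x) borel"
      by (rule measurable_compose[OF measurable_snd]) (simp add: measurable_cong_sets[OF sets_K refl] d)
    moreover have "fst \<in> measurable (lborel \<Otimes>\<^sub>M K t x) (borel :: real measure)" by measurable
    ultimately have "(\<lambda>z. (fst z, case_option a id (snd z))) \<in> measurable (lborel \<Otimes>\<^sub>M K t x) ((borel :: real measure) \<Otimes>\<^sub>M borel)"
      by (intro measurable_Pair)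
    from measurable_compose[OF this transition_measurable_pair[OF h]]
    have 1: "(\<lambda>z. transition P X (fst z) h (case_option a id (snd z))) \<in> borel_measurable (lborel \<Otimes>\<^sub>M K t x)" by simp
    have 2: "(\<lambda>z. case_option (0::ennreal) (\<lambda>_. 1) (snd z)) \<in> borel_measurable (lborel \<Otimes>\<^sub>M K t x)"
      by (rule measurable_compose[OF measurable_snd]) (simp add: measurable_cong_sets[OF sets_K refl] i)
    have "(\<lambda>z. case_option (0::ennreal) (\<lambda>_. 1) (snd z) * transition P X (fst z) h (case_option a id (snd z))) = (\<lambda>z. ?T (fst z) (snd z))"
      by (auto split: option.split)
    with borel_measurable_times_ennreal[OF 2 1] show ?thesis by simp
  qed
  have "transition P X t (resolvent P X \<beta> h) x = (\<integral>\<^sup>+z. \<integral>\<^sup>+s. exp_weight \<beta> s * ?T s z \<partial>lborel \<partial>K t x)"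
    unfolding transition_K[OF resolvent_measurable[OF h]]
    by (intro nn_integral_cong) (auto simp: resolvent_eq[OF h] split: option.split)
  also have "\<dots> = (\<integral>\<^sup>+s. \<integral>\<^sup>+z. exp_weight \<beta> s * ?T s z \<partial>K t x \<partial>lborel)"
    using Tm by (intro Fubini') (simp add: split_beta')
  also have "\<dots> = (\<integral>\<^sup>+s. exp_weight \<beta> s * transition P X (t + s) h x \<partial>lborel)"
  proof (intro nn_integral_cong)
    fix s
    have "?T s \<in> borel_measurable (K t x)"
      using measurable_case_option_cemetery[OF transition_measurable[OF h], of 0 s] by (simp add: measurable_cong_sets[OF sets_K refl])
    then have "(\<integral>\<^sup>+z. exp_weight \<beta> s * ?T s z \<partial>K t x) = exp_weight \<beta> s * transition P X t (transition P X s h) x"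
      using transition_K[OF transition_measurable[OF h]] by (simp add: nn_integral_cmult)
    also have "\<dots> = exp_weight \<beta> s * transition P X (t + s) h x"
      using transition_semigroup[OF h t, of s x] by (cases "0 \<le> s") (auto simp: exp_weight_def)
    finally show "(\<integral>\<^sup>+z. exp_weight \<beta> s * ?T s z \<partial>K t x) = exp_weight \<beta> s * transition P X (t + s) h x" .
  qed
  finally show ?thesis .
qed

lemma resolvent_resolvent:
  assumes h: "h \<in> borel_measurable borel"
  shows "resolvent P X \<alpha> (resolvent P X \<beta> h) x =
    (\<integral>\<^sup>+t. \<integral>\<^sup>+s. exp_weight \<alpha> t * (exp_weight \<beta> s * transition P X (t + s) h x) \<partial>lborel \<partial>lborel)"
proof -
  note [measurable] = transition_time_measurable[OF h]
  have "resolvent P X \<alpha> (resolvent P X \<beta> h) x = (\<integral>\<^sup>+t. exp_weight \<alpha> t * transition P X t (resolvent P X \<beta> h) x \<partial>lborel)"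
    by (rule resolvent_eq[OF resolvent_measurable[OF h]])
  also have "\<dots> = (\<integral>\<^sup>+t. \<integral>\<^sup>+s. exp_weight \<alpha> t * (exp_weight \<beta> s * transition P X (t + s) h x) \<partial>lborel \<partial>lborel)"
  proof (intro nn_integral_cong)
    fix t
    show "exp_weight \<alpha> t * transition P X t (resolvent P X \<beta> h) x = (\<integral>\<^sup>+s. exp_weight \<alpha> t * (exp_weight \<beta> s * transition P X (t + s) h x) \<partial>lborel)"
    proof (cases "0 \<le> t")
      case True
      then show ?thesis using transition_resolvent[OF h True, of \<beta> x] by (simp add: nn_integral_cmult)
    qed (simp add: exp_weight_def)
  qed
  finally show ?thesis .
qed

text \<open>Both sides are the same double time integral, because the semigroup depends on t + s
  only.\<close>

lemma resolvent_resolvent_commute: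
  assumes h: "h \<in> borel_measurable borel"
  shows "resolvent P X \<alpha> (resolvent P X \<beta> h) x = resolvent P X \<beta> (resolvent P X \<alpha> h) x"
proof -
  note [measurable] = transition_time_measurable[OF h]
  have "resolvent P X \<alpha> (resolvent P X \<beta> h) x =
      (\<integral>\<^sup>+s. \<integral>\<^sup>+t. exp_weight \<alpha> t * (exp_weight \<beta> s * transition P X (t + s) h x) \<partial>lborel \<partial>lborel)"
    unfolding resolvent_resolvent[OF h] by (rule lborel_pair.Fubini'[symmetric]) measurable
  also have "\<dots> = resolvent P X \<beta> (resolvent P X \<alpha> h) x"
    unfolding resolvent_resolvent[OF h] by (simp add: add.commute mult.left_commute)
  finally show ?thesis .
qed

lemma resolvent_equation:
  assumes h: "h \<in> borel_measurable borel" and \<alpha>: "0 \<le> \<alpha>" "\<alpha> \<le> \<beta>"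
  shows "resolvent P X \<alpha> h x = resolvent P X \<beta> h x + ennreal (\<beta> - \<alpha>) * resolvent P X \<beta> (resolvent P X \<alpha> h) x"
proof (cases "\<alpha> = \<beta>")
  case False
  then have lt: "\<alpha> < \<beta>" using \<alpha> by simp
  define F where "F t = transition P X t h x" for t
  have [measurable]: "F \<in> borel_measurable borel" unfolding F_def[abs_def] by (rule transition_time_measurable[OF h])
  have "resolvent P X \<beta> (resolvent P X \<alpha> h) x = (\<integral>\<^sup>+t. \<integral>\<^sup>+s. exp_weight \<beta> t * (exp_weight \<alpha> s * F (t + s)) \<partial>lborel \<partial>lborel)"
    unfolding F_def by (rule resolvent_resolvent[OF h])
  \<comment> \<open>The substitution v = t + s turns the double integral into a convolution of
    weights against one transition function.\<close>
  also have "\<dots> = (\<integral>\<^sup>+t. \<integral>\<^sup>+v. exp_weight \<beta> t * (exp_weight \<alpha> (v - t) * F v) \<partial>lborel \<partial>lborel)"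
  proof (rule nn_integral_cong)
    fix t
    show "(\<integral>\<^sup>+s. exp_weight \<beta> t * (exp_weight \<alpha> s * F (t + s)) \<partial>lborel) = (\<integral>\<^sup>+v. exp_weight \<beta> t * (exp_weight \<alpha> (v - t) * F v) \<partial>lborel)"
      by (subst nn_integral_real_affine[of _ 1 "- t"]) auto
  qed
  also have "\<dots> = (\<integral>\<^sup>+v. \<integral>\<^sup>+t. exp_weight \<beta> t * (exp_weight \<alpha> (v - t) * F v) \<partial>lborel \<partial>lborel)"
    by (rule lborel_pair.Fubini'[symmetric]) measurable
  also have "\<dots> = (\<integral>\<^sup>+v. (\<integral>\<^sup>+t. exp_weight \<beta> t * exp_weight \<alpha> (v - t) \<partial>lborel) * F v \<partial>lborel)"
    by (intro nn_integral_cong, subst nn_integral_multc[symmetric]) (auto simp: mult.assoc)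
  finally have "resolvent P X \<beta> h x + ennreal (\<beta> - \<alpha>) * resolvent P X \<beta> (resolvent P X \<alpha> h) x =
      (\<integral>\<^sup>+v. exp_weight \<beta> v * F v + ennreal (\<beta> - \<alpha>) * ((\<integral>\<^sup>+t. exp_weight \<beta> t * exp_weight \<alpha> (v - t) \<partial>lborel) * F v) \<partial>lborel)"
    unfolding resolvent_eq[OF h] F_def[symmetric]
    by (subst nn_integral_add) (auto simp: nn_integral_cmult)
  also have "\<dots> = (\<integral>\<^sup>+v. exp_weight \<alpha> v * F v \<partial>lborel)"
  proof (intro nn_integral_cong)
    fix v
    have "exp_weight \<beta> v * F v + ennreal (\<beta> - \<alpha>) * ((\<integral>\<^sup>+t. exp_weight \<beta> t * exp_weight \<alpha> (v - t) \<partial>lborel) * F v) =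
      (ennreal (\<beta> - \<alpha>) * (\<integral>\<^sup>+t. exp_weight \<beta> t * exp_weight \<alpha> (v - t) \<partial>lborel) + exp_weight \<beta> v) * F v"
      by (simp add: distrib_right mult.assoc add.commute)
    then show "exp_weight \<beta> v * F v + ennreal (\<beta> - \<alpha>) * ((\<integral>\<^sup>+t. exp_weight \<beta> t * exp_weight \<alpha> (v - t) \<partial>lborel) * F v) = exp_weight \<alpha> v * F v"
      unfolding exp_weight_convolution[OF lt] .
  qed
  also have "\<dots> = resolvent P X \<alpha> h x" unfolding resolvent_eq[OF h] F_def ..
  finally show ?thesis by simp
qed simp

lemma resolvent_one:
  assumes "0 < \<alpha>"
  shows "ennreal \<alpha> * resolvent P X \<alpha> (\<lambda>_. 1) x \<le> 1"
proof -
  have "resolvent P X \<alpha> (\<lambda>_. 1) x \<le> (\<integral>\<^sup>+t. exp_weight \<alpha> t * 1 \<partial>lborel)"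
    unfolding resolvent_eq[OF borel_measurable_const]
    by (intro nn_integral_mono mult_left_mono transition_le_const) auto
  from mult_left_mono[OF this, of "ennreal \<alpha>"] show ?thesis using exp_weight_mass[OF assms] by simp
qed

lemma resolvent_SUP:
  assumes h: "h \<in> borel_measurable borel"
  shows "(SUP n. resolvent P X (1 / real (Suc n)) h x) = resolvent P X 0 h x"
proof -
  note [measurable] = transition_time_measurable[OF h]
  have inc: "incseq (\<lambda>n t. exp_weight (1 / real (Suc n)) t * transition P X t h x)"
  proof (unfold incseq_def le_fun_def, intro allI impI)
    fix i j :: nat and t :: real assume ij: "i \<le> j"
    have "exp_weight (1 / real (Suc i)) t \<le> exp_weight (1 / real (Suc j)) t"
    proof (cases "0 \<le> t")
      case True
      have "1 / real (Suc j) * t \<le> 1 / real (Suc i) * t" using ij True by (intro mult_right_mono divide_left_mono) auto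
      then show ?thesis unfolding exp_weight_def by (intro mult_right_mono ennreal_leI) auto
    qed (simp add: exp_weight_def)
    then show "exp_weight (1 / real (Suc i)) t * transition P X t h x \<le> exp_weight (1 / real (Suc j)) t * transition P X t h x"
      by (rule mult_right_mono) simp
  qed
  have sup: "(SUP n. exp_weight (1 / real (Suc n)) t * transition P X t h x) = exp_weight 0 t * transition P X t h x" for t
  proof (cases "0 \<le> t")
    case True
    have "(SUP n. exp_weight (1 / real (Suc n)) t) = exp_weight 0 t"
    proof (rule LIMSEQ_unique[OF LIMSEQ_SUP])
      have "1 / real (Suc j) * t \<le> 1 / real (Suc i) * t" if "i \<le> j" for i j :: nat
        using that True by (intro mult_right_mono divide_left_mono) auto
      then show "incseq (\<lambda>n. exp_weight (1 / real (Suc n)) t)"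
        unfolding incseq_def exp_weight_def by (auto intro!: mult_right_mono ennreal_leI)
      have "(\<lambda>n. ennreal (exp (- (1 / real (Suc n)) * t))) \<longlonglongrightarrow> ennreal (exp (- 0 * t))"
        by (intro tendsto_ennrealI tendsto_exp tendsto_mult tendsto_minus tendsto_const LIMSEQ_Suc[OF lim_1_over_n])
      then show "(\<lambda>n. exp_weight (1 / real (Suc n)) t) \<longlonglongrightarrow> exp_weight 0 t" using True by (simp add: exp_weight_def)
    qed
    then show ?thesis by (simp only: SUP_mult_right_ennreal[symmetric])
  qed (simp add: exp_weight_def)
  have "resolvent P X 0 h x = (\<integral>\<^sup>+t. (SUP n. exp_weight (1 / real (Suc n)) t * transition P X t h x) \<partial>lborel)"
    unfolding sup by (rule resolvent_eq[OF h])
  also have "\<dots> = (SUP n. \<integral>\<^sup>+t. exp_weight (1 / real (Suc n)) t * transition P X t h x \<partial>lborel)"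
    by (rule nn_integral_monotone_convergence_SUP[OF inc]) measurable
  finally show ?thesis by (simp only: resolvent_eq[OF h])
qed

end

section \<open>Identification of the resolvents\<close>

text \<open>Cauchy-Schwarz for the measure e(s) ds at each point, then Fubini: the L2 norm of a time
  average is controlled by the average of the L2 norms. It serves both the resolvent and the
  averaged error near time 0.\<close>

lemma nn_integral_square_average_le:
  fixes e :: "real \<Rightarrow> ennreal"
  assumes "sigma_finite_measure m" and e [measurable]: "e \<in> borel_measurable borel"
    and a [measurable]: "(\<lambda>z. a (fst z) (snd z)) \<in> borel_measurable (borel \<Otimes>\<^sub>M m)"
  shows "(\<integral>\<^sup>+x. (\<integral>\<^sup>+s. e s * a s x \<partial>lborel)\<^sup>2 \<partial>m) \<le> (\<integral>\<^sup>+s. e s \<partial>lborel) * (\<integral>\<^sup>+s. e s * (\<integral>\<^sup>+x. (a s x)\<^sup>2 \<partial>m) \<partial>lborel)"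
proof -
  interpret sigma_finite_measure m by fact
  interpret pair_sigma_finite lborel m ..
  have a' [measurable]: "(\<lambda>z. a (fst z) (snd z)) \<in> borel_measurable (lborel \<Otimes>\<^sub>M m)"
    using a by (simp add: measurable_cong_sets[OF sets_pair_measure_cong[OF sets_lborel refl] refl])
  have am: "(\<lambda>s. a s x) \<in> borel_measurable borel" if "x \<in> space m" for x
    using measurable_compose[OF measurable_Pair2'[OF that, of borel] a] by simp
  have am2: "a s \<in> borel_measurable m" for s
    using measurable_compose[OF measurable_Pair1'[of s borel m] a] by simp
  have "(\<integral>\<^sup>+x. (\<integral>\<^sup>+s. e s * a s x \<partial>lborel)\<^sup>2 \<partial>m) \<le> (\<integral>\<^sup>+x. (\<integral>\<^sup>+s. e s \<partial>lborel) * (\<integral>\<^sup>+s. e s * (a s x)\<^sup>2 \<partial>lborel) \<partial>m)"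
  proof (rule nn_integral_mono)
    fix x assume x: "x \<in> space m"
    note [measurable] = am[OF x]
    have "(\<integral>\<^sup>+s. a s x * 1 \<partial>density lborel e)\<^sup>2 \<le> (\<integral>\<^sup>+s. (a s x)\<^sup>2 \<partial>density lborel e) * (\<integral>\<^sup>+s. 1\<^sup>2 \<partial>density lborel e)"
      by (rule Cauchy_Schwarz_nn_integral) measurable
    then show "(\<integral>\<^sup>+s. e s * a s x \<partial>lborel)\<^sup>2 \<le> (\<integral>\<^sup>+s. e s \<partial>lborel) * (\<integral>\<^sup>+s. e s * (a s x)\<^sup>2 \<partial>lborel)"
      by (simp add: nn_integral_density emeasure_density mult.commute)
  qed
  also have "\<dots> = (\<integral>\<^sup>+s. e s \<partial>lborel) * (\<integral>\<^sup>+x. (\<integral>\<^sup>+s. e s * (a s x)\<^sup>2 \<partial>lborel) \<partial>m)"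
  proof (rule nn_integral_cmult)
    have "(\<lambda>(x, s). e s * (a s x)\<^sup>2) \<in> borel_measurable (m \<Otimes>\<^sub>M lborel)"
    proof -
      have "(\<lambda>z. (snd z, fst z)) \<in> measurable (m \<Otimes>\<^sub>M lborel) (lborel \<Otimes>\<^sub>M m)" by measurable
      from measurable_compose[OF this a'] have "(\<lambda>z. a (snd z) (fst z)) \<in> borel_measurable (m \<Otimes>\<^sub>M lborel)" by simp
      then show ?thesis by (simp add: split_beta')
    qed
    from lborel.borel_measurable_nn_integral[OF this] show "(\<lambda>x. \<integral>\<^sup>+s. e s * (a s x)\<^sup>2 \<partial>lborel) \<in> borel_measurable m" .
  qed
  also have "(\<integral>\<^sup>+x. (\<integral>\<^sup>+s. e s * (a s x)\<^sup>2 \<partial>lborel) \<partial>m) = (\<integral>\<^sup>+s. (\<integral>\<^sup>+x. e s * (a s x)\<^sup>2 \<partial>m) \<partial>lborel)"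
    using a' by (intro Fubini') (simp add: split_beta')
  also have "\<dots> = (\<integral>\<^sup>+s. e s * (\<integral>\<^sup>+x. (a s x)\<^sup>2 \<partial>m) \<partial>lborel)"
  proof (rule nn_integral_cong)
    fix s
    note [measurable] = am2[of s]
    show "(\<integral>\<^sup>+x. e s * (a s x)\<^sup>2 \<partial>m) = e s * (\<integral>\<^sup>+x. (a s x)\<^sup>2 \<partial>m)" by (rule nn_integral_cmult) measurable
  qed
  finally show ?thesis .
qed

locale associated_Hunt_process = regular_Dirichlet_form m D \<E> + Hunt_process M P X F
  for m :: "'a::{metric_space, second_countable_topology} measure" and D \<E>
    and M :: "'w measure" and P :: "'a option \<Rightarrow> 'w measure" and X F +
  assumes associated: "associated_process m D \<E> P X"
begin

declare sets_m [measurable_cong]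

definition T :: "real \<Rightarrow> ('a \<Rightarrow> real) \<Rightarrow> 'a \<Rightarrow> real" where
  "T s h x = transition_real P X s h x"

text \<open>The squared norm with values in [0, \<infinity>], so that estimates can precede, and
  prove, square integrability.\<close>

definition N2 :: "('a \<Rightarrow> real) \<Rightarrow> ennreal" where
  "N2 f = (\<integral>\<^sup>+x. ennreal ((f x)\<^sup>2) \<partial>m)"

lemma L2_N2: "u \<in> borel_measurable borel \<Longrightarrow> u \<in> L2 m \<longleftrightarrow> N2 u < \<infinity>"
proof -
  assume u [measurable]: "u \<in> borel_measurable borel"
  have "integrable (completion m) (\<lambda>x. (u x)\<^sup>2) \<longleftrightarrow> integrable m (\<lambda>x. (u x)\<^sup>2)"
    by (rule integrable_completion) measurable
  moreover have "u \<in> borel_measurable (completion m)" by (intro measurable_completion) measurable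
  ultimately show ?thesis by (auto simp: L2_def integrable_iff_bounded N2_def)
qed

lemma N2_inner: "u \<in> L2 m \<Longrightarrow> N2 u = ennreal (inner_L2 m u u)"
  unfolding N2_def inner_L2_def power2_eq_square[symmetric]
  by (subst nn_integral_eq_integral[symmetric]) (auto simp: L2_def nn_integral_completion)

lemma N2_add:
  assumes [measurable]: "f \<in> borel_measurable borel" "g \<in> borel_measurable borel"
  shows "N2 (\<lambda>x. f x + g x) \<le> 2 * N2 f + 2 * N2 g"
proof -
  have "N2 (\<lambda>x. f x + g x) \<le> (\<integral>\<^sup>+x. 2 * ennreal ((f x)\<^sup>2) + 2 * ennreal ((g x)\<^sup>2) \<partial>m)"
    unfolding N2_def
  proof (intro nn_integral_mono)
    fix x
    have "(f x + g x)\<^sup>2 \<le> 2 * (f x)\<^sup>2 + 2 * (g x)\<^sup>2"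
      using zero_le_power2[of "f x - g x"] by (simp add: power2_sum power2_diff)
    then have "ennreal ((f x + g x)\<^sup>2) \<le> ennreal (2 * (f x)\<^sup>2 + 2 * (g x)\<^sup>2)" by (rule ennreal_leI)
    then show "ennreal ((f x + g x)\<^sup>2) \<le> 2 * ennreal ((f x)\<^sup>2) + 2 * ennreal ((g x)\<^sup>2)"
      by (simp add: ennreal_plus ennreal_mult)
  qed
  also have "\<dots> = 2 * N2 f + 2 * N2 g" unfolding N2_def by (simp add: nn_integral_add nn_integral_cmult)
  finally show ?thesis .
qed

lemma N2_scale:
  assumes [measurable]: "f \<in> borel_measurable borel"
  shows "N2 (\<lambda>x. c * f x) = ennreal (c\<^sup>2) * N2 f"
  unfolding N2_def by (simp add: power_mult_distrib ennreal_mult nn_integral_cmult)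

lemma T_Xh: "T s h x = (\<integral>\<omega>. Xh h 0 s \<omega> \<partial>P (Some x))"
  by (simp add: T_def transition_real_def Xh_def)

lemma T_K:
  assumes h: "h \<in> borel_measurable borel"
  shows "T s h y = (\<integral>z. case_option 0 h z \<partial>K s y)"
  unfolding T_Xh K_def Xh_def
  by (rule integral_distr[symmetric]) (auto simp: measurable_P_eq X_measurable intro: measurable_case_option_cemetery[OF h])

lemma T_measurable_pair:
  assumes h: "h \<in> borel_measurable borel"
  shows "(\<lambda>z. T (fst z) h (snd z)) \<in> borel_measurable (borel \<Otimes>\<^sub>M borel)"
  unfolding T_K[OF h]
  by (rule measurable_compose[OF K_measurable integral_measurable_subprob_algebra])
     (rule measurable_case_option_cemetery[OF h], simp)

lemma T_measurable [measurable]: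
  assumes h: "h \<in> borel_measurable borel"
  shows "T s h \<in> borel_measurable borel"
  using measurable_compose[OF measurable_Pair1' T_measurable_pair[OF h], of s] by simp

lemma T_time_measurable:
  assumes h: "h \<in> borel_measurable borel"
  shows "(\<lambda>s. T s h x) \<in> borel_measurable borel"
proof -
  have "(\<lambda>s. (s, x)) \<in> measurable borel (borel \<Otimes>\<^sub>M borel)" by measurable
  from measurable_compose[OF this T_measurable_pair[OF h]] show ?thesis by simp
qed

lemma Xh_integrable:
  assumes h: "h \<in> borel_measurable borel" and b: "\<And>x. \<bar>h x\<bar> \<le> (c::real)"
  shows "integrable (P z) (Xh h 0 s)"
proof -
  interpret prob_space "P z" by (rule prob_P)
  have "0 \<le> c" using b[of undefined] by (meson abs_ge_zero order_trans)
  then show ?thesis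
    using b Xh_measurable[of h borel 0 s] h
    by (intro integrable_const_bound[where B=c]) (auto simp: measurable_P_eq Xh_def split: option.split)
qed

lemma T_diff:
  assumes h: "h \<in> borel_measurable borel" "\<And>x. \<bar>h x\<bar> \<le> c" and k: "k \<in> borel_measurable borel" "\<And>x. \<bar>k x\<bar> \<le> d"
  shows "T s (\<lambda>x. h x - k x) x = T s h x - T s k x"
proof -
  have "T s (\<lambda>x. h x - k x) x = (\<integral>\<omega>. Xh h 0 s \<omega> - Xh k 0 s \<omega> \<partial>P (Some x))"
    unfolding T_Xh by (intro Bochner_Integration.integral_cong) (auto simp: Xh_def split: option.split)
  then show ?thesis unfolding T_Xh
    by (simp add: Bochner_Integration.integral_diff[OF Xh_integrable[OF h] Xh_integrable[OF k]])
qed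

lemma T_nonneg:
  assumes h: "h \<in> borel_measurable borel" "\<And>x. 0 \<le> h x"
  shows "T s h x = enn2real (transition P X s (\<lambda>y. ennreal (h y)) x)"
proof -
  have "T s h x = enn2real (\<integral>\<^sup>+\<omega>. ennreal (Xh h 0 s \<omega>) \<partial>P (Some x))"
    unfolding T_Xh using h Xh_measurable[of h borel 0 s]
    by (intro integral_eq_nn_integral) (auto simp: measurable_P_eq Xh_def split: option.split)
  also have "(\<integral>\<^sup>+\<omega>. ennreal (Xh h 0 s \<omega>) \<partial>P (Some x)) = transition P X s (\<lambda>y. ennreal (h y)) x"
    unfolding transition_def by (intro nn_integral_cong) (auto simp: Xh_def split: option.split)
  finally show ?thesis .
qed

lemma T_bounded:
  assumes h: "h \<in> borel_measurable borel" "\<And>x. \<bar>h x\<bar> \<le> c"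
  shows "\<bar>T s h x\<bar> \<le> c"
proof -
  interpret prob_space "P (Some x)" by (rule prob_P)
  have c: "0 \<le> c" using h(2)[of undefined] by (meson abs_ge_zero order_trans)
  have "\<bar>T s h x\<bar> \<le> (\<integral>\<omega>. \<bar>Xh h 0 s \<omega>\<bar> \<partial>P (Some x))" unfolding T_Xh by (rule integral_abs_bound)
  also have "\<dots> \<le> (\<integral>\<omega>. c \<partial>P (Some x))"
    by (rule integral_mono[OF integrable_abs[OF Xh_integrable[OF h]]])
       (use h c in \<open>auto simp: Xh_def split: option.split\<close>)
  finally show ?thesis using prob_space by simp
qed

lemma T_zero:
  assumes h: "h \<in> borel_measurable borel"
  shows "T 0 h x = h x"
proof -
  interpret prob_space "P (Some x)" by (rule prob_P)
  have "T 0 h x = (\<integral>\<omega>. h x \<partial>P (Some x))"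
    unfolding T_Xh
  proof (rule integral_cong_AE)
    show "Xh h 0 0 \<in> borel_measurable (P (Some x))" using Xh_measurable[of h borel 0 0] h by (simp add: measurable_P_eq)
    show "AE \<omega> in P (Some x). Xh h 0 0 \<omega> = h x" using normal[of "Some x"] by eventually_elim (simp add: Xh_def)
  qed simp
  then show ?thesis using prob_space by simp
qed

text \<open>Nonnegativity of the variance, together with total mass 1, gives (T h) squared \<le> T
  (h squared) pointwise. Symmetry against the constant 1 then moves the semigroup onto 1.\<close>

lemma T_contraction:
  assumes h: "h \<in> borel_measurable borel" "\<And>x. \<bar>h x\<bar> \<le> c" and s: "0 \<le> s"
  shows "N2 (T s h) \<le> N2 h"
proof -
  have sq: "ennreal ((T s h x)\<^sup>2) \<le> transition P X s (\<lambda>y. ennreal ((h y)\<^sup>2)) x" for x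
  proof -
    interpret prob_space "P (Some x)" by (rule prob_P)
    have i: "integrable (P (Some x)) (Xh h 0 s)" by (rule Xh_integrable[OF h])
    have e: "(\<lambda>\<omega>. (Xh h 0 s \<omega>)\<^sup>2) = Xh (\<lambda>y. (h y)\<^sup>2) 0 s" by (auto simp: Xh_def split: option.split)
    have "\<bar>(h y)\<^sup>2\<bar> \<le> c\<^sup>2" for y using h(2)[of y] by (simp add: power2_le_iff_abs_le abs_le_square_iff[symmetric])
    then have i2: "integrable (P (Some x)) (\<lambda>\<omega>. (Xh h 0 s \<omega>)\<^sup>2)"
      unfolding e using h by (intro Xh_integrable[where c="c\<^sup>2"]) auto
    have "(T s h x)\<^sup>2 \<le> (\<integral>\<omega>. (Xh h 0 s \<omega>)\<^sup>2 \<partial>P (Some x))"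
      using variance_eq[OF i i2] variance_positive[of "Xh h 0 s"] by (simp add: T_Xh)
    then have "ennreal ((T s h x)\<^sup>2) \<le> ennreal (\<integral>\<omega>. (Xh h 0 s \<omega>)\<^sup>2 \<partial>P (Some x))" by (rule ennreal_leI)
    also have "\<dots> = (\<integral>\<^sup>+\<omega>. ennreal ((Xh h 0 s \<omega>)\<^sup>2) \<partial>P (Some x))" by (rule nn_integral_eq_integral[symmetric, OF i2]) simp
    also have "\<dots> = transition P X s (\<lambda>y. ennreal ((h y)\<^sup>2)) x"
      unfolding transition_def by (intro nn_integral_cong) (auto simp: Xh_def split: option.split)
    finally show ?thesis .
  qed
  have hm: "(\<lambda>y. ennreal ((h y)\<^sup>2)) \<in> borel_measurable borel" using h(1) by measurable
  have "N2 (T s h) \<le> (\<integral>\<^sup>+x. transition P X s (\<lambda>y. ennreal ((h y)\<^sup>2)) x * 1 \<partial>m)"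
    unfolding N2_def using sq by (intro nn_integral_mono) simp
  also have "\<dots> = (\<integral>\<^sup>+x. ennreal ((h x)\<^sup>2) * transition P X s (\<lambda>_. 1) x \<partial>m)"
    by (rule conjunct1[OF associated[unfolded associated_process_def], rule_format, OF s hm]) simp
  also have "\<dots> \<le> (\<integral>\<^sup>+x. ennreal ((h x)\<^sup>2) * 1 \<partial>m)"
    by (intro nn_integral_mono mult_left_mono transition_le_const) auto
  finally show ?thesis by (simp add: N2_def)
qed

lemma T_L2:
  assumes h: "h \<in> borel_measurable borel" "\<And>x. \<bar>h x\<bar> \<le> c" and L: "h \<in> L2 m" and s: "0 \<le> s"
  shows "T s h \<in> L2 m" "inner_L2 m (T s h) (T s h) \<le> inner_L2 m h h"
proof -
  have le: "N2 (T s h) \<le> N2 h" by (rule T_contraction[OF h s])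
  then show TL: "T s h \<in> L2 m" using L h(1) L2_N2[of h] L2_N2[of "T s h"] T_measurable[OF h(1)]
    by (auto intro: order.strict_trans1)
  show "inner_L2 m (T s h) (T s h) \<le> inner_L2 m h h"
    using le L2.nonneg[OF L] unfolding N2_inner[OF TL] N2_inner[OF L] by (simp add: ennreal_le_iff)
qed

lemma Cc_bounded:
  assumes "\<phi> \<in> Cc"
  obtains c where "\<And>x. \<bar>\<phi> x\<bar> \<le> (c::real)"
proof -
  let ?C = "closure {x. \<phi> x \<noteq> 0}"
  have "compact (\<phi> ` ?C)" using assms by (intro compact_continuous_image) (auto simp: Cc_def intro: continuous_on_subset)
  from compact_imp_bounded[OF this] obtain c where "\<forall>y\<in>\<phi> ` ?C. norm y \<le> c" unfolding bounded_iff by blast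
  then have c: "\<bar>\<phi> x\<bar> \<le> c" if "x \<in> ?C" for x using that by simp
  have "\<bar>\<phi> x\<bar> \<le> max c 0" for x
  proof (cases "\<phi> x = 0")
    case False
    then have "x \<in> ?C" using closure_subset[of "{x. \<phi> x \<noteq> 0}"] by auto
    then show ?thesis using c[of x] by simp
  qed simp
  then show ?thesis by (rule that)
qed

lemma Cc_borel: "\<phi> \<in> Cc \<Longrightarrow> \<phi> \<in> borel_measurable borel"
  by (auto simp: Cc_def intro: borel_measurable_continuous_onI)

text \<open>Contraction gives (T\<phi> - \<phi>, T\<phi> - \<phi>) \<le> 2 (\<phi>, \<phi> -
  T\<phi>). The right-hand integrand lives on the compact support of \<phi>, where dominated
  convergence applies.\<close>

lemma T_strong_continuity_Cc:
  assumes \<phi>: "\<phi> \<in> Cc" and L: "\<phi> \<in> L2 m"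
  shows "((\<lambda>s. inner_L2 m (\<lambda>x. T s \<phi> x - \<phi> x) (\<lambda>x. T s \<phi> x - \<phi> x)) \<longlongrightarrow> 0) (at_right 0)"
proof (rule tendsto_at_right_sequentially[of 0 1])
  obtain c where c: "\<And>x. \<bar>\<phi> x\<bar> \<le> c" by (rule Cc_bounded[OF \<phi>]) blast
  have c0: "0 \<le> c" using c[of undefined] by (meson abs_ge_zero order_trans)
  have \<phi>m [measurable]: "\<phi> \<in> borel_measurable borel" by (rule Cc_borel[OF \<phi>])
  have \<phi>c: "continuous_on UNIV \<phi>" using \<phi> by (simp add: Cc_def)
  let ?C = "closure {x. \<phi> x \<noteq> 0}"
  have C: "?C \<in> sets borel" "emeasure m ?C < \<infinity>" using \<phi> compact_finite by (auto simp: Cc_def)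
  fix S :: "nat \<Rightarrow> real" assume S: "\<And>n. 0 < S n" "S \<longlonglongrightarrow> 0"
  have "S n \<noteq> 0" for n using S(1)[of n] by simp
  with S have Sl: "filterlim S (at_right 0) sequentially" by (simp add: filterlim_at)
  have TL: "T (S n) \<phi> \<in> L2 m" "inner_L2 m (T (S n) \<phi>) (T (S n) \<phi>) \<le> inner_L2 m \<phi> \<phi>" for n
    using T_L2[OF \<phi>m c L, of "S n"] S(1)[of n] by auto
  have dL: "(\<lambda>x. T (S n) \<phi> x - \<phi> x) \<in> L2 m" for n by (rule L2.diff_mem[OF TL(1) L])
  have "(\<lambda>n. \<integral>x. \<phi> x * (\<phi> x - T (S n) \<phi> x) \<partial>m) \<longlonglongrightarrow> (\<integral>x. 0 \<partial>m)"
  proof (rule integral_dominated_convergence[where w="\<lambda>x. 2 * c * c * indicator ?C x"])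
    show "integrable m (\<lambda>x. 2 * c * c * indicator ?C x)"
      using C by (intro integrable_mult_right integrable_real_indicator) (auto simp: sets_m)
    show "AE x in m. (\<lambda>n. \<phi> x * (\<phi> x - T (S n) \<phi> x)) \<longlonglongrightarrow> 0"
    proof (rule AE_I2)
      fix x
      have "((\<lambda>s. T s \<phi> x) \<longlongrightarrow> T 0 \<phi> x) (at_right 0)"
        unfolding T_Xh by (rule transition_right_continuous[OF \<phi>c c])
      from filterlim_compose[OF this Sl] have "(\<lambda>n. T (S n) \<phi> x) \<longlonglongrightarrow> \<phi> x" by (simp add: T_zero[OF \<phi>m])
      from tendsto_mult[OF tendsto_const tendsto_diff[OF tendsto_const this], of "\<phi> x" "\<phi> x"]
      show "(\<lambda>n. \<phi> x * (\<phi> x - T (S n) \<phi> x)) \<longlonglongrightarrow> 0" by simp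
    qed
    show "AE x in m. norm (\<phi> x * (\<phi> x - T (S n) \<phi> x)) \<le> 2 * c * c * indicator ?C x" for n
    proof (rule AE_I2)
      fix x
      show "norm (\<phi> x * (\<phi> x - T (S n) \<phi> x)) \<le> 2 * c * c * indicator ?C x"
      proof (cases "x \<in> ?C")
        case True
        have "\<bar>\<phi> x - T (S n) \<phi> x\<bar> \<le> 2 * c" using c[of x] T_bounded[OF \<phi>m c, of "S n" x] by linarith
        then have "\<bar>\<phi> x\<bar> * \<bar>\<phi> x - T (S n) \<phi> x\<bar> \<le> c * (2 * c)" using c[of x] c0 by (intro mult_mono) auto
        then show ?thesis using True by (simp add: abs_mult)
      next
        case False
        then have "\<phi> x = 0" using closure_subset[of "{x. \<phi> x \<noteq> 0}"] by auto
        then show ?thesis using False by simp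
      qed
    qed
  qed measurable
  moreover have "(\<integral>x. \<phi> x * (\<phi> x - T (S n) \<phi> x) \<partial>m) = inner_L2 m \<phi> (\<lambda>x. \<phi> x - T (S n) \<phi> x)" for n
    unfolding inner_L2_def by (rule integral_completion[symmetric]) measurable
  ultimately have lim: "(\<lambda>n. 2 * inner_L2 m \<phi> (\<lambda>x. \<phi> x - T (S n) \<phi> x)) \<longlonglongrightarrow> 2 * 0"
    by (intro tendsto_mult tendsto_const) simp
  have le: "\<forall>\<^sub>F n in sequentially. norm (inner_L2 m (\<lambda>x. T (S n) \<phi> x - \<phi> x) (\<lambda>x. T (S n) \<phi> x - \<phi> x)) \<le> 2 * inner_L2 m \<phi> (\<lambda>x. \<phi> x - T (S n) \<phi> x)"
  proof (rule always_eventually, rule allI)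
    fix n
    show "norm (inner_L2 m (\<lambda>x. T (S n) \<phi> x - \<phi> x) (\<lambda>x. T (S n) \<phi> x - \<phi> x)) \<le> 2 * inner_L2 m \<phi> (\<lambda>x. \<phi> x - T (S n) \<phi> x)"
      using TL(2)[of n] L2.nonneg[OF dL, of n] L2.diff_sq[OF TL(1) L, of n] L2.sym[OF TL(1) L, of n] L2.diff_right[OF L TL(1) L, of n]
      by simp
  qed
  have "(\<lambda>n. 2 * inner_L2 m \<phi> (\<lambda>x. \<phi> x - T (S n) \<phi> x)) \<longlonglongrightarrow> 0" using lim by simp
  from Lim_null_comparison[OF le this]
  show "(\<lambda>n. inner_L2 m (\<lambda>x. T (S n) \<phi> x - \<phi> x) (\<lambda>x. T (S n) \<phi> x - \<phi> x)) \<longlonglongrightarrow> 0" .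
qed simp

text \<open>Regularity of the form makes compactly supported continuous functions dense in L2, and
  contraction transports the continuity from them.\<close>

lemma T_strong_continuity:
  assumes h: "h \<in> borel_measurable borel" "\<And>x. \<bar>h x\<bar> \<le> c" and L: "h \<in> L2 m" and e: "0 < e"
  shows "\<forall>\<^sub>F s in at_right 0. inner_L2 m (\<lambda>x. T s h x - h x) (\<lambda>x. T s h x - h x) < e"
proof -
  \<comment> \<open>Three successive inequalities for squares, each costing a factor 4 in total,
    turn e / 64 into e.\<close>
  obtain v where v: "v \<in> D" "inner_L2 m (\<lambda>x. h x - v x) (\<lambda>x. h x - v x) < e / 64"
    using D_dense[OF L, of "e / 64"] e by auto
  note vL = D_in_L2[OF v(1)]
  obtain \<phi> where \<phi>: "\<phi> \<in> D" "\<phi> \<in> Cc" "form1 m \<E> (\<lambda>x. v x - \<phi> x) (\<lambda>x. v x - \<phi> x) < e / 64"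
    using regular_form[OF v(1), of "e / 64"] e by auto
  note \<phi>L = D_in_L2[OF \<phi>(1)] and \<phi>m = Cc_borel[OF \<phi>(2)]
  obtain d where d: "\<And>x. \<bar>\<phi> x\<bar> \<le> d" by (rule Cc_bounded[OF \<phi>(2)]) blast
  define g where "g = (\<lambda>x. h x - \<phi> x)"
  have gm: "g \<in> borel_measurable borel" unfolding g_def using h(1) \<phi>m by measurable
  have gb: "\<bar>g x\<bar> \<le> c + d" for x using h(2)[of x] d[of x] by (simp add: g_def abs_le_iff)
  have gL: "g \<in> L2 m" unfolding g_def by (rule L2.diff_mem[OF L \<phi>L])
  have "inner_L2 m (\<lambda>x. v x - \<phi> x) (\<lambda>x. v x - \<phi> x) < e / 64"
    using \<phi>(3) form.nonneg[OF form.diff_mem[OF v(1) \<phi>(1)]] by (simp add: form1_def)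
  moreover have "inner_L2 m g g \<le> 2 * inner_L2 m (\<lambda>x. h x - v x) (\<lambda>x. h x - v x) + 2 * inner_L2 m (\<lambda>x. v x - \<phi> x) (\<lambda>x. v x - \<phi> x)"
    using L2.add_sq_le[OF L2.diff_mem[OF L vL] L2.diff_mem[OF vL \<phi>L]] by (simp add: g_def)
  ultimately have g: "inner_L2 m g g < e / 16" using v(2) by simp
  have "\<forall>\<^sub>F s in at_right 0. inner_L2 m (\<lambda>x. T s \<phi> x - \<phi> x) (\<lambda>x. T s \<phi> x - \<phi> x) < e / 4"
    by (rule order_tendstoD(2)[OF T_strong_continuity_Cc[OF \<phi>(2) \<phi>L]]) (use e in simp)
  moreover have "\<forall>\<^sub>F s in at_right 0. (0::real) < s" by (simp add: eventually_at_right_less)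
  ultimately show ?thesis
  proof eventually_elim
    case (elim s)
    have s: "0 \<le> s" using elim(2) by simp
    note TgL = T_L2[OF gm gb gL s] and T\<phi>L = T_L2(1)[OF \<phi>m d \<phi>L s]
    have 1: "inner_L2 m (\<lambda>x. T s g x - g x) (\<lambda>x. T s g x - g x) \<le> 2 * inner_L2 m (T s g) (T s g) + 2 * inner_L2 m g g"
      by (rule L2.diff_sq_le[OF TgL(1) gL])
    have "(\<lambda>x. T s h x - h x) = (\<lambda>x. (T s g x - g x) + (T s \<phi> x - \<phi> x))"
      using T_diff[OF h \<phi>m d, of s] by (auto simp: g_def)
    then have "inner_L2 m (\<lambda>x. T s h x - h x) (\<lambda>x. T s h x - h x) \<le>
        2 * inner_L2 m (\<lambda>x. T s g x - g x) (\<lambda>x. T s g x - g x) + 2 * inner_L2 m (\<lambda>x. T s \<phi> x - \<phi> x) (\<lambda>x. T s \<phi> x - \<phi> x)"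
      using L2.add_sq_le[OF L2.diff_mem[OF TgL(1) gL] L2.diff_mem[OF T\<phi>L \<phi>L]] by simp
    then show ?case using 1 TgL(2) g elim(1) by linarith
  qed
qed

end

context associated_Hunt_process
begin

text \<open>The difference quotients of w = R_\<alpha> h converge in L2 to \<alpha> w - h. By
  association the pair (w, \<alpha> w - h) lies in the graph of A, and the definition of that graph
  is the weak resolvent equation.\<close>

lemma bounded_resolvent_is_res:
  assumes \<alpha>: "0 < \<alpha>" and h: "h \<in> borel_measurable borel" and b: "\<And>x. 0 \<le> h x \<and> h x \<le> C" and L: "h \<in> L2 m"
  shows "is_res \<alpha> h (\<lambda>x. enn2real (resolvent P X \<alpha> (\<lambda>y. ennreal (h y)) x))"
proof -
  note hm [measurable] = h
  have hb: "\<bar>h x\<bar> \<le> C" and h0: "0 \<le> h x" for x using b[of x] by auto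
  have hh: "(\<lambda>y. ennreal (h y)) \<in> borel_measurable borel" by measurable
  define R where "R = resolvent P X \<alpha> (\<lambda>y. ennreal (h y))"
  define w where "w x = enn2real (R x)" for x
  have Rm [measurable]: "R \<in> borel_measurable borel" unfolding R_def by (rule resolvent_measurable[OF hh])
  have wm [measurable]: "w \<in> borel_measurable borel" unfolding w_def[abs_def] by measurable
  have trT: "transition P X s (\<lambda>y. ennreal (h y)) x = ennreal (T s h x)" and T0: "0 \<le> T s h x" for s x
  proof -
    have "transition P X s (\<lambda>y. ennreal (h y)) x \<le> ennreal C" by (rule transition_le_const) (use b in \<open>auto intro: ennreal_leI\<close>)
    then have "transition P X s (\<lambda>y. ennreal (h y)) x < top" by (rule order.strict_trans1) simp
    then show "transition P X s (\<lambda>y. ennreal (h y)) x = ennreal (T s h x)"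
      using T_nonneg[OF h h0, of s x] by (simp add: less_top)
    show "0 \<le> T s h x" using T_nonneg[OF h h0, of s x] by simp
  qed
  have R_eq: "R x = (\<integral>\<^sup>+s. exp_weight \<alpha> s * ennreal (T s h x) \<partial>lborel)" for x
    unfolding R_def resolvent_eq[OF hh] trT ..
  have Tt [measurable]: "(\<lambda>s. T s h x) \<in> borel_measurable borel" for x by (rule T_time_measurable[OF h])
  have R_le: "R x \<le> ennreal (C / \<alpha>)" for x
  proof -
    have "R x \<le> (\<integral>\<^sup>+s. exp_weight \<alpha> s * ennreal C \<partial>lborel)"
      unfolding R_eq using T_bounded[OF h hb] by (intro nn_integral_mono mult_left_mono ennreal_leI) (auto simp: abs_le_iff)
    also have "\<dots> = (\<integral>\<^sup>+s. exp_weight \<alpha> s \<partial>lborel) * ennreal C" by (rule nn_integral_multc) measurable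
    also have "(\<integral>\<^sup>+s. exp_weight \<alpha> s \<partial>lborel) = ennreal (1 / \<alpha>)"
    proof -
      have "ennreal (1 / \<alpha>) * (ennreal \<alpha> * (\<integral>\<^sup>+s. exp_weight \<alpha> s \<partial>lborel)) = ennreal (1 / \<alpha>)"
        using exp_weight_mass[OF \<alpha>] by simp
      then show ?thesis using \<alpha> by (simp add: mult.assoc[symmetric] ennreal_mult[symmetric])
    qed
    also have "ennreal (1 / \<alpha>) * ennreal C = ennreal (C / \<alpha>)" using \<alpha> b by (simp add: ennreal_mult[symmetric] order_trans[of 0 "h _"])
    finally show ?thesis .
  qed
  have Rw: "R x = ennreal (w x)" for x
    using order.strict_trans1[OF R_le ennreal_less_top, of x] by (simp add: w_def less_top)
  have C0: "0 \<le> C" using b[of undefined] by simp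
  have w0: "0 \<le> w x" "\<bar>w x\<bar> \<le> C / \<alpha>" for x
    using R_le[of x] C0 \<alpha> unfolding Rw by (auto simp: w_def ennreal_le_iff)
  have mass: "(\<integral>\<^sup>+s. exp_weight \<alpha> s \<partial>lborel) < top"
    using exp_weight_mass[OF \<alpha>] \<alpha> ennreal_mult_less_top_imp[of "ennreal \<alpha>" "\<integral>\<^sup>+s. exp_weight \<alpha> s \<partial>lborel"] by simp
  have Nh: "N2 h < top" using L L2_N2[OF h] by simp
  have wL: "w \<in> L2 m"
  proof -
    have am: "(\<lambda>z. ennreal (T (fst z) h (snd z))) \<in> borel_measurable (borel \<Otimes>\<^sub>M m)"
      using T_measurable_pair[OF h] by measurable
    have "N2 w = (\<integral>\<^sup>+x. (\<integral>\<^sup>+s. exp_weight \<alpha> s * ennreal (T s h x) \<partial>lborel)\<^sup>2 \<partial>m)"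
      unfolding N2_def R_eq[symmetric] Rw using w0 by (simp add: ennreal_power)
    also have "\<dots> \<le> (\<integral>\<^sup>+s. exp_weight \<alpha> s \<partial>lborel) * (\<integral>\<^sup>+s. exp_weight \<alpha> s * (\<integral>\<^sup>+x. (ennreal (T s h x))\<^sup>2 \<partial>m) \<partial>lborel)"
      by (rule nn_integral_square_average_le[OF sigma_finite_m _ am]) measurable
    also have "\<dots> \<le> (\<integral>\<^sup>+s. exp_weight \<alpha> s \<partial>lborel) * (\<integral>\<^sup>+s. exp_weight \<alpha> s * N2 h \<partial>lborel)"
    proof (rule mult_left_mono, rule nn_integral_mono)
      fix s
      show "exp_weight \<alpha> s * (\<integral>\<^sup>+x. (ennreal (T s h x))\<^sup>2 \<partial>m) \<le> exp_weight \<alpha> s * N2 h"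
      proof (cases "0 \<le> s")
        case True
        have "(\<integral>\<^sup>+x. (ennreal (T s h x))\<^sup>2 \<partial>m) = N2 (T s h)" unfolding N2_def using T0 by (simp add: ennreal_power)
        then show ?thesis using T_contraction[OF h hb True] by (intro mult_left_mono) auto
      qed (simp add: exp_weight_def)
    qed simp
    also have "\<dots> < top" using mass Nh by (simp add: nn_integral_multc ennreal_mult_less_top)
    finally show ?thesis using L2_N2[OF wm] by simp
  qed
  \<comment> \<open>The contribution of times before t; boundedness of h makes it a finite real
    integral.\<close>
  define S where "S t x = (\<integral>s. indicator {0..<t} s * (exp (- \<alpha> * s) * T s h x) \<partial>lborel)" for t x
  have int: "integrable lborel (\<lambda>s. indicator {0..<t} s * g s)"
    if [measurable]: "g \<in> borel_measurable borel" and g: "\<And>s. 0 \<le> s \<Longrightarrow> s < t \<Longrightarrow> \<bar>g s\<bar> \<le> c" and t: "0 < t" for g :: "real \<Rightarrow> real" and c t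
  proof (rule Bochner_Integration.integrable_bound[of _ "\<lambda>s. indicator {0..<t} s * c"])
    show "integrable lborel (\<lambda>s. indicator {0..<t} s * c)"
      using t by (intro integrable_mult_left integrable_real_indicator) auto
    show "AE s in lborel. norm (indicator {0..<t} s * g s) \<le> norm (indicator {0..<t} s * c)"
      using g by (intro AE_I2) (auto simp: indicator_def intro: order_trans[OF _ abs_ge_self])
  qed measurable
  have Tb: "\<bar>T s h x\<bar> \<le> C" for s x by (rule T_bounded[OF h hb])
  \<comment> \<open>The Laplace integral is cut at t; by the semigroup property the remainder is w
    transported by time t and discounted.\<close>
  have split: "w x = S t x + exp (- \<alpha> * t) * T t w x" if t: "0 < t" for t x
  proof -
    have "R x = (\<integral>\<^sup>+s. exp_weight \<alpha> s * ennreal (T s h x) * indicator {..<t} s + exp_weight \<alpha> s * ennreal (T s h x) * indicator {t..} s \<partial>lborel)"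
      unfolding R_eq by (intro nn_integral_cong) (auto simp: indicator_def)
    also have "\<dots> = (\<integral>\<^sup>+s. exp_weight \<alpha> s * ennreal (T s h x) * indicator {..<t} s \<partial>lborel) + (\<integral>\<^sup>+s. exp_weight \<alpha> s * ennreal (T s h x) * indicator {t..} s \<partial>lborel)"
      by (rule nn_integral_add) measurable
    also have "(\<integral>\<^sup>+s. exp_weight \<alpha> s * ennreal (T s h x) * indicator {..<t} s \<partial>lborel) = ennreal (S t x)"
    proof -
      have "(\<integral>\<^sup>+s. exp_weight \<alpha> s * ennreal (T s h x) * indicator {..<t} s \<partial>lborel) = (\<integral>\<^sup>+s. ennreal (indicator {0..<t} s * (exp (- \<alpha> * s) * T s h x)) \<partial>lborel)"
        using T0 by (intro nn_integral_cong) (auto simp: exp_weight_def indicator_def ennreal_mult)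
      also have "\<dots> = ennreal (S t x)"
        unfolding S_def
      proof (rule nn_integral_eq_integral)
        show "integrable lborel (\<lambda>s. indicator {0..<t} s * (exp (- \<alpha> * s) * T s h x))"
        proof (rule int[OF _ _ t])
          fix s :: real assume s: "0 \<le> s"
          have "exp (- \<alpha> * s) * \<bar>T s h x\<bar> \<le> 1 * C" using s \<alpha> Tb[of s x] C0 by (intro mult_mono) auto
          then show "\<bar>exp (- \<alpha> * s) * T s h x\<bar> \<le> C" by (simp add: abs_mult)
        qed measurable
      qed (use T0 in auto)
      finally show ?thesis .
    qed
    also have "(\<integral>\<^sup>+s. exp_weight \<alpha> s * ennreal (T s h x) * indicator {t..} s \<partial>lborel) = ennreal (exp (- \<alpha> * t) * T t w x)"
    proof -
      have "(\<integral>\<^sup>+s. exp_weight \<alpha> s * ennreal (T s h x) * indicator {t..} s \<partial>lborel) =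
          (\<integral>\<^sup>+s. exp_weight \<alpha> (t + s) * ennreal (T (t + s) h x) * indicator {t..} (t + s) \<partial>lborel)"
        by (subst nn_integral_real_affine[of _ 1 t]) auto
      also have "\<dots> = (\<integral>\<^sup>+s. ennreal (exp (- \<alpha> * t)) * (exp_weight \<alpha> s * ennreal (T (t + s) h x)) \<partial>lborel)"
      proof (rule nn_integral_cong)
        fix s
        have "exp (- \<alpha> * (t + s)) = exp (- \<alpha> * t) * exp (- \<alpha> * s)" by (simp add: exp_add[symmetric] algebra_simps)
        then show "exp_weight \<alpha> (t + s) * ennreal (T (t + s) h x) * indicator {t..} (t + s) = ennreal (exp (- \<alpha> * t)) * (exp_weight \<alpha> s * ennreal (T (t + s) h x))"
          using t by (auto simp: exp_weight_def indicator_def ennreal_mult mult.assoc)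
      qed
      also have "\<dots> = ennreal (exp (- \<alpha> * t)) * (\<integral>\<^sup>+s. exp_weight \<alpha> s * ennreal (T (t + s) h x) \<partial>lborel)"
        by (rule nn_integral_cmult) measurable
      also have "(\<integral>\<^sup>+s. exp_weight \<alpha> s * ennreal (T (t + s) h x) \<partial>lborel) = transition P X t (\<lambda>y. ennreal (w y)) x"
        using transition_resolvent[OF hh less_imp_le[OF t], of \<alpha> x] unfolding trT R_def[symmetric] by (simp add: Rw[abs_def, symmetric])
      also have "\<dots> = ennreal (T t w x)"
      proof -
        have "transition P X t (\<lambda>y. ennreal (w y)) x \<le> ennreal (C / \<alpha>)" using w0 by (intro transition_le_const ennreal_leI) (auto simp: abs_le_iff)
        then have "transition P X t (\<lambda>y. ennreal (w y)) x < top" by (rule order.strict_trans1) simp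
        then show ?thesis using T_nonneg[OF wm w0(1), of t x] by (simp add: less_top)
      qed
      finally show ?thesis by (simp add: ennreal_mult')
    qed
    finally have e: "ennreal (w x) = ennreal (S t x) + ennreal (exp (- \<alpha> * t) * T t w x)" unfolding Rw .
    have S0: "0 \<le> S t x" unfolding S_def using T0 by (intro integral_nonneg_AE AE_I2) (auto simp: indicator_def)
    have Tw0: "0 \<le> T t w x" using T_nonneg[OF wm w0(1), of t x] by simp
    from e have "ennreal (w x) = ennreal (S t x + exp (- \<alpha> * t) * T t w x)" using S0 Tw0 by (simp add: ennreal_plus)
    then show ?thesis using w0 S0 Tw0 by (subst (asm) ennreal_inj) auto
  qed
  \<comment> \<open>The error of the difference quotient becomes c(t) w + B(t): c(t) is the error in
    the derivative of the exponential at 0, and B(t) compares h with its average over [0,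
    t).\<close>
  define c where "c t = (exp (\<alpha> * t) - 1) / t - \<alpha>" for t
  define d where "d t x = (transition_real P X t w x - w x) / t - (\<alpha> * w x - h x)" for t x
  define B where "B t x = h x - exp (\<alpha> * t) / t * S t x" for t x
  have d_eq: "d t x = c t * w x + B t x" if t: "0 < t" for t x
  proof -
    have "exp (\<alpha> * t) * w x = exp (\<alpha> * t) * S t x + T t w x"
      using arg_cong[OF split[OF t, of x], of "\<lambda>z. exp (\<alpha> * t) * z"] by (simp add: distrib_left mult.assoc[symmetric] exp_add[symmetric])
    then have Tw: "transition_real P X t w x = exp (\<alpha> * t) * w x - exp (\<alpha> * t) * S t x" by (simp add: T_def)
    show ?thesis unfolding d_def Tw c_def B_def using t by (simp add: field_simps)
  qed
  have Sm [measurable]: "S t \<in> borel_measurable borel" for t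
  proof -
    have "(\<lambda>(x, s). indicator {0..<t} s * (exp (- \<alpha> * s) * T s h x)) \<in> borel_measurable (borel \<Otimes>\<^sub>M lborel)"
    proof -
      have "(\<lambda>z. (snd z, fst z)) \<in> measurable (borel \<Otimes>\<^sub>M lborel) (borel \<Otimes>\<^sub>M borel)" by measurable
      from measurable_compose[OF this T_measurable_pair[OF h]]
      have "(\<lambda>z. T (snd z) h (fst z)) \<in> borel_measurable (borel \<Otimes>\<^sub>M lborel)" by simp
      then show ?thesis by (simp add: split_beta')
    qed
    from lborel.borel_measurable_lebesgue_integral[OF this] show ?thesis unfolding S_def[abs_def] .
  qed
  have Bm [measurable]: "B t \<in> borel_measurable borel" for t unfolding B_def[abs_def] by measurable
  \<comment> \<open>B(t) is the uniform average over s in [0, t) of h - exp (\<alpha> (t - s)) T_s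
    h. The integrand splits into h - T_s h, of squared norm at most e, and a factor of modulus at
    most exp (\<alpha> t) - 1 applied to T_s h.\<close>
  have B_bound: "N2 (B t) \<le> ennreal (2 * e + 2 * (exp (\<alpha> * t) - 1)\<^sup>2 * inner_L2 m h h)"
    if t: "0 < t" and e: "\<And>s. 0 < s \<Longrightarrow> s < t \<Longrightarrow> inner_L2 m (\<lambda>x. T s h x - h x) (\<lambda>x. T s h x - h x) \<le> e" and e0: "0 \<le> e" for t e
  proof -
    let ?k = "\<lambda>s x. h x - exp (\<alpha> * (t - s)) * T s h x"
    define u where "u s = ennreal (1 / t) * indicator {0..<t} s" for s :: real
    have um [measurable]: "u \<in> borel_measurable borel" unfolding u_def[abs_def] by measurable
    have u1: "(\<integral>\<^sup>+s. u s \<partial>lborel) = 1"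
      unfolding u_def using t by (subst nn_integral_cmult_indicator) (auto simp: ennreal_mult[symmetric])
    have kint: "integrable lborel (\<lambda>s. indicator {0..<t} s * (1 / t * ?k s x))" for x
    proof (rule int[OF _ _ t])
      fix s assume s: "0 \<le> s" "s < t"
      have "\<bar>exp (\<alpha> * (t - s)) * T s h x\<bar> \<le> exp (\<alpha> * t) * C"
        unfolding abs_mult using s \<alpha> Tb[of s x] by (intro mult_mono) auto
      then have "\<bar>?k s x\<bar> \<le> C + exp (\<alpha> * t) * C" using hb[of x] by (simp add: abs_le_iff)
      then show "\<bar>1 / t * ?k s x\<bar> \<le> 1 / t * (C + exp (\<alpha> * t) * C)" using t by (simp add: abs_mult divide_right_mono)
    qed measurable
    have sint: "integrable lborel (\<lambda>s. indicator {0..<t} s * (exp (- \<alpha> * s) * T s h x))" for x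
    proof (rule int[OF _ _ t])
      fix s :: real assume s: "0 \<le> s"
      have "exp (- \<alpha> * s) * \<bar>T s h x\<bar> \<le> 1 * C" using s \<alpha> Tb[of s x] C0 by (intro mult_mono) auto
      then show "\<bar>exp (- \<alpha> * s) * T s h x\<bar> \<le> C" by (simp add: abs_mult)
    qed measurable
    have B_int: "B t x = (\<integral>s. indicator {0..<t} s * (1 / t * ?k s x) \<partial>lborel)" for x
    proof -
      have "(\<integral>s. indicator {0..<t} s * (1 / t * ?k s x) \<partial>lborel) =
          (\<integral>s. h x / t * indicator {0..<t} s - exp (\<alpha> * t) / t * (indicator {0..<t} s * (exp (- \<alpha> * s) * T s h x)) \<partial>lborel)"
      proof (rule Bochner_Integration.integral_cong[OF refl])
        fix s
        have "exp (\<alpha> * (t - s)) = exp (\<alpha> * t) * exp (- \<alpha> * s)" by (simp add: exp_add[symmetric] algebra_simps)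
        then show "indicator {0..<t} s * (1 / t * ?k s x) = h x / t * indicator {0..<t} s - exp (\<alpha> * t) / t * (indicator {0..<t} s * (exp (- \<alpha> * s) * T s h x))"
          using t by (simp add: field_simps)
      qed
      also have "\<dots> = h x / t * t - exp (\<alpha> * t) / t * S t x"
        unfolding S_def using t sint[of x] by (subst Bochner_Integration.integral_diff) auto
      finally show ?thesis using t by (simp add: B_def)
    qed
    have B_le: "ennreal \<bar>B t x\<bar> \<le> (\<integral>\<^sup>+s. u s * ennreal \<bar>?k s x\<bar> \<partial>lborel)" for x
    proof -
      have "ennreal (norm (B t x)) \<le> (\<integral>\<^sup>+s. ennreal (norm (indicator {0..<t} s * (1 / t * ?k s x))) \<partial>lborel)"
        unfolding B_int by (rule integral_norm_bound_ennreal[OF kint])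
      also have "\<dots> = (\<integral>\<^sup>+s. u s * ennreal \<bar>?k s x\<bar> \<partial>lborel)"
        using t by (intro nn_integral_cong) (auto simp: u_def indicator_def abs_mult ennreal_mult[symmetric])
      finally show ?thesis by simp
    qed
    have km: "(\<lambda>z. ennreal \<bar>?k (fst z) (snd z)\<bar>) \<in> borel_measurable (borel \<Otimes>\<^sub>M m)"
      using T_measurable_pair[OF h] by measurable
    have "N2 (B t) = (\<integral>\<^sup>+x. (ennreal \<bar>B t x\<bar>)\<^sup>2 \<partial>m)" unfolding N2_def by (simp add: ennreal_power)
    also have "\<dots> \<le> (\<integral>\<^sup>+x. (\<integral>\<^sup>+s. u s * ennreal \<bar>?k s x\<bar> \<partial>lborel)\<^sup>2 \<partial>m)"
      by (intro nn_integral_mono power_mono B_le) simp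
    also have "\<dots> \<le> (\<integral>\<^sup>+s. u s \<partial>lborel) * (\<integral>\<^sup>+s. u s * (\<integral>\<^sup>+x. (ennreal \<bar>?k s x\<bar>)\<^sup>2 \<partial>m) \<partial>lborel)"
      by (rule nn_integral_square_average_le[OF sigma_finite_m um km])
    also have "\<dots> \<le> (\<integral>\<^sup>+s. u s \<partial>lborel) * (\<integral>\<^sup>+s. u s * ennreal (2 * e + 2 * (exp (\<alpha> * t) - 1)\<^sup>2 * inner_L2 m h h) \<partial>lborel)"
    proof (rule mult_left_mono, rule nn_integral_mono)
      fix s :: real
      show "u s * (\<integral>\<^sup>+x. (ennreal \<bar>?k s x\<bar>)\<^sup>2 \<partial>m) \<le> u s * ennreal (2 * e + 2 * (exp (\<alpha> * t) - 1)\<^sup>2 * inner_L2 m h h)"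
      proof (cases "s \<in> {0..<t}")
        case True
        then have s: "0 \<le> s" "s < t" by auto
        note TL = T_L2[OF h hb L s(1)]
        have dL: "(\<lambda>x. h x - T s h x) \<in> L2 m" by (rule L2.diff_mem[OF L TL(1)])
        have sm: "inner_L2 m (\<lambda>x. h x - T s h x) (\<lambda>x. h x - T s h x) \<le> e"
        proof (cases "s = 0")
          case True then show ?thesis using e0 by (simp add: T_zero[OF h] inner_L2_def)
        next
          case False then show ?thesis using e[of s] s L2.minus_commute[OF L TL(1)] by simp
        qed
        let ?a = "1 - exp (\<alpha> * (t - s))"
        have a: "?a\<^sup>2 \<le> (exp (\<alpha> * t) - 1)\<^sup>2"
        proof -
          have "1 \<le> exp (\<alpha> * (t - s))" "exp (\<alpha> * (t - s)) \<le> exp (\<alpha> * t)" using s \<alpha> by auto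
          then have "(exp (\<alpha> * (t - s)) - 1)\<^sup>2 \<le> (exp (\<alpha> * t) - 1)\<^sup>2" by (intro power_mono) auto
          then show ?thesis by (simp add: power2_commute)
        qed
        have kL: "?k s \<in> L2 m" using L2.diff_mem[OF L L2.scale_mem[OF TL(1)]] .
        have "(\<integral>\<^sup>+x. (ennreal \<bar>?k s x\<bar>)\<^sup>2 \<partial>m) = N2 (?k s)" unfolding N2_def by (simp add: ennreal_power)
        also have "\<dots> = ennreal (inner_L2 m (?k s) (?k s))" by (rule N2_inner[OF kL])
        finally have F1: "(\<integral>\<^sup>+x. (ennreal \<bar>?k s x\<bar>)\<^sup>2 \<partial>m) = ennreal (inner_L2 m (?k s) (?k s))" .
        have k: "?k s = (\<lambda>x. (h x - T s h x) + ?a * T s h x)" by (auto simp: algebra_simps)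
        have F2: "inner_L2 m (?k s) (?k s) \<le>
            2 * inner_L2 m (\<lambda>x. h x - T s h x) (\<lambda>x. h x - T s h x) + 2 * inner_L2 m (\<lambda>x. ?a * T s h x) (\<lambda>x. ?a * T s h x)"
          unfolding k by (rule L2.add_sq_le[OF dL L2.scale_mem[OF TL(1)]])
        have "?a\<^sup>2 * inner_L2 m (T s h) (T s h) \<le> (exp (\<alpha> * t) - 1)\<^sup>2 * inner_L2 m h h"
          by (rule mult_mono[OF a TL(2) _ L2.nonneg[OF TL(1)]]) simp
        then have "2 * inner_L2 m (\<lambda>x. h x - T s h x) (\<lambda>x. h x - T s h x) + 2 * inner_L2 m (\<lambda>x. ?a * T s h x) (\<lambda>x. ?a * T s h x) \<le> 2 * e + 2 * (exp (\<alpha> * t) - 1)\<^sup>2 * inner_L2 m h h"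
          unfolding L2.scale_sq[OF TL(1)] using sm by linarith
        from ennreal_leI[OF order_trans[OF F2 this]]
        show ?thesis unfolding F1 by (rule mult_left_mono) simp
      qed (simp add: u_def)
    qed simp
    also have "\<dots> = ennreal (2 * e + 2 * (exp (\<alpha> * t) - 1)\<^sup>2 * inner_L2 m h h)" by (simp add: nn_integral_multc u1)
    finally show ?thesis .
  qed
  have "((\<lambda>t. N2 (d t)) \<longlongrightarrow> 0) (at_right 0)"
  proof (rule order_tendstoI)
    fix a :: ennreal assume "0 < a"
    then obtain \<epsilon> where \<epsilon>: "0 < \<epsilon>" "ennreal \<epsilon> < a"
    proof -
      obtain z where z: "0 < z" "z < a" using dense[OF \<open>0 < a\<close>] by blast
      then have "z < top" by (auto intro: order.strict_trans2)
      with z show ?thesis by (intro that[of "enn2real z"]) (auto simp: enn2real_positive_iff less_top)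
    qed
    \<comment> \<open>The bound \<open>?b\<close> then tends to \<epsilon> / 4, safely below
      \<epsilon>.\<close>
    let ?e = "\<epsilon> / 16"
    have "\<forall>\<^sub>F s in at_right 0. inner_L2 m (\<lambda>x. T s h x - h x) (\<lambda>x. T s h x - h x) < ?e"
      by (rule T_strong_continuity[OF h hb L]) (use \<epsilon> in simp)
    then obtain \<delta> where \<delta>: "0 < \<delta>" "\<And>s. 0 < s \<Longrightarrow> s < \<delta> \<Longrightarrow> inner_L2 m (\<lambda>x. T s h x - h x) (\<lambda>x. T s h x - h x) < ?e"
      unfolding eventually_at_right_field by auto
    have clim: "(c \<longlongrightarrow> 0) (at_right 0)"
    proof -
      have "DERIV (\<lambda>t. exp (\<alpha> * t)) 0 :> exp (\<alpha> * 0) * \<alpha>" by (auto intro!: derivative_eq_intros)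
      then have "((\<lambda>t. (exp (\<alpha> * t) - 1) / t) \<longlongrightarrow> \<alpha>) (at 0)" by (simp add: DERIV_def)
      then have "((\<lambda>t. (exp (\<alpha> * t) - 1) / t) \<longlongrightarrow> \<alpha>) (at_right 0)" by (rule tendsto_mono[OF at_le, rotated]) simp
      from tendsto_diff[OF this tendsto_const, of \<alpha>] show ?thesis by (simp add: c_def[abs_def])
    qed
    have elim: "((\<lambda>t. exp (\<alpha> * t) - 1) \<longlongrightarrow> exp (\<alpha> * 0) - 1) (at_right 0)" by (intro tendsto_intros)
    let ?b = "\<lambda>t. 2 * ((c t)\<^sup>2 * inner_L2 m w w) + 2 * (2 * ?e + 2 * (exp (\<alpha> * t) - 1)\<^sup>2 * inner_L2 m h h)"
    have "(?b \<longlongrightarrow> 2 * (0\<^sup>2 * inner_L2 m w w) + 2 * (2 * ?e + 2 * (exp (\<alpha> * 0) - 1)\<^sup>2 * inner_L2 m h h)) (at_right 0)"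
      by (intro tendsto_add tendsto_mult tendsto_power tendsto_const clim elim)
    then have "\<forall>\<^sub>F t in at_right 0. ?b t < \<epsilon>"
      by (rule order_tendstoD(2)) (use \<epsilon> in simp)
    moreover have "\<forall>\<^sub>F t in at_right 0. 0 < t \<and> t < \<delta>"
      unfolding eventually_at_right_field using \<delta>(1) by (intro exI[of _ \<delta>]) auto
    ultimately show "\<forall>\<^sub>F t in at_right 0. N2 (d t) < a"
    proof eventually_elim
      case (elim t)
      then have t: "0 < t" "t < \<delta>" by auto
      have "N2 (d t) = N2 (\<lambda>x. c t * w x + B t x)" using d_eq[OF t(1)] by presburger
      also have "\<dots> \<le> 2 * N2 (\<lambda>x. c t * w x) + 2 * N2 (B t)" by (rule N2_add) measurable
      also have "N2 (\<lambda>x. c t * w x) = ennreal ((c t)\<^sup>2 * inner_L2 m w w)"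
        unfolding N2_scale[OF wm] N2_inner[OF wL] by (simp add: ennreal_mult')
      also have "2 * ennreal ((c t)\<^sup>2 * inner_L2 m w w) + 2 * N2 (B t) \<le> 2 * ennreal ((c t)\<^sup>2 * inner_L2 m w w) + 2 * ennreal (2 * ?e + 2 * (exp (\<alpha> * t) - 1)\<^sup>2 * inner_L2 m h h)"
        using \<delta>(2) t \<epsilon>(1) by (intro add_left_mono mult_left_mono B_bound) (auto simp: less_imp_le)
      also have "\<dots> = ennreal (?b t)"
      proof -
        have "0 \<le> (c t)\<^sup>2 * inner_L2 m w w" "0 \<le> 2 * ?e + 2 * (exp (\<alpha> * t) - 1)\<^sup>2 * inner_L2 m h h"
          using L2.nonneg[OF wL] L2.nonneg[OF L] \<epsilon>(1) by auto
        then show ?thesis by (simp only: ennreal_plus ennreal_mult'[OF zero_le_numeral] ennreal_numeral mult_nonneg_nonneg zero_le_numeral)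
      qed
      also have "\<dots> < a" using elim(1) \<epsilon> by (intro order.strict_trans1[OF ennreal_leI \<epsilon>(2)]) simp
      finally show ?case .
    qed
  qed simp
  then have lim: "((\<lambda>t. \<integral>\<^sup>+x. ennreal (((transition_real P X t w x - w x) / t - (\<alpha> * w x - h x))\<^sup>2) \<partial>m) \<longlongrightarrow> 0) (at_right 0)"
    unfolding N2_def d_def .
  have vL: "(\<lambda>x. \<alpha> * w x - h x) \<in> L2 m" by (intro L2.diff_mem L2.scale_mem wL L)
  \<comment> \<open>This is where association is used: convergence of the difference quotients is
    equivalent to membership in the graph of the form operator.\<close>
  have "(w, \<lambda>x. \<alpha> * w x - h x) \<in> form_operator m D \<E>"
  proof (rule iffD2[OF conjunct2[OF associated[unfolded associated_process_def], rule_format] lim])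
    show "w \<in> L2 m \<inter> borel_measurable borel" using wL by simp
    show "(\<lambda>x. \<alpha> * w x - h x) \<in> L2 m \<inter> borel_measurable borel" using vL by simp
  qed
  then have wD: "w \<in> D" and wE: "\<And>v. v \<in> D \<Longrightarrow> \<E> w v = inner_L2 m (\<lambda>x. - (\<alpha> * w x - h x)) v"
    by (auto simp: form_operator_def)
  have "\<E> w v = inner_L2 m h v - \<alpha> * inner_L2 m w v" if v: "v \<in> D" for v
  proof -
    have "(\<lambda>x. - (\<alpha> * w x - h x)) = (\<lambda>x. h x - \<alpha> * w x)" by auto
    then show ?thesis
      using wE[OF v] L2.diff_left[OF L L2.scale_mem[OF wL] D_in_L2[OF v], of \<alpha>] L2.scale_left[OF wL D_in_L2[OF v], of \<alpha>] by simp
  qed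
  with wD have "is_res \<alpha> h w" by (simp add: is_res_def)
  then show ?thesis unfolding w_def[abs_def] R_def .
qed

lemma resolvent_kernel_op:
  assumes r: "resolvent_kernel m P X r" and \<alpha>: "0 \<le> \<alpha>" and h: "h \<in> borel_measurable borel"
  shows "kernel_op m r \<alpha> h = resolvent P X \<alpha> h"
  using r \<alpha> h unfolding resolvent_kernel_def kernel_op_def by (intro ext) simp

lemma symmetric_resolvent_kernel:
  assumes r: "resolvent_kernel m P X r"
  shows "symmetric_resolvent m D \<E> r"
proof
  note k = resolvent_kernel_op[OF r]
  show "(\<lambda>(x, y). r \<alpha> x y) \<in> borel_measurable (borel \<Otimes>\<^sub>M borel)" "r \<alpha> x y = r \<alpha> y x" if "0 \<le> \<alpha>" for \<alpha> x y
    using r that unfolding resolvent_kernel_def by blast+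
  show "ennreal \<alpha> * kernel_op m r \<alpha> (\<lambda>_. 1) x \<le> 1" if "0 < \<alpha>" for \<alpha> x
    using resolvent_one[OF that] k[of \<alpha> "\<lambda>_. 1"] that by simp
  fix h :: "'a \<Rightarrow> ennreal" assume h: "h \<in> borel_measurable borel"
  note rm = resolvent_measurable[OF h]
  show "kernel_op m r \<alpha> h x = kernel_op m r \<beta> h x + ennreal (\<beta> - \<alpha>) * kernel_op m r \<beta> (kernel_op m r \<alpha> h) x"
    if "0 \<le> \<alpha>" "\<alpha> \<le> \<beta>" for \<alpha> \<beta> x
    using resolvent_equation[OF h that] that by (simp add: k h rm)
  show "kernel_op m r \<alpha> (kernel_op m r \<beta> h) x = kernel_op m r \<beta> (kernel_op m r \<alpha> h) x" if "0 \<le> \<alpha>" "0 \<le> \<beta>" for \<alpha> \<beta> x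
    using resolvent_resolvent_commute[OF h] that by (simp add: k h rm)
  show "(SUP n. kernel_op m r (1 / real (Suc n)) h x) = kernel_op m r 0 h x" for x
    using resolvent_SUP[OF h, of x] by (simp add: k h)
next
  fix \<alpha> C :: real and h :: "'a \<Rightarrow> real"
  assume "0 < \<alpha>" "h \<in> borel_measurable borel" "\<And>x. 0 \<le> h x \<and> h x \<le> C" "h \<in> L2 m"
  from bounded_resolvent_is_res[OF this]
  show "is_res \<alpha> h (\<lambda>x. enn2real (kernel_op m r \<alpha> (\<lambda>y. ennreal (h y)) x))"
    using \<open>0 < \<alpha>\<close> \<open>h \<in> borel_measurable borel\<close> by (simp add: resolvent_kernel_op[OF r])
qed

end

section \<open>Solutions of the equation\<close>

text \<open>Rounding v down to a grid leaves countably many values of y, so measurability in x at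
  fixed y suffices; continuity in y removes the rounding.\<close>

lemma Caratheodory_measurable:
  fixes f :: "'a \<Rightarrow> real \<Rightarrow> real"
  assumes c: "\<And>x. continuous_on UNIV (f x)" and m: "\<And>y. (\<lambda>x. f x y) \<in> borel_measurable N"
    and v [measurable]: "v \<in> borel_measurable N"
  shows "(\<lambda>x. f x (v x)) \<in> borel_measurable N"
proof (rule borel_measurable_LIMSEQ_real)
  let ?v = "\<lambda>n x. real_of_int \<lfloor>real (Suc n) * v x\<rfloor> / real (Suc n)"
  show "(\<lambda>x. f x (?v n x)) \<in> borel_measurable N" for n
  proof (rule measurable_compose_countable[where f = "\<lambda>i x. f x (real_of_int i / real (Suc n))" and g = "\<lambda>x. \<lfloor>real (Suc n) * v x\<rfloor>"])
    show "(\<lambda>x. f x (real_of_int i / real (Suc n))) \<in> borel_measurable N" for i by (rule m)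
    show "(\<lambda>x. \<lfloor>real (Suc n) * v x\<rfloor>) \<in> measurable N (count_space UNIV)" by measurable
  qed
  fix x
  have b: "norm (?v n x - v x) \<le> 1 / real (Suc n)" for n
  proof -
    define c where "c = real (Suc n)"
    have c: "0 < c" by (simp add: c_def)
    have "\<bar>(real_of_int \<lfloor>c * v x\<rfloor> - c * v x) / c\<bar> \<le> 1 / c"
      unfolding abs_divide abs_of_pos[OF c] by (rule divide_right_mono) (linarith, use c in simp)
    then have "\<bar>real_of_int \<lfloor>c * v x\<rfloor> / c - v x\<bar> \<le> 1 / c" using c by (simp add: diff_divide_distrib)
    then show ?thesis by (simp only: c_def real_norm_def)
  qed
  have "(\<lambda>n. 1 / real (Suc n)) \<longlonglongrightarrow> 0" using LIMSEQ_inverse_real_of_nat by (simp add: inverse_eq_divide)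
  then have "(\<lambda>n. ?v n x - v x) \<longlonglongrightarrow> 0"
    by (rule Lim_null_comparison[OF always_eventually, rotated]) (rule allI, rule b)
  then have "(\<lambda>n. ?v n x) \<longlonglongrightarrow> v x" by (rule LIM_zero_cancel)
  moreover have "isCont (f x) (v x)" using c[of x] by (simp add: continuous_on_eq_continuous_at)
  ultimately show "(\<lambda>n. f x (?v n x)) \<longlonglongrightarrow> f x (v x)" by (rule isCont_tendsto_compose[rotated])
qed

text \<open>The equation a = b + c in terms of positive and negative parts, with only sums. It can
  be integrated before anything is known to be finite.\<close>

lemma ennreal_part_diff:
  fixes a b c :: real
  assumes "a = b + c"
  shows "ennreal a + ennreal (- b) + ennreal (- c) = ennreal (- a) + ennreal b + ennreal c"
proof -
  have "ennreal (max 0 a) + ennreal (max 0 (- b)) + ennreal (max 0 (- c)) = ennreal (max 0 (- a)) + ennreal (max 0 b) + ennreal (max 0 c)"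
    using assms by (simp only: ennreal_plus[symmetric] max.cobounded1 add_nonneg_nonneg) (rule arg_cong[of _ _ ennreal], simp add: max_def)
  then show ?thesis by (simp add: ennreal_max_0)
qed

lemma ennreal_abs_parts: "ennreal \<bar>a\<bar> = ennreal a + ennreal (- a)" for a :: real
  by (cases "0 \<le> a") (simp_all add: ennreal_neg)

section \<open>Exceptional sets and Borel representatives\<close>

context regular_Dirichlet_form
begin

text \<open>Universal measurability speaks of finite measures, while m is only sigma-finite. A
  positive integrable density gives a finite measure with the same null sets.\<close>

lemma universal_borel_measurable:
  assumes h: "h \<in> measurable universal_borel N"
  shows "h \<in> measurable (completion m) N"
proof -
  interpret sigma_finite_measure m by (rule sigma_finite_m)
  obtain w :: "'a \<Rightarrow> real" where w: "w \<in> borel_measurable m" "\<And>x. 0 < w x" "integrable m w"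
    by (rule obtain_positive_integrable_function) blast
  define \<nu> where "\<nu> = density m (\<lambda>x. ennreal (w x))"
  have "emeasure \<nu> UNIV = ennreal (\<integral>x. w x \<partial>m)"
    unfolding \<nu>_def using w nn_integral_eq_integral[OF w(3)] by (subst emeasure_density) (auto simp: less_imp_le sets_m)
  then have f: "finite_measure \<nu>" by (intro finite_measureI) (simp add: \<nu>_def)
  have s: "sets \<nu> = sets borel" by (simp add: \<nu>_def sets_m)
  let ?U = "{A :: 'a set. \<forall>\<nu>. finite_measure \<nu> \<and> sets \<nu> = sets borel \<longrightarrow> A \<in> sets (completion \<nu>)}"
  have "?U \<subseteq> sets (completion m)"
  proof
    fix A assume "A \<in> ?U"
    with f s have "A \<in> sets (completion \<nu>)" by blast
    then obtain S K K' where A: "A = S \<union> K" "K \<subseteq> K'" "K' \<in> null_sets \<nu>" "S \<in> sets \<nu>" by (rule sets_completionE)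
    have "K' \<in> null_sets m"
    proof (rule null_setsI)
      have K': "K' \<in> sets m" "AE x in m. x \<in> K' \<longrightarrow> ennreal (w x) = 0"
        using A(3) w(1) by (simp_all add: \<nu>_def null_sets_density_iff)
      from K'(2) have "AE x in m. x \<notin> K'"
      proof eventually_elim
        case (elim x) then show ?case using w(2)[of x] by auto
      qed
      with K'(1) show "emeasure m K' = 0" by (simp add: AE_iff_null_sets null_setsD1)
      show "K' \<in> sets m" by fact
    qed
    with A show "A \<in> sets (completion m)" by (intro sets_completionI[of A S K K']) (simp_all add: \<nu>_def)
  qed
  then have "sigma_sets UNIV ?U \<subseteq> sets (completion m)"
    using sets.sigma_sets_subset[of ?U "completion m"] by simp
  moreover have "sets universal_borel = sigma_sets UNIV ?U" unfolding universal_borel_def by (rule sets_measure_of) simp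
  ultimately have "sets (universal_borel :: 'a measure) \<subseteq> sets (completion m)" by simp
  moreover have "space (universal_borel :: 'a measure) = UNIV" unfolding universal_borel_def by (simp add: space_measure_of_conv)
  ultimately show ?thesis using h unfolding measurable_def by auto
qed

text \<open>For an open U containing N and u \<ge> 1 on U, transience bounds \<integral> g dm over U
  by sqrt (\<E> u u), which can be made arbitrarily small. A countable intersection of such U is a
  Borel set over which the positive g has integral 0.\<close>

lemma quasi_everywhere_AE:
  assumes tr: "transient_form m D \<E>" and q: "quasi_everywhere m D \<E> Q"
  shows "AE x in m. Q x"
proof -
  obtain N where N: "Cap m D \<E> N = 0" "\<And>x. x \<notin> N \<Longrightarrow> Q x" using q unfolding quasi_everywhere_def by blast
  obtain g where g [measurable]: "g \<in> borel_measurable (completion m)" and g0: "\<And>x. 0 < g x"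
    and gE: "\<And>u. u \<in> D \<Longrightarrow> (\<integral>\<^sup>+x. ennreal (\<bar>u x\<bar> * g x) \<partial>completion m) \<le> ennreal (sqrt (\<E> u u))"
    using tr unfolding transient_form_def by blast
  have "\<exists>U. open U \<and> N \<subseteq> U \<and> (\<integral>\<^sup>+x. ennreal (g x) * indicator U x \<partial>completion m) \<le> ennreal (1 / real (Suc n))" for n
  proof -
    have "Cap m D \<E> N < ennreal ((1 / real (Suc n))\<^sup>2)" unfolding N(1) by simp
    then obtain U where U: "open U" "N \<subseteq> U" "Cap_open m D \<E> U < ennreal ((1 / real (Suc n))\<^sup>2)"
      unfolding Cap_def INF_less_iff by blast
    then obtain u where u: "u \<in> D" "AE x in m. indicator U x \<le> u x" "ennreal (\<E> u u) < ennreal ((1 / real (Suc n))\<^sup>2)"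
      unfolding Cap_open_def INF_less_iff by blast
    have "(\<integral>\<^sup>+x. ennreal (g x) * indicator U x \<partial>completion m) \<le> (\<integral>\<^sup>+x. ennreal (\<bar>u x\<bar> * g x) \<partial>completion m)"
    proof (rule nn_integral_mono_AE)
      from AE_completion[OF u(2)] show "AE x in completion m. ennreal (g x) * indicator U x \<le> ennreal (\<bar>u x\<bar> * g x)"
      proof eventually_elim
        case (elim x)
        show ?case
        proof (cases "x \<in> U")
          case True
          then have "1 * g x \<le> \<bar>u x\<bar> * g x" using elim g0[of x] by (intro mult_right_mono) auto
          then show ?thesis using True by (simp add: ennreal_leI)
        qed simp
      qed
    qed
    also have "\<dots> \<le> ennreal (sqrt (\<E> u u))" by (rule gE[OF u(1)])
    also have "\<dots> \<le> ennreal (1 / real (Suc n))"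
    proof (rule ennreal_leI, rule real_le_lsqrt)
      show "\<E> u u \<le> (1 / real (Suc n))\<^sup>2" using u(3) form_nonneg[OF u(1)] by (simp add: ennreal_less_iff)
    qed simp_all
    finally show ?thesis using U by blast
  qed
  then obtain U where U: "\<And>n. open (U n)" "\<And>n. N \<subseteq> U n"
    "\<And>n. (\<integral>\<^sup>+x. ennreal (g x) * indicator (U n) x \<partial>completion m) \<le> ennreal (1 / real (Suc n))"
    by metis
  define V where "V = (\<Inter>n. U n)"
  have V: "V \<in> sets m" unfolding V_def sets_m using U(1) by auto
  then have V' [measurable]: "V \<in> sets (completion m)" by simp
  have "(\<integral>\<^sup>+x. ennreal (g x) * indicator V x \<partial>completion m) \<le> ennreal (1 / real (Suc n))" for n
    by (rule order_trans[OF _ U(3)]) (auto intro!: nn_integral_mono mult_left_mono simp: V_def indicator_def)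
  moreover have "(\<lambda>n. ennreal (1 / real (Suc n))) \<longlonglongrightarrow> ennreal 0"
    by (rule tendsto_ennrealI) (use LIMSEQ_inverse_real_of_nat in \<open>simp add: inverse_eq_divide\<close>)
  ultimately have "(\<integral>\<^sup>+x. ennreal (g x) * indicator V x \<partial>completion m) \<le> ennreal 0"
    by (intro LIMSEQ_le_const[of "\<lambda>n. ennreal (1 / real (Suc n))"]) auto
  then have "(\<integral>\<^sup>+x. ennreal (g x) * indicator V x \<partial>completion m) = 0" by simp
  then have "AE x in completion m. ennreal (g x) * indicator V x = 0" by (subst (asm) nn_integral_0_iff_AE) auto
  then have "AE x in m. ennreal (g x) * indicator V x = 0" by (simp add: AE_completion_iff)
  then show ?thesis
  proof eventually_elim
    case (elim x)
    then have "x \<notin> V" using g0[of x] by (auto simp: indicator_def)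
    then have "x \<notin> N" using U(2) by (auto simp: V_def)
    then show ?case by (rule N(2))
  qed
qed

lemma nn_integral_density_borel_version:
  assumes h: "h \<in> borel_measurable (completion m)" and e: "AE x in m. h x = h' x" and \<phi>: "\<phi> \<in> borel_measurable borel"
  shows "(\<integral>\<^sup>+y. \<phi> y \<partial>distr (density (completion m) (\<lambda>x. ennreal (h x))) borel (\<lambda>x. x)) = (\<integral>\<^sup>+y. ennreal (h' y) * \<phi> y \<partial>m)"
proof -
  have id: "(\<lambda>x. x) \<in> measurable (completion m) borel" by (rule measurable_completion) (simp add: measurable_cong_sets[OF sets_m refl])
  have \<phi>': "\<phi> \<in> borel_measurable (completion m)" by (rule measurable_compose[OF id \<phi>])
  have "(\<integral>\<^sup>+y. \<phi> y \<partial>distr (density (completion m) (\<lambda>x. ennreal (h x))) borel (\<lambda>x. x)) = (\<integral>\<^sup>+y. \<phi> y \<partial>density (completion m) (\<lambda>x. ennreal (h x)))"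
    using id \<phi> by (subst nn_integral_distr) simp_all
  also have "\<dots> = (\<integral>\<^sup>+y. ennreal (h y) * \<phi> y \<partial>completion m)" using h \<phi>' by (intro nn_integral_density) auto
  also have "\<dots> = (\<integral>\<^sup>+y. ennreal (h' y) * \<phi> y \<partial>completion m)"
    using AE_completion[OF e] by (intro nn_integral_cong_AE) (auto elim: eventually_mono)
  finally show ?thesis by (simp add: nn_integral_completion)
qed

end

lemma resolvent_mono: "(\<And>y. h y \<le> k y) \<Longrightarrow> resolvent P X \<alpha> h x \<le> resolvent P X \<alpha> k x"
  unfolding resolvent_def
  by (intro nn_integral_mono mult_right_mono mult_left_mono) (auto split: option.split)

text \<open>\<open>resolvent\<close> applied to a function that is merely almost everywhere Borel is
  a lower integral, about which only monotonicity is available. The existence of a kernel density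
  makes null sets invisible.\<close>

lemma (in associated_Hunt_process) resolvent_borel_version:
  assumes r: "resolvent_kernel m P X r" and \<alpha>: "0 \<le> \<alpha>" and h': "h' \<in> borel_measurable borel" and e: "AE x in m. h x = h' x"
  shows "resolvent P X \<alpha> h x = kernel_op m r \<alpha> h' x"
proof (rule antisym)
  obtain N where N: "{x \<in> space m. h x \<noteq> h' x} \<subseteq> N" "N \<in> sets m" "emeasure m N = 0" using e by (rule AE_E)
  have Nb [measurable]: "N \<in> sets borel" using N(2) by (simp add: sets_m)
  have eq: "h x = h' x" if "x \<notin> N" for x using N(1) that by auto
  have ae: "AE x in m. x \<notin> N" using N by (intro AE_not_in) (simp add: null_setsI)
  have k: "kernel_op m r \<alpha> h'' x = kernel_op m r \<alpha> h' x" if "\<And>x. x \<notin> N \<Longrightarrow> h'' x = h' x" for h''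
    unfolding kernel_op_def using ae that by (intro nn_integral_cong_AE) (auto elim: eventually_mono)
  \<comment> \<open>Borel functions that sandwich h: off the exceptional set both equal it, and on
    that set they take the extreme values.\<close>
  let ?l = "\<lambda>x. if x \<in> N then 0 else h' x" and ?u = "\<lambda>x. if x \<in> N then top else h' x"
  have m: "?l \<in> borel_measurable borel" "?u \<in> borel_measurable borel" using h' by measurable
  have "resolvent P X \<alpha> h x \<le> resolvent P X \<alpha> ?u x" by (rule resolvent_mono) (simp add: eq)
  also have "\<dots> = kernel_op m r \<alpha> ?u x" by (simp add: resolvent_kernel_op[OF r \<alpha> m(2)])
  also have "\<dots> = kernel_op m r \<alpha> h' x" by (rule k) simp
  finally show "resolvent P X \<alpha> h x \<le> kernel_op m r \<alpha> h' x" .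
  have "kernel_op m r \<alpha> h' x = kernel_op m r \<alpha> ?l x" by (rule k[symmetric]) simp
  also have "\<dots> = resolvent P X \<alpha> ?l x" by (simp add: resolvent_kernel_op[OF r \<alpha> m(1)])
  also have "\<dots> \<le> resolvent P X \<alpha> h x" by (rule resolvent_mono) (simp add: eq)
  finally show "kernel_op m r \<alpha> h' x \<le> resolvent P X \<alpha> h x" .
qed

theorem theorem4p9:
  fixes m :: "'a::{metric_space, second_countable_topology} measure"
    and D :: "('a \<Rightarrow> real) set"
    and \<E> :: "('a \<Rightarrow> real) \<Rightarrow> ('a \<Rightarrow> real) \<Rightarrow> real"
    and M :: "'w measure"
    and P :: "'a option \<Rightarrow> 'w measure"
    and X :: "ennreal \<Rightarrow> 'w \<Rightarrow> 'a option"
    and F :: "ennreal \<Rightarrow> 'w measure"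
    and r :: "real \<Rightarrow> 'a \<Rightarrow> 'a \<Rightarrow> ennreal"
    and f :: "'a \<Rightarrow> real \<Rightarrow> real"
    and \<mu> :: "'a signed_measure"
    and u :: "'a \<Rightarrow> ereal"
    and k :: real
  assumes "regular_Dirichlet_form m D \<E>"
    and "transient_form m D \<E>"
    and "Hunt_process M P X F"
    and "associated_process m D \<E> P X"
    and "absolutely_continuous_resolvent m P X"
    and "resolvent_kernel m P X r"
    and "\<And>x. continuous_on UNIV (f x)"
    and "\<And>y. (\<lambda>x. f x y) \<in> borel_measurable universal_borel"
    and "\<And>x. antimono (f x)"
    and "integrable (completion m) (\<lambda>x. f x 0)"
    and "bounded_borel_measure \<mu>"
    and "is_solution m D \<E> P X r f \<mu> u"
    and "k \<ge> 0"
  shows "truncation k u \<in> extended_domain m D \<E> \<and>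
    extended_energy m D \<E> (truncation k u)
      \<le> 2 * k * ((\<integral>x. \<bar>f x 0\<bar> \<partial>completion m) + TV_norm \<mu>)"
proof -
  interpret regular_Dirichlet_form m D \<E> by fact
  interpret H: associated_Hunt_process m D \<E> M P X F
    using assms(1,3,4) by (intro associated_Hunt_process.intro associated_Hunt_process_axioms.intro)
  note r = assms(6)
  interpret symmetric_resolvent m D \<E> r by (rule H.symmetric_resolvent_kernel[OF r])
  note tr = assms(2)
  note qe = quasi_everywhere_AE[OF tr]
  note bm = measurable_cong_sets[OF sets_m refl]
  have \<mu>: "sets (fst \<mu>) = sets borel" "sets (snd \<mu>) = sets borel" "finite_measure (fst \<mu>)" "finite_measure (snd \<mu>)"
    using assms(11) by (auto simp: bounded_borel_measure_def signed_borel_measure_def)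
  note sol = assms(12)[unfolded is_solution_def]
  have um [measurable]: "u \<in> borel_measurable (completion m)" using sol by (intro universal_borel_measurable) simp
  define v where "v x = real_of_ereal (u x)" for x
  have vm [measurable]: "v \<in> borel_measurable (completion m)" unfolding v_def[abs_def] by measurable
  define h where "h = Nemytskii f u"
  have h_eq: "h x = f x (v x)" for x by (simp add: h_def Nemytskii_def v_def)
  have fm: "(\<lambda>x. f x y) \<in> borel_measurable (completion m)" for y by (rule universal_borel_measurable[OF assms(8)])
  have hm [measurable]: "h \<in> borel_measurable (completion m)"
    unfolding h_eq[abs_def] by (rule Caratheodory_measurable[OF assms(7) fm vm])
  obtain v' where v' [measurable]: "v' \<in> borel_measurable borel" and v'e: "AE x in m. v x = v' x"
    using completion_ex_borel_measurable_real[OF vm] unfolding bm by blast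
  obtain h' where h' [measurable]: "h' \<in> borel_measurable borel" and h'e: "AE x in m. h x = h' x"
    using completion_ex_borel_measurable_real[OF hm] unfolding bm by blast
  obtain f0 where f0 [measurable]: "f0 \<in> borel_measurable borel" and f0e: "AE x in m. f x 0 = f0 x"
    using completion_ex_borel_measurable_real[OF fm] unfolding bm by blast
  have f0m: "f0 \<in> borel_measurable m" using f0 by (simp add: bm)
  have f0i: "integrable (completion m) f0"
    by (rule iffD1[OF integrable_cong_AE assms(10)]) (use fm measurable_completion[OF f0m] AE_completion[OF f0e] in auto)
  have f0I: "(\<integral>x. \<bar>f x 0\<bar> \<partial>completion m) = (\<integral>x. \<bar>f0 x\<bar> \<partial>completion m)"
    by (rule integral_cong_AE) (use fm measurable_completion[OF f0m] AE_completion[OF f0e] in \<open>auto elim: eventually_mono\<close>)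
  have f0n: "(\<integral>\<^sup>+x. ennreal \<bar>f0 x\<bar> \<partial>m) = ennreal (\<integral>x. \<bar>f x 0\<bar> \<partial>completion m)"
    unfolding f0I using nn_integral_eq_integral[OF integrable_abs[OF f0i]] by (simp add: nn_integral_completion)
  \<comment> \<open>The sign s = 1 or s = -1 selects the positive or the negative part of
    f(\<cdot>,0) m.\<close>
  define \<nu> where "\<nu> s = density m (\<lambda>x. ennreal (s * f0 x))" for s
  have \<nu>s: "sets (\<nu> s) = sets borel" for s by (simp add: \<nu>_def sets_m)
  have \<nu>e: "emeasure (\<nu> s) UNIV = (\<integral>\<^sup>+x. ennreal (s * f0 x) \<partial>m)" for s
    unfolding \<nu>_def using f0m by (subst emeasure_density) (auto simp: sets_m)
  have \<nu>f: "finite_measure (\<nu> s)" if "\<bar>s\<bar> = 1" for s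
  proof (rule finite_measureI)
    have "emeasure (\<nu> s) UNIV \<le> (\<integral>\<^sup>+x. ennreal \<bar>f0 x\<bar> \<partial>m)"
      unfolding \<nu>e using that by (intro nn_integral_mono ennreal_leI) (metis abs_ge_self abs_mult mult_1)
    also have "\<dots> < \<infinity>" unfolding f0n by simp
    finally show "emeasure (\<nu> s) (space (\<nu> s)) \<noteq> \<infinity>" by (simp add: \<nu>_def)
  qed
  note \<nu>f1 = \<nu>f[of 1, simplified] and \<nu>f2 = \<nu>f[of "-1", simplified]
  have \<nu>G: "pot 0 (\<nu> s) x = G 0 (\<lambda>y. ennreal (s * f0 y)) x" for s x
    unfolding pot_def \<nu>_def kernel_op_def using f0m r_measurable_right[of 0 x] by (subst nn_integral_density) (auto simp: bm)
  have \<nu>mass: "measure (\<nu> 1) UNIV + measure (\<nu> (-1)) UNIV = (\<integral>x. \<bar>f x 0\<bar> \<partial>completion m)"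
  proof -
    have "ennreal (measure (\<nu> 1) UNIV + measure (\<nu> (-1)) UNIV) = emeasure (\<nu> 1) UNIV + emeasure (\<nu> (-1)) UNIV"
      using finite_measure.emeasure_eq_measure[OF \<nu>f1] finite_measure.emeasure_eq_measure[OF \<nu>f2] by simp
    also have "\<dots> = (\<integral>\<^sup>+x. ennreal (f0 x) + ennreal (- f0 x) \<partial>m)"
      unfolding \<nu>e using f0m by (subst nn_integral_add[symmetric]) auto
    also have "\<dots> = ennreal (\<integral>x. \<bar>f x 0\<bar> \<partial>completion m)" unfolding ennreal_abs_parts[symmetric] by (rule f0n)
    finally show ?thesis by (subst (asm) ennreal_inj) auto
  qed
  define \<kappa>p where "\<kappa>p = add_measure (\<nu> 1) (fst \<mu>)"
  define \<kappa>n where "\<kappa>n = add_measure (\<nu> (-1)) (snd \<mu>)"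
  have ss: "sets (fst \<mu>) = sets (\<nu> 1)" "sets (snd \<mu>) = sets (\<nu> (-1))" by (simp_all add: \<mu> \<nu>s)
  have \<kappa>: "sets \<kappa>p = sets borel" "finite_measure \<kappa>p" "sets \<kappa>n = sets borel" "finite_measure \<kappa>n"
    unfolding \<kappa>p_def \<kappa>n_def using \<nu>s finite_measure_add_measure[OF ss(1) \<nu>f1 \<mu>(3)] finite_measure_add_measure[OF ss(2) \<nu>f2 \<mu>(4)] by auto
  have \<kappa>pot: "pot 0 \<kappa>p x = G 0 (\<lambda>y. ennreal (f0 y)) x + pot 0 (fst \<mu>) x"
    "pot 0 \<kappa>n x = G 0 (\<lambda>y. ennreal (- f0 y)) x + pot 0 (snd \<mu>) x" for x
    unfolding \<kappa>p_def \<kappa>n_def using pot_add_measure[OF \<nu>s \<mu>(1), of 0] pot_add_measure[OF \<nu>s \<mu>(2), of 0] \<nu>G[of 1] \<nu>G[of "-1"] by simp_all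
  have mass: "measure \<kappa>p UNIV + measure \<kappa>n UNIV = (\<integral>x. \<bar>f x 0\<bar> \<partial>completion m) + TV_norm \<mu>"
    unfolding \<kappa>p_def \<kappa>n_def TV_norm_def \<nu>mass[symmetric]
    using measure_add_measure[OF ss(1) \<nu>f1 \<mu>(3), of UNIV] measure_add_measure[OF ss(2) \<nu>f2 \<mu>(4), of UNIV] \<nu>s by simp
  \<comment> \<open>The absorption term f(\<cdot>,u) - f(\<cdot>,0), formed from Borel
    representatives.\<close>
  define q where "q x = h' x - f0 x" for x
  have q [measurable]: "q \<in> borel_measurable borel" unfolding q_def[abs_def] by measurable
  have Hfin: "AE x in m. potential_abs r (density_signed m h) x < \<infinity>"
    using sol by (intro qe) (simp add: class_M_def h_def)
  have "potential_abs r (density_signed m h) x = G 0 (\<lambda>y. ennreal (h' y)) x + G 0 (\<lambda>y. ennreal (- h' y)) x" for x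
  proof -
    have hn: "(\<lambda>x. - h x) \<in> borel_measurable (completion m)" by measurable
    have hne: "AE x in m. - h x = - h' x" using h'e by (auto elim: eventually_mono)
    show ?thesis
      unfolding potential_abs_def density_signed_def fst_conv snd_conv kernel_op_def
      using nn_integral_density_borel_version[OF hm h'e r_measurable_right, of 0 x] nn_integral_density_borel_version[OF hn hne r_measurable_right, of 0 x]
      by simp
  qed
  then have Hfin: "AE x in m. G 0 (\<lambda>y. ennreal (h' y)) x + G 0 (\<lambda>y. ennreal (- h' y)) x < \<infinity>" using Hfin by simp
  have Gm: "(\<lambda>y. ennreal (g y)) \<in> borel_measurable borel" if "g \<in> borel_measurable borel" for g :: "'a \<Rightarrow> real" using that by measurable
  have q_le: "G 0 (\<lambda>y. ennreal \<bar>q y\<bar>) x \<le> (G 0 (\<lambda>y. ennreal (h' y)) x + G 0 (\<lambda>y. ennreal (- h' y)) x) + (G 0 (\<lambda>y. ennreal (f0 y)) x + G 0 (\<lambda>y. ennreal (- f0 y)) x)" for x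
  proof -
    have "G 0 (\<lambda>y. ennreal \<bar>q y\<bar>) x \<le> G 0 (\<lambda>y. (ennreal (h' y) + ennreal (- h' y)) + (ennreal (f0 y) + ennreal (- f0 y))) x"
    proof (rule G_mono)
      fix y
      have "ennreal \<bar>q y\<bar> \<le> ennreal (\<bar>h' y\<bar> + \<bar>f0 y\<bar>)" unfolding q_def by (intro ennreal_leI) simp
      also have "\<dots> = ennreal \<bar>h' y\<bar> + ennreal \<bar>f0 y\<bar>" by simp
      finally show "ennreal \<bar>q y\<bar> \<le> (ennreal (h' y) + ennreal (- h' y)) + (ennreal (f0 y) + ennreal (- f0 y))" unfolding ennreal_abs_parts .
    qed
    then show ?thesis by (simp add: G_add)
  qed
  \<comment> \<open>The decomposition f(\<cdot>,u) = q + f(\<cdot>,0) at the level of potentials.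
    The parts of the sum are not the sums of the parts, so only this balanced identity holds; it is
    solved for real numbers once all six terms are finite.\<close>
  have G_parts: "G 0 (\<lambda>y. ennreal (h' y)) x + G 0 (\<lambda>y. ennreal (- q y)) x + G 0 (\<lambda>y. ennreal (- f0 y)) x
      = G 0 (\<lambda>y. ennreal (- h' y)) x + G 0 (\<lambda>y. ennreal (q y)) x + G 0 (\<lambda>y. ennreal (f0 y)) x" for x
  proof -
    have "G 0 (\<lambda>y. ennreal (h' y) + ennreal (- q y) + ennreal (- f0 y)) x = G 0 (\<lambda>y. ennreal (- h' y) + ennreal (q y) + ennreal (f0 y)) x"
      by (rule arg_cong[where f = "\<lambda>g. G 0 g x"], rule ext, rule ennreal_part_diff) (simp add: q_def)
    then show ?thesis by (simp add: G_add)
  qed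
  have sol_AE: "AE x in m. u x = potential_fun P X h x + potential_meas r \<mu> x"
    using sol by (intro qe) (simp add: h_def)
  have pf: "potential_fun P X h x = ennreal_diff0 (G 0 (\<lambda>y. ennreal (h' y)) x) (G 0 (\<lambda>y. ennreal (- h' y)) x)" for x
  proof -
    have "AE x in m. ennreal (h x) = ennreal (h' x)" "AE x in m. ennreal (- h x) = ennreal (- h' x)"
      using h'e by (auto elim: eventually_mono)
    from H.resolvent_borel_version[OF r order_refl _ this(1), of x] H.resolvent_borel_version[OF r order_refl _ this(2), of x]
    show ?thesis unfolding potential_fun_def by simp
  qed
  have pm: "potential_meas r \<mu> x = ennreal_diff0 (pot 0 (fst \<mu>) x) (pot 0 (snd \<mu>) x)" for x
    by (simp add: potential_meas_def pot_def)
  have qfin: "AE x in m. G 0 (\<lambda>y. ennreal \<bar>q y\<bar>) x < \<infinity>"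
    using Hfin pot_finite[OF tr \<kappa>(1,2)] pot_finite[OF tr \<kappa>(3,4)]
  proof eventually_elim
    case (elim x)
    show ?case by (rule order.strict_trans1[OF q_le]) (use elim in \<open>simp add: \<kappa>pot\<close>)
  qed
  \<comment> \<open>Where both terms are finite, the convention for \<infinity> - \<infinity> never
    comes into play.\<close>
  have diff0: "ennreal_diff0 a b = ereal (enn2real a - enn2real b)" if "a < top" "b < top" for a b
    using that by (cases a; cases b) (auto simp: ennreal_diff0_def enn2ereal_ennreal)
  have u_AE: "AE x in m. u x = ereal ((enn2real (G 0 (\<lambda>y. ennreal (q y)) x) + enn2real (pot 0 \<kappa>p x))
        - (enn2real (G 0 (\<lambda>y. ennreal (- q y)) x) + enn2real (pot 0 \<kappa>n x)))"
    using sol_AE Hfin qfin pot_finite[OF tr \<kappa>(1,2)] pot_finite[OF tr \<kappa>(3,4)]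
  proof eventually_elim
    case (elim x)
    let ?hp = "G 0 (\<lambda>y. ennreal (h' y)) x" and ?hn = "G 0 (\<lambda>y. ennreal (- h' y)) x"
    let ?qp = "G 0 (\<lambda>y. ennreal (q y)) x" and ?qn = "G 0 (\<lambda>y. ennreal (- q y)) x"
    let ?fp = "G 0 (\<lambda>y. ennreal (f0 y)) x" and ?fn = "G 0 (\<lambda>y. ennreal (- f0 y)) x"
    have hf: "?hp < top" "?hn < top" using elim(2) by simp_all
    have "?qp \<le> G 0 (\<lambda>y. ennreal \<bar>q y\<bar>) x" "?qn \<le> G 0 (\<lambda>y. ennreal \<bar>q y\<bar>) x" by (rule G_mono, simp add: ennreal_leI)+
    with elim(3) have qf: "?qp < top" "?qn < top" by (auto intro: order.strict_trans1)
    have ff: "?fp < top" "?fn < top" "pot 0 (fst \<mu>) x < top" "pot 0 (snd \<mu>) x < top" using elim(4,5) by (simp_all add: \<kappa>pot)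
    have "enn2real (?hp + ?qn + ?fn) = enn2real (?hn + ?qp + ?fp)" by (simp only: G_parts)
    then have "enn2real ?hp + enn2real ?qn + enn2real ?fn = enn2real ?hn + enn2real ?qp + enn2real ?fp"
      using hf qf ff by (simp add: enn2real_plus)
    moreover have "u x = ereal (enn2real ?hp - enn2real ?hn) + ereal (enn2real (pot 0 (fst \<mu>) x) - enn2real (pot 0 (snd \<mu>) x))"
      unfolding elim(1) pf pm using hf ff by (simp only: diff0)
    ultimately show ?case unfolding \<kappa>pot using ff by (simp add: enn2real_plus)
  qed
  \<comment> \<open>The representation just obtained is real-valued, so \<open>u\<close> is finite
    almost everywhere and the value 0 that \<open>real_of_ereal\<close> assigns at infinity affects
    a null set only.\<close>
  have u_eq: "AE x in m. u x = ereal (v' x)" using u_AE v'e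
  proof eventually_elim
    case (elim x) then show ?case by (simp add: v_def)
  qed
  have eq: "AE x in m. v' x = (enn2real (G 0 (\<lambda>y. ennreal (q y)) x) + enn2real (pot 0 \<kappa>p x))
        - (enn2real (G 0 (\<lambda>y. ennreal (- q y)) x) + enn2real (pot 0 \<kappa>n x))" using u_AE u_eq
  proof eventually_elim
    case (elim x) then show ?case by simp
  qed
  have sgn: "AE x in m. q x * sgn (v' x) = - \<bar>q x\<bar>" using v'e h'e f0e
  proof eventually_elim
    case (elim x)
    have qx: "q x = f x (v' x) - f x 0" using elim by (simp add: q_def h_eq[symmetric]) (simp add: h_eq)
    consider "v' x = 0" | "0 < v' x" | "v' x < 0" by linarith
    then show ?case
    proof cases
      case 2 then have "q x \<le> 0" using antimonoD[OF assms(9), of 0 "v' x" x] qx by simp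
      then show ?thesis using 2 by simp
    next
      case 3 then have "0 \<le> q x" using antimonoD[OF assms(9), of "v' x" 0 x] qx by simp
      then show ?thesis using 3 by simp
    qed (simp add: qx)
  qed
  have tm: "truncation k u \<in> borel_measurable (completion m)" unfolding truncation_def[abs_def] by measurable
  have tu: "AE x in m. truncation k u x = clamp_real k (v' x)" using u_eq
  proof eventually_elim
    case (elim x) then show ?case by (simp add: truncation_def clamp_real_def max_def min_def)
  qed
  note main = truncation_energy[OF tr \<kappa> q v' qfin eq sgn assms(13) tm tu]
  show ?thesis using main unfolding mass by simp
qed

end
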